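(* Weil exponentiable and microlinear Frölicher spaces, together with the smooth mappings among them, form a cartesian closed (full) subcategory $\mathbf{FS}_{\mathbf{WE,ML}}$ of the category $\mathbf{FS}$ of Frölicher spaces and smooth mappings.
   Context: A Frölicher space is a set $X$ with a set of curves $\mathbb{R}\to X$ and a set $C^\infty(X,\mathbb{R})$ of functions $X\to\mathbb{R}$ such that a function belongs to the latter iff its composite with every given curve is smooth, and a curve belongs to the former iff its composite with every given function is smooth; smooth mappings are those carrying smooth curves to smooth curves. $\mathbf{FS}$ is the cartesian closed category of Frölicher spaces and smooth mappings; $X^Y$ denotes its exponential (the Frölicher space of smooth mappings $Y\to X$). $\mathbf{W}$ is the category of Weil algebras: finite-dimensional local $\mathbb{R}$-algebras with residue field $\mathbb{R}$, equivalently quotients $W=\mathcal{C}^\infty(\mathbb{R}^n)/I$ with $I$ an ideal contained in the ideal $\mathfrak m_0$ of functions vanishing at $0$ and containing a power of $\mathfrak m_0$; morphisms are algebra homomorphisms. $\otimes_\infty$ is the coproduct of $\mathcal{C}^\infty$-algebras, which on Weil algebras is the usual tensor product. Weil prolongation: for $X$ in $\mathbf{FS}$ and $W=\mathcal{C}^\infty(\mathbb{R}^n)/I$, the underlying set of $X\otimes W$ is the set of smooth mappings $\mathbb{R}^n\to X$ modulo the relation $f\sim g$ iff $f(0)=g(0)$ and $\chi\circ f-\chi\circ g\in I$ for every $\chi\in C^\infty(X,\mathbb{R})$. For smooth $h:X\to Y$, $h\otimes W$ sends $[f]$ to $[h\circ f]$; $X\otimes W$ carries the initial Frölicher structure with respect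 to the maps $\chi\otimes W:X\otimes W\to\mathbb{R}\otimes W=W$, $\chi\in C^\infty(X,\mathbb{R})$, where $W$ has its structure of a finite-dimensional vector space. A homomorphism $\mathcal{C}^\infty(\mathbb{R}^n)/I\to\mathcal{C}^\infty(\mathbb{R}^m)/J$ induced by precomposition with a smooth $\theta:\mathbb{R}^m\to\mathbb{R}^n$, $\theta(0)=0$, induces $[f]\mapsto[f\circ\theta]$. This gives a bifunctor $\otimes:\mathbf{FS}\times\mathbf{W}\to\mathbf{FS}$. $X$ is Weil exponentiable if $(X\otimes(W_1\otimes_\infty W_2))^Y=(X\otimes W_1)^Y\otimes W_2$ holds naturally (canonical natural isomorphism of Frölicher spaces, given by transposition on elements represented by smooth mappings into $X$) for every Frölicher space $Y$ and all Weil algebras $W_1,W_2$. $X$ is microlinear if for any finite limit diagram $\mathcal{D}$ in $\mathbf{W}$ (a limit cone over a finite diagram), the diagram $X\otimes\mathcal{D}$, obtained by applying $X\otimes\cdot$ to every object and morphism of $\mathcal{D}$, is a limit diagram in $\mathbf{FS}$. *)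

theory Defs
  imports
    "HOL-Analysis.Analysis"
    "HOL-Algebra.QuotRing"
    "HOL-Algebra.Ideal_Product"
begin

section \<open>Smooth functions on Euclidean spaces\<close>

definition smooth_real :: "(real \<Rightarrow> real) \<Rightarrow> bool" where
  "smooth_real f \<longleftrightarrow> (\<forall>k x. (deriv ^^ k) f differentiable (at x))"

text \<open>The number of variables has to range over the natural numbers inside formulas, so points
  of Euclidean n-space are sequences vanishing from index \<open>n\<close> on. The product topology of
  \<open>nat \<Rightarrow> real\<close> induces the Euclidean topology on this set.\<close>

type_synonym point = "nat \<Rightarrow> real"

definition Rn :: "nat \<Rightarrow> point set" where
  "Rn n = {x. \<forall>i\<ge>n. x i = 0}"

definition partial :: "nat \<Rightarrow> (point \<Rightarrow> real) \<Rightarrow> point \<Rightarrow> real" where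
  "partial i f x = deriv (\<lambda>t. f (x(i := t))) (x i)"

text \<open>Smooth: all iterated partial derivatives exist and are continuous.\<close>

definition smooth_Rn :: "nat \<Rightarrow> (point \<Rightarrow> real) \<Rightarrow> bool" where
  "smooth_Rn n f \<longleftrightarrow> (\<forall>is. set is \<subseteq> {..<n} \<longrightarrow>
     continuous_on (Rn n) (foldr partial is f) \<and>
     (\<forall>i<n. \<forall>x\<in>Rn n. (\<lambda>t. foldr partial is f (x(i := t))) differentiable (at (x i))))"

definition Cinf :: "nat \<Rightarrow> (point \<Rightarrow> real) ring" where
  "Cinf n = \<lparr>carrier = {f \<in> extensional (Rn n). smooth_Rn n f},
     monoid.mult = (\<lambda>f g. \<lambda>x\<in>Rn n. f x * g x),
     one = (\<lambda>x\<in>Rn n. 1),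
     zero = (\<lambda>x\<in>Rn n. 0),
     add = (\<lambda>f g. \<lambda>x\<in>Rn n. f x + g x)\<rparr>"


section \<open>Weil algebras\<close>

text \<open>Weil algebras are given by presentations: the quotient of the smooth functions in
  \<open>wvars W\<close> variables by the ideal \<open>wideal W\<close>.\<close>

record weil_pres =
  wvars :: nat
  wideal :: "(point \<Rightarrow> real) set"

definition max_ideal0 :: "nat \<Rightarrow> (point \<Rightarrow> real) set" where
  "max_ideal0 n = {f \<in> carrier (Cinf n). f (\<lambda>_. 0) = 0}"

definition weil :: "weil_pres \<Rightarrow> bool" where
  "weil W \<longleftrightarrow> ideal (wideal W) (Cinf (wvars W)) \<and>
     wideal W \<subseteq> max_ideal0 (wvars W) \<and>
     (\<exists>k. (ideal_prod (Cinf (wvars W)) (max_ideal0 (wvars W)) ^^ k) (carrier (Cinf (wvars W)))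
            \<subseteq> wideal W)"

type_synonym welem = "(point \<Rightarrow> real) set"
type_synonym whom = "welem \<Rightarrow> welem"

definition weil_alg :: "weil_pres \<Rightarrow> welem ring" where
  "weil_alg W = Cinf (wvars W) Quot wideal W"

definition wcls :: "weil_pres \<Rightarrow> (point \<Rightarrow> real) \<Rightarrow> welem" where
  "wcls W f = wideal W +>\<^bsub>Cinf (wvars W)\<^esub> f"

definition wconst :: "weil_pres \<Rightarrow> real \<Rightarrow> welem" where
  "wconst W r = wcls W (\<lambda>x\<in>Rn (wvars W). r)"

text \<open>Homomorphisms of real algebras: unital ring homomorphisms preserving the real constants.\<close>

definition weil_hom :: "weil_pres \<Rightarrow> weil_pres \<Rightarrow> whom set" where
  "weil_hom V W = {\<phi> \<in> ring_hom (weil_alg V) (weil_alg W) \<inter> extensional (carrier (weil_alg V)).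
     \<forall>r. \<phi> (wconst V r) = wconst W r}"

text \<open>Coproduct of \<open>C\<^sup>\<infinity>\<close>-algebras. The variables of the second factor are shifted behind those
  of the first one.\<close>

definition pr_left :: "nat \<Rightarrow> point \<Rightarrow> point" where
  "pr_left n x = (\<lambda>i. if i < n then x i else 0)"

definition pr_right :: "nat \<Rightarrow> point \<Rightarrow> point" where
  "pr_right n x = (\<lambda>i. x (n + i))"

definition join :: "nat \<Rightarrow> point \<Rightarrow> point \<Rightarrow> point" where
  "join n a b = (\<lambda>i. if i < n then a i else b (i - n))"

definition weil_tensor :: "weil_pres \<Rightarrow> weil_pres \<Rightarrow> weil_pres"  (infixl "\<otimes>\<^sub>W" 70) where
  "V \<otimes>\<^sub>W W =
     (let n = wvars V; m = wvars W in
      \<lparr>wvars = n + m,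
       wideal = Idl\<^bsub>Cinf (n + m)\<^esub>
         ((\<lambda>f. compose (Rn (n + m)) f (pr_left n)) ` wideal V \<union>
          (\<lambda>g. compose (Rn (n + m)) g (pr_right n)) ` wideal W)\<rparr>)"

definition weil_inl :: "weil_pres \<Rightarrow> weil_pres \<Rightarrow> whom" where
  "weil_inl V W = (\<lambda>a\<in>carrier (weil_alg V). the_elem
     ((\<lambda>f. wcls (V \<otimes>\<^sub>W W) (compose (Rn (wvars V + wvars W)) f (pr_left (wvars V)))) ` a))"

definition weil_inr :: "weil_pres \<Rightarrow> weil_pres \<Rightarrow> whom" where
  "weil_inr V W = (\<lambda>b\<in>carrier (weil_alg W). the_elem
     ((\<lambda>g. wcls (V \<otimes>\<^sub>W W) (compose (Rn (wvars V + wvars W)) g (pr_right (wvars V)))) ` b))"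

definition weil_tensor_hom ::
    "weil_pres \<Rightarrow> weil_pres \<Rightarrow> weil_pres \<Rightarrow> weil_pres \<Rightarrow> whom \<Rightarrow> whom \<Rightarrow> whom" where
  "weil_tensor_hom V V' W W' \<phi> \<psi> = (THE h. h \<in> weil_hom (V \<otimes>\<^sub>W W) (V' \<otimes>\<^sub>W W') \<and>
     compose (carrier (weil_alg V)) h (weil_inl V W) =
       compose (carrier (weil_alg V)) (weil_inl V' W') \<phi> \<and>
     compose (carrier (weil_alg W)) h (weil_inr V W) =
       compose (carrier (weil_alg W)) (weil_inr V' W') \<psi>)"


section \<open>Finite diagrams of Weil algebras and their limits\<close>

text \<open>The shape of a diagram is a finite directed graph; an arrow \<open>(u, v, \<phi>)\<close> carries the
  homomorphism \<open>\<phi>\<close> from the algebra at \<open>u\<close> to the one at \<open>v\<close>. Every diagram indexed by a finite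
  category has the same cones as its underlying graph.\<close>

record weil_diagram =
  dverts :: "nat set"
  dobj :: "nat \<Rightarrow> weil_pres"
  darrs :: "(nat \<times> nat \<times> whom) set"

definition finite_diagrams :: "weil_diagram set" where
  "finite_diagrams = {D. finite (dverts D) \<and> finite (darrs D) \<and>
     (\<forall>v\<in>dverts D. weil (dobj D v)) \<and>
     (\<forall>(u, v, \<phi>)\<in>darrs D. u \<in> dverts D \<and> v \<in> dverts D \<and> \<phi> \<in> weil_hom (dobj D u) (dobj D v))}"

text \<open>For diagrams of nonempty connected shape, limits of Weil algebras are limits of real
  algebras. For others they are not: the real numbers are the limit of the empty diagram.\<close>

definition connected_finite_diagrams :: "weil_diagram set" where
  "connected_finite_diagrams = {D \<in> finite_diagrams. dverts D \<noteq> {} \<and>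
     (\<forall>u\<in>dverts D. \<forall>v\<in>dverts D.
        (u, v) \<in> {(a, b). \<exists>\<phi>. (a, b, \<phi>) \<in> darrs D \<or> (b, a, \<phi>) \<in> darrs D}\<^sup>*)}"

definition weil_cone :: "weil_diagram \<Rightarrow> weil_pres \<Rightarrow> (nat \<Rightarrow> whom) \<Rightarrow> bool" where
  "weil_cone D A p \<longleftrightarrow> weil A \<and> (\<forall>v\<in>dverts D. p v \<in> weil_hom A (dobj D v)) \<and>
     (\<forall>(u, v, \<phi>)\<in>darrs D. compose (carrier (weil_alg A)) \<phi> (p u) = p v)"

definition weil_limit :: "weil_diagram \<Rightarrow> weil_pres \<Rightarrow> (nat \<Rightarrow> whom) \<Rightarrow> bool" where
  "weil_limit D A p \<longleftrightarrow> weil_cone D A p \<and>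
     (\<forall>B q. weil_cone D B q \<longrightarrow>
        (\<exists>!h. h \<in> weil_hom B A \<and>
          (\<forall>v\<in>dverts D. compose (carrier (weil_alg B)) (p v) h = q v)))"


section \<open>Froelicher spaces\<close>

record 'a froelicher = "'a partial_object" +
  curves :: "(real \<Rightarrow> 'a) set"
  funcs :: "('a \<Rightarrow> real) set"

definition froelicher :: "'a froelicher \<Rightarrow> bool" where
  "froelicher X \<longleftrightarrow>
     funcs X = {f \<in> extensional (carrier X). \<forall>c\<in>curves X. smooth_real (f \<circ> c)} \<and>
     curves X = {c \<in> UNIV \<rightarrow> carrier X. \<forall>f\<in>funcs X. smooth_real (f \<circ> c)}"

definition smooth_maps :: "'a froelicher \<Rightarrow> 'b froelicher \<Rightarrow> ('a \<Rightarrow> 'b) set" where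
  "smooth_maps X Y = {h \<in> carrier X \<rightarrow>\<^sub>E carrier Y. \<forall>c\<in>curves X. h \<circ> c \<in> curves Y}"

definition fs_iso :: "'a froelicher \<Rightarrow> 'b froelicher \<Rightarrow> ('a \<Rightarrow> 'b) \<Rightarrow> bool" where
  "fs_iso X Y h \<longleftrightarrow> h \<in> smooth_maps X Y \<and>
     (\<exists>k\<in>smooth_maps Y X. (\<forall>x\<in>carrier X. k (h x) = x) \<and> (\<forall>y\<in>carrier Y. h (k y) = y))"

definition fs_of_curves :: "'a set \<Rightarrow> (real \<Rightarrow> 'a) set \<Rightarrow> 'a froelicher" where
  "fs_of_curves A C =
     \<lparr>carrier = A, curves = C, funcs = {f \<in> extensional A. \<forall>c\<in>C. smooth_real (f \<circ> c)}\<rparr>"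

definition fs_real :: "real froelicher" where
  "fs_real = fs_of_curves UNIV {c. smooth_real c}"

text \<open>By Boman's theorem \<open>funcs (fs_Rn n)\<close> is \<open>carrier (Cinf n)\<close>.\<close>

definition fs_Rn :: "nat \<Rightarrow> point froelicher" where
  "fs_Rn n = fs_of_curves (Rn n) {c \<in> UNIV \<rightarrow> Rn n. \<forall>i<n. smooth_real (\<lambda>t. c t i)}"

definition fs_point :: "unit froelicher" where
  "fs_point = fs_of_curves UNIV UNIV"

definition fs_prod :: "'a froelicher \<Rightarrow> 'b froelicher \<Rightarrow> ('a \<times> 'b) froelicher" where
  "fs_prod X Y = fs_of_curves (carrier X \<times> carrier Y)
     {c. fst \<circ> c \<in> curves X \<and> snd \<circ> c \<in> curves Y}"

text \<open>\<open>fs_exp X Y\<close> is the space of smooth maps from \<open>Y\<close> to \<open>X\<close>. A curve in it is smooth iff its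
  transpose is a smooth map on the product of the real line and \<open>Y\<close>.\<close>

definition fs_exp :: "'a froelicher \<Rightarrow> 'b froelicher \<Rightarrow> ('b \<Rightarrow> 'a) froelicher" where
  "fs_exp X Y = fs_of_curves (smooth_maps Y X)
     {c \<in> UNIV \<rightarrow> smooth_maps Y X.
        (\<lambda>(t, y)\<in>UNIV \<times> carrier Y. c t y) \<in> smooth_maps (fs_prod fs_real Y) X}"

definition fs_eval :: "'a froelicher \<Rightarrow> 'b froelicher \<Rightarrow> ('b \<Rightarrow> 'a) \<times> 'b \<Rightarrow> 'a" where
  "fs_eval X Y = (\<lambda>(u, y)\<in>smooth_maps Y X \<times> carrier Y. u y)"

definition precomp ::
    "'a froelicher \<Rightarrow> 'b froelicher \<Rightarrow> 'c froelicher \<Rightarrow> ('c \<Rightarrow> 'b) \<Rightarrow> ('b \<Rightarrow> 'a) \<Rightarrow> ('c \<Rightarrow> 'a)" where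
  "precomp X Y Y' g = (\<lambda>u\<in>carrier (fs_exp X Y). compose (carrier Y') u g)"

definition postcomp ::
    "'a froelicher \<Rightarrow> 'b froelicher \<Rightarrow> ('a \<Rightarrow> 'c) \<Rightarrow> ('b \<Rightarrow> 'a) \<Rightarrow> ('b \<Rightarrow> 'c)" where
  "postcomp X Y k = (\<lambda>u\<in>carrier (fs_exp X Y). compose (carrier Y) k u)"


section \<open>Universal properties in the category of Froelicher spaces\<close>

text \<open>The argument of type \<open>'t itself\<close> is the type of the points of the test objects. Formulas
  cannot quantify over types, so ``for every Froelicher space'' becomes ``for every Froelicher
  space with points in \<open>'t\<close>'', where \<open>'t\<close> is an arbitrary type.\<close>

definition fs_terminal :: "'t itself \<Rightarrow> 'a froelicher \<Rightarrow> bool" where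
  "fs_terminal t P \<longleftrightarrow>
     (\<forall>T :: 't froelicher. froelicher T \<longrightarrow> (\<exists>!h. h \<in> smooth_maps T P))"

definition fs_product :: "'t itself \<Rightarrow> 'a froelicher \<Rightarrow> 'b froelicher \<Rightarrow>
    'p froelicher \<Rightarrow> ('p \<Rightarrow> 'a) \<Rightarrow> ('p \<Rightarrow> 'b) \<Rightarrow> bool" where
  "fs_product t X Y P p q \<longleftrightarrow> p \<in> smooth_maps P X \<and> q \<in> smooth_maps P Y \<and>
     (\<forall>(T :: 't froelicher) f g. froelicher T \<and> f \<in> smooth_maps T X \<and> g \<in> smooth_maps T Y \<longrightarrow>
        (\<exists>!h. h \<in> smooth_maps T P \<and>
           compose (carrier T) p h = f \<and> compose (carrier T) q h = g))"

definition fs_exponential :: "'t itself \<Rightarrow> 'a froelicher \<Rightarrow> 'b froelicher \<Rightarrow>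
    'e froelicher \<Rightarrow> ('e \<times> 'b \<Rightarrow> 'a) \<Rightarrow> bool" where
  "fs_exponential t X Y E ev \<longleftrightarrow> ev \<in> smooth_maps (fs_prod E Y) X \<and>
     (\<forall>(T :: 't froelicher) f. froelicher T \<and> f \<in> smooth_maps (fs_prod T Y) X \<longrightarrow>
        (\<exists>!h. h \<in> smooth_maps T E \<and>
           compose (carrier (fs_prod T Y)) ev (\<lambda>(s, y). (h s, y)) = f))"

definition fs_cone :: "nat set \<Rightarrow> (nat \<Rightarrow> 'a froelicher) \<Rightarrow> (nat \<times> nat \<times> ('a \<Rightarrow> 'a)) set \<Rightarrow>
    't froelicher \<Rightarrow> (nat \<Rightarrow> 't \<Rightarrow> 'a) \<Rightarrow> bool" where
  "fs_cone V Ob Ar T f \<longleftrightarrow> froelicher T \<and> (\<forall>v\<in>V. f v \<in> smooth_maps T (Ob v)) \<and>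
     (\<forall>(u, v, a)\<in>Ar. compose (carrier T) a (f u) = f v)"

definition fs_limit :: "'t itself \<Rightarrow> nat set \<Rightarrow> (nat \<Rightarrow> 'a froelicher) \<Rightarrow>
    (nat \<times> nat \<times> ('a \<Rightarrow> 'a)) set \<Rightarrow> 'a froelicher \<Rightarrow> (nat \<Rightarrow> 'a \<Rightarrow> 'a) \<Rightarrow> bool" where
  "fs_limit t V Ob Ar P p \<longleftrightarrow> fs_cone V Ob Ar P p \<and>
     (\<forall>(T :: 't froelicher) f. fs_cone V Ob Ar T f \<longrightarrow>
        (\<exists>!h. h \<in> smooth_maps T P \<and> (\<forall>v\<in>V. compose (carrier T) (p v) h = f v)))"


section \<open>Weil prolongation\<close>

text \<open>The Froelicher structure of \<open>W\<close> as a finite-dimensional real vector space: a curve is smooth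
  iff all linear functionals are smooth along it.\<close>

definition weil_functional :: "weil_pres \<Rightarrow> (welem \<Rightarrow> real) \<Rightarrow> bool" where
  "weil_functional W l \<longleftrightarrow>
     (\<forall>a\<in>carrier (weil_alg W). \<forall>b\<in>carrier (weil_alg W). l (a \<oplus>\<^bsub>weil_alg W\<^esub> b) = l a + l b) \<and>
     (\<forall>r. \<forall>a\<in>carrier (weil_alg W). l (wconst W r \<otimes>\<^bsub>weil_alg W\<^esub> a) = r * l a)"

definition weil_space :: "weil_pres \<Rightarrow> welem froelicher" where
  "weil_space W = fs_of_curves (carrier (weil_alg W))
     {c \<in> UNIV \<rightarrow> carrier (weil_alg W). \<forall>l. weil_functional W l \<longrightarrow> smooth_real (l \<circ> c)}"

definition prolong_rel :: "'a froelicher \<Rightarrow> weil_pres \<Rightarrow> ((point \<Rightarrow> 'a) \<times> (point \<Rightarrow> 'a)) set" where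
  "prolong_rel X W = {(f, g).
     f \<in> smooth_maps (fs_Rn (wvars W)) X \<and> g \<in> smooth_maps (fs_Rn (wvars W)) X \<and>
     f (\<lambda>_. 0) = g (\<lambda>_. 0) \<and>
     (\<forall>\<xi>\<in>funcs X. (\<lambda>x\<in>Rn (wvars W). \<xi> (f x) - \<xi> (g x)) \<in> wideal W)}"

definition pcls :: "'a froelicher \<Rightarrow> weil_pres \<Rightarrow> (point \<Rightarrow> 'a) \<Rightarrow> (point \<Rightarrow> 'a) set" where
  "pcls X W f = prolong_rel X W `` {f}"

text \<open>The map induced by a smooth function \<open>\<xi>\<close>, with values in \<open>W\<close> itself. Here and below
  \<open>the_elem\<close> selects the common value for all representatives \<open>f\<close> of a class.\<close>

definition prolong_func ::
    "weil_pres \<Rightarrow> ('a \<Rightarrow> real) \<Rightarrow> (point \<Rightarrow> 'a) set \<Rightarrow> welem" where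
  "prolong_func W \<xi> a = the_elem ((\<lambda>f. wcls W (compose (Rn (wvars W)) \<xi> f)) ` a)"

definition prolong :: "'a froelicher \<Rightarrow> weil_pres \<Rightarrow> (point \<Rightarrow> 'a) set froelicher" where
  "prolong X W =
     (let A = smooth_maps (fs_Rn (wvars W)) X // prolong_rel X W in
      fs_of_curves A
        {c \<in> UNIV \<rightarrow> A. \<forall>\<xi>\<in>funcs X. prolong_func W \<xi> \<circ> c \<in> curves (weil_space W)})"

definition prolong_map :: "'a froelicher \<Rightarrow> 'b froelicher \<Rightarrow> weil_pres \<Rightarrow> ('a \<Rightarrow> 'b) \<Rightarrow>
    (point \<Rightarrow> 'a) set \<Rightarrow> (point \<Rightarrow> 'b) set" where
  "prolong_map X Y W h = (\<lambda>a\<in>carrier (prolong X W).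
     the_elem ((\<lambda>f. pcls Y W (compose (Rn (wvars W)) h f)) ` a))"

text \<open>Every homomorphism of Weil algebras is precomposition with some smooth map \<open>\<theta>\<close> fixing the
  origin, and the induced map below does not depend on the choice of \<open>\<theta>\<close>.\<close>

definition induces_hom :: "weil_pres \<Rightarrow> weil_pres \<Rightarrow> (point \<Rightarrow> point) \<Rightarrow> whom \<Rightarrow> bool" where
  "induces_hom V W \<theta> \<phi> \<longleftrightarrow> \<theta> \<in> smooth_maps (fs_Rn (wvars W)) (fs_Rn (wvars V)) \<and>
     \<theta> (\<lambda>_. 0) = (\<lambda>_. 0) \<and>
     (\<forall>g\<in>carrier (Cinf (wvars V)). \<phi> (wcls V g) = wcls W (compose (Rn (wvars W)) g \<theta>))"

definition prolong_hom :: "'a froelicher \<Rightarrow> weil_pres \<Rightarrow> weil_pres \<Rightarrow> whom \<Rightarrow>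
    (point \<Rightarrow> 'a) set \<Rightarrow> (point \<Rightarrow> 'a) set" where
  "prolong_hom X V W \<phi> = (\<lambda>a\<in>carrier (prolong X V).
     the_elem ((\<lambda>f. pcls X W (compose (Rn (wvars W)) f (SOME \<theta>. induces_hom V W \<theta> \<phi>))) ` a))"


section \<open>Weil exponentiability and microlinearity\<close>

text \<open>Both sides of the defining isomorphism of Weil exponentiability.\<close>

definition we_lhs :: "'a froelicher \<Rightarrow> 'y froelicher \<Rightarrow> weil_pres \<Rightarrow> weil_pres \<Rightarrow>
    ('y \<Rightarrow> (point \<Rightarrow> 'a) set) froelicher" where
  "we_lhs X Y V W = fs_exp (prolong X (V \<otimes>\<^sub>W W)) Y"

definition we_rhs :: "'a froelicher \<Rightarrow> 'y froelicher \<Rightarrow> weil_pres \<Rightarrow> weil_pres \<Rightarrow>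
    (point \<Rightarrow> 'y \<Rightarrow> (point \<Rightarrow> 'a) set) set froelicher" where
  "we_rhs X Y V W = prolong (fs_exp (prolong X V) Y) W"

text \<open>The elements of both sides represented by a smooth map \<open>F\<close> on the product of \<open>Y\<close> and a
  Euclidean space with values in \<open>X\<close>.\<close>

definition we_lhs_elem :: "'a froelicher \<Rightarrow> 'y froelicher \<Rightarrow> weil_pres \<Rightarrow> weil_pres \<Rightarrow>
    ('y \<times> point \<Rightarrow> 'a) \<Rightarrow> 'y \<Rightarrow> (point \<Rightarrow> 'a) set" where
  "we_lhs_elem X Y V W F =
     (\<lambda>y\<in>carrier Y. pcls X (V \<otimes>\<^sub>W W) (\<lambda>x\<in>Rn (wvars V + wvars W). F (y, x)))"

definition we_rhs_elem :: "'a froelicher \<Rightarrow> 'y froelicher \<Rightarrow> weil_pres \<Rightarrow> weil_pres \<Rightarrow>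
    ('y \<times> point \<Rightarrow> 'a) \<Rightarrow> (point \<Rightarrow> 'y \<Rightarrow> (point \<Rightarrow> 'a) set) set" where
  "we_rhs_elem X Y V W F =
     pcls (fs_exp (prolong X V) Y) W
       (\<lambda>b\<in>Rn (wvars W). \<lambda>y\<in>carrier Y.
          pcls X V (\<lambda>a\<in>Rn (wvars V). F (y, join (wvars V) a b)))"

text \<open>The four conjuncts: \<open>\<Phi>\<close> consists of isomorphisms, it is given by transposition on
  represented elements, it is natural in \<open>Y\<close>, and it is natural in the two Weil algebras.\<close>

definition weil_exponentiable :: "'y itself \<Rightarrow> 'a froelicher \<Rightarrow> bool" where
  "weil_exponentiable t X \<longleftrightarrow> (\<exists>\<Phi>.
     (\<forall>(Y :: 'y froelicher) V W. froelicher Y \<and> weil V \<and> weil W \<longrightarrow>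
        fs_iso (we_lhs X Y V W) (we_rhs X Y V W) (\<Phi> Y V W)) \<and>
     (\<forall>(Y :: 'y froelicher) V W. froelicher Y \<and> weil V \<and> weil W \<longrightarrow>
        (\<forall>F\<in>smooth_maps (fs_prod Y (fs_Rn (wvars V + wvars W))) X.
           \<Phi> Y V W (we_lhs_elem X Y V W F) = we_rhs_elem X Y V W F)) \<and>
     (\<forall>(Y :: 'y froelicher) (Y' :: 'y froelicher) V W.
        froelicher Y \<and> froelicher Y' \<and> weil V \<and> weil W \<longrightarrow>
        (\<forall>g\<in>smooth_maps Y' Y.
           compose (carrier (we_lhs X Y V W))
             (\<Phi> Y' V W) (precomp (prolong X (V \<otimes>\<^sub>W W)) Y Y' g) =
           compose (carrier (we_lhs X Y V W))
             (prolong_map (fs_exp (prolong X V) Y) (fs_exp (prolong X V) Y') W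
                (precomp (prolong X V) Y Y' g))
             (\<Phi> Y V W))) \<and>
     (\<forall>(Y :: 'y froelicher) V V' W W'.
        froelicher Y \<and> weil V \<and> weil V' \<and> weil W \<and> weil W' \<longrightarrow>
        (\<forall>\<phi>\<in>weil_hom V V'. \<forall>\<psi>\<in>weil_hom W W'.
           compose (carrier (we_lhs X Y V W))
             (\<Phi> Y V' W')
             (postcomp (prolong X (V \<otimes>\<^sub>W W)) Y
                (prolong_hom X (V \<otimes>\<^sub>W W) (V' \<otimes>\<^sub>W W') (weil_tensor_hom V V' W W' \<phi> \<psi>))) =
           compose (carrier (we_lhs X Y V W))
             (compose (carrier (we_rhs X Y V W))
                (prolong_hom (fs_exp (prolong X V') Y) W W' \<psi>)
                (prolong_map (fs_exp (prolong X V) Y) (fs_exp (prolong X V') Y) W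
                   (postcomp (prolong X V) Y (prolong_hom X V V' \<phi>))))
             (\<Phi> Y V W))))"

text \<open>The parameter \<open>\<K>\<close> is the class of finite diagrams whose limits are to be preserved. With
  \<open>\<K> = finite_diagrams\<close> and limits taken in the category of Weil algebras, the empty diagram
  (whose limit is the algebra of real numbers) forces \<open>X\<close> to be terminal; with
  \<open>\<K> = connected_finite_diagrams\<close> the limits are those that agree with limits of real algebras.\<close>

definition microlinear :: "'t itself \<Rightarrow> weil_diagram set \<Rightarrow> 'a froelicher \<Rightarrow> bool" where
  "microlinear t \<K> X \<longleftrightarrow> (\<forall>D\<in>\<K>. \<forall>A p. weil_limit D A p \<longrightarrow>
     fs_limit TYPE('t) (dverts D) (\<lambda>v. prolong X (dobj D v))
       ((\<lambda>(u, v, \<phi>). (u, v, prolong_hom X (dobj D u) (dobj D v) \<phi>)) ` darrs D)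
       (prolong X A) (\<lambda>v. prolong_hom X A (dobj D v) (p v)))"

text \<open>Being an object of the subcategory amounts to \<open>FS_WE_ML TYPE('t) \<K> X\<close> for every type \<open>'t\<close>.
  To test \<open>fs_exp X Y\<close>, where \<open>Y\<close> has points in \<open>'b\<close>, against spaces with points in \<open>'t\<close>, the
  instances of this property of \<open>X\<close> at \<open>'t \<times> 'b\<close> and \<open>'b\<close> are relevant.\<close>

definition FS_WE_ML :: "'t itself \<Rightarrow> weil_diagram set \<Rightarrow> 'a froelicher \<Rightarrow> bool" where
  "FS_WE_ML t \<K> X \<longleftrightarrow>
     froelicher X \<and> weil_exponentiable TYPE('t) X \<and> microlinear TYPE('t) \<K> X"

end

theory Submission imports Defs begin

text \<open>
  Smoothness in a Froelicher space is tested along curves and by functions only, while the elements of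
  a prolongation \<open>X \<otimes> W\<close> are classes of maps on Euclidean space modulo an ideal. The proof
  reduces every statement about \<open>X \<otimes> W\<close> to real functions and then lets cartesian closedness do
  the rest.

  The analytic basis is Boman's theorem, \<open>boman\<close>: a function on Euclidean space that is smooth along
  smooth curves has continuous partial derivatives of all orders. It makes Euclidean spaces
  Froelicher spaces with the expected smooth functions and gives Hadamard's lemma, hence Taylor
  expansion with smooth remainder. The second analytic fact is \<open>smooth2_if_smooth_functionals\<close>: a curve
  of smooth functions \<open>G t\<close> is jointly smooth if \<open>\<mu> (G t)\<close> is smooth for every linear functional \<open>\<mu>\<close>
  that is smooth on smooth families. It is what makes the function space \<open>X\<^sup>Y\<close> a Froelicher space whose
  curves are the smooth maps of two variables, so that exponentials exist.

  A Weil algebra is finite-dimensional: modulo its ideal, smooth functions are polynomials of bounded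
  degree. Hence there is a dual basis of functionals (\<open>weil_dual_basis\<close>). These functionals only see a
  jet at \<open>0\<close>; therefore they preserve smooth dependence on parameters and commute with the functionals
  in the parameter (\<open>jet_functional_family\<close>). A curve \<open>t \<mapsto> [f\<^sub>t]\<close> of \<open>X \<otimes> W\<close> is smooth iff
  \<open>L (\<xi> \<circ> f\<^sub>t)\<close> is smooth in \<open>t\<close> for all smooth \<open>\<xi>\<close> on \<open>X\<close> and all functionals \<open>L\<close> that vanish on the ideal.

  Prolongation preserves products (\<open>prolong_prod_iso\<close>). The difficulty is that a smooth function on
  \<open>X \<times> Y\<close> mixes both components. Each component is treated with the other one fixed, and a diagonal
  argument (\<open>wnull_diagonal\<close>) puts the two together.

  Weil exponentiability amounts to one isomorphism \<open>(X \<otimes> (V \<otimes> W))\<^sup>Z \<cong> (X \<otimes> V)\<^sup>Z \<otimes> W\<close> that matches the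
  elements represented by smooth maps into \<open>X\<close>. The choice \<open>V = \<real>\<close> has two consequences: every element
  of \<open>(X \<otimes> W)\<^sup>Z\<close> is represented by a smooth map into \<open>X\<close>, so that naturality becomes a computation with
  representatives, and \<open>X\<^sup>Y \<otimes> W \<cong> (X \<otimes> W)\<^sup>Y\<close>. The isomorphism for \<open>X \<times> Y\<close> then follows componentwise, and
  the one for \<open>X\<^sup>Y\<close> from
  \<open>(X\<^sup>Y \<otimes> (V \<otimes> W))\<^sup>Z \<cong> (X \<otimes> (V \<otimes> W))\<^sup>Z\<^sup>\<times>\<^sup>Y \<cong> (X \<otimes> V)\<^sup>Z\<^sup>\<times>\<^sup>Y \<otimes> W \<cong> (X\<^sup>Y \<otimes> V)\<^sup>Z \<otimes> W\<close>.

  Microlinearity is a property of cones \<open>T \<rightarrow> X \<otimes> D\<close>. Because prolongation commutes with products and,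
  on Weil exponentiable spaces, with exponents, a cone \<open>T \<rightarrow> (X \<times> Y) \<otimes> D\<close> is a pair of cones, and a
  cone \<open>T \<rightarrow> X\<^sup>Y \<otimes> D\<close> is a cone \<open>T \<times> Y \<rightarrow> X \<otimes> D\<close>; their unique lifts are carried back.
\<close>

section \<open>Smooth functions of one real variable\<close>

lemma smooth_real_coinduct:
 assumes "P f" and step: "!!f. P f ==> EX f'. P f' & (ALL x. (f has_real_derivative f' x) (at x))"
 shows "smooth_real f"
proof -
 have P: "P ((deriv ^^ k) f)" for k
 proof (induction k)
  case (Suc k)
  then obtain f' where f': "P f'" "!!x. ((deriv ^^ k) f has_real_derivative f' x) (at x)" using step by blast
  then have "deriv ((deriv ^^ k) f) = f'" by (intro ext DERIV_imp_deriv)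
  with f' show ?case by simp
 qed (use assms in simp)
 show ?thesis unfolding smooth_real_def
 proof (intro allI)
  fix k x
  obtain f' where "((deriv ^^ k) f has_real_derivative f' x) (at x)" using step[OF P[of k]] by blast
  then show "(deriv ^^ k) f differentiable at x" unfolding real_differentiable_def by blast
 qed
qed

lemma smooth_real_differentiable: "smooth_real f ==> f differentiable (at x)"
 unfolding smooth_real_def by (drule spec[of _ 0]) simp

lemma smooth_real_deriv: "smooth_real f ==> smooth_real (deriv f)"
 unfolding smooth_real_def by (metis comp_apply funpow_Suc_right)

lemma smooth_real_derivs: "smooth_real f ==> smooth_real ((deriv ^^ k) f)"
 by (induction k) (auto intro: smooth_real_deriv)

lemma smooth_real_DERIV: "smooth_real f ==> (f has_real_derivative deriv f x) (at x)"
 using smooth_real_differentiable[of f x] by (metis DERIV_imp_deriv real_differentiable_def)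

lemma smooth_real_DERIV_derivs:
 "smooth_real f ==> ((deriv ^^ k) f has_real_derivative (deriv ^^ Suc k) f x) (at x)"
 using smooth_real_DERIV[OF smooth_real_derivs] by simp

lemma smooth_real_isCont: "smooth_real f ==> isCont f x" by (meson DERIV_isCont smooth_real_DERIV)

lemma smooth_real_continuous_on: "smooth_real f ==> continuous_on S f"
 by (simp add: continuous_at_imp_continuous_on smooth_real_isCont)

lemma smooth_real_const [simp]: "smooth_real (%x. c)"
 by (rule smooth_real_coinduct[where P = "%f. EX c. f = (%x. c)"]) (auto intro!: exI[of _ "%_. 0"])

lemma smooth_real_id [simp]: "smooth_real (%x. x)"
proof (rule smooth_real_coinduct[where P = "%f. f = (%x. x) \<or> smooth_real f"])
 fix f :: "real => real" assume "f = (%x. x) \<or> smooth_real f"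
 then show "EX f'. (f' = (%x. x) \<or> smooth_real f') & (ALL x. (f has_real_derivative f' x) (at x))"
 proof
  assume "f = (%x. x)"
  then show ?thesis by (intro exI[of _ "%_. 1"]) auto
 qed (use smooth_real_DERIV smooth_real_deriv in blast)
qed simp

text \<open>Sums, products and composites generate a class of functions that contains the derivatives
  of its members.\<close>

inductive smooth_closure :: "(real => real) => bool" where
 base: "smooth_real f ==> smooth_closure f"
| comp: "smooth_real f ==> smooth_real g ==> smooth_closure (%x. f (g x))"
| add: "smooth_closure f ==> smooth_closure g ==> smooth_closure (%x. f x + g x)"
| mult: "smooth_closure f ==> smooth_closure g ==> smooth_closure (%x. f x * g x)"

lemma smooth_closure_smooth:
 assumes "smooth_closure f" shows "smooth_real f"
proof (rule smooth_real_coinduct[where P = smooth_closure])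
 fix f assume "smooth_closure f"
 then show "EX f'. smooth_closure f' & (ALL x. (f has_real_derivative f' x) (at x))"
 proof induction
  case (base f)
  then show ?case using smooth_real_DERIV smooth_real_deriv smooth_closure.base by blast
 next
  case (comp f g)
  have "((%x. f (g x)) has_real_derivative deriv f (g x) * deriv g x) (at x)" for x
   using DERIV_chain2[OF smooth_real_DERIV[OF comp(1)] smooth_real_DERIV[OF comp(2)]] .
  moreover have "smooth_closure (%x. deriv f (g x) * deriv g x)"
   by (intro smooth_closure.mult smooth_closure.comp smooth_closure.base smooth_real_deriv comp)
  ultimately show ?case by blast
 next
  case (add f g)
  then obtain f' g' where *: "smooth_closure f'" "smooth_closure g'"
   "!!x. (f has_real_derivative f' x) (at x)" "!!x. (g has_real_derivative g' x) (at x)" by blast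
  show ?case by (intro exI[of _ "%x. f' x + g' x"] conjI allI smooth_closure.add DERIV_add *)
 next
  case (mult f g)
  then obtain f' g' where *: "smooth_closure f'" "smooth_closure g'"
   "!!x. (f has_real_derivative f' x) (at x)" "!!x. (g has_real_derivative g' x) (at x)" by blast
  show ?case by (intro exI[of _ "%x. f' x * g x + g' x * f x"] conjI allI
     smooth_closure.add smooth_closure.mult DERIV_mult * mult)
 qed
qed fact

lemma smooth_real_add: "smooth_real f ==> smooth_real g ==> smooth_real (%x. f x + g x)"
 by (rule smooth_closure_smooth, rule smooth_closure.add) (simp_all add: smooth_closure.base)

lemma smooth_real_mult: "smooth_real f ==> smooth_real g ==> smooth_real (%x. f x * g x)"
 by (rule smooth_closure_smooth, rule smooth_closure.mult) (simp_all add: smooth_closure.base)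

lemma smooth_real_compose: "smooth_real f ==> smooth_real g ==> smooth_real (%x. f (g x))"
 by (rule smooth_closure_smooth, rule smooth_closure.comp)

lemma smooth_real_cmult: "smooth_real f ==> smooth_real (%x. c * f x)" by (intro smooth_real_mult smooth_real_const)

lemma smooth_real_uminus: "smooth_real f ==> smooth_real (%x. - f x)" using smooth_real_cmult[of f "-1"] by simp

lemma smooth_real_diff: "smooth_real f ==> smooth_real g ==> smooth_real (%x. f x - g x)"
 using smooth_real_add[OF _ smooth_real_uminus, of f g] by simp

lemma smooth_real_sum: "(!!i. i \<in> A ==> smooth_real (f i)) ==> smooth_real (%x. \<Sum>i\<in>A. f i x)"
 by (induction A rule: infinite_finite_induct) (auto intro: smooth_real_add)

lemma smooth_real_power: "smooth_real f ==> smooth_real (%x. f x ^ n)" by (induction n) (auto intro: smooth_real_mult)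

lemmas smooth_real_intros = smooth_real_const smooth_real_id smooth_real_add smooth_real_mult
 smooth_real_uminus smooth_real_diff smooth_real_sum smooth_real_power

lemma derivs_cong_ev:
 assumes "\<forall>\<^sub>F y in nhds x. f y = g y"
 shows "(deriv ^^ k) f x = (deriv ^^ k) g (x::real)"
proof -
 have "\<forall>\<^sub>F y in nhds x. (deriv ^^ k) f y = (deriv ^^ k) g y"
 proof (induction k)
  case (Suc k)
  then have "\<forall>\<^sub>F y in nhds x. \<forall>\<^sub>F z in nhds y. (deriv ^^ k) f z = (deriv ^^ k) g z"
   by (simp add: eventually_eventually)
  then show ?case by (rule eventually_mono) (auto intro: deriv_cong_ev)
 qed (use assms in simp)
 then show ?thesis by (rule eventually_nhds_x_imp_x)
qed

lemma derivs_add: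
 assumes "smooth_real f" "smooth_real g"
 shows "(deriv ^^ k) (%x. f x + g x) = (%x. (deriv ^^ k) f x + (deriv ^^ k) g x)"
proof (induction k)
 case (Suc k)
 show ?case using smooth_real_DERIV_derivs[OF assms(1)] smooth_real_DERIV_derivs[OF assms(2)]
  by (auto simp: Suc fun_eq_iff intro!: DERIV_imp_deriv DERIV_add)
qed simp

lemma derivs_cmult:
 assumes "smooth_real f"
 shows "(deriv ^^ k) (%x. c * f x) = (%x. c * (deriv ^^ k) f x)"
proof (induction k)
 case (Suc k)
 show ?case using smooth_real_DERIV_derivs[OF assms(1)]
  by (auto simp: Suc fun_eq_iff intro!: DERIV_imp_deriv DERIV_cmult)
qed simp

lemma derivs_diff:
 assumes "smooth_real f" "smooth_real g"
 shows "(deriv ^^ k) (%x. f x - g x) = (%x. (deriv ^^ k) f x - (deriv ^^ k) g x)"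
 using derivs_add[OF assms(1) smooth_real_cmult[OF assms(2)], of k "-1"] derivs_cmult[OF assms(2), of k "-1"] by simp

lemma derivs_sum:
 assumes "!!i. i \<in> A ==> smooth_real (f i)"
 shows "(deriv ^^ k) (%x. \<Sum>i\<in>A. f i x) = (%x. \<Sum>i\<in>A. (deriv ^^ k) (f i) x)" using assms
proof (induction A rule: infinite_finite_induct)
 case (insert i A)
 then show ?case by (simp add: derivs_add smooth_real_sum)
next
 case (infinite A)
 have "(deriv ^^ k) (%x::real. 0::real) = (%x. 0)" by (induction k) auto
 with infinite show ?case by simp
next
 case empty
 have "(deriv ^^ k) (%x::real. 0::real) = (%x. 0)" by (induction k) auto
 then show ?case by simp
qed

lemma derivs_affine:
 assumes "smooth_real f"
 shows "(deriv ^^ k) (%x. f (a * x + b)) = (%x. a ^ k * (deriv ^^ k) f (a * x + b))"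
proof (induction k)
 case (Suc k)
 have "((%x. a ^ k * (deriv ^^ k) f (a * x + b)) has_real_derivative
   a ^ k * ((deriv ^^ Suc k) f (a * x + b) * a)) (at x)" for x
  by (intro DERIV_cmult DERIV_chain2[OF smooth_real_DERIV_derivs[OF assms]])
    (auto intro!: derivative_eq_intros)
 from DERIV_imp_deriv[OF this] show ?case by (auto simp: Suc fun_eq_iff)
qed simp

lemma smooth_real_bounded:
 assumes "smooth_real f" shows "EX C. ALL x. \<bar>x\<bar> \<le> R --> \<bar>f x\<bar> \<le> C"
proof -
 have "compact (f ` {-R..R})" by (intro compact_continuous_image smooth_real_continuous_on assms) auto
 then obtain C where "\<forall>y\<in>f ` {-R..R}. \<bar>y\<bar> \<le> C"
  using compact_imp_bounded bounded_iff by (metis real_norm_def)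
 then show ?thesis by (intro exI[of _ C]) (simp add: abs_le_iff)
qed

text \<open>The bounds are only required up to the order \<open>r\<close> and on a bounded interval, so that the
  lemma also applies when different orders of differentiability need different series.\<close>

lemma series_derivs:
 assumes sm: "!!n. smooth_real (g n)"
  and bd: "!!j. j \<le> r ==> EX M. summable M & (ALL n x. \<bar>x\<bar> < R --> \<bar>(deriv ^^ j) (g n) x\<bar> \<le> M n)"
  and x: "\<bar>x\<bar> < R" and j: "j \<le> r"
 shows "summable (%n. \<bar>(deriv ^^ j) (g n) x\<bar>)"
  and "(deriv ^^ j) (%x. \<Sum>n. g n x) x = (\<Sum>n. (deriv ^^ j) (g n) x)"
  and "j < r ==> ((deriv ^^ j) (%x. \<Sum>n. g n x) has_real_derivative
      (\<Sum>n. (deriv ^^ Suc j) (g n) x)) (at x)"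
proof -
 have summ: "summable (%n. \<bar>(deriv ^^ j) (g n) x\<bar>)" if j: "j \<le> r" "\<bar>x\<bar> < R" for j x
 proof -
  obtain M where M: "summable M" "!!n x. \<bar>x\<bar> < R ==> \<bar>(deriv ^^ j) (g n) x\<bar> \<le> M n"
   using bd[OF j(1)] by auto
  show ?thesis by (rule summable_comparison_test'[OF M(1), of 0]) (simp add: M(2) j(2))
 qed
 show "summable (%n. \<bar>(deriv ^^ j) (g n) x\<bar>)" by (rule summ[OF j x])
 have step: "((%x. \<Sum>n. (deriv ^^ j) (g n) x) has_real_derivative
      (\<Sum>n. (deriv ^^ Suc j) (g n) x)) (at x)" if j: "j < r" and x: "\<bar>x\<bar> < R" for j x
 proof -
  obtain M where M: "summable M" "!!n x. \<bar>x\<bar> < R ==> \<bar>(deriv ^^ Suc j) (g n) x\<bar> \<le> M n"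
   using bd[of "Suc j"] j by auto
  show ?thesis
  proof (rule has_field_derivative_series'(2)[where S = "{-R<..<R}" and ?x0.0 = x])
   show "uniformly_convergent_on {- R<..<R} (%n x. \<Sum>i<n. (deriv ^^ Suc j) (g i) x)"
    by (rule Weierstrass_m_test'[OF _ M(1)]) (use M(2) in auto)
   show "summable (%n. (deriv ^^ j) (g n) x)" using summ[of j x] j x summable_rabs_cancel by simp
   show "((deriv ^^ j) (g n) has_real_derivative (deriv ^^ Suc j) (g n) x) (at x within {- R<..<R})"
    for n x by (rule has_field_derivative_at_within[OF smooth_real_DERIV_derivs[OF sm]])
  qed (use x in \<open>auto simp: interior_open\<close>)
 qed
 have ev: "\<forall>\<^sub>F y in nhds x. \<bar>y\<bar> < R" if "\<bar>x\<bar> < R" for x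
  using eventually_nhds_in_open[of "{-R<..<R}" x] that by (simp add: abs_less_iff conj_commute minus_less_iff)
 have eq: "(deriv ^^ j) (%x. \<Sum>n. g n x) x = (\<Sum>n. (deriv ^^ j) (g n) x)" if "j \<le> r" "\<bar>x\<bar> < R" for j x
  using that
 proof (induction j arbitrary: x)
  case (Suc j)
  have "deriv ((deriv ^^ j) (%x. \<Sum>n. g n x)) x = deriv (%x. \<Sum>n. (deriv ^^ j) (g n) x) x"
   using ev[OF Suc.prems(2)] by (intro deriv_cong_ev) (use Suc in \<open>auto elim!: eventually_mono\<close>)
  also have "\<dots> = (\<Sum>n. (deriv ^^ Suc j) (g n) x)" by (rule DERIV_imp_deriv, rule step) (use Suc in auto)
  finally show ?case by simp
 qed simp
 show "(deriv ^^ j) (%x. \<Sum>n. g n x) x = (\<Sum>n. (deriv ^^ j) (g n) x)" using j x by (rule eq)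
 show "((deriv ^^ j) (%x. \<Sum>n. g n x) has_real_derivative
      (\<Sum>n. (deriv ^^ Suc j) (g n) x)) (at x)" if "j < r" using step[OF that x]
  by (rule DERIV_cong_ev[THEN iffD1, rotated -1])
    (use ev[OF x] that in \<open>auto elim!: eventually_mono simp: eq\<close>)
qed

lemma smooth_real_series:
 assumes sm: "!!n. smooth_real (g n)"
  and bd: "!!j R. EX M. summable M & (ALL n x. \<bar>x\<bar> < R --> \<bar>(deriv ^^ j) (g n) x\<bar> \<le> M n)"
 shows "smooth_real (%x. \<Sum>n. g n x)"
  and "(deriv ^^ j) (%x. \<Sum>n. g n x) x = (\<Sum>n. (deriv ^^ j) (g n) x)"
  and "summable (%n. \<bar>g n x\<bar>)"
proof -
 show "smooth_real (%x. \<Sum>n. g n x)" unfolding smooth_real_def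
 proof (intro allI)
  fix k x
  show "(deriv ^^ k) (%x. \<Sum>n. g n x) differentiable at x"
   using series_derivs(3)[OF sm bd, of x "\<bar>x\<bar> + 1" k "Suc k"] unfolding real_differentiable_def by auto
 qed
 show "(deriv ^^ j) (%x. \<Sum>n. g n x) x = (\<Sum>n. (deriv ^^ j) (g n) x)"
  using series_derivs(2)[OF sm bd, of x "\<bar>x\<bar> + 1" j j] by auto
 show "summable (%n. \<bar>g n x\<bar>)" using series_derivs(1)[OF sm bd, of x "\<bar>x\<bar> + 1" 0 0] by auto
qed

section \<open>Curves through rapidly convergent sequences\<close>

definition flat :: "real poly => real => real" where
 "flat p t = (if t > 0 then poly p (1 / t) * exp (- (1 / t)) else 0)"

lemma poly_times_exp_tendsto_0: "((%x::real. poly p x * exp (- x)) \<longlongrightarrow> 0) at_top"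
proof -
 have "((%x. \<Sum>i\<le>degree p. coeff p i * (x ^ i / exp x)) \<longlongrightarrow> (\<Sum>i\<le>degree p. coeff p i * 0)) at_top"
  by (intro tendsto_sum tendsto_mult tendsto_const tendsto_power_div_exp_0)
 moreover have "poly p x * exp (- x) = (\<Sum>i\<le>degree p. coeff p i * (x ^ i / exp x))" for x :: real
  by (simp add: poly_altdef sum_distrib_right exp_minus divide_inverse mult.assoc)
 ultimately show ?thesis by simp
qed

lemma DERIV_flat: "(flat p has_real_derivative flat ([:0, 0, 1:] * (p - pderiv p)) t) (at t)"
proof -
 consider "t > 0" | "t < 0" | "t = 0" by linarith
 then show ?thesis
 proof cases
  case 1
  have "((%t. poly p (1 / t) * exp (- (1 / t))) has_real_derivative
    poly (pderiv p) (1 / t) * (- (1 / t\<^sup>2)) * exp (- (1 / t)) + poly p (1 / t) * (exp (- (1 / t)) * (1 / t\<^sup>2))) (at t)"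
   using 1 by (auto intro!: derivative_eq_intros DERIV_chain'[OF _ poly_DERIV]
     simp: power2_eq_square field_simps)
  moreover have "\<forall>\<^sub>F s in nhds t. flat p s = poly p (1 / s) * exp (- (1 / s))"
   using eventually_nhds_in_open[of "{0<..}" t] 1 by (auto elim!: eventually_mono simp: flat_def)
  ultimately show ?thesis using 1 by (subst DERIV_cong_ev[OF refl _ refl])
    (auto simp: flat_def algebra_simps power2_eq_square)
 next
  case 2
  have "\<forall>\<^sub>F s in nhds t. flat p s = 0"
   using eventually_nhds_in_open[of "{..<0}" t] 2 by (auto elim!: eventually_mono simp: flat_def)
  then show ?thesis using 2 by (subst DERIV_cong_ev[OF refl _ refl]) (auto simp: flat_def)
 next
  case 3
  have "((%h. flat p h / h) \<longlongrightarrow> 0) (at 0)" unfolding filterlim_at_split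
  proof
   have "\<forall>\<^sub>F h in at_left 0. flat p h / h = (0::real)" by (auto simp: flat_def eventually_at_filter)
   then show "((%h. flat p h / h) \<longlongrightarrow> 0) (at_left 0)" by (rule tendsto_eventually)
  next
   have "((%h::real. poly ([:0,1:] * p) (inverse h) * exp (- inverse h)) \<longlongrightarrow> 0) (at_right 0)"
    by (rule filterlim_compose[OF poly_times_exp_tendsto_0 filterlim_inverse_at_top_right])
   moreover have "\<forall>\<^sub>F h in at_right 0. poly ([:0,1:] * p) (inverse h) * exp (- inverse h) = flat p h / (h::real)"
    using eventually_at_right_less[of "0::real"] by (auto elim!: eventually_mono simp: flat_def field_simps)
   ultimately show "((%h. flat p h / h) \<longlongrightarrow> 0) (at_right 0)" by (rule Lim_transform_eventually)
  qed
  then show ?thesis using 3 by (simp add: DERIV_def flat_def)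
 qed
qed

lemma smooth_real_flat: "smooth_real (flat p)"
 by (rule smooth_real_coinduct[where P = "%f. EX p. f = flat p"]) (use DERIV_flat in blast)+

definition plateau :: "real => real" where
 "plateau t = flat 1 (1 - 2 * flat 1 (t\<^sup>2 - 1/4)) / flat 1 1"

lemma smooth_real_plateau: "smooth_real plateau"
proof -
 have "smooth_real (%t. (1 / flat 1 1) * flat 1 (1 - 2 * flat 1 (t\<^sup>2 - 1/4)))"
  by (intro smooth_real_cmult smooth_real_compose[OF smooth_real_flat] smooth_real_intros)
 then show ?thesis unfolding plateau_def by simp
qed

lemma plateau_1: "\<bar>t\<bar> \<le> 1/2 ==> plateau t = 1"
proof -
 assume "\<bar>t\<bar> \<le> 1/2"
 then have "t\<^sup>2 \<le> (1/2)\<^sup>2" by (metis abs_le_square_iff abs_of_nonneg zero_le_divide_1_iff zero_le_numeral)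
 then have "flat 1 (t\<^sup>2 - 1/4) = 0" by (simp add: flat_def power2_eq_square)
 then show ?thesis by (simp add: plateau_def) (simp add: flat_def)
qed

lemma plateau_0: "3/2 \<le> \<bar>t\<bar> ==> plateau t = 0"
proof -
 assume "3/2 \<le> \<bar>t\<bar>"
 then have "(3/2)\<^sup>2 \<le> t\<^sup>2" by (metis abs_le_square_iff abs_of_nonneg zero_le_divide_iff zero_le_numeral)
 then have t: "2 \<le> t\<^sup>2 - 1/4" by (simp add: power2_eq_square)
 then have "1 / (t\<^sup>2 - 1/4) \<le> 1/2" by (simp add: field_simps)
 then have "1/2 \<le> exp (- (1 / (t\<^sup>2 - 1/4)))"
  using exp_ge_add_one_self[of "- (1 / (t\<^sup>2 - 1/4))"] by linarith
 then have "1 - 2 * flat 1 (t\<^sup>2 - 1/4) \<le> 0" using t by (simp add: flat_def)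
 then show ?thesis by (simp add: plateau_def flat_def)
qed

lemma derivs_bounded_if_compact_support:
 assumes "smooth_real f" and 0: "!!t. r \<le> \<bar>t\<bar> ==> f t = 0"
 shows "EX C. ALL t. \<bar>(deriv ^^ k) f t\<bar> \<le> C"
proof -
 obtain C where C: "!!t. \<bar>t\<bar> \<le> r + 1 ==> \<bar>(deriv ^^ k) f t\<bar> \<le> C"
  using smooth_real_bounded[OF smooth_real_derivs[OF assms(1)]] by blast
 have "(deriv ^^ k) f t = 0" if "r + 1 < \<bar>t\<bar>" for t
 proof -
  have "open {t::real. r < \<bar>t\<bar>}" by (intro open_Collect_less continuous_intros)
  then have "\<forall>\<^sub>F s in nhds t. f s = (%_. 0) s"
   using eventually_nhds_in_open[of "{t. r < \<bar>t\<bar>}" t] that by (auto elim!: eventually_mono simp: 0)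
  then have "(deriv ^^ k) f t = (deriv ^^ k) (%_. 0) t" by (rule derivs_cong_ev)
  also have "(deriv ^^ k) (%x::real. 0::real) = (%x. 0)" by (induction k) auto
  finally show ?thesis by simp
 qed
 then have "\<bar>(deriv ^^ k) f t\<bar> \<le> max C 0" for t
  using C[of t] by (cases "\<bar>t\<bar> \<le> r + 1") (auto simp: max_def)
 then show ?thesis by blast
qed

lemma summable_exp_square: "summable (%n. C * ((2::real) ^ (n + 3)) ^ k * (1/2) ^ n\<^sup>2)"
proof -
 have "summable (%n. ((2::real) ^ n) ^ k * (1/2) ^ n\<^sup>2)"
 proof (rule summable_comparison_test'[of "%n. (1/2::real) ^ n" "Suc k"])
  fix n assume n: "Suc k \<le> n"
  then have "n * k + n \<le> n\<^sup>2" by (metis add.commute mult_Suc_right mult_le_mono2 power2_eq_square)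
  then have "(1/2::real) ^ n\<^sup>2 \<le> (1/2) ^ (n * k + n)" by (intro power_decreasing) auto
  then have "((2::real) ^ n) ^ k * (1/2) ^ n\<^sup>2 \<le> (2 ^ n) ^ k * (1/2) ^ (n * k + n)"
   by (intro mult_left_mono) auto
  also have "\<dots> = (1/2) ^ n" by (simp add: power_add power_mult[symmetric] power_divide)
  finally show "norm (((2::real) ^ n) ^ k * (1/2) ^ n\<^sup>2) \<le> (1/2) ^ n" by simp
 qed simp
 from summable_mult[OF this, of "C * 8 ^ k"] show ?thesis by (simp add: power_add power_mult_distrib mult_ac)
qed

text \<open>The curve is a sum of linear pieces, cut off by rescaled plateau functions with disjoint
  supports. The decay \<open>2\<^sup>-\<^sup>n\<^sup>n\<close> of the data beats the factors \<open>2\<^sup>n\<^sup>k\<close> of the \<open>k\<close>-th derivatives.\<close>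

lemma curve_through_segments:
 assumes p: "!!n. \<bar>p n\<bar> \<le> (1/2) ^ n\<^sup>2" and q: "!!n. \<bar>q n\<bar> \<le> (1/2) ^ n\<^sup>2"
 obtains \<gamma> where "smooth_real \<gamma>" "\<gamma> 0 = 0"
  "!!n. \<forall>\<^sub>F u in nhds (1 / 2 ^ n). \<gamma> u = p n + q n * (u - 1 / 2 ^ n)"
proof -
 define g where "g n u = p n * plateau (2 ^ (n + 3) * u + (- 8)) +
   (q n / 2 ^ (n + 3)) * ((%v. v * plateau v) (2 ^ (n + 3) * u + (- 8)))" for n u
 define \<gamma> where "\<gamma> u = (\<Sum>n. g n u)" for u
 have sm2: "smooth_real (%v. v * plateau v)" by (intro smooth_real_intros smooth_real_plateau)
 have sm: "smooth_real (g n)" for n unfolding g_def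
  by (intro smooth_real_add smooth_real_cmult smooth_real_compose[OF smooth_real_plateau]
    smooth_real_compose[OF sm2] smooth_real_intros)
 have der: "(deriv ^^ k) (g n) u = (2 ^ (n + 3)) ^ k * (p n * (deriv ^^ k) plateau (2 ^ (n + 3) * u + (- 8))
   + (q n / 2 ^ (n + 3)) * (deriv ^^ k) (%v. v * plateau v) (2 ^ (n + 3) * u + (- 8)))" for k n u
 proof -
  have s1: "smooth_real (%u. plateau (2 ^ (n + 3) * u + (- 8)))"
   by (rule smooth_real_compose[OF smooth_real_plateau]) (intro smooth_real_intros)
  have s2: "smooth_real (%u. (%v. v * plateau v) (2 ^ (n + 3) * u + (- 8)))"
   by (rule smooth_real_compose[OF sm2]) (intro smooth_real_intros)
  show ?thesis unfolding g_def derivs_add[OF smooth_real_cmult[OF s1] smooth_real_cmult[OF s2]]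
    derivs_cmult[OF s1] derivs_cmult[OF s2]
    derivs_affine[OF smooth_real_plateau] derivs_affine[OF sm2] by (simp add: algebra_simps)
 qed
 have bd: "EX M. summable M & (ALL n u. \<bar>u\<bar> < R --> \<bar>(deriv ^^ k) (g n) u\<bar> \<le> M n)" for k R
 proof -
  obtain C1 where C1: "!!t. \<bar>(deriv ^^ k) plateau t\<bar> \<le> C1"
   using derivs_bounded_if_compact_support[OF smooth_real_plateau plateau_0] by metis
  obtain C2 where C2: "!!t. \<bar>(deriv ^^ k) (%v. v * plateau v) t\<bar> \<le> C2"
   using derivs_bounded_if_compact_support[OF sm2, of "3/2" k] plateau_0 by auto
  have "\<bar>(deriv ^^ k) (g n) u\<bar> \<le> (C1 + C2) * (2 ^ (n + 3)) ^ k * (1/2) ^ n\<^sup>2" for n u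
  proof -
   have "\<bar>q n / 2 ^ (n + 3)\<bar> \<le> \<bar>q n\<bar>"
    using mult_left_mono[of 1 "2 ^ (n + 3)" "\<bar>q n\<bar>"] by (simp add: field_simps abs_divide)
   then have q': "\<bar>q n / 2 ^ (n + 3)\<bar> \<le> (1/2) ^ n\<^sup>2" using q[of n] by linarith
   have "\<bar>p n * (deriv ^^ k) plateau (2 ^ (n + 3) * u + (- 8))
    + (q n / 2 ^ (n + 3)) * (deriv ^^ k) (%v. v * plateau v) (2 ^ (n + 3) * u + (- 8))\<bar>
    \<le> (1/2) ^ n\<^sup>2 * C1 + (1/2) ^ n\<^sup>2 * C2" by (rule order_trans[OF abs_triangle_ineq])
      (unfold abs_mult, intro add_mono mult_mono p q' C1 C2, auto)
   then have "(2 ^ (n + 3)) ^ k * \<bar>p n * (deriv ^^ k) plateau (2 ^ (n + 3) * u + (- 8))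
    + (q n / 2 ^ (n + 3)) * (deriv ^^ k) (%v. v * plateau v) (2 ^ (n + 3) * u + (- 8))\<bar>
    \<le> (2 ^ (n + 3)) ^ k * ((1/2) ^ n\<^sup>2 * C1 + (1/2) ^ n\<^sup>2 * C2)" by (intro mult_left_mono) auto
   then show ?thesis unfolding der abs_mult by (simp add: algebra_simps)
  qed
  then show ?thesis using summable_exp_square[of "C1 + C2" k] by blast
 qed
 have "smooth_real \<gamma>" unfolding \<gamma>_def using sm bd by (rule smooth_real_series)
 moreover have "\<gamma> 0 = 0" unfolding \<gamma>_def g_def by (simp add: plateau_0)
 moreover have "\<forall>\<^sub>F u in nhds (1 / 2 ^ n). \<gamma> u = p n + q n * (u - 1 / 2 ^ n)" for n
 proof -
  have "\<gamma> u = p n + q n * (u - 1 / 2 ^ n)" if u: "u \<in> {15/16 * (1 / 2 ^ n)<..<17/16 * (1 / 2 ^ n)}" for u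
  proof -
   define v where "v = 2 ^ n * u"
   have v: "15/16 < v" "v < 17/16" using u by (auto simp: v_def field_simps)
   have "g m u = 0" if m: "m ~= n" for m
   proof -
    have "3/2 \<le> \<bar>2 ^ (m + 3) * u + (- 8)\<bar>"
    proof (cases "n < m")
     case True
     then have "2 ^ 1 \<le> (2::real) ^ (m - n)" by (intro power_increasing) auto
     moreover have "2 ^ (m + 3) * u = 8 * 2 ^ (m - n) * v"
      using True unfolding v_def by (simp add: power_add[symmetric])
       (simp add: power_add)
     moreover have "2 * v \<le> 2 ^ (m - n) * v" using calculation(1) v by (intro mult_right_mono) auto
     ultimately have "19/2 \<le> 2 ^ (m + 3) * u" using v by linarith
     then show ?thesis by linarith
    next
     case False
     then have "2 ^ 1 \<le> (2::real) ^ (n - m)" using m by (intro power_increasing) auto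
     moreover have "2 ^ (m + 3) * u * 2 ^ (n - m) = 8 * v"
      using False m unfolding v_def by (simp add: power_add) (simp flip: power_add)
     moreover have "u > 0" using v zero_less_mult_pos[of "2 ^ n" u] unfolding v_def by simp
     moreover have "2 ^ (m + 3) * u * 2 \<le> 2 ^ (m + 3) * u * 2 ^ (n - m)"
      using calculation by (intro mult_left_mono) auto
     ultimately have "2 ^ (m + 3) * u \<le> 13/2" using v by linarith
     then show ?thesis by linarith
    qed
    then show ?thesis by (simp add: g_def plateau_0)
   qed
   then have "\<gamma> u = g n u" unfolding \<gamma>_def by (subst suminf_finite[of "{n}"]) auto
   also have "\<bar>2 ^ (n + 3) * u + (- 8)\<bar> \<le> 1/2" using v unfolding v_def by (simp add: power_add abs_if)
   then have "g n u = p n + q n * (u - 1 / 2 ^ n)" by (simp add: g_def plateau_1 power_add field_simps)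
   finally show ?thesis .
  qed
  have "0 < (1 / 2 ^ n :: real)" by simp
  then have "(1 / 2 ^ n :: real) \<in> {15/16 * (1 / 2 ^ n)<..<17/16 * (1 / 2 ^ n)}"
   unfolding greaterThanLessThan_iff by linarith
  from eventually_nhds_in_open[OF open_greaterThanLessThan this]
  show ?thesis by (rule eventually_mono) fact
 qed
 ultimately show ?thesis using that by blast
qed

section \<open>Functions that are smooth along the curves of the plane\<close>

definition smooth2 :: "(real => real => real) => bool" where
 "smooth2 F \<longleftrightarrow> (ALL a b. smooth_real a & smooth_real b --> smooth_real (%u. F (a u) (b u)))"

lemma smooth2D: "smooth2 F ==> smooth_real a ==> smooth_real b ==> smooth_real (%u. F (a u) (b u))"
 unfolding smooth2_def by blast

lemma smooth2_swap: "smooth2 F ==> smooth2 (%s t. F t s)" unfolding smooth2_def by blast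

lemma smooth2_slices: "smooth2 F ==> smooth_real (F s)" "smooth2 F ==> smooth_real (%s. F s t)"
 using smooth2D[of F "%_. s" "%u. u"] smooth2D[of F "%u. u" "%_. t"] by simp_all

text \<open>If the derivatives in the first direction were unbounded on a square, a smooth curve could
  run through a sequence of points where they explode; near each point it is a slow straight
  segment in the first direction, so the explosion would be visible along the curve.\<close>

lemma smooth2_derivs_bounded:
 assumes F: "smooth2 F"
 shows "EX C. ALL s t. \<bar>s\<bar> \<le> R --> \<bar>t\<bar> \<le> R --> \<bar>(deriv ^^ k) (%s. F s t) s\<bar> \<le> C"
proof (rule ccontr)
 assume "\<not> ?thesis"
 then have "EX s t. \<bar>s\<bar> \<le> R & \<bar>t\<bar> \<le> R & \<bar>(deriv ^^ k) (%s. F s t) s\<bar> > real n * (2 ^ n\<^sup>2) ^ k" for n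
  unfolding not_ex not_all not_imp not_le by blast
 then have "ALL n. EX p. \<bar>fst p\<bar> \<le> R & \<bar>snd p\<bar> \<le> R & \<bar>(deriv ^^ k) (%s. F s (snd p)) (fst p)\<bar> > real n * (2 ^ n\<^sup>2) ^ k"
  by simp
 from choice[OF this] obtain P where P: "!!n. \<bar>fst (P n)\<bar> \<le> R & \<bar>snd (P n)\<bar> \<le> R & \<bar>(deriv ^^ k) (%s. F s (snd (P n))) (fst (P n))\<bar> > real n * (2 ^ n\<^sup>2) ^ k"
  by blast
 define S T where "S n = fst (P n)" and "T n = snd (P n)" for n
 have ST: "!!n. \<bar>S n\<bar> \<le> R" "!!n. \<bar>T n\<bar> \<le> R"
  "!!n. \<bar>(deriv ^^ k) (%s. F s (T n)) (S n)\<bar> > real n * (2 ^ n\<^sup>2) ^ k"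
  using P by (auto simp: S_def T_def)
 have "compact ({-R..R} \<times> {-R..R})" by (intro compact_Times) auto
 moreover have "ALL n. (S n, T n) \<in> {-R..R} \<times> {-R..R}" using ST(1,2) by (auto simp: abs_le_iff minus_le_iff)
 ultimately obtain l r where r: "strict_mono r" "((%n. (S n, T n)) \<circ> r) \<longlonglongrightarrow> l"
  unfolding compact_def by fast
 have "(%n. S (r n)) \<longlonglongrightarrow> fst l" "(%n. T (r n)) \<longlonglongrightarrow> snd l"
  using tendsto_fst[OF r(2)] tendsto_snd[OF r(2)] by (simp_all add: o_def)
 then have ev: "\<forall>\<^sub>F m in sequentially. \<bar>S (r m) - fst l\<bar> \<le> (1/2) ^ n\<^sup>2 & \<bar>T (r m) - snd l\<bar> \<le> (1/2) ^ n\<^sup>2" for n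
 proof -
  have "\<forall>\<^sub>F m in sequentially. \<bar>S (r m) - fst l\<bar> < (1/2) ^ n\<^sup>2"
   "\<forall>\<^sub>F m in sequentially. \<bar>T (r m) - snd l\<bar> < (1/2) ^ n\<^sup>2"
   if "(%n. S (r n)) \<longlonglongrightarrow> fst l" "(%n. T (r n)) \<longlonglongrightarrow> snd l"
   using tendstoD[OF that(1), of "(1/2) ^ n\<^sup>2"] tendstoD[OF that(2), of "(1/2) ^ n\<^sup>2"]
   by (simp_all add: dist_real_def)
  from eventually_conj[OF this] show ?thesis
   if "(%n. S (r n)) \<longlonglongrightarrow> fst l" "(%n. T (r n)) \<longlonglongrightarrow> snd l"
   using that by (auto elim!: eventually_mono)
 qed
 have "\<exists>m\<ge>n. \<bar>S m - fst l\<bar> \<le> (1/2) ^ n\<^sup>2 & \<bar>T m - snd l\<bar> \<le> (1/2) ^ n\<^sup>2" for n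
 proof -
  obtain N where "!!m. m \<ge> N ==> \<bar>S (r m) - fst l\<bar> \<le> (1/2) ^ n\<^sup>2 & \<bar>T (r m) - snd l\<bar> \<le> (1/2) ^ n\<^sup>2"
   using ev[of n] unfolding eventually_sequentially by blast
  moreover have "r (max N n) \<ge> n" using seq_suble[OF r(1), of "max N n"] by simp
  ultimately show ?thesis by (intro exI[of _ "r (max N n)"]) auto
 qed
 then have "ALL n. EX m. m \<ge> n & \<bar>S m - fst l\<bar> \<le> (1/2) ^ n\<^sup>2 & \<bar>T m - snd l\<bar> \<le> (1/2) ^ n\<^sup>2" by blast
 from choice[OF this] obtain m where m: "!!n. m n \<ge> n" "!!n. \<bar>S (m n) - fst l\<bar> \<le> (1/2) ^ n\<^sup>2"
   "!!n. \<bar>T (m n) - snd l\<bar> \<le> (1/2) ^ n\<^sup>2" by blast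
 obtain \<gamma> where g: "smooth_real \<gamma>"
   "!!n. \<forall>\<^sub>F u in nhds (1 / 2 ^ n). \<gamma> u = (S (m n) - fst l) + (1/2) ^ n\<^sup>2 * (u - 1 / 2 ^ n)"
  by (rule curve_through_segments[of "%n. S (m n) - fst l" "%n. (1/2) ^ n\<^sup>2"]) (auto simp: m(2))
 obtain \<delta> where d: "smooth_real \<delta>"
   "!!n. \<forall>\<^sub>F u in nhds (1 / 2 ^ n). \<delta> u = (T (m n) - snd l) + 0 * (u - 1 / 2 ^ n)"
  by (rule curve_through_segments[of "%n. T (m n) - snd l" "%n. 0"]) (auto simp: m(3))
 define f where "f u = F (fst l + \<gamma> u) (snd l + \<delta> u)" for u
 have "smooth_real f" unfolding f_def by (intro smooth2D[OF F] smooth_real_add smooth_real_const g(1) d(1))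
 then obtain C where C: "!!u. \<bar>u\<bar> \<le> 1 ==> \<bar>(deriv ^^ k) f u\<bar> \<le> C"
  using smooth_real_bounded[OF smooth_real_derivs] by metis
 have "real n < C" for n
 proof -
  have "\<forall>\<^sub>F u in nhds (1 / 2 ^ n). f u = (%u. (%s. F s (T (m n))) ((1/2) ^ n\<^sup>2 * u + (S (m n) - (1/2) ^ n\<^sup>2 / 2 ^ n))) u"
  proof (rule eventually_mono[OF eventually_conj[OF g(2)[of n] d(2)[of n]]])
   fix u assume *: "\<gamma> u = (S (m n) - fst l) + (1/2) ^ n\<^sup>2 * (u - 1 / 2 ^ n) &
    \<delta> u = (T (m n) - snd l) + 0 * (u - 1 / 2 ^ n)"
   then have "fst l + \<gamma> u = (1/2) ^ n\<^sup>2 * u + (S (m n) - (1/2) ^ n\<^sup>2 / 2 ^ n)"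
    by (simp add: algebra_simps)
   with * show "f u = (%u. (%s. F s (T (m n))) ((1/2) ^ n\<^sup>2 * u + (S (m n) - (1/2) ^ n\<^sup>2 / 2 ^ n))) u"
    by (simp add: f_def add_diff_eq add.commute)
  qed
  then have "(deriv ^^ k) f (1 / 2 ^ n) = ((1/2) ^ n\<^sup>2) ^ k * (deriv ^^ k) (%s. F s (T (m n))) (S (m n))"
   by (subst derivs_cong_ev, assumption) (simp add: derivs_affine[OF smooth2_slices(2)[OF F]])
  then have eq: "\<bar>(deriv ^^ k) f (1 / 2 ^ n)\<bar> = ((1/2) ^ n\<^sup>2) ^ k * \<bar>(deriv ^^ k) (%s. F s (T (m n))) (S (m n))\<bar>"
   by (simp add: abs_mult)
  have "real n * (2 ^ n\<^sup>2) ^ k \<le> real (m n) * (2 ^ (m n)\<^sup>2) ^ k"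
   using m(1)[of n] by (intro mult_mono power_mono power_increasing power_mono_iff[THEN iffD2]) auto
  also have "\<dots> < \<bar>(deriv ^^ k) (%s. F s (T (m n))) (S (m n))\<bar>" by (rule ST)
  finally have "((1/2) ^ n\<^sup>2) ^ k * (real n * (2 ^ n\<^sup>2) ^ k) < \<bar>(deriv ^^ k) f (1 / 2 ^ n)\<bar>"
   unfolding eq by (intro mult_strict_left_mono) auto
  also have "((1/2) ^ n\<^sup>2) ^ k * (real n * (2 ^ n\<^sup>2) ^ k) = real n"
   by (simp add: power_one_over field_simps)
  also have "\<bar>(deriv ^^ k) f (1 / 2 ^ n)\<bar> \<le> C" by (rule C) simp
  finally show ?thesis .
 qed
 then show False using reals_Archimedean2[of C] less_asym by blast
qed

section \<open>Uniform boundedness\<close>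

fun hump :: "(nat => nat => real) => nat => real" where
 "hump B j = (if (\<Sum>i<j. hump B i * B j i) * B j j \<ge> 0 then (1/3) ^ j else - ((1/3) ^ j))"

declare hump.simps [simp del]

lemma abs_hump: "\<bar>hump B j\<bar> = (1/3) ^ j" by (subst hump.simps) auto

lemma hump_partial_sum: "(1/3) ^ j * \<bar>B j j\<bar> \<le> \<bar>\<Sum>i<Suc j. hump B i * B j i\<bar>"
proof -
 define P where "P = (\<Sum>i<j. hump B i * B j i)"
 have "\<bar>x + y\<bar> \<ge> \<bar>y\<bar>" if "x * y \<ge> 0" for x y :: real
  using that by (auto simp: zero_le_mult_iff)
 moreover have "P * (hump B j * B j j) \<ge> 0"
 proof (cases "P * B j j \<ge> 0")
  case True
  then have "hump B j = (1/3) ^ j" by (subst hump.simps) (simp add: P_def)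
  moreover have "0 \<le> (1/3) ^ j * (P * B j j)" using True by simp
  ultimately show ?thesis by (simp add: mult.left_commute)
 next
  case False
  then have "hump B j = - ((1/3) ^ j)" by (subst hump.simps) (simp add: P_def)
  moreover have "0 \<le> (1/3) ^ j * (- (P * B j j))" using False by (intro mult_nonneg_nonneg) auto
  ultimately show ?thesis by (simp add: mult.left_commute)
 qed
 ultimately have "\<bar>P + hump B j * B j j\<bar> \<ge> \<bar>hump B j * B j j\<bar>" by blast
 then show ?thesis by (simp add: P_def abs_mult abs_hump)
qed

text \<open>Gliding hump: the weight of index \<open>j\<close> is large enough for the functional number \<open>j\<close> to notice,
  its sign keeps the earlier terms from cancelling it, and the later terms are too small to do so.\<close>

lemma uniform_boundedness_series:
 fixes b :: "'i => 's => real"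
 assumes rows: "!!i. i \<in> I ==> EX C. \<forall>s\<in>S. \<bar>b i s\<bar> \<le> C"
  and ser: "!!\<sigma> a. (!!n. \<sigma> n \<in> S) ==> (!!n::nat. \<bar>a n\<bar> \<le> (1/3) ^ n) ==>
        EX C. \<forall>i\<in>I. \<bar>\<Sum>n. a n * b i (\<sigma> n)\<bar> \<le> C"
 shows "EX C. \<forall>i\<in>I. \<forall>s\<in>S. \<bar>b i s\<bar> \<le> C"
proof (rule ccontr)
 assume neg: "\<not> ?thesis"
 have "EX i s C. i \<in> I & s \<in> S & (\<forall>s'\<in>S. \<bar>b i s'\<bar> \<le> C) & 2/3 * C \<le> \<bar>b i s\<bar> & N < \<bar>b i s\<bar>" for N
 proof -
  obtain i s0 where is0: "i \<in> I" "s0 \<in> S" "max N 0 < \<bar>b i s0\<bar>" using neg by (meson not_le)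
  define A where "A = (%s. \<bar>b i s\<bar>) ` S"
  have A: "A ~= {}" "bdd_above A" using rows[OF is0(1)] is0(2) by (auto simp: A_def bdd_above_def)
  have "\<bar>b i s0\<bar> \<le> Sup A" using A is0 by (intro cSup_upper) (auto simp: A_def)
  then have "max N (2/3 * Sup A) < Sup A" using is0(3) by auto
  then obtain y where "y \<in> A" "max N (2/3 * Sup A) < y" using less_cSupD[OF A(1)] by blast
  then obtain s where s: "s \<in> S" "max N (2/3 * Sup A) < \<bar>b i s\<bar>" by (auto simp: A_def)
  have "\<forall>s'\<in>S. \<bar>b i s'\<bar> \<le> Sup A" using A by (auto simp: A_def intro: cSup_upper)
  then show ?thesis using is0 s by (intro exI[of _ i] exI[of _ s] exI[of _ "Sup A"]) auto
 qed
 then have "ALL j. EX h. case h of (i, s, C) => i \<in> I & s \<in> S & (\<forall>s'\<in>S. \<bar>b i s'\<bar> \<le> C) & 2/3 * C \<le> \<bar>b i s\<bar> &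
   6 * 3 ^ j * real j < \<bar>b i s\<bar>" by simp
 from choice[OF this] obtain h where h: "!!j. case h j of (i, s, C) => i \<in> I & s \<in> S &
   (\<forall>s'\<in>S. \<bar>b i s'\<bar> \<le> C) & 2/3 * C \<le> \<bar>b i s\<bar> & 6 * 3 ^ j * real j < \<bar>b i s\<bar>" by blast
 define \<iota> \<sigma> C where "\<iota> j = fst (h j)" and "\<sigma> j = fst (snd (h j))" and "C j = snd (snd (h j))" for j
 have *: "\<iota> j \<in> I" "\<sigma> j \<in> S" "s \<in> S ==> \<bar>b (\<iota> j) s\<bar> \<le> C j"
   "2/3 * C j \<le> \<bar>b (\<iota> j) (\<sigma> j)\<bar>" "6 * 3 ^ j * real j < \<bar>b (\<iota> j) (\<sigma> j)\<bar>" for j s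
  using h[of j] by (auto simp: \<iota>_def \<sigma>_def C_def split_beta)
 define B where "B j i = b (\<iota> j) (\<sigma> i)" for j i
 define a where "a = hump B"
 obtain K where K: "!!i. i \<in> I ==> \<bar>\<Sum>n. a n * b i (\<sigma> n)\<bar> \<le> K"
  using ser[of \<sigma> a] *(2) by (auto simp: a_def abs_hump)
 have "real j \<le> K" for j
 proof -
  have B: "\<bar>B j i\<bar> \<le> C j" for i unfolding B_def by (intro * )
  have C0: "C j \<ge> 0" using B[of 0] by linarith
  have summ: "summable (%i. a i * B j i)" by (rule summable_comparison_test'[of "%i. C j * (1/3) ^ i" 0])
     (auto simp: abs_mult a_def abs_hump mult.commute intro!: mult_right_mono B)
  have summ': "summable (%i. C j * (1/3::real) ^ (i + Suc j))"
   using summable_ignore_initial_segment[OF summable_mult[OF summable_geometric[of "1/3::real"]], of "C j" "Suc j"]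
   by simp
  have "(\<Sum>i. C j * (1/3::real) ^ (i + Suc j)) = C j * (1/3) ^ Suc j * (\<Sum>i. (1/3) ^ i)"
   by (subst suminf_mult[symmetric]) (auto simp: power_add mult_ac)
  also have "\<dots> = C j * (1/3) ^ j / 2" by (simp add: suminf_geometric)
  finally have tail_eq: "(\<Sum>i. C j * (1/3::real) ^ (i + Suc j)) = C j * (1/3) ^ j / 2" .
  have "\<bar>\<Sum>i. a (i + Suc j) * B j (i + Suc j)\<bar> \<le> (\<Sum>i. C j * (1/3::real) ^ (i + Suc j))"
   unfolding real_norm_def[symmetric] by (intro norm_suminf_le summ')
     (auto simp: abs_mult a_def abs_hump mult.commute intro!: mult_right_mono B)
  moreover have "(\<Sum>i. a i * B j i) = (\<Sum>i. a (i + Suc j) * B j (i + Suc j)) + (\<Sum>i<Suc j. a i * B j i)"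
   by (rule suminf_split_initial_segment[OF summ])
  moreover have "\<bar>\<Sum>i<Suc j. a i * B j i\<bar> \<ge> (1/3) ^ j * \<bar>B j j\<bar>"
   unfolding a_def by (rule hump_partial_sum)
  ultimately have "\<bar>\<Sum>i. a i * B j i\<bar> \<ge> (1/3) ^ j * \<bar>B j j\<bar> - C j * (1/3) ^ j / 2"
   using tail_eq by linarith
  moreover have "(1/3) ^ j * (2/3 * C j) \<le> (1/3) ^ j * \<bar>B j j\<bar>"
   unfolding B_def by (intro mult_left_mono * ) auto
  ultimately have "\<bar>\<Sum>i. a i * B j i\<bar> \<ge> (1/3) ^ j * \<bar>B j j\<bar> / 4" by (simp add: field_simps)
  moreover have "(1/3) ^ j * (6 * 3 ^ j * real j) \<le> (1/3) ^ j * \<bar>B j j\<bar>"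
   unfolding B_def by (intro mult_left_mono less_imp_le * ) auto
  then have "6 * real j \<le> (1/3) ^ j * \<bar>B j j\<bar>" by (simp add: power_one_over field_simps)
  moreover have "\<bar>\<Sum>i. a i * B j i\<bar> \<le> K" unfolding B_def by (intro K * )
  ultimately show ?thesis by linarith
 qed
 then show False using reals_Archimedean2[of K] not_less by blast
qed

section \<open>Mixed derivatives from bounds on the pure ones\<close>

definition sep_bounded :: "(real => real => real) => bool" where
 "sep_bounded F \<longleftrightarrow> (ALL s. smooth_real (F s)) & (ALL t. smooth_real (%s. F s t)) &
   (ALL k R. EX C. ALL s t. \<bar>s\<bar> \<le> R --> \<bar>t\<bar> \<le> R -->
    \<bar>(deriv ^^ k) (%s. F s t) s\<bar> \<le> C & \<bar>(deriv ^^ k) (F s) t\<bar> \<le> C)"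

lemma sep_bounded_swap: "sep_bounded F ==> sep_bounded (%s t. F t s)" unfolding sep_bounded_def by blast

lemma sep_boundedI:
 assumes "!!s. smooth_real (F s)" "!!t. smooth_real (%s. F s t)"
  and "!!k R. EX C. ALL s t. \<bar>s\<bar> \<le> R --> \<bar>t\<bar> \<le> R --> \<bar>(deriv ^^ k) (%s. F s t) s\<bar> \<le> C"
  and "!!k R. EX C. ALL s t. \<bar>s\<bar> \<le> R --> \<bar>t\<bar> \<le> R --> \<bar>(deriv ^^ k) (F s) t\<bar> \<le> C"
 shows "sep_bounded F" unfolding sep_bounded_def
proof (intro conjI allI)
 fix k R
 obtain C1 C2 where "!!s t. \<bar>s\<bar> \<le> R ==> \<bar>t\<bar> \<le> R ==> \<bar>(deriv ^^ k) (%s. F s t) s\<bar> \<le> C1"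
  "!!s t. \<bar>s\<bar> \<le> R ==> \<bar>t\<bar> \<le> R ==> \<bar>(deriv ^^ k) (F s) t\<bar> \<le> C2"
  using assms(3,4)[of R k] by blast
 then show "EX C. ALL s t. \<bar>s\<bar> \<le> R --> \<bar>t\<bar> \<le> R -->
    \<bar>(deriv ^^ k) (%s. F s t) s\<bar> \<le> C & \<bar>(deriv ^^ k) (F s) t\<bar> \<le> C"
  by (intro exI[of _ "max C1 C2"]) (simp add: max.coboundedI1 max.coboundedI2)
qed (use assms in auto)

lemma smooth2_imp_sep_bounded:
 assumes "smooth2 F" shows "sep_bounded F"
proof (rule sep_boundedI)
 fix k R
 show "EX C. ALL s t. \<bar>s\<bar> \<le> R --> \<bar>t\<bar> \<le> R --> \<bar>(deriv ^^ k) (F s) t\<bar> \<le> C"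
  using smooth2_derivs_bounded[OF smooth2_swap[OF assms], of R k] by blast
qed (use smooth2_slices[OF assms] smooth2_derivs_bounded[OF assms] in auto)

lemma taylor_forward:
 assumes f: "smooth_real f" and u: "0 \<le> u" and n: "0 < n"
 shows "EX xi. t \<le> xi & xi \<le> t + u &
  f (t + u) = (\<Sum>m<n. (deriv ^^ m) f t / fact m * u ^ m) + (deriv ^^ n) f xi / fact n * u ^ n"
proof (cases "u = 0")
 case True
 have "(\<Sum>m<n. (deriv ^^ m) f t / fact m * 0 ^ m) = (\<Sum>m\<in>{0}. (deriv ^^ m) f t / fact m * 0 ^ m)"
  by (rule sum.mono_neutral_right) (use n in auto)
 with True n show ?thesis by (intro exI[of _ t]) auto
next
 case False
 then have "EX xi. t < xi & xi < t + u &
  f (t + u) = (\<Sum>m<n. (deriv ^^ m) f t / fact m * (t + u - t) ^ m) + (deriv ^^ n) f xi / fact n * (t + u - t) ^ n"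
  using u by (intro Taylor_up[where a = t] n) (use smooth_real_DERIV_derivs[OF f] in auto)
 then obtain xi where "t < xi" "xi < t + u"
  "f (t + u) = (\<Sum>m<n. (deriv ^^ m) f t / fact m * u ^ m) + (deriv ^^ n) f xi / fact n * u ^ n" by auto
 then show ?thesis by (intro exI[of _ xi]) auto
qed

text \<open>Lagrange interpolation at \<open>0, \<dots>, K\<close> expresses the derivative at \<open>0\<close> of a polynomial of
  degree at most \<open>K\<close> by its values.\<close>

lemma exists_difference_coefficients:
 "\<exists>a::nat => real. \<forall>m\<le>K. (\<Sum>j\<le>K. a j * real j ^ m) = (if m = 1 then 1 else 0)"
proof -
 define l where "l j = (\<Prod>i\<in>{..K} - {j}. smult (1 / (real j - real i)) [:- real i, 1:])" for j
 have l: "poly (l j) (real i) = (if i = j then 1 else 0)" if "i \<le> K" "j \<le> K" for i j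
 proof (cases "i = j")
  case True
  have "poly (smult (1 / (real j - real k)) [:- real k, 1:]) (real j) = 1" if "k ~= j" for k
   using that by (simp add: diff_divide_distrib[symmetric])
  with True show ?thesis unfolding l_def poly_prod by (simp add: prod.neutral del: poly_smult)
 next
  case False
  with that show ?thesis by (auto simp: l_def poly_prod prod_zero_iff)
 qed
 have deg: "degree (l j) \<le> K" if "j \<le> K" for j
 proof -
  have "degree (l j) \<le> (\<Sum>i\<in>{..K} - {j}. degree (smult (1 / (real j - real i)) [:- real i, 1:]))"
   unfolding l_def using degree_prod_sum_le[of "{..K} - {j}" "%i. smult (1 / (real j - real i)) [:- real i, 1:]"] by (simp add: o_def)
  also have "\<dots> \<le> (\<Sum>i\<in>{..K} - {j}. 1)" by (intro sum_mono order_trans[OF degree_smult_le]) simp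
  also have "\<dots> = K" using that by simp
  finally show ?thesis .
 qed
 have "(\<Sum>j\<le>K. coeff (l j) 1 * real j ^ m) = (if m = 1 then 1 else 0)" if m: "m \<le> K" for m
 proof -
  have "(\<Sum>j\<le>K. smult (real j ^ m) (l j)) = monom 1 m"
  proof (rule poly_eqI_degree[of "real ` {..K}"])
   fix x assume "x \<in> real ` {..K}"
   then obtain i where i: "i \<le> K" "x = real i" by auto
   have "poly (\<Sum>j\<le>K. smult (real j ^ m) (l j)) x = (\<Sum>j\<le>K. real j ^ m * (if i = j then 1 else 0))"
    unfolding poly_sum by (rule sum.cong) (auto simp: i l)
   also have "\<dots> = x ^ m" using i by (simp add: if_distrib cong: if_cong)
   finally show "poly (\<Sum>j\<le>K. smult (real j ^ m) (l j)) x = poly (monom 1 m) x" by (simp add: poly_monom)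
  next
   have "degree (\<Sum>j\<le>K. smult (real j ^ m) (l j)) \<le> K"
    by (intro degree_sum_le) (auto intro: order_trans[OF degree_smult_le] deg)
   then show "degree (\<Sum>j\<le>K. smult (real j ^ m) (l j)) < card (real ` {..K})" by (subst card_image) auto
   show "degree (monom (1::real) m) < card (real ` {..K})" using m by (subst card_image) (auto simp: degree_monom_eq)
  qed
  then have "coeff (\<Sum>j\<le>K. smult (real j ^ m) (l j)) 1 = coeff (monom 1 m) 1" by simp
  then show ?thesis by (simp add: coeff_sum mult.commute)
 qed
 then show ?thesis by (intro exI[of _ "%j. coeff (l j) 1"]) auto
qed

fun rate :: "nat => nat" where
 "rate 0 = 1"
| "rate (Suc r) = 2 * (rate r + 1)"

lemma rate_mono: "j \<le> r ==> rate j \<le> rate r" by (rule lift_Suc_mono_le) auto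

lemma derivative_between:
 assumes d: "smooth_real d" and A: "!!s. \<bar>s\<bar> \<le> R + 1 ==> \<bar>d s\<bar> \<le> A"
  and B: "!!s. \<bar>s\<bar> \<le> R + 1 ==> \<bar>(deriv ^^ 2) d s\<bar> \<le> B"
  and h: "0 < h" "h \<le> 1" and s: "\<bar>s\<bar> \<le> R"
 shows "\<bar>deriv d s\<bar> \<le> 2 * A / h + B * h"
proof -
 obtain xi where xi: "s \<le> xi" "xi \<le> s + h"
  "d (s + h) = (\<Sum>m<2. (deriv ^^ m) d s / fact m * h ^ m) + (deriv ^^ 2) d xi / fact 2 * h ^ 2"
  using taylor_forward[OF d, of h 2 s] h by auto
 then have "deriv d s * h = d (s + h) - d s - (deriv ^^ 2) d xi / 2 * h\<^sup>2" by (simp add: numeral_2_eq_2)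
 moreover have "\<bar>deriv d s\<bar> * h = \<bar>deriv d s * h\<bar>" using h(1) by (simp add: abs_mult)
 ultimately have "\<bar>deriv d s\<bar> * h = \<bar>d (s + h) - d s - (deriv ^^ 2) d xi / 2 * h\<^sup>2\<bar>" by simp
 also have "\<dots> \<le> \<bar>d (s + h)\<bar> + \<bar>d s\<bar> + \<bar>(deriv ^^ 2) d xi / 2 * h\<^sup>2\<bar>" by linarith
 also have "\<dots> \<le> A + A + B * h\<^sup>2"
 proof (intro add_mono A)
  have "\<bar>(deriv ^^ 2) d xi\<bar> \<le> B" using xi s h by (intro B) auto
  then have "\<bar>(deriv ^^ 2) d xi / 2\<bar> \<le> B" by auto
  then have "\<bar>(deriv ^^ 2) d xi / 2\<bar> * h\<^sup>2 \<le> B * h\<^sup>2" by (rule mult_right_mono) simp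
  then show "\<bar>(deriv ^^ 2) d xi / 2 * h\<^sup>2\<bar> \<le> B * h\<^sup>2" by (simp add: abs_mult)
 qed (use s h in auto)
 finally have "\<bar>deriv d s\<bar> * h \<le> (2 * A / h + B * h) * h"
  using h by (simp add: algebra_simps power2_eq_square)
 then show ?thesis using h by simp
qed

text \<open>The Landau-Kolmogorov principle: if all derivatives of a sequence grow at most like \<open>2\<^sup>i\<close>
  and the sequence itself decays at a sufficiently high exponential rate, then the derivatives of low
  order decay, too. Each derivative costs half of the rate.\<close>

lemma derivatives_decay:
 fixes d :: "nat => real => real => real"
 assumes "!!i p. smooth_real (d i p)"
  and "!!i p s. p \<in> P ==> \<bar>s\<bar> \<le> R + real r ==> \<bar>d i p s\<bar> \<le> A * (1/2) ^ (i * rate r)"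
  and "!!l. EX B. ALL i p s. p \<in> P --> \<bar>s\<bar> \<le> R + real r --> \<bar>(deriv ^^ l) (d i p) s\<bar> \<le> B * 2 ^ i"
 shows "EX C. ALL i p s. p \<in> P --> \<bar>s\<bar> \<le> R --> \<bar>(deriv ^^ r) (d i p) s\<bar> \<le> C * (1/2) ^ i"
 using assms
proof (induction r arbitrary: d A)
 case 0
 then show ?case by (intro exI[of _ A]) auto
next
 case (Suc r)
 obtain B where B: "!!i p s. p \<in> P ==> \<bar>s\<bar> \<le> R + real (Suc r) ==> \<bar>(deriv ^^ 2) (d i p) s\<bar> \<le> B * 2 ^ i"
  using Suc.prems(3) by blast
 have "EX C. ALL i p s. p \<in> P --> \<bar>s\<bar> \<le> R --> \<bar>(deriv ^^ r) (deriv (d i p)) s\<bar> \<le> C * (1/2) ^ i"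
 proof (rule Suc.IH[where A = "2 * A + B"])
  show "smooth_real (deriv (d i p))" for i p by (intro smooth_real_deriv Suc.prems)
  show "EX B. ALL i p s. p \<in> P --> \<bar>s\<bar> \<le> R + real r --> \<bar>(deriv ^^ l) (deriv (d i p)) s\<bar> \<le> B * 2 ^ i" for l
  proof -
   obtain B where "!!i p s. p \<in> P ==> \<bar>s\<bar> \<le> R + real (Suc r) ==> \<bar>(deriv ^^ Suc l) (d i p) s\<bar> \<le> B * 2 ^ i"
    using Suc.prems(3) by blast
   then show ?thesis unfolding funpow_Suc_right o_def by (intro exI[of _ B]) auto
  qed
  fix i p s assume p: "p \<in> P" and s: "\<bar>s\<bar> \<le> R + real r"
  define h :: real where "h = (1/2) ^ (i * (rate r + 1))"
  have h: "0 < h" "h \<le> 1" by (auto simp: h_def power_le_one)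
  have r: "R + real (Suc r) = (R + real r) + 1" by simp
  have "\<bar>deriv (d i p) s\<bar> \<le> 2 * (A * (1/2) ^ (i * rate (Suc r))) / h + (B * 2 ^ i) * h"
   by (rule derivative_between[OF Suc.prems(1) _ _ h s]; (rule Suc.prems(2)[OF p] B[OF p])) (simp_all add: r)
  also have "(1/2) ^ (i * rate (Suc r)) = h * h"
   unfolding h_def power_add[symmetric] by (rule arg_cong[of _ _ "power _"]) simp
  also have "2 * (A * (h * h)) / h + (B * 2 ^ i) * h = 2 * A * h + B * (2 ^ i * h)" using h by simp
  also have "2 ^ i * h = (1/2) ^ (i * rate r)" by (simp add: h_def algebra_simps power_add power_one_over)
  also have "2 * A * h \<le> 2 * A * (1/2) ^ (i * rate r)"
  proof -
   have "0 \<le> A * (1/2) ^ (i * rate (Suc r))"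
    using Suc.prems(2)[OF p, of s i] s abs_ge_zero[of "d i p s"] by (simp add: r)
   moreover have "0 < (1/2::real) ^ (i * rate (Suc r))" by (rule zero_less_power) simp
   ultimately have "0 \<le> A" by (simp add: zero_le_mult_iff not_le del: rate.simps)
   moreover have "h \<le> (1/2) ^ (i * rate r)" unfolding h_def by (intro power_decreasing) auto
   ultimately show ?thesis by (intro mult_left_mono) auto
  qed
  finally show "\<bar>deriv (d i p) s\<bar> \<le> (2 * A + B) * (1/2) ^ (i * rate r)" by (simp add: algebra_simps)
 qed
 then show ?case by (simp add: funpow_Suc_right del: funpow.simps)
qed

text \<open>High order difference quotients in the second variable approximate \<open>deriv (F s) t\<close> at a high
  rate, and their derivatives in the first variable grow slowly.\<close>

lemma sep_bounded_partial2_local: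
 assumes F: "sep_bounded F"
 shows "EX C. ALL s t. \<bar>s\<bar> < R --> \<bar>t\<bar> \<le> R -->
   (deriv ^^ r) (%s. deriv (F s) t) differentiable (at s) & \<bar>(deriv ^^ r) (%s. deriv (F s) t) s\<bar> \<le> C"
proof -
 define K where "K = rate (Suc r)"
 have K1: "1 \<le> K" using rate_mono[of 0 "Suc r"] by (simp add: K_def)
 obtain a :: "nat => real" where a: "!!m. m \<le> K ==> (\<Sum>j\<le>K. a j * real j ^ m) = (if m = 1 then 1 else 0)"
  using exists_difference_coefficients[of K] by blast
 have sm1: "smooth_real (F s)" and sm2: "smooth_real (%s. F s t)" for s t using F by (auto simp: sep_bounded_def)
 define Q where "Q = R + real K + real r + 1"
 have "EX C. ALL s t. \<bar>s\<bar> \<le> Q --> \<bar>t\<bar> \<le> Q -->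
    \<bar>(deriv ^^ k) (%s. F s t) s\<bar> \<le> C & \<bar>(deriv ^^ k) (F s) t\<bar> \<le> C" for k
  using F unfolding sep_bounded_def by blast
 then have "ALL k. EX C. ALL s t. \<bar>s\<bar> \<le> Q --> \<bar>t\<bar> \<le> Q -->
    \<bar>(deriv ^^ k) (%s. F s t) s\<bar> \<le> C & \<bar>(deriv ^^ k) (F s) t\<bar> \<le> C" ..
 from choice[OF this] obtain C where C: "!!k s t. \<bar>s\<bar> \<le> Q ==> \<bar>t\<bar> \<le> Q ==>
    \<bar>(deriv ^^ k) (%s. F s t) s\<bar> \<le> C k & \<bar>(deriv ^^ k) (F s) t\<bar> \<le> C k" by blast
 define g where "g i t s = 2 ^ i * (\<Sum>j\<le>K. a j * F s (t + real j / 2 ^ i))" for i t s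
 define d where "d i t s = g (Suc i) t s - g i t s" for i t s
 have jle: "real j / 2 ^ i \<le> real K" if "j \<le> K" for i j
 proof -
  have "real j / 2 ^ i \<le> real j / 1" by (intro divide_left_mono) auto
  with that show ?thesis by simp
 qed
 have smg: "smooth_real (g i t)" for i t unfolding g_def by (intro smooth_real_cmult smooth_real_sum sm2)
 have smd: "smooth_real (d i t)" for i t unfolding d_def by (intro smooth_real_diff smg)
 define P where "P = {t. \<bar>t\<bar> \<le> R}"
 define S where "S = (\<Sum>j\<le>K. \<bar>a j\<bar>)"
 have gb: "\<bar>(deriv ^^ l) (g i t) s\<bar> \<le> (S * C l) * 2 ^ i" if t: "t \<in> P" and s: "\<bar>s\<bar> \<le> R + real (Suc r)" for l i t s
 proof -
  have "(deriv ^^ l) (g i t) s = 2 ^ i * (\<Sum>j\<le>K. a j * (deriv ^^ l) (%s. F s (t + real j / 2 ^ i)) s)"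
   unfolding g_def by (simp add: derivs_cmult smooth_real_sum smooth_real_cmult sm2 derivs_sum)
  also have "\<bar>\<dots>\<bar> \<le> 2 ^ i * (\<Sum>j\<le>K. \<bar>a j\<bar> * C l)" unfolding abs_mult
  proof (intro mult_mono order_trans[OF sum_abs] sum_mono)
   fix j assume j: "j \<in> {..K}"
   have "\<bar>t + real j / 2 ^ i\<bar> \<le> Q" "\<bar>s\<bar> \<le> Q"
    using jle[of j i] j t s by (auto simp: P_def Q_def intro!: order_trans[OF abs_triangle_ineq])
   then have "\<bar>(deriv ^^ l) (%s. F s (t + real j / 2 ^ i)) s\<bar> \<le> C l" using C by blast
   then show "\<bar>a j * (deriv ^^ l) (%s. F s (t + real j / 2 ^ i)) s\<bar> \<le> \<bar>a j\<bar> * C l"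
    unfolding abs_mult by (intro mult_left_mono) auto
  qed auto
  finally show ?thesis by (simp add: S_def sum_distrib_right sum_distrib_left mult_ac)
 qed
 define E where "E = (\<Sum>j\<le>K. \<bar>a j\<bar> * (C (Suc K) * real j ^ Suc K))"
 have approx: "\<bar>g i t s - deriv (F s) t\<bar> \<le> E * (1/2) ^ (i * K)" if t: "t \<in> P" and s: "\<bar>s\<bar> \<le> R + real (Suc r)" for i t s
 proof -
  define u where "u j = real j / 2 ^ i" for j
  have "EX xi. t \<le> xi & xi \<le> t + u j & F s (t + u j) = (\<Sum>m<Suc K. (deriv ^^ m) (F s) t / fact m * u j ^ m)
    + (deriv ^^ Suc K) (F s) xi / fact (Suc K) * u j ^ Suc K" for j
   by (rule taylor_forward[OF sm1]) (auto simp: u_def)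
  then have "ALL j. EX xi. t \<le> xi & xi \<le> t + u j & F s (t + u j) = (\<Sum>m<Suc K. (deriv ^^ m) (F s) t / fact m * u j ^ m)
    + (deriv ^^ Suc K) (F s) xi / fact (Suc K) * u j ^ Suc K" ..
  from choice[OF this] obtain xi where xi: "!!j. t \<le> xi j" "!!j. xi j \<le> t + u j"
   "!!j. F s (t + u j) = (\<Sum>m<Suc K. (deriv ^^ m) (F s) t / fact m * u j ^ m)
    + (deriv ^^ Suc K) (F s) (xi j) / fact (Suc K) * u j ^ Suc K" by blast
  define \<rho> where "\<rho> j = (deriv ^^ Suc K) (F s) (xi j) / fact (Suc K) * u j ^ Suc K" for j
  have "(\<Sum>j\<le>K. a j * F s (t + u j)) =
    (\<Sum>m<Suc K. \<Sum>j\<le>K. a j * ((deriv ^^ m) (F s) t / fact m * u j ^ m)) + (\<Sum>j\<le>K. a j * \<rho> j)"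
   unfolding xi(3) \<rho>_def[symmetric]
   by (simp add: distrib_left sum.distrib sum_distrib_left del: sum.lessThan_Suc) (rule sum.swap)
  also have "(\<Sum>m<Suc K. \<Sum>j\<le>K. a j * ((deriv ^^ m) (F s) t / fact m * u j ^ m)) =
    (\<Sum>m<Suc K. (deriv ^^ m) (F s) t / fact m * (1 / 2 ^ i) ^ m * (\<Sum>j\<le>K. a j * real j ^ m))"
   by (intro sum.cong) (auto simp: u_def sum_distrib_left power_divide field_simps intro!: sum.cong)
  also have "\<dots> = (\<Sum>m<Suc K. if m = 1 then deriv (F s) t * (1 / 2 ^ i) else 0)"
   by (intro sum.cong) (auto simp: a)
  also have "\<dots> = deriv (F s) t * (1 / 2 ^ i)" using K1 by (simp add: sum.delta del: sum.lessThan_Suc)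
  finally have "g i t s - deriv (F s) t = 2 ^ i * (\<Sum>j\<le>K. a j * \<rho> j)"
   unfolding g_def u_def by (simp add: field_simps)
  also have "\<bar>\<dots>\<bar> \<le> 2 ^ i * (\<Sum>j\<le>K. \<bar>a j\<bar> * (C (Suc K) * u j ^ Suc K))"
   unfolding abs_mult
  proof (intro mult_mono order_trans[OF sum_abs] sum_mono)
   fix j assume j: "j \<in> {..K}"
   have "\<bar>xi j\<bar> \<le> Q" "\<bar>s\<bar> \<le> Q"
    using xi(1,2)[of j] jle[of j i] j t s by (auto simp: P_def Q_def u_def)
   then have c: "\<bar>(deriv ^^ Suc K) (F s) (xi j)\<bar> \<le> C (Suc K)" using C by blast
   have "1 \<le> (fact (Suc K) :: real)" by (rule fact_ge_1)
   then have "\<bar>(deriv ^^ Suc K) (F s) (xi j)\<bar> / fact (Suc K) \<le> \<bar>(deriv ^^ Suc K) (F s) (xi j)\<bar> / 1"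
    by (intro divide_left_mono) auto
   then have "\<bar>(deriv ^^ Suc K) (F s) (xi j) / fact (Suc K)\<bar> \<le> C (Suc K)" using c by simp
   then show "\<bar>a j * \<rho> j\<bar> \<le> \<bar>a j\<bar> * (C (Suc K) * u j ^ Suc K)"
    unfolding \<rho>_def abs_mult by (intro mult_left_mono mult_mono) (use order_trans[OF abs_ge_zero c] in \<open>auto simp: u_def\<close>)
  qed auto
  also have "\<dots> = E * (1/2) ^ (i * K)"
  proof -
   have "2 ^ i * u j ^ Suc K = real j ^ Suc K * (1/2) ^ (i * K)" for j
    by (simp add: u_def power_divide power_one_over power_mult)
   then have "2 ^ i * (\<bar>a j\<bar> * (C (Suc K) * u j ^ Suc K)) = \<bar>a j\<bar> * (C (Suc K) * real j ^ Suc K) * (1/2) ^ (i * K)" for j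
    by (metis (no_types, lifting) mult.assoc mult.left_commute)
   then show ?thesis unfolding E_def sum_distrib_left sum_distrib_right by (intro sum.cong) auto
  qed
  finally show ?thesis .
 qed
 have E0: "0 \<le> E" if "0 \<le> R" using approx[of 0 0 0] that abs_ge_zero[of "g 0 0 0 - deriv (F 0) 0"] by (simp add: P_def)
 have db: "\<bar>d i t s\<bar> \<le> 2 * E * (1/2) ^ (i * K)" if t: "t \<in> P" and s: "\<bar>s\<bar> \<le> R + real (Suc r)" for i t s
 proof -
  have "E * (1/2) ^ (Suc i * K) \<le> E * (1/2) ^ (i * K)"
   using t E0 by (intro mult_left_mono power_decreasing) (auto simp: P_def)
  then show ?thesis using approx[OF t s, of i] approx[OF t s, of "Suc i"] unfolding d_def by linarith
 qed
 have dl: "\<bar>(deriv ^^ l) (d i t) s\<bar> \<le> (3 * (S * C l)) * 2 ^ i" if t: "t \<in> P" and s: "\<bar>s\<bar> \<le> R + real (Suc r)" for l i t s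
 proof -
  have "(deriv ^^ l) (d i t) s = (deriv ^^ l) (g (Suc i) t) s - (deriv ^^ l) (g i t) s"
   using derivs_diff[OF smg smg, of l "Suc i" t i t] by (simp add: d_def[abs_def])
  then have "\<bar>(deriv ^^ l) (d i t) s\<bar> \<le> (S * C l) * 2 ^ Suc i + (S * C l) * 2 ^ i"
   using gb[OF t s, of l i] gb[OF t s, of l "Suc i"] by linarith
  then show ?thesis by (simp add: algebra_simps)
 qed
 have decay: "EX D. ALL i t s. t \<in> P --> \<bar>s\<bar> \<le> R --> \<bar>(deriv ^^ j) (d i t) s\<bar> \<le> D * (1/2) ^ i" if j: "j \<le> Suc r" for j
 proof (rule derivatives_decay[where A = "2 * E"])
  fix i t s assume t: "t \<in> P" and s: "\<bar>s\<bar> \<le> R + real j"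
  have "2 * E * (1/2) ^ (i * K) \<le> 2 * E * (1/2) ^ (i * rate j)"
   using rate_mono[OF j] t E0 by (intro mult_left_mono power_decreasing mult_le_mono) (auto simp: K_def P_def)
  moreover have "\<bar>d i t s\<bar> \<le> 2 * E * (1/2) ^ (i * K)" using s j by (intro db t) linarith
  ultimately show "\<bar>d i t s\<bar> \<le> 2 * E * (1/2) ^ (i * rate j)" by linarith
 next
  fix l
  show "EX B. ALL i t s. t \<in> P --> \<bar>s\<bar> \<le> R + real j --> \<bar>(deriv ^^ l) (d i t) s\<bar> \<le> B * 2 ^ i"
  proof (intro exI[of _ "3 * (S * C l)"] allI impI)
   fix i t s assume "t \<in> P" and "\<bar>s\<bar> \<le> R + real j"
   moreover from this j have "\<bar>s\<bar> \<le> R + real (Suc r)" by linarith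
   ultimately show "\<bar>(deriv ^^ l) (d i t) s\<bar> \<le> 3 * (S * C l) * 2 ^ i" by (intro dl)
  qed
 qed (rule smd)
 have "ALL j. EX D. j \<le> Suc r --> (ALL i t s. t \<in> P --> \<bar>s\<bar> \<le> R --> \<bar>(deriv ^^ j) (d i t) s\<bar> \<le> D * (1/2) ^ i)"
 proof
  fix j
  show "EX D. j \<le> Suc r --> (ALL i t s. t \<in> P --> \<bar>s\<bar> \<le> R --> \<bar>(deriv ^^ j) (d i t) s\<bar> \<le> D * (1/2) ^ i)"
   by (cases "j \<le> Suc r") (use decay[of j] in simp_all)
 qed
 from choice[OF this] obtain D where
  D0: "ALL j. j \<le> Suc r --> (ALL i t s. t \<in> P --> \<bar>s\<bar> \<le> R --> \<bar>(deriv ^^ j) (d i t) s\<bar> \<le> D j * (1/2) ^ i)" ..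
 have D: "\<bar>(deriv ^^ j) (d i t) s\<bar> \<le> D j * (1/2) ^ i" if "j \<le> Suc r" "t \<in> P" "\<bar>s\<bar> \<le> R" for j i t s
  using D0[rule_format, OF that] .
 define e where "e t n = (case n of 0 => g 0 t | Suc i => d i t)" for t n
 define M where "M j n = (case n of 0 => S * C j | Suc i => D j * (1/2) ^ i)" for j n
 have sme: "smooth_real (e t n)" for t n by (cases n) (auto simp: e_def smg smd)
 have M: "summable (M j)" for j by (subst summable_Suc_iff[symmetric]) (simp add: M_def)
 have eM: "\<bar>(deriv ^^ j) (e t n) s\<bar> \<le> M j n" if "j \<le> Suc r" "t \<in> P" "\<bar>s\<bar> < R" for j t n s
  using that gb[of t s j 0] D[of j t s] by (cases n) (auto simp: e_def M_def)
 have partial_sums: "(\<Sum>k<Suc n. e t k s) = g n t s" for n t s by (induction n) (auto simp: e_def d_def)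
 have lim: "deriv (F s) t = (\<Sum>n. e t n s)" if t: "t \<in> P" and s: "\<bar>s\<bar> < R" for t s
 proof -
  have "(%i. E * (1/2) ^ (i * K)) \<longlonglongrightarrow> 0"
  proof -
   have "(%i. E * ((1/2) ^ K) ^ i) \<longlonglongrightarrow> E * 0"
    using K1 by (intro tendsto_mult tendsto_const LIMSEQ_realpow_zero) (auto simp: power_less_one_iff)
   then show ?thesis by (simp add: power_mult[symmetric] mult.commute)
  qed
  then have "(%i. g i t s - deriv (F s) t) \<longlonglongrightarrow> 0"
   by (rule Lim_null_comparison[rotated]) (use approx[OF t, of s] s in auto)
  then have "(%i. g i t s) \<longlonglongrightarrow> deriv (F s) t" by (simp add: LIM_zero_iff)
  then have "(%n. \<Sum>k<n. e t k s) \<longlonglongrightarrow> deriv (F s) t"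
   unfolding partial_sums[symmetric] by (subst (asm) filterlim_sequentially_Suc)
  then show ?thesis by (simp add: sums_def[symmetric] sums_iff)
 qed
 show ?thesis
 proof (intro exI[of _ "\<Sum>n. M r n"] allI impI)
  fix s t assume s: "\<bar>s\<bar> < R" and "\<bar>t\<bar> \<le> R"
  then have t: "t \<in> P" by (simp add: P_def)
  have ev: "\<forall>\<^sub>F y in nhds s. deriv (F y) t = (\<Sum>n. e t n y)"
   using eventually_nhds_in_open[of "{-R<..<R}" s] s by (auto elim!: eventually_mono intro!: lim[OF t] simp: abs_less_iff)
  have ev': "\<forall>\<^sub>F y in nhds s. (deriv ^^ r) (%s. deriv (F s) t) y = (deriv ^^ r) (%y. \<Sum>n. e t n y) y"
  proof (rule eventually_mono)
   show "\<forall>\<^sub>F y in nhds s. \<forall>\<^sub>F z in nhds y. deriv (F z) t = (\<Sum>n. e t n z)"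
    using ev by (simp only: eventually_eventually)
  qed (rule derivs_cong_ev)
  have bd: "EX M. summable M & (ALL n x. \<bar>x\<bar> < R --> \<bar>(deriv ^^ j) (e t n) x\<bar> \<le> M n)" if "j \<le> Suc r" for j
   using M eM[OF that t] by blast
  note ser = series_derivs[where r = "Suc r" and j = r and g = "e t", OF sme bd s]
  have "(deriv ^^ r) (%y. \<Sum>n. e t n y) differentiable (at s)"
   using ser(3) unfolding real_differentiable_def by auto
  then have "(deriv ^^ r) (%s. deriv (F s) t) differentiable (at s)"
   unfolding real_differentiable_def using DERIV_cong_ev[OF refl ev' refl] by blast
  moreover have "(deriv ^^ r) (%s. deriv (F s) t) s = (\<Sum>n. (deriv ^^ r) (e t n) s)"
   using ser(2) eventually_nhds_x_imp_x[OF ev'] by simp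
  moreover have "\<bar>\<Sum>n. (deriv ^^ r) (e t n) s\<bar> \<le> (\<Sum>n. M r n)"
   unfolding real_norm_def[symmetric] by (rule norm_suminf_le[OF _ M]) (use eM[of r t s] t s in auto)
  ultimately show "(deriv ^^ r) (%s. deriv (F s) t) differentiable (at s) & \<bar>(deriv ^^ r) (%s. deriv (F s) t) s\<bar> \<le> (\<Sum>n. M r n)"
   by simp
 qed
qed

lemma sep_bounded_partial2:
 assumes F: "sep_bounded F"
 shows "sep_bounded (%s t. deriv (F s) t)"
proof (rule sep_boundedI)
 show "smooth_real (deriv (F s))" for s using F by (auto simp: sep_bounded_def intro: smooth_real_deriv)
 show "smooth_real (%s. deriv (F s) t)" for t unfolding smooth_real_def
 proof (intro allI)
  fix k s
  show "(deriv ^^ k) (%s. deriv (F s) t) differentiable (at s)"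
   using sep_bounded_partial2_local[OF F, of "max (\<bar>s\<bar> + 1) \<bar>t\<bar>" k] by fastforce
 qed
 fix k R
 show "EX C. ALL s t. \<bar>s\<bar> \<le> R --> \<bar>t\<bar> \<le> R --> \<bar>(deriv ^^ k) (%s. deriv (F s) t) s\<bar> \<le> C"
 proof -
  obtain C where C: "ALL s t. \<bar>s\<bar> < R + 1 --> \<bar>t\<bar> \<le> R + 1 -->
    (deriv ^^ k) (%s. deriv (F s) t) differentiable (at s) & \<bar>(deriv ^^ k) (%s. deriv (F s) t) s\<bar> \<le> C"
   using sep_bounded_partial2_local[OF F, of "R + 1" k] ..
  show ?thesis
  proof (intro exI[of _ C] allI impI)
   fix s t assume "\<bar>s\<bar> \<le> R" "\<bar>t\<bar> \<le> R"
   then show "\<bar>(deriv ^^ k) (%s. deriv (F s) t) s\<bar> \<le> C" using C[rule_format, of s t] by simp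
  qed
 qed
 obtain C where "!!s t. \<bar>s\<bar> \<le> R ==> \<bar>t\<bar> \<le> R ==> \<bar>(deriv ^^ Suc k) (F s) t\<bar> \<le> C"
  using F unfolding sep_bounded_def by blast
 then show "EX C. ALL s t. \<bar>s\<bar> \<le> R --> \<bar>t\<bar> \<le> R --> \<bar>(deriv ^^ k) (deriv (F s)) t\<bar> \<le> C"
  unfolding funpow_Suc_right o_def by (intro exI[of _ C]) auto
qed

section \<open>Boman's theorem\<close>

lemma tendsto_coordinatewise:
 fixes f :: "'u => 'i => 'b::topological_space"
 assumes "!!i. ((%u. f u i) \<longlongrightarrow> l i) F"
 shows "(f \<longlongrightarrow> l) F"
proof -
 have "limitin (product_topology (%i. euclidean) UNIV) f l F" unfolding limitin_componentwise using assms by simp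
 then show ?thesis by (simp add: euclidean_product_topology)
qed

lemma mvt_symmetric:
 fixes h :: "real => real"
 assumes "!!t. (h has_real_derivative h' t) (at t)"
 shows "\<exists>\<zeta>. \<bar>\<zeta> - a\<bar> \<le> \<bar>b - a\<bar> & h b - h a = h' \<zeta> * (b - a)"
proof -
 consider "a < b" | "b < a" | "a = b" by linarith
 then show ?thesis
 proof cases
  case 1
  then obtain z where "a < z" "z < b" "h b - h a = (b - a) * h' z" using MVT2[of a b h h'] assms by blast
  then show ?thesis by (intro exI[of _ z]) (auto simp: mult.commute)
 next
  case 2
  then obtain z where "b < z" "z < a" "h a - h b = (a - b) * h' z" using MVT2[of b a h h'] assms by blast
  then show ?thesis by (intro exI[of _ z]) (auto simp: algebra_simps)
 qed auto
qed

lemma Rn_upd: "x \<in> Rn n ==> i < n ==> x(i := t) \<in> Rn n" by (auto simp: Rn_def)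

lemma DERIV_along_curve:
 assumes cont: "!!i. i < n ==> continuous_on (Rn n) (partial i f)"
  and diff: "!!i x. i < n ==> x \<in> Rn n ==> (%t. f (x(i := t))) differentiable (at (x i))"
  and c: "!!u. c u \<in> Rn n" and c': "!!i. i < n ==> ((%u. c u i) has_real_derivative c' i) (at u0)"
 shows "((%u. f (c u)) has_real_derivative (\<Sum>i<n. partial i f (c u0) * c' i)) (at u0)"
proof -
 define mix where "mix j u = (%i. if i < j then c u i else c u0 i)" for j u
 have mixRn: "mix j u \<in> Rn n" for j u using c[of u] c[of u0] by (auto simp: mix_def Rn_def)
 have lim: "((%u. c u i) \<longlongrightarrow> c u0 i) (at u0)" for i
 proof (cases "i < n")
  case True
  then show ?thesis using DERIV_isCont[OF c'] by (simp add: isCont_def)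
 next
  case False
  then show ?thesis using c by (simp add: Rn_def)
 qed
 have "((%u. f (mix j u)) has_real_derivative (\<Sum>i<j. partial i f (c u0) * c' i)) (at u0)" if "j \<le> n" for j
  using that
 proof (induction j)
  case 0
  have "mix 0 = (%u. c u0)" by (auto simp: mix_def fun_eq_iff)
  then show ?case by simp
 next
  case (Suc j)
  have j: "j < n" using Suc by simp
  have D: "((%t. f ((mix j u)(j := t))) has_real_derivative partial j f ((mix j u)(j := t))) (at t)" for u t
   using diff[OF j Rn_upd[OF mixRn j], of j u t]
   by (simp add: partial_def real_differentiable_def) (metis DERIV_imp_deriv)
  have "ALL u. \<exists>\<zeta>. \<bar>\<zeta> - c u0 j\<bar> \<le> \<bar>c u j - c u0 j\<bar> &
    f ((mix j u)(j := c u j)) - f ((mix j u)(j := c u0 j)) = partial j f ((mix j u)(j := \<zeta>)) * (c u j - c u0 j)"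
   by (intro allI mvt_symmetric D)
  from choice[OF this] obtain \<zeta> where \<zeta>: "!!u. \<bar>\<zeta> u - c u0 j\<bar> \<le> \<bar>c u j - c u0 j\<bar>"
    "!!u. f ((mix j u)(j := c u j)) - f ((mix j u)(j := c u0 j)) = partial j f ((mix j u)(j := \<zeta> u)) * (c u j - c u0 j)"
   by blast
  have mix1: "(mix j u)(j := c u j) = mix (Suc j) u" and mix2: "(mix j u)(j := c u0 j) = mix j u" for u
   by (auto simp: mix_def fun_eq_iff)
  define z where "z u = (mix j u)(j := \<zeta> u)" for u
  have \<zeta>lim: "(\<zeta> \<longlongrightarrow> c u0 j) (at u0)"
  proof (rule LIM_zero_cancel, rule Lim_null_comparison)
   show "\<forall>\<^sub>F u in at u0. norm (\<zeta> u - c u0 j) \<le> \<bar>c u j - c u0 j\<bar>" using \<zeta>(1) by simp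
   show "((%u. \<bar>c u j - c u0 j\<bar>) \<longlongrightarrow> 0) (at u0)"
    using tendsto_rabs_zero[OF LIM_zero[OF lim[of j]]] .
  qed
  have "(z \<longlongrightarrow> c u0) (at u0)"
  proof (rule tendsto_coordinatewise)
   fix i
   show "((%u. z u i) \<longlongrightarrow> c u0 i) (at u0)"
    using lim[of i] \<zeta>lim by (cases "i = j"; cases "i < j") (auto simp: z_def mix_def)
  qed
  then have part: "((%u. partial j f (z u)) \<longlongrightarrow> partial j f (c u0)) (at u0)"
   by (rule continuous_on_tendsto_compose[OF cont[OF j] _ c])
     (auto simp: z_def intro!: always_eventually Rn_upd mixRn j)
  have "((%u. f (mix (Suc j) u) - f (mix j u)) has_real_derivative partial j f (c u0) * c' j) (at u0)"
   unfolding has_field_derivative_iff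
  proof -
   have eq: "f (mix (Suc j) u) - f (mix j u) = partial j f (z u) * (c u j - c u0 j)" for u
    using \<zeta>(2)[of u] unfolding mix1 mix2 z_def .
   have "((%u. (c u j - c u0 j) / (u - u0)) \<longlongrightarrow> c' j) (at u0)"
    using c'[OF j] unfolding has_field_derivative_iff .
   from tendsto_mult[OF part this]
   show "((%u. (f (mix (Suc j) u) - f (mix j u) - (f (mix (Suc j) u0) - f (mix j u0))) / (u - u0))
     \<longlongrightarrow> partial j f (c u0) * c' j) (at u0)" unfolding eq by simp
  qed
  from DERIV_add[OF this Suc.IH] show ?case using j by (simp add: add.commute)
 qed
 moreover have "mix n = c" using c by (auto simp: mix_def fun_eq_iff Rn_def)
 ultimately show ?thesis by force
qed

lemma smooth_Rn_partial: "smooth_Rn n f ==> i < n ==> smooth_Rn n (partial i f)" unfolding smooth_Rn_def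
proof (intro allI impI)
 fix "is" assume *: "ALL is. set is \<subseteq> {..<n} -->
   continuous_on (Rn n) (foldr partial is f) &
   (\<forall>i<n. \<forall>x\<in>Rn n. (%t. foldr partial is f (x(i := t))) differentiable (at (x i)))" "i < n" "set is \<subseteq> {..<n}"
 then have "set (is @ [i]) \<subseteq> {..<n}" by simp
 with *(1) have "continuous_on (Rn n) (foldr partial (is @ [i]) f) &
   (\<forall>j<n. \<forall>x\<in>Rn n. (%t. foldr partial (is @ [i]) f (x(j := t))) differentiable (at (x j)))" by blast
 then show "continuous_on (Rn n) (foldr partial is (partial i f)) &
   (\<forall>j<n. \<forall>x\<in>Rn n. (%t. foldr partial is (partial i f) (x(j := t))) differentiable (at (x j)))"
  by simp
qed

lemma smooth_Rn_continuous: "smooth_Rn n f ==> continuous_on (Rn n) f"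
 and smooth_Rn_differentiable:
  "smooth_Rn n f ==> i < n ==> x \<in> Rn n ==> (%t. f (x(i := t))) differentiable (at (x i))"
 unfolding smooth_Rn_def by (drule spec[of _ "[]"]; simp)+

definition curve_Rn :: "nat => (real => point) => bool" where
 "curve_Rn n c \<longleftrightarrow> (ALL u. c u \<in> Rn n) & (\<forall>i<n. smooth_real (%u. c u i))"

inductive curve_closure :: "nat => (real => real) => bool" for n where
 along: "smooth_Rn n f ==> curve_Rn n c ==> curve_closure n (%u. f (c u))"
| add: "curve_closure n f ==> curve_closure n g ==> curve_closure n (%u. f u + g u)"
| mult: "curve_closure n f ==> smooth_real g ==> curve_closure n (%u. f u * g u)"
| zero: "curve_closure n (%u. 0)"

lemma curve_closure_sum: "(!!i. i < m ==> curve_closure n (f i)) ==> curve_closure n (%u. \<Sum>i<m::nat. f i u)"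
 by (induction m) (auto intro: curve_closure.zero curve_closure.add)

lemma smooth_Rn_along_curve:
 assumes "smooth_Rn n f" "curve_Rn n c"
 shows "smooth_real (%u. f (c u))"
proof (rule smooth_real_coinduct[where P = "curve_closure n"])
 fix f assume "curve_closure n f"
 then show "EX f'. curve_closure n f' & (ALL x. (f has_real_derivative f' x) (at x))"
 proof induction
  case (along f c)
  have "((%u. f (c u)) has_real_derivative (\<Sum>i<n. partial i f (c u) * deriv (%u. c u i) u)) (at u)" for u
  proof (rule DERIV_along_curve)
   show "(%t. f (x(i := t))) differentiable (at (x i))" if "i < n" "x \<in> Rn n" for i x
    by (rule smooth_Rn_differentiable[OF along(1) that])
  qed (use along in \<open>auto simp: curve_Rn_def intro: smooth_Rn_continuous smooth_Rn_partial smooth_real_DERIV\<close>)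
  moreover have "curve_closure n (%u. \<Sum>i<n. partial i f (c u) * deriv (%u. c u i) u)"
   using along by (intro curve_closure_sum curve_closure.mult curve_closure.along)
    (auto simp: curve_Rn_def intro: smooth_Rn_partial smooth_real_deriv)
  ultimately show ?case by blast
 next
  case (add f g)
  then obtain f' g' where *: "curve_closure n f'" "curve_closure n g'"
   "!!x. (f has_real_derivative f' x) (at x)" "!!x. (g has_real_derivative g' x) (at x)" by blast
  show ?case by (intro exI[of _ "%x. f' x + g' x"] conjI allI curve_closure.add DERIV_add *)
 next
  case (mult f g)
  then obtain f' where *: "curve_closure n f'" "!!x. (f has_real_derivative f' x) (at x)" by blast
  have "((%u. f u * g u) has_real_derivative f' u * g u + f u * deriv g u) (at u)" for u
   using DERIV_mult[OF *(2) smooth_real_DERIV[OF mult(2)]] by (simp add: algebra_simps)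
  moreover have "curve_closure n (%u. f' u * g u + f u * deriv g u)"
   by (intro curve_closure.add curve_closure.mult * mult smooth_real_deriv)
  ultimately show ?case by blast
 next
  case zero
  then show ?case by (intro exI[of _ "%_. 0"]) (auto intro: curve_closure.zero)
 qed
qed (intro curve_closure.along assms)

lemma sep_bounded_partial1: "sep_bounded F ==> sep_bounded (%s t. deriv (%s. F s t) s)"
 using sep_bounded_swap[OF sep_bounded_partial2[OF sep_bounded_swap]] .

lemma sep_bounded_continuous:
 assumes F: "sep_bounded F" shows "continuous_on UNIV (%p. F (fst p) (snd p))"
proof (rule continuous_at_imp_continuous_on, rule ballI)
 fix p0 :: "real \<times> real"
 obtain s0 t0 where p0: "p0 = (s0, t0)" by (cases p0)
 define R where "R = max \<bar>s0\<bar> \<bar>t0\<bar> + 1"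
 have sm: "smooth_real (F s)" "smooth_real (%s. F s t)" for s t using F by (auto simp: sep_bounded_def)
 have "EX C. ALL s t. \<bar>s\<bar> \<le> R --> \<bar>t\<bar> \<le> R -->
    \<bar>(deriv ^^ 1) (%s. F s t) s\<bar> \<le> C & \<bar>(deriv ^^ 1) (F s) t\<bar> \<le> C"
  using F unfolding sep_bounded_def by blast
 then obtain C where C0: "ALL s t. \<bar>s\<bar> \<le> R --> \<bar>t\<bar> \<le> R -->
    \<bar>(deriv ^^ 1) (%s. F s t) s\<bar> \<le> C & \<bar>(deriv ^^ 1) (F s) t\<bar> \<le> C" ..
 have C: "\<bar>deriv (%s. F s t) s\<bar> \<le> C" if "\<bar>s\<bar> \<le> R" "\<bar>t\<bar> \<le> R" for s t
  using C0[rule_format, OF that] by simp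
 have lip: "\<bar>F s t - F s0 t\<bar> \<le> C * \<bar>s - s0\<bar>" if "\<bar>s - s0\<bar> < 1" "\<bar>t - t0\<bar> < 1" for s t
 proof -
  obtain \<zeta> where \<zeta>: "\<bar>\<zeta> - s0\<bar> \<le> \<bar>s - s0\<bar>" "F s t - F s0 t = deriv (%s. F s t) \<zeta> * (s - s0)"
   using mvt_symmetric[of "%s. F s t" "deriv (%s. F s t)" s0 s, OF smooth_real_DERIV[OF sm(2)]] by blast
  have "\<bar>\<zeta>\<bar> \<le> R" "\<bar>t\<bar> \<le> R" using \<zeta>(1) that unfolding R_def by linarith+
  then have "\<bar>deriv (%s. F s t) \<zeta>\<bar> \<le> C" by (rule C)
  then show ?thesis unfolding \<zeta>(2) abs_mult by (intro mult_right_mono) auto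
 qed
 have ft: "(fst \<longlongrightarrow> s0) (at p0)" "(snd \<longlongrightarrow> t0) (at p0)"
  using tendsto_fst[OF tendsto_ident_at[of p0 UNIV]] tendsto_snd[OF tendsto_ident_at[of p0 UNIV]]
  by (simp_all add: p0)
 have "((%p. F (fst p) (snd p) - F s0 (snd p)) \<longlongrightarrow> 0) (at p0)"
 proof (rule Lim_null_comparison)
  show "((%p. C * \<bar>fst p - s0\<bar>) \<longlongrightarrow> 0) (at p0)"
   by (rule tendsto_mult_right_zero[OF tendsto_rabs_zero[OF LIM_zero[OF ft(1)]]])
  have "\<forall>\<^sub>F p in at p0. \<bar>fst p - s0\<bar> < 1 & \<bar>snd p - t0\<bar> < 1"
   using eventually_conj[OF tendstoD[OF ft(1), of 1] tendstoD[OF ft(2), of 1]] by (simp add: dist_real_def)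
  then show "\<forall>\<^sub>F p in at p0. norm (F (fst p) (snd p) - F s0 (snd p)) \<le> C * \<bar>fst p - s0\<bar>"
   by (rule eventually_mono) (use lip in auto)
 qed
 moreover have "((%p. F s0 (snd p)) \<longlongrightarrow> F s0 t0) (at p0)"
  by (rule isCont_tendsto_compose[OF smooth_real_isCont[OF sm(1)] ft(2)])
 ultimately have "((%p. (F (fst p) (snd p) - F s0 (snd p)) + F s0 (snd p)) \<longlongrightarrow> 0 + F s0 t0) (at p0)"
  by (rule tendsto_add)
 then show "isCont (%p. F (fst p) (snd p)) p0" by (simp add: isCont_def p0)
qed

lemma sep_bounded_smooth_Rn:
 assumes "sep_bounded F" shows "smooth_Rn 2 (%x. F (x 0) (x 1))" unfolding smooth_Rn_def
proof (intro allI impI)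
 fix "is" :: "nat list" assume "set is \<subseteq> {..<2}"
 then have "EX G. sep_bounded G & foldr partial is (%x. F (x 0) (x 1)) = (%x. G (x 0) (x 1))"
 proof (induction "is")
  case Nil
  then show ?case using assms by auto
 next
  case (Cons i "is")
  then obtain G where G: "sep_bounded G" "foldr partial is (%x. F (x 0) (x 1)) = (%x. G (x 0) (x 1))" by auto
  consider "i = 0" | "i = 1" using Cons(2) by fastforce
  then show ?case
  proof cases
   case 1
   then show ?thesis by (intro exI[of _ "%s t. deriv (%s. G s t) s"])
      (simp add: G sep_bounded_partial1, simp add: 1 G(2)[unfolded One_nat_def] partial_def fun_eq_iff)
  next
   case 2
   then show ?thesis by (intro exI[of _ "%s t. deriv (G s) t"])
      (simp add: G sep_bounded_partial2, simp add: 2 G(2)[unfolded One_nat_def] partial_def fun_eq_iff)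
  qed
 qed
 then obtain G where G: "sep_bounded G" "foldr partial is (%x. F (x 0) (x 1)) = (%x. G (x 0) (x 1))" by blast
 have "continuous_on (Rn 2) (%x. (%p. G (fst p) (snd p)) (x 0, x 1))"
  by (intro continuous_on_compose2[OF sep_bounded_continuous[OF G(1)]] continuous_on_Pair
    continuous_on_subset[OF continuous_on_product_coordinates]) simp_all
 moreover have "(%t. G ((x(i := t)) 0) ((x(i := t)) 1)) differentiable (at (x i))" if "i < 2" for i and x :: point
 proof -
  have "smooth_real (G s)" "smooth_real (%s. G s t)" for s t using G(1) by (auto simp: sep_bounded_def)
  moreover have "i = 0 \<or> i = 1" using that by auto
  ultimately show ?thesis by (auto intro: smooth_real_differentiable)
 qed
 ultimately show "continuous_on (Rn 2) (foldr partial is (%x. F (x 0) (x 1))) &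
   (\<forall>i<2. \<forall>x\<in>Rn 2. (%t. foldr partial is (%x. F (x 0) (x 1)) (x(i := t))) differentiable (at (x i)))"
  unfolding G(2) by (simp del: One_nat_def fun_upd_apply)
qed

text \<open>Bounds on the pure derivatives are inherited by both partial derivatives; so all iterated partial
  derivatives exist and are continuous, and the chain rule applies.\<close>

lemma sep_bounded_imp_smooth2:
 assumes "sep_bounded F" shows "smooth2 F" unfolding smooth2_def
proof (intro allI impI)
 fix a b assume "smooth_real a & smooth_real b"
 then have "curve_Rn 2 (%u i. if i = 0 then a u else if i = 1 then b u else 0)"
  by (auto simp: curve_Rn_def Rn_def less_2_cases_iff)
 from smooth_Rn_along_curve[OF sep_bounded_smooth_Rn[OF assms] this]
 show "smooth_real (%u. F (a u) (b u))" by simp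
qed

lemma smooth2_iff_sep_bounded: "smooth2 F \<longleftrightarrow> sep_bounded F"
 using smooth2_imp_sep_bounded sep_bounded_imp_smooth2 by blast

lemma smooth2_partial2: "smooth2 F ==> smooth2 (%s t. deriv (F s) t)"
 by (simp add: smooth2_iff_sep_bounded sep_bounded_partial2)

lemma smooth2_partial1: "smooth2 F ==> smooth2 (%s t. deriv (%s. F s t) s)"
 by (simp add: smooth2_iff_sep_bounded sep_bounded_partial1)

lemma smooth2_partials2: "smooth2 F ==> smooth2 (%s t. (deriv ^^ k) (F s) t)"
proof (induction k)
 case (Suc k)
 from smooth2_partial2[OF Suc.IH[OF Suc.prems]] show ?case by simp
qed simp

definition csmooth :: "nat => (point => real) => bool" where
 "csmooth n f \<longleftrightarrow> (ALL c. curve_Rn n c --> smooth_real (%u. f (c u)))"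

lemma csmooth_upd:
 assumes f: "csmooth n f" and i: "i < n" and c: "curve_Rn n c"
 shows "smooth2 (%s t. f ((c s)(i := t)))" unfolding smooth2_def
proof (intro allI impI)
 fix a b assume ab: "smooth_real a & smooth_real b"
 have "curve_Rn n (%u. (c (a u))(i := b u))" unfolding curve_Rn_def
 proof (intro conjI allI impI)
  show "(c (a u))(i := b u) \<in> Rn n" for u using c i by (auto simp: curve_Rn_def Rn_upd)
  fix j assume "j < n"
  then show "smooth_real (%u. ((c (a u))(i := b u)) j)"
   using c ab smooth_real_compose[of "%u. c u j" a] by (cases "j = i") (auto simp: curve_Rn_def)
 qed
 then show "smooth_real (%u. f ((c (a u))(i := b u)))" using f by (simp add: csmooth_def)
qed

lemma csmooth_partial:
 assumes f: "csmooth n f" and i: "i < n" shows "csmooth n (partial i f)" unfolding csmooth_def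
proof (intro allI impI)
 fix c assume c: "curve_Rn n c"
 have "smooth_real (%u. deriv (%t. f ((c u)(i := t))) (c u i))"
  by (rule smooth2D[OF smooth2_partial2[OF csmooth_upd[OF f i c]]])
    (use c i in \<open>auto simp: curve_Rn_def\<close>)
 then show "smooth_real (%u. partial i f (c u))" by (simp add: partial_def)
qed

lemma csmooth_differentiable:
 assumes f: "csmooth n f" and i: "i < n" and x: "x \<in> Rn n"
 shows "(%t. f (x(i := t))) differentiable (at (x i))"
proof -
 have "curve_Rn n (%_. x)" using x by (simp add: curve_Rn_def)
 from smooth2_slices(1)[OF csmooth_upd[OF f i this]] show ?thesis by (rule smooth_real_differentiable)
qed

lemma csmooth_continuous:
 assumes f: "csmooth n f" shows "continuous_on (Rn n) f" unfolding continuous_on_sequentially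
proof (intro ballI allI impI, elim conjE)
 fix x and l assume l: "l \<in> Rn n" and x: "ALL k. x k \<in> Rn n" and lim: "x \<longlonglongrightarrow> l"
 have limi: "(%k. x k i) \<longlonglongrightarrow> l i" for i
  by (rule continuous_on_tendsto_compose[where f = "%y. y i" and s = UNIV])
    (simp_all add: lim)
 show "(f \<circ> x) \<longlonglongrightarrow> f l"
 proof (rule ccontr)
  assume "\<not> (f \<circ> x) \<longlonglongrightarrow> f l"
  then have "\<not> (\<forall>e>0. \<forall>\<^sub>F k in sequentially. dist (f (x k)) (f l) < e)"
   by (simp only: tendsto_iff o_def not_False_eq_True)
  then obtain e where e: "e > 0" "\<not> (\<forall>\<^sub>F k in sequentially. dist (f (x k)) (f l) < e)" by blast
  have "ALL m. EX k. dist (f (x k)) (f l) \<ge> e & (\<forall>i<n. \<bar>x k i - l i\<bar> \<le> (1/2) ^ m\<^sup>2)"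
  proof
   fix m
   have "\<forall>\<^sub>F k in sequentially. \<forall>i\<in>{..<n}. \<bar>x k i - l i\<bar> < (1/2) ^ m\<^sup>2"
   proof (rule eventually_ball_finite, simp, rule ballI)
    fix i show "\<forall>\<^sub>F k in sequentially. \<bar>x k i - l i\<bar> < (1/2) ^ m\<^sup>2"
     using tendstoD[OF limi[of i], of "(1/2) ^ m\<^sup>2"] by (simp add: dist_real_def)
   qed
   then obtain N where "\<forall>k\<ge>N. \<forall>i\<in>{..<n}. \<bar>x k i - l i\<bar> < (1/2) ^ m\<^sup>2"
    unfolding eventually_sequentially ..
   then have N: "\<bar>x k i - l i\<bar> < (1/2) ^ m\<^sup>2" if "k \<ge> N" "i < n" for k i using that by simp
   have "\<exists>k\<ge>N. \<not> dist (f (x k)) (f l) < e" using e(2) unfolding eventually_sequentially by blast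
   then obtain k where k: "k \<ge> N" "\<not> dist (f (x k)) (f l) < e" by blast
   have "\<bar>x k i - l i\<bar> \<le> (1/2) ^ m\<^sup>2" if "i < n" for i by (rule less_imp_le[OF N[OF k(1) that]])
   with k(2) show "EX k. dist (f (x k)) (f l) \<ge> e & (\<forall>i<n. \<bar>x k i - l i\<bar> \<le> (1/2) ^ m\<^sup>2)"
    unfolding not_less by blast
  qed
  from choice[OF this] obtain r where
   "ALL m. dist (f (x (r m))) (f l) \<ge> e & (\<forall>i<n. \<bar>x (r m) i - l i\<bar> \<le> (1/2) ^ m\<^sup>2)" ..
  then have r: "dist (f (x (r m))) (f l) \<ge> e" "i < n ==> \<bar>x (r m) i - l i\<bar> \<le> (1/2) ^ m\<^sup>2" for m i
   by simp_all
  have "ALL i. EX g. i < n --> smooth_real g & g 0 = 0 & (ALL m. g (1 / 2 ^ m) = x (r m) i - l i)"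
  proof
   fix i
   show "EX g. i < n --> smooth_real g & g 0 = 0 & (ALL m. g (1 / 2 ^ m) = x (r m) i - l i)"
   proof (cases "i < n")
    case True
    obtain g where g: "smooth_real g" "g 0 = 0"
     "!!m. \<forall>\<^sub>F u in nhds (1 / 2 ^ m). g u = (x (r m) i - l i) + 0 * (u - 1 / 2 ^ m)"
     by (rule curve_through_segments[of "%m. x (r m) i - l i" "%_. 0"]) (simp_all add: r(2)[OF True])
    have "g (1 / 2 ^ m) = x (r m) i - l i" for m using eventually_nhds_x_imp_x[OF g(3)[of m]] by simp
    with g(1,2) show ?thesis by (intro exI[of _ g]) simp
   qed simp
  qed
  from choice[OF this] obtain g where
   g0: "ALL i. i < n --> smooth_real (g i) & g i 0 = 0 & (ALL m. g i (1 / 2 ^ m) = x (r m) i - l i)" ..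
  have g: "smooth_real (g i)" "g i 0 = 0" "g i (1 / 2 ^ m) = x (r m) i - l i" if "i < n" for i m
   using g0[rule_format, OF that] by simp_all
  define c where "c u = (%i. if i < n then l i + g i u else 0)" for u
  have "curve_Rn n c" unfolding curve_Rn_def
  proof (intro conjI allI impI)
   show "c u \<in> Rn n" for u by (simp add: c_def Rn_def)
   show "smooth_real (%u. c u i)" if "i < n" for i
    using smooth_real_add[OF smooth_real_const g(1)[OF that], of "l i"] that by (simp add: c_def)
  qed
  with f have "smooth_real (%u. f (c u))" by (simp add: csmooth_def)
  then have cont: "isCont (%u. f (c u)) 0" by (rule smooth_real_isCont)
  have "(%m. 1 / 2 ^ m :: real) \<longlonglongrightarrow> 0" by (rule LIMSEQ_divide_realpow_zero) simp
  note lim_f = isCont_tendsto_compose[OF cont this]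
  have c0: "c 0 = l" using l by (auto simp: c_def Rn_def fun_eq_iff g(2))
  have cm: "c (1 / 2 ^ m) = x (r m)" for m
  proof
   fix i
   have "x (r m) i = 0" if "\<not> i < n" using x that by (simp add: Rn_def)
   then show "c (1 / 2 ^ m) i = x (r m) i" using g(3)[of i m] by (simp add: c_def)
  qed
  have "(%m. f (x (r m))) \<longlonglongrightarrow> f l" using lim_f unfolding c0 cm .
  from tendstoD[OF this e(1)] have ev: "\<forall>\<^sub>F m in sequentially. dist (f (x (r m))) (f l) < e" .
  have "\<forall>\<^sub>F m in sequentially. False" using ev
  proof (rule eventually_mono)
   fix m assume "dist (f (x (r m))) (f l) < e"
   then show False using r(1)[of m] by (simp only: leD)
  qed
  then show False by simp
 qed
qed

theorem boman: "csmooth n f \<longleftrightarrow> smooth_Rn n f"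
proof
 assume f: "csmooth n f"
 have "csmooth n (foldr partial is f)" if "set is \<subseteq> {..<n}" for "is"
  using that by (induction "is") (auto simp: f csmooth_partial)
 then show "smooth_Rn n f" unfolding smooth_Rn_def
  by (intro allI impI conjI ballI csmooth_continuous csmooth_differentiable) auto
qed (auto simp: csmooth_def smooth_Rn_along_curve)

section \<open>Division by a coordinate\<close>

lemma smooth2_continuous: "smooth2 F ==> continuous_on S (%(s, t). F s t)"
 unfolding split_beta smooth2_iff_sep_bounded by (rule continuous_on_subset[OF sep_bounded_continuous]) simp_all

lemma smooth_real_integral:
 assumes "smooth2 P" shows "smooth_real (%s. integral {0..1} (P s))"
proof (rule smooth_real_coinduct[where P = "%f. EX P. smooth2 P & f = (%s. integral {0..1} (P s))"])
 fix f :: "real => real"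
 assume "EX P. smooth2 P & f = (%s. integral {0..1} (P s))"
 then obtain P where P: "smooth2 P" "f = (%s. integral {0..1} (P s))" by blast
 have "((%s. integral (cbox 0 1) (P s)) has_vector_derivative
   integral (cbox 0 1) (%t. deriv (%s. P s t) s0)) (at s0 within UNIV)" for s0
 proof (rule leibniz_rule_vector_derivative)
  show "((%s. P s t) has_vector_derivative deriv (%s. P s t) s) (at s within UNIV)" for s t
   using smooth_real_DERIV[OF smooth2_slices(2)[OF P(1)]] by (simp add: has_real_derivative_iff_has_vector_derivative)
  show "P s integrable_on cbox 0 1" for s unfolding box_real
   by (intro integrable_continuous_real smooth_real_continuous_on smooth2_slices(1)[OF P(1)])
  show "continuous_on (UNIV \<times> cbox 0 1) (%(s, t). deriv (%s. P s t) s)"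
   by (rule smooth2_continuous[OF smooth2_partial1[OF P(1)]])
 qed auto
 then have "(f has_real_derivative integral {0..1} (%t. deriv (%s. P s t) s0)) (at s0)" for s0
  by (simp add: P(2) has_real_derivative_iff_has_vector_derivative)
 then show "EX f'. (EX P. smooth2 P & f' = (%s. integral {0..1} (P s))) & (ALL x. (f has_real_derivative f' x) (at x))"
  by (intro exI[of _ "%s0. integral {0..1} (%t. deriv (%s. P s t) s0)"] conjI allI
    exI[of _ "%s t. deriv (%s. P s t) s"] smooth2_partial1[OF P(1)] refl)
qed (rule exI[of _ P], simp add: assms)

definition hadq :: "(real => real) => real => real" where
 "hadq h t = (if t = 0 then deriv h 0 else (h t - h 0) / t)"

lemma hadq_eq: "h t = h 0 + t * hadq h t" by (simp add: hadq_def)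

lemma hadq_integral:
 assumes h: "smooth_real h" shows "hadq h t = integral {0..1} (%\<tau>. deriv h (\<tau> * t))"
proof (cases "t = 0")
 case False
 have "((%\<tau>. deriv h (\<tau> * t)) has_integral (h (1 * t) / t - h (0 * t) / t)) {0..1}"
 proof (rule fundamental_theorem_of_calculus)
  fix \<tau> :: real
  have "((%\<tau>. h (\<tau> * t) / t) has_real_derivative deriv h (\<tau> * t) * t / t) (at \<tau> within {0..1})"
   by (intro DERIV_cdivide DERIV_chain2[where f = h] smooth_real_DERIV[OF h]) (auto intro!: derivative_eq_intros)
  then show "((%\<tau>. h (\<tau> * t) / t) has_vector_derivative deriv h (\<tau> * t)) (at \<tau> within {0..1})"
   using False by (simp add: has_real_derivative_iff_has_vector_derivative)
 qed simp
 then show ?thesis using False by (simp add: hadq_def integral_unique diff_divide_distrib)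
qed (simp add: hadq_def)

text \<open>The difference quotient at \<open>0\<close> is the integral of the derivative over the segment from \<open>0\<close>.\<close>

lemma smooth2_hadq:
 assumes F: "smooth2 F" shows "smooth2 (%s t. hadq (F s) t)" unfolding smooth2_def
proof (intro allI impI)
 fix a b assume ab: "smooth_real a & smooth_real b"
 have "smooth2 (%u \<tau>. deriv (F (a u)) (\<tau> * b u))" unfolding smooth2_def
 proof (intro allI impI)
  fix \<alpha> \<beta> assume *: "smooth_real \<alpha> & smooth_real \<beta>"
  have "smooth_real (%v. a (\<alpha> v))" "smooth_real (%v. \<beta> v * b (\<alpha> v))"
   using ab * by (simp_all add: smooth_real_mult smooth_real_compose)
  from smooth2D[OF smooth2_partial2[OF F] this]
  show "smooth_real (%v. deriv (F (a (\<alpha> v))) (\<beta> v * b (\<alpha> v)))" .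
 qed
 from smooth_real_integral[OF this] show "smooth_real (%u. hadq (F (a u)) (b u))"
  by (simp add: hadq_integral[OF smooth2_slices(1)[OF F]])
qed

lemma smooth_real_hadq: "smooth_real h ==> smooth_real (hadq h)"
 by (rule smooth2_slices(1)[OF smooth2_hadq[of "%_. h"]]) (simp add: smooth2_def smooth_real_compose)

lemma eq_at_0_if_eq_off_0:
 fixes f g :: "real => real"
 assumes "smooth_real f" "smooth_real g" "!!t. t ~= 0 ==> f t = g t"
 shows "f t = g t"
proof (cases "t = 0")
 case True
 have "f \<midarrow>0\<rightarrow> f 0" "g \<midarrow>0\<rightarrow> g 0" using smooth_real_isCont[of f 0] smooth_real_isCont[of g 0] assms by (auto simp: isCont_def)
 moreover have "\<forall>\<^sub>F t in at 0. g t = f t" using assms(3) by (auto simp: eventually_at_filter)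
 ultimately have "f \<midarrow>0\<rightarrow> g 0" using Lim_transform_eventually by blast
 then show ?thesis using True LIM_unique[OF \<open>f \<midarrow>0\<rightarrow> f 0\<close>] by simp
qed (use assms in auto)

section \<open>Smooth linear functionals of smooth functions\<close>

definition smooth_functional :: "((real => real) => real) => bool" where
 "smooth_functional \<mu> \<longleftrightarrow>
   (ALL f g. smooth_real f & smooth_real g --> \<mu> (%s. f s + g s) = \<mu> f + \<mu> g) &
   (ALL c f. smooth_real f --> \<mu> (%s. c * f s) = c * \<mu> f) &
   (ALL F. smooth2 F --> smooth_real (%t. \<mu> (%s. F s t)))"

lemma smooth_functionalD:
 assumes "smooth_functional \<mu>"
 shows "smooth_real f ==> smooth_real g ==> \<mu> (%s. f s + g s) = \<mu> f + \<mu> g"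
  and "smooth_real f ==> \<mu> (%s. c * f s) = c * \<mu> f"
  and "smooth2 F ==> smooth_real (%t. \<mu> (%s. F s t))"
proof -
 show "smooth_real f ==> smooth_real g ==> \<mu> (%s. f s + g s) = \<mu> f + \<mu> g"
  using assms[unfolded smooth_functional_def, THEN conjunct1] by simp
 show "smooth_real f ==> \<mu> (%s. c * f s) = c * \<mu> f"
  using assms[unfolded smooth_functional_def, THEN conjunct2, THEN conjunct1] by simp
 show "smooth2 F ==> smooth_real (%t. \<mu> (%s. F s t))"
  using assms[unfolded smooth_functional_def, THEN conjunct2, THEN conjunct2] by simp
qed

lemma smooth_functional_sum:
 assumes "smooth_functional \<mu>" "!!i. i \<in> A ==> smooth_real (f i)" "finite A"
 shows "\<mu> (%s. \<Sum>i\<in>A. f i s) = (\<Sum>i\<in>A. \<mu> (f i))" using assms(3,2)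
proof (induction A rule: finite_induct)
 case empty
 show ?case using smooth_functionalD(2)[OF assms(1), of "%_. 0" 0] by simp
next
 case (insert i A)
 then show ?case by (simp add: smooth_functionalD(1)[OF assms(1)] smooth_real_sum)
qed

lemma smooth_functional_hadq:
 assumes \<mu>: "smooth_functional \<mu>" and F: "smooth2 F"
 shows "hadq (%t. \<mu> (%s. F s t)) t = \<mu> (%s. hadq (F s) t)"
proof (rule eq_at_0_if_eq_off_0[where f = "hadq (%t. \<mu> (%s. F s t))"])
 show "smooth_real (hadq (%t. \<mu> (%s. F s t)))" by (intro smooth_real_hadq smooth_functionalD(3)[OF \<mu>] F)
 show "smooth_real (%t. \<mu> (%s. hadq (F s) t))" by (rule smooth_functionalD(3)[OF \<mu> smooth2_hadq[OF F]])
 fix t :: real assume t: "t ~= 0"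
 have sm: "smooth_real (%s. F s t)" "smooth_real (%s. -1 * F s 0)"
  by (intro smooth_real_cmult smooth2_slices(2)[OF F])+
 have "\<mu> (%s. hadq (F s) t) = \<mu> (%s. (1/t) * (F s t + -1 * F s 0))" using t by (simp add: hadq_def)
 also have "\<dots> = (1/t) * (\<mu> (%s. F s t) + -1 * \<mu> (%s. F s 0))"
  using smooth_functionalD(2)[OF \<mu> smooth_real_add[OF sm], of "1/t"] smooth_functionalD(1)[OF \<mu> sm]
   smooth_functionalD(2)[OF \<mu> smooth2_slices(2)[OF F], of "-1" 0] by simp
 finally show "hadq (%t. \<mu> (%s. F s t)) t = \<mu> (%s. hadq (F s) t)" using t by (simp add: hadq_def)
qed

lemma summable_weighted:
 fixes a b :: "nat => real"
 assumes "!!n. \<bar>a n\<bar> \<le> (1/3) ^ n" "!!n. \<bar>b n\<bar> \<le> C"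
 shows "summable (%n. a n * b n)"
proof (rule summable_comparison_test'[of "%n. (1/3) ^ n * C" 0])
 show "summable (%n. (1/3) ^ n * C)" by (intro summable_mult2 summable_geometric) simp
 show "norm (a n * b n) \<le> (1/3) ^ n * C" for n
  unfolding real_norm_def abs_mult by (intro mult_mono assms) simp_all
qed

lemma smooth_functional_jets:
 assumes a: "!!n. \<bar>a n\<bar> \<le> (1/3) ^ n" and \<sigma>: "!!n::nat. \<bar>\<sigma> n\<bar> \<le> R"
 shows "smooth_functional (%h. \<Sum>n. a n * (deriv ^^ k) h (\<sigma> n))" unfolding smooth_functional_def
proof (intro conjI allI impI)
 have summ: "summable (%n. a n * (deriv ^^ k) f (\<sigma> n))" if f: "smooth_real f" for f
 proof -
  obtain C where C: "ALL x. \<bar>x\<bar> \<le> R --> \<bar>(deriv ^^ k) f x\<bar> \<le> C"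
   using smooth_real_bounded[OF smooth_real_derivs[OF f]] ..
  show ?thesis by (rule summable_weighted[where C = C]) (simp_all add: C \<sigma> a)
 qed
 show "(\<Sum>n. a n * (deriv ^^ k) (%s. f s + g s) (\<sigma> n)) =
   (\<Sum>n. a n * (deriv ^^ k) f (\<sigma> n)) + (\<Sum>n. a n * (deriv ^^ k) g (\<sigma> n))"
  if "smooth_real f & smooth_real g" for f g
  using suminf_add[OF summ summ, of f g] that by (simp only: derivs_add distrib_left)
 show "(\<Sum>n. a n * (deriv ^^ k) (%s. c * f s) (\<sigma> n)) = c * (\<Sum>n. a n * (deriv ^^ k) f (\<sigma> n))"
  if "smooth_real f" for c f
  using suminf_mult[OF summ[OF that], of c] that by (simp only: derivs_cmult mult.left_commute)
 fix F assume "smooth2 F"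
 then have W: "smooth2 (%t s. (deriv ^^ k) (%s. F s t) s)" by (rule smooth2_partials2[OF smooth2_swap])
 show "smooth_real (%t. \<Sum>n. a n * (deriv ^^ k) (%s. F s t) (\<sigma> n))"
 proof (rule smooth_real_series)
  show "smooth_real (%t. a n * (deriv ^^ k) (%s. F s t) (\<sigma> n))" for n
   by (intro smooth_real_cmult smooth2_slices(2)[OF W])
  fix j R'
  obtain C where C0: "ALL t s. \<bar>t\<bar> \<le> max R R' --> \<bar>s\<bar> \<le> max R R' -->
    \<bar>(deriv ^^ j) (%t. (deriv ^^ k) (%s. F s t) s) t\<bar> \<le> C" using smooth2_derivs_bounded[OF W] ..
  note C = C0[rule_format]
  show "EX M. summable M & (ALL n x. \<bar>x\<bar> < R' --> \<bar>(deriv ^^ j) (%t. a n * (deriv ^^ k) (%s. F s t) (\<sigma> n)) x\<bar> \<le> M n)"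
  proof (intro exI[of _ "%n. (1/3) ^ n * C"] conjI allI impI)
   show "summable (%n. (1/3) ^ n * C)" by (intro summable_mult2 summable_geometric) simp
   fix n x assume x: "\<bar>x\<bar> < R'"
   have s: "\<bar>\<sigma> n\<bar> \<le> max R R'" using \<sigma>[of n] by simp
   have "\<bar>a n * (deriv ^^ j) (%t. (deriv ^^ k) (%s. F s t) (\<sigma> n)) x\<bar> \<le> (1/3) ^ n * C"
    unfolding abs_mult
   proof (rule mult_mono[OF a])
    show "\<bar>(deriv ^^ j) (%t. (deriv ^^ k) (%s. F s t) (\<sigma> n)) x\<bar> \<le> C" using x by (intro C s) simp
   qed simp_all
   then show "\<bar>(deriv ^^ j) (%t. a n * (deriv ^^ k) (%s. F s t) (\<sigma> n)) x\<bar> \<le> (1/3) ^ n * C"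
    by (simp add: derivs_cmult smooth2_slices(2)[OF W])
  qed
 qed
qed

lemma smooth_functional_eval: "smooth_functional (%h. h s)"
 unfolding smooth_functional_def by (simp add: smooth2_slices)

definition fdiff :: "real => (real => real) => real => real" where
 "fdiff h g = (%t. g (t + h) - g t)"

lemma fdiff_smooth:
 "(!!t. smooth_real (G t)) ==> smooth_real (%s. (fdiff h ^^ k) (%t. G t s) t)"
proof (induction k arbitrary: G)
 case (Suc k)
 have "smooth_real (%s. (fdiff h ^^ k) (%t. G (t + h) s - G t s) t)"
  by (rule Suc.IH) (intro smooth_real_diff Suc.prems)
 then show ?case unfolding funpow_Suc_right o_def by (simp add: fdiff_def)
qed simp

lemma fdiff_cmult: "(fdiff h ^^ k) (%t. c * g t) = (%t. c * (fdiff h ^^ k) g t)"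
 by (induction k) (auto simp: fdiff_def right_diff_distrib)

lemma fdiff_series:
 assumes "!!t. summable (%n. f n t)"
 shows "summable (%n. (fdiff h ^^ k) (f n) t)"
  "(fdiff h ^^ k) (%t. \<Sum>n. f n t) t = (\<Sum>n. (fdiff h ^^ k) (f n) t)"
proof (induction k arbitrary: t)
 case (Suc k)
 case 1 show ?case using Suc.IH(1) by (simp add: fdiff_def summable_diff)
 case 2 show ?case using Suc.IH by (simp add: fdiff_def suminf_diff)
qed (use assms in auto)

lemma fdiff_mean_value:
 assumes "smooth_real g" "0 < h"
 shows "EX xi. t \<le> xi & xi \<le> t + real k * h & (fdiff h ^^ k) g t = h ^ k * (deriv ^^ k) g xi" using assms(1)
proof (induction k arbitrary: g)
 case 0
 then show ?case by (intro exI[of _ t]) auto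
next
 case (Suc k)
 have g: "smooth_real (%t. g (t + h))" by (rule smooth_real_compose[OF Suc.prems]) (intro smooth_real_intros)
 then have "smooth_real (fdiff h g)" unfolding fdiff_def by (intro smooth_real_diff Suc.prems)
 from Suc.IH[OF this] obtain xi where xi: "t \<le> xi" "xi \<le> t + real k * h"
   "(fdiff h ^^ k) (fdiff h g) t = h ^ k * (deriv ^^ k) (fdiff h g) xi" by blast
 have "(deriv ^^ k) (fdiff h g) xi = (deriv ^^ k) g (xi + h) - (deriv ^^ k) g xi"
  unfolding fdiff_def using derivs_diff[OF g Suc.prems, of k] derivs_affine[OF Suc.prems, of k 1 h] by simp
 moreover have "EX z. xi < z & z < xi + h & (deriv ^^ k) g (xi + h) - (deriv ^^ k) g xi = (xi + h - xi) * (deriv ^^ Suc k) g z"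
  using assms(2) by (intro MVT2 smooth_real_DERIV_derivs Suc.prems) auto
 ultimately obtain z where "xi < z" "z < xi + h" "(deriv ^^ k) (fdiff h g) xi = h * (deriv ^^ Suc k) g z" by auto
 with xi show ?case
  by (intro exI[of _ z]) (auto simp: funpow_Suc_right[of k "fdiff h"] algebra_simps simp del: funpow.simps)
qed

text \<open>A family of smooth functions is jointly smooth as soon as every smooth linear functional of
  its members depends smoothly on the parameter. The functionals \<open>\<Sum>a\<^sub>n h\<^sup>(\<^sup>k\<^sup>)(\<sigma>\<^sub>n)\<close> with rapidly
  decreasing \<open>a\<close> suffice: by uniform boundedness they bound all pure derivatives.\<close>

theorem smooth2_if_smooth_functionals:
 assumes sl: "!!t. smooth_real (G t)"
  and fn: "!!\<mu>. smooth_functional \<mu> ==> smooth_real (%t. \<mu> (G t))"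
 shows "smooth2 G"
proof (rule sep_bounded_imp_smooth2, rule sep_boundedI)
 show sl2: "smooth_real (%t. G t s)" for s by (rule fn[OF smooth_functional_eval])
 fix k R
 define S :: "real set" where "S = {t. \<bar>t\<bar> \<le> R}"
 have "EX C. \<forall>t\<in>S. \<forall>s\<in>S. \<bar>(deriv ^^ k) (G t) s\<bar> \<le> C"
 proof (rule uniform_boundedness_series)
  fix t
  show "EX C. \<forall>s\<in>S. \<bar>(deriv ^^ k) (G t) s\<bar> \<le> C"
   using smooth_real_bounded[OF smooth_real_derivs[OF sl], of R k t] by (simp add: S_def)
 next
  fix \<sigma> and a :: "nat => real" assume \<sigma>: "!!n::nat. \<sigma> n \<in> S" and a: "!!n. \<bar>a n\<bar> \<le> (1/3) ^ n"
  have "smooth_real (%t. \<Sum>n. a n * (deriv ^^ k) (G t) (\<sigma> n))"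
   by (rule fn[OF smooth_functional_jets[OF a, of \<sigma> R]]) (use \<sigma> in \<open>simp add: S_def\<close>)
  from smooth_real_bounded[OF this, of R]
  show "EX C. \<forall>t\<in>S. \<bar>\<Sum>n. a n * (deriv ^^ k) (G t) (\<sigma> n)\<bar> \<le> C"
   by (simp add: S_def)
 qed
 then show "EX C. ALL t s. \<bar>t\<bar> \<le> R --> \<bar>s\<bar> \<le> R --> \<bar>(deriv ^^ k) (G t) s\<bar> \<le> C"
  by (simp add: S_def)
 define b where "b = (%(t, h) s. (fdiff h ^^ k) (%t. G t s) t / h ^ k)"
 have "EX C. \<forall>i\<in>S \<times> {0<..1}. \<forall>s\<in>S. \<bar>b i s\<bar> \<le> C"
 proof (rule uniform_boundedness_series)
  fix i :: "real \<times> real"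
  obtain t h where i: "i = (t, h)" by (cases i)
  have "smooth_real (%s. 1 / h ^ k * (fdiff h ^^ k) (%t. G t s) t)" by (intro smooth_real_cmult fdiff_smooth sl)
  from smooth_real_bounded[OF this, of R]
  show "EX C. \<forall>s\<in>S. \<bar>b i s\<bar> \<le> C" by (simp add: b_def i S_def)
 next
  fix \<sigma> and a :: "nat => real" assume \<sigma>: "!!n::nat. \<sigma> n \<in> S" and a: "!!n. \<bar>a n\<bar> \<le> (1/3) ^ n"
  have \<sigma>R: "\<bar>\<sigma> n\<bar> \<le> R" for n using \<sigma>[of n] by (auto simp: S_def)
  define g where "g t = (\<Sum>n. a n * G t (\<sigma> n))" for t
  have g: "smooth_real g" using fn[OF smooth_functional_jets[OF a \<sigma>R, of 0]] by (simp add: g_def[abs_def])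
  obtain C where C: "!!t. \<bar>t\<bar> \<le> R + real k ==> \<bar>(deriv ^^ k) g t\<bar> \<le> C"
   using smooth_real_bounded[OF smooth_real_derivs[OF g], of "R + real k" k] by auto
  have summ: "summable (%n. a n * G t (\<sigma> n))" for t
  proof -
   obtain D where D: "ALL s. \<bar>s\<bar> \<le> R --> \<bar>G t s\<bar> \<le> D" using smooth_real_bounded[OF sl] ..
   show ?thesis by (rule summable_weighted[where C = D]) (simp_all add: D \<sigma>R a)
  qed
  have "\<bar>\<Sum>n. a n * b (t, h) (\<sigma> n)\<bar> \<le> C" if t: "t \<in> S" and h: "0 < h" "h \<le> 1" for t h
  proof -
   obtain xi where xi: "t \<le> xi" "xi \<le> t + real k * h" "(fdiff h ^^ k) g t = h ^ k * (deriv ^^ k) g xi"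
    using fdiff_mean_value[OF g h(1), of t k] by auto
   have "real k * h \<le> real k" using h by (simp add: mult_left_le)
   then have "\<bar>(deriv ^^ k) g xi\<bar> \<le> C" using xi(1,2) t by (intro C) (auto simp: S_def abs_le_iff)
   moreover have "(\<Sum>n. a n * b (t, h) (\<sigma> n)) = (\<Sum>n. (fdiff h ^^ k) (%t. a n * G t (\<sigma> n)) t / h ^ k)"
    by (simp add: b_def fdiff_cmult)
   moreover have "\<dots> = (fdiff h ^^ k) g t / h ^ k"
    unfolding g_def[abs_def] by (simp add: fdiff_series[OF summ] suminf_divide)
   ultimately show ?thesis using xi(3) h by simp
  qed
  then show "EX C. \<forall>i\<in>S \<times> {0<..1}. \<bar>\<Sum>n. a n * b i (\<sigma> n)\<bar> \<le> C" by (intro exI[of _ C]) auto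
 qed
 then obtain C where C: "\<forall>i\<in>S \<times> {0<..1}. \<forall>s\<in>S. \<bar>b i s\<bar> \<le> C" ..
 have "\<bar>(deriv ^^ k) (%t. G t s) t\<bar> \<le> C" if "\<bar>t\<bar> \<le> R" "\<bar>s\<bar> \<le> R" for t s
 proof -
  define h where "h n = 1 / real (Suc n)" for n
  have h: "0 < h n" "h n \<le> 1" for n by (auto simp: h_def)
  have "ALL n. EX xi. t \<le> xi & xi \<le> t + real k * h n & (fdiff (h n) ^^ k) (%t. G t s) t = h n ^ k * (deriv ^^ k) (%t. G t s) xi"
   by (intro allI fdiff_mean_value[OF sl2 h(1)])
  from choice[OF this] obtain xi where "ALL n. t \<le> xi n & xi n \<le> t + real k * h n &
   (fdiff (h n) ^^ k) (%t. G t s) t = h n ^ k * (deriv ^^ k) (%t. G t s) (xi n)" ..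
  then have xi: "t \<le> xi n" "xi n \<le> t + real k * h n"
   "(fdiff (h n) ^^ k) (%t. G t s) t = h n ^ k * (deriv ^^ k) (%t. G t s) (xi n)" for n by auto
  have "(%n. t + real k * h n) \<longlonglongrightarrow> t + real k * 0"
   unfolding h_def by (intro tendsto_intros LIMSEQ_Suc[OF lim_1_over_n])
  then have "xi \<longlonglongrightarrow> t"
   by (intro tendsto_sandwich[of "%_. t" xi sequentially "%n. t + real k * h n" t]) (auto simp: xi)
  then have "(%n. \<bar>(deriv ^^ k) (%t. G t s) (xi n)\<bar>) \<longlonglongrightarrow> \<bar>(deriv ^^ k) (%t. G t s) t\<bar>"
   by (intro tendsto_rabs isCont_tendsto_compose[where g = "(deriv ^^ k) (%t. G t s)"]
     smooth_real_isCont smooth_real_derivs sl2)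
  moreover have "\<bar>(deriv ^^ k) (%t. G t s) (xi n)\<bar> \<le> C" for n
  proof -
   have "\<bar>b (t, h n) s\<bar> \<le> C" using C that h by (simp add: S_def)
   moreover have "b (t, h n) s = (deriv ^^ k) (%t. G t s) (xi n)" using xi(3)[of n] h(1)[of n] by (simp add: b_def)
   ultimately show ?thesis by simp
  qed
  ultimately show ?thesis by (intro LIMSEQ_le_const2) auto
 qed
 then show "EX C. ALL t s. \<bar>t\<bar> \<le> R --> \<bar>s\<bar> \<le> R --> \<bar>(deriv ^^ k) (%t. G t s) t\<bar> \<le> C" by blast
qed (rule sl)

section \<open>Smooth functions modulo ideals\<close>

lemma csmooth_cong: "(!!x. x \<in> Rn n ==> f x = g x) ==> csmooth n f \<longleftrightarrow> csmooth n g"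
 by (simp add: csmooth_def curve_Rn_def cong: conj_cong)

lemma csmooth_restrict [simp]: "csmooth n (restrict f (Rn n)) \<longleftrightarrow> csmooth n f"
 by (rule csmooth_cong) simp

lemma csmooth_const [simp]: "csmooth n (%x. c)" by (simp add: csmooth_def)

lemma csmooth_coord [simp]: "csmooth n (%x. x i)"
proof (cases "i < n")
 case False
 then have "csmooth n (%x. x i) \<longleftrightarrow> csmooth n (%x. 0)" by (intro csmooth_cong) (simp add: Rn_def)
 then show ?thesis by simp
qed (simp add: csmooth_def curve_Rn_def)

lemma csmooth_add: "csmooth n f ==> csmooth n g ==> csmooth n (%x. f x + g x)"
 by (simp add: csmooth_def smooth_real_add)

lemma csmooth_mult: "csmooth n f ==> csmooth n g ==> csmooth n (%x. f x * g x)"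
 by (simp add: csmooth_def smooth_real_mult)

lemma csmooth_scale: "csmooth n f ==> csmooth n (%x. c * f x)" by (simp add: csmooth_def smooth_real_cmult)

lemma csmooth_uminus: "csmooth n f ==> csmooth n (%x. - f x)" by (simp add: csmooth_def smooth_real_uminus)

lemma csmooth_diff: "csmooth n f ==> csmooth n g ==> csmooth n (%x. f x - g x)"
 by (simp add: csmooth_def smooth_real_diff)

lemma csmooth_sum: "(!!i. i \<in> A ==> csmooth n (f i)) ==> csmooth n (%x. \<Sum>i\<in>A. f i x)"
 by (simp add: csmooth_def smooth_real_sum)

lemma csmooth_power: "csmooth n f ==> csmooth n (%x. f x ^ k)" by (simp add: csmooth_def smooth_real_power)

lemma zero_in_Rn [simp]: "(%_. 0) \<in> Rn n" by (simp add: Rn_def)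

definition smooth_family :: "nat => (real => point => real) => bool" where
 "smooth_family n H \<longleftrightarrow> (ALL a c. smooth_real a --> curve_Rn n c --> smooth_real (%u. H (a u) (c u)))"

lemma smooth_familyD: "smooth_family n H ==> smooth_real a ==> curve_Rn n c ==> smooth_real (%u. H (a u) (c u))"
 by (simp add: smooth_family_def)

lemma smooth_family_const: "smooth_family n (%s. f) \<longleftrightarrow> csmooth n f"
 by (auto simp: smooth_family_def csmooth_def intro: smooth_real_const)

lemma curve_Rn_const: "x \<in> Rn n ==> curve_Rn n (%_. x)" by (simp add: curve_Rn_def)

lemma curve_Rn_reparam: "curve_Rn n c ==> smooth_real b ==> curve_Rn n (%u. c (b u))"
 unfolding curve_Rn_def using smooth_real_compose[of "%u. c u i" b for i] by simp

lemma smooth_family_slice: "smooth_family n H ==> csmooth n (H s)"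
 using smooth_familyD[of n H "%_. s"] by (simp add: csmooth_def)

lemma smooth_family_point: "smooth_family n H ==> x \<in> Rn n ==> smooth_real (%s. H s x)"
 using smooth_familyD[of n H "%s. s" "%_. x"] curve_Rn_const by simp

lemma smooth_family_curve2: "smooth_family n H ==> curve_Rn n c ==> smooth2 (%s u. H s (c u))"
 by (simp add: smooth2_def smooth_family_def curve_Rn_reparam)

text \<open>Hadamard's lemma: \<open>coordq j g\<close> is the factor of the \<open>j\<close>-th coordinate when the coordinates are
  moved to \<open>0\<close> one after the other.\<close>

definition zero_below :: "nat => point => point" where
 "zero_below j x = (%i. if i < j then 0 else x i)"

definition coordq :: "nat => (point => real) => point => real" where
 "coordq j g x = hadq (%t. g ((zero_below j x)(j := t))) (x j)"

lemma curve_Rn_zero_below: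
 assumes "curve_Rn n c" shows "curve_Rn n (%u. zero_below j (c u))"
proof -
 have "smooth_real (%u. if i < j then 0 else c u i)" if "i < n" for i
  using assms that by (cases "i < j") (simp_all add: curve_Rn_def)
 then show ?thesis using assms by (simp add: curve_Rn_def Rn_def zero_below_def)
qed

lemma curve_Rn_upd:
 assumes "curve_Rn n c" "j < n" "smooth_real b" shows "curve_Rn n (%u. (c u)(j := b u))"
proof -
 have "smooth_real (%u. ((c u)(j := b u)) i)" if "i < n" for i
  using assms that by (cases "i = j") (simp_all add: curve_Rn_def)
 then show ?thesis using assms by (simp add: curve_Rn_def Rn_upd del: fun_upd_apply)
qed

lemma smooth_family_coordq_aux:
 assumes H: "smooth_family n H" and j: "j < n" and a: "smooth_real a" and c: "curve_Rn n c"
 shows "smooth2 (%u t. H (a u) ((zero_below j (c u))(j := t)))" unfolding smooth2_def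
proof (intro allI impI)
 fix \<alpha> \<beta> assume ab: "smooth_real \<alpha> & smooth_real \<beta>"
 have 1: "smooth_real (%u. a (\<alpha> u))" using smooth_real_compose[OF a] ab by blast
 have "curve_Rn n (%u. zero_below j (c (\<alpha> u)))"
  using curve_Rn_zero_below[OF curve_Rn_reparam[OF c]] ab by blast
 from curve_Rn_upd[OF this j] ab have 2: "curve_Rn n (%u. (zero_below j (c (\<alpha> u)))(j := \<beta> u))" by blast
 show "smooth_real (%u. H (a (\<alpha> u)) ((zero_below j (c (\<alpha> u)))(j := \<beta> u)))"
  by (rule smooth_familyD[OF H 1 2])
qed

lemma smooth_family_coordq:
 assumes H: "smooth_family n H" and j: "j < n"
 shows "smooth_family n (%s. coordq j (H s))" unfolding smooth_family_def
proof (intro allI impI)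
 fix a c assume a: "smooth_real a" and c: "curve_Rn n c"
 have "smooth_real (%u. c u j)" using c j by (simp add: curve_Rn_def)
 from smooth2D[OF smooth2_hadq[OF smooth_family_coordq_aux[OF H j a c]] smooth_real_id this]
 show "smooth_real (%u. coordq j (H (a u)) (c u))" by (simp add: coordq_def)
qed

lemma csmooth_coordq: "csmooth n g ==> j < n ==> csmooth n (coordq j g)"
 using smooth_family_coordq[of n "%_. g" j] by (simp add: smooth_family_const)

lemma hadamard:
 assumes "x \<in> Rn n"
 shows "g x = g (%_. 0) + (\<Sum>j<n. x j * coordq j g x)"
proof -
 have "g x = g (zero_below m x) + (\<Sum>j<m. x j * coordq j g x)" for m
 proof (induction m)
  case 0
  have "zero_below 0 x = x" by (simp add: zero_below_def)
  then show ?case by simp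
 next
  case (Suc m)
  have "(zero_below m x)(m := x m) = zero_below m x" "(zero_below m x)(m := 0) = zero_below (Suc m) x"
   by (auto simp: zero_below_def fun_eq_iff)
  then have "g (zero_below m x) = g (zero_below (Suc m) x) + x m * coordq m g x"
   using hadq_eq[of "%t. g ((zero_below m x)(m := t))" "x m"] by (simp add: coordq_def)
  then show ?case using Suc by simp
 qed
 from this[of n] have "g x = g (zero_below n x) + (\<Sum>j<n. x j * coordq j g x)" .
 moreover have "zero_below n x = (%_. 0)" using assms by (auto simp: zero_below_def Rn_def)
 ultimately show ?thesis by simp
qed

definition monomial :: "nat list => point => real" where
 "monomial w x = (\<Prod>i\<leftarrow>w. x i)"

lemma monomial_simps [simp]: "monomial [] = (%x. 1)" "monomial (i # w) = (%x. x i * monomial w x)"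
 by (auto simp: monomial_def)

lemma monomial_append: "monomial (v @ w) x = monomial v x * monomial w x" by (simp add: monomial_def)

lemma csmooth_monomial [simp]: "csmooth n (monomial w)" by (induction w) (auto intro: csmooth_mult)

locale function_space =
 fixes n :: nat and P :: "(point => real) => bool"
 assumes smooth: "P f ==> csmooth n f"
  and cong: "P f ==> (!!x. x \<in> Rn n ==> f x = g x) ==> P g"
  and zero: "P (%_. 0)"
  and add: "P f ==> P g ==> P (%x. f x + g x)"
  and scale: "P f ==> P (%x. c * f x)"
begin

lemma diff: "P f ==> P g ==> P (%x. f x - g x)" using add[of f "%x. -1 * g x"] scale[of g "-1"] by simp

lemma sum: "(!!i. i \<in> A ==> P (f i)) ==> P (%x. \<Sum>i\<in>A. f i x)"
 by (induction A rule: infinite_finite_induct) (auto intro: zero add)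

lemma scaleD: "P (%x. c * f x) ==> c ~= 0 ==> P f" using scale[of "%x. c * f x" "1 / c"] by simp

end

locale function_ideal =
 fixes n :: nat and P :: "(point => real) => bool"
 assumes smooth: "P f ==> csmooth n f"
  and cong: "P f ==> (!!x. x \<in> Rn n ==> f x = g x) ==> P g"
  and zero: "P (%_. 0)"
  and add: "P f ==> P g ==> P (%x. f x + g x)"
  and mult: "csmooth n h ==> P f ==> P (%x. h x * f x)"
begin

sublocale function_space n P
proof
 show "P f ==> csmooth n f" for f by (rule smooth)
 show "P f ==> (!!x. x \<in> Rn n ==> f x = g x) ==> P g" for f g by (rule cong)
 show "P (%_. 0)" by (rule zero)
 show "P f ==> P g ==> P (%x. f x + g x)" for f g by (rule add)
 show "P f ==> P (%x. c * f x)" for f c by (rule mult[OF csmooth_const])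
qed

lemma mult_right: "csmooth n h ==> P f ==> P (%x. f x * h x)" using mult[of h f] by (simp add: mult.commute)

lemma hadamard_mult:
 assumes f: "csmooth n f" and 0: "f (%_. 0) = 0"
  and j: "!!j. j < n ==> P (%x. (x j * coordq j f x) * g x)"
 shows "P (%x. f x * g x)"
proof (rule cong[OF sum])
 fix j assume "j \<in> {..<n}"
 then show "P (%x. (x j * coordq j f x) * g x)" using j by simp
next
 fix x assume "x \<in> Rn n"
 then show "(\<Sum>j<n. (x j * coordq j f x) * g x) = f x * g x"
  using hadamard[of x n f] 0 by (simp add: sum_distrib_right)
qed

text \<open>Hadamard's lemma turns every factor into a combination of coordinates; \<open>k\<close> factors give monomials
  of degree \<open>k\<close>.\<close>

lemma nilpotent:
 assumes mon: "!!w. length w = k ==> set w \<subseteq> {..<n} ==> P (monomial w)"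
  and f: "csmooth n f" "f (%_. 0) = 0"
 shows "P (%x. f x ^ k)"
proof -
 have "P (%x. f x ^ j * (monomial w x * g x))"
  if "length w + j = k" "set w \<subseteq> {..<n}" "csmooth n g" for j w g using that
 proof (induction j arbitrary: w g)
  case 0
  then show ?case using mult_right[OF 0(3) mon[of w]] by simp
 next
  case (Suc j)
  have "P (%x. f x * (f x ^ j * (monomial w x * g x)))"
  proof (rule hadamard_mult[OF f])
   fix i assume i: "i < n"
   have "P (%x. f x ^ j * (monomial (i # w) x * (coordq i f x * g x)))"
    using Suc.prems i by (intro Suc.IH csmooth_mult csmooth_coordq f) auto
   then show "P (%x. (x i * coordq i f x) * (f x ^ j * (monomial w x * g x)))" by (simp add: mult_ac)
  qed
  then show ?case by (simp add: mult_ac)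
 qed
 from this[of "[]" k "%_. 1"] show ?thesis by simp
qed

end

text \<open>Modulo high powers of the coordinates, smooth functions are polynomials.\<close>

lemma polynomial_induct:
 assumes g: "csmooth n g"
  and cong: "!!f g. Q f ==> (!!x. x \<in> Rn n ==> f x = g x) ==> Q g"
  and const: "!!c. Q (%_. c)" and coord: "!!i. i < n ==> Q (%x. x i)"
  and add: "!!f g. csmooth n f ==> csmooth n g ==> Q f ==> Q g ==> Q (%x. f x + g x)"
  and mult: "!!f g. csmooth n f ==> csmooth n g ==> Q f ==> Q g ==> Q (%x. f x * g x)"
  and high: "!!w g. length w = k ==> set w \<subseteq> {..<n} ==> csmooth n g ==> Q (%x. monomial w x * g x)"
 shows "Q g"
proof -
 have mon: "Q (monomial w)" if "set w \<subseteq> {..<n}" for w using that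
 proof (induction w)
  case Nil
  then show ?case by (simp add: const)
 next
  case (Cons i w)
  then show ?case using mult[of "%x. x i" "monomial w"] coord[of i] by simp
 qed
 have sum: "csmooth n (%x. \<Sum>j<m. f j x) & Q (%x. \<Sum>j<m. f j x)"
  if "!!j. j < m ==> csmooth n (f j) & Q (f j)" for f and m :: nat
  using that by (induction m) (auto intro: const csmooth_add add)
 have "Q (%x. monomial w x * g x)" if "length w + j = k" "set w \<subseteq> {..<n}" "csmooth n g" for j w g using that
 proof (induction j arbitrary: w g)
  case 0
  then show ?case using high by simp
 next
  case (Suc j)
  have *: "csmooth n (%x. monomial (i # w) x * coordq i g x) & Q (%x. monomial (i # w) x * coordq i g x)"
   if "i < n" for i using Suc.prems that by (intro conjI Suc.IH csmooth_mult csmooth_monomial csmooth_coordq) auto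
  have 1: "Q (%x. monomial w x * g (%_. 0))"
   using mult[OF csmooth_monomial csmooth_const mon[OF Suc.prems(2)] const] by simp
  have 2: "csmooth n (%x. monomial w x * g (%_. 0))" by (intro csmooth_mult csmooth_monomial csmooth_const)
  note 3 = sum[of n "%i x. monomial (i # w) x * coordq i g x", OF *]
  have "Q (%x. monomial w x * g (%_. 0) + (\<Sum>i<n. monomial (i # w) x * coordq i g x))"
   by (rule add[OF 2 conjunct1[OF 3] 1 conjunct2[OF 3]])
  then show ?case
  proof (rule cong)
   fix x assume "x \<in> Rn n"
   from hadamard[OF this, of g]
   have "monomial w x * g x = monomial w x * (g (%_. 0) + (\<Sum>j<n. x j * coordq j g x))" by simp
   then show "monomial w x * g (%_. 0) + (\<Sum>i<n. monomial (i # w) x * coordq i g x) = monomial w x * g x"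
    by (simp add: distrib_left sum_distrib_left mult_ac)
  qed
 qed
 from this[of "[]" k g] g show ?thesis by simp
qed

section \<open>Linear functionals of smooth functions\<close>

text \<open>Linear functionals on the smooth functions that vanish on the multiples of the monomials of
  degree \<open>k\<close>, that is, functionals of the \<open>k-1\<close>-jet at the origin.\<close>

definition jet_functional :: "nat => nat => ((point => real) => real) => bool" where
 "jet_functional n k L \<longleftrightarrow>
   (ALL f g. csmooth n f --> csmooth n g --> L (%x. f x + g x) = L f + L g) &
   (ALL c f. csmooth n f --> L (%x. c * f x) = c * L f) &
   (ALL f g. csmooth n f --> (\<forall>x\<in>Rn n. f x = g x) --> L f = L g) &
   (ALL w g. length w = k --> set w \<subseteq> {..<n} --> csmooth n g --> L (%x. monomial w x * g x) = 0)"

lemma jet_functionalD: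
 assumes "jet_functional n k L"
 shows "csmooth n f ==> csmooth n g ==> L (%x. f x + g x) = L f + L g"
  and "csmooth n f ==> L (%x. c * f x) = c * L f"
  and "csmooth n f ==> (!!x. x \<in> Rn n ==> f x = g x) ==> L f = L g"
  and "length w = k ==> set w \<subseteq> {..<n} ==> csmooth n g ==> L (%x. monomial w x * g x) = 0"
 using assms unfolding jet_functional_def by simp_all

lemma jet_functional_sum:
 assumes "jet_functional n k L" "!!i. i < (m::nat) ==> csmooth n (f i)"
 shows "L (%x. \<Sum>i<m. f i x) = (\<Sum>i<m. L (f i))" using assms(2)
proof (induction m)
 case 0
 show ?case using jet_functionalD(2)[OF assms(1) csmooth_const, of 0 0] by simp
next
 case (Suc m)
 have "csmooth n (%x. \<Sum>i<m. f i x)" "csmooth n (f m)" using Suc.prems by (auto intro!: csmooth_sum)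
 from jet_functionalD(1)[OF assms(1) this] show ?case using Suc by simp
qed

lemma jet_functional_coord:
 assumes L: "jet_functional n (Suc k) L" and j: "j < n"
 shows "jet_functional n k (%g. L (%x. x j * g x))" unfolding jet_functional_def
proof (intro conjI allI impI)
 note s = csmooth_mult[OF csmooth_coord]
 fix f g assume f: "csmooth n f"
 show "L (%x. x j * (c * f x)) = c * L (%x. x j * f x)" for c
  using jet_functionalD(2)[OF L s[OF f, of j], of c] by (simp add: mult.left_commute)
 show "L (%x. x j * f x) = L (%x. x j * g x)" if "\<forall>x\<in>Rn n. f x = g x"
  by (rule jet_functionalD(3)[OF L s[OF f]]) (use that in simp)
 assume g: "csmooth n g"
 show "L (%x. x j * (f x + g x)) = L (%x. x j * f x) + L (%x. x j * g x)"
  using jet_functionalD(1)[OF L s[OF f, of j] s[OF g, of j]] by (simp add: distrib_left)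
next
 fix w :: "nat list" and g assume "length w = k" "set w \<subseteq> {..<n}" "csmooth n g"
 then show "L (%x. x j * (monomial w x * g x)) = 0"
  using jet_functionalD(4)[OF L, of "j # w" g] j by (simp add: mult.assoc)
qed

lemma jet_functional_hadamard:
 assumes L: "jet_functional n k L" and g: "csmooth n g"
 shows "L g = g (%_. 0) * L (%_. 1) + (\<Sum>j<n. L (%x. x j * coordq j g x))"
proof -
 have s: "csmooth n (%x. x j * coordq j g x)" if "j < n" for j
  using that g by (intro csmooth_mult csmooth_coordq) auto
 have "L (%x. g (%_. 0) * 1 + (\<Sum>j<n. x j * coordq j g x)) = L g"
 proof (rule jet_functionalD(3)[OF L])
  show "csmooth n (%x. g (%_. 0) * 1 + (\<Sum>j<n. x j * coordq j g x))"
   using s by (intro csmooth_add csmooth_sum) auto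
  show "g (%_. 0) * 1 + (\<Sum>j<n. x j * coordq j g x) = g x" if "x \<in> Rn n" for x
   using hadamard[OF that, of g] by simp
 qed
 also have "L (%x. g (%_. 0) * 1 + (\<Sum>j<n. x j * coordq j g x)) = L (%x. g (%_. 0) * 1) + L (%x. \<Sum>j<n. x j * coordq j g x)"
  using s by (intro jet_functionalD(1)[OF L] csmooth_sum) auto
 also have "L (%x. \<Sum>j<n. x j * coordq j g x) = (\<Sum>j<n. L (%x. x j * coordq j g x))"
  by (rule jet_functional_sum[OF L s])
 also have "L (%x. g (%_. 0) * 1) = g (%_. 0) * L (%_. 1)" by (rule jet_functionalD(2)[OF L csmooth_const])
 finally show ?thesis by simp
qed

lemma smooth_functional_family:
 assumes "smooth_functional \<mu>" "smooth_family n H"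
 shows "csmooth n (%x. \<mu> (%s. H s x))" unfolding csmooth_def
proof (intro allI impI)
 fix c assume "curve_Rn n c"
 from smooth_functionalD(3)[OF assms(1) smooth_family_curve2[OF assms(2) this]]
 show "smooth_real (%u. \<mu> (%s. H s (c u)))" .
qed

text \<open>A functional of jets in the variables and a functional of the parameter commute. By Hadamard's
  lemma this reduces to the same statement for jets of a lower order.\<close>

lemma jet_functional_family:
 assumes "jet_functional n k L" "smooth_family n H"
 shows "smooth_real (%s. L (H s)) &
  (\<forall>\<mu>. smooth_functional \<mu> --> \<mu> (%s. L (H s)) = L (%x. \<mu> (%s. H s x)))" using assms
proof (induction k arbitrary: L H)
 case 0
 have L0: "L g = 0" if "csmooth n g" for g using jet_functionalD(4)[OF 0(1), of "[]" g] that by simp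
 have "\<mu> (%s. 0) = 0" if "smooth_functional \<mu>" for \<mu>
  using smooth_functionalD(2)[OF that smooth_real_const, of 0 0] by simp
 then show ?case using L0 smooth_family_slice[OF 0(2)] smooth_functional_family[OF _ 0(2)] by simp
next
 case (Suc k)
 note L = Suc.prems(1) and H = Suc.prems(2)
 define Lj where "Lj j g = L (%x. x j * g x)" for j g
 have IH: "smooth_real (%s. Lj j (coordq j (H s)))"
   "smooth_functional \<mu> ==> \<mu> (%s. Lj j (coordq j (H s))) = Lj j (%x. \<mu> (%s. coordq j (H s) x))"
  if "j < n" for j \<mu> using Suc.IH[OF jet_functional_coord[OF L that] smooth_family_coordq[OF H that]]
  unfolding Lj_def by simp_all
 have eq: "L (H s) = H s (%_. 0) * L (%_. 1) + (\<Sum>j<n. Lj j (coordq j (H s)))" for s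
  unfolding Lj_def by (rule jet_functional_hadamard[OF L smooth_family_slice[OF H]])
 have sm0: "smooth_real (%s. H s (%_. 0))" by (rule smooth_family_point[OF H zero_in_Rn])
 have sm1: "smooth_real (%s. L (%_. 1) * H s (%_. 0))" by (rule smooth_real_cmult[OF sm0])
 have sm2: "smooth_real (%s. \<Sum>j<n. Lj j (coordq j (H s)))" by (rule smooth_real_sum) (simp add: IH(1))
 show ?case
 proof (intro conjI allI impI)
  show "smooth_real (%s. L (H s))" unfolding eq using smooth_real_add[OF sm1 sm2] by (simp add: mult.commute)
  fix \<mu> assume \<mu>: "smooth_functional \<mu>"
  define G where "G x = \<mu> (%s. H s x)" for x
  have G: "csmooth n G" unfolding G_def by (rule smooth_functional_family[OF \<mu> H])
  have "\<mu> (%s. L (H s)) = \<mu> (%s. L (%_. 1) * H s (%_. 0) + (\<Sum>j<n. Lj j (coordq j (H s))))"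
   unfolding eq by (simp add: mult.commute)
  also have "\<dots> = \<mu> (%s. L (%_. 1) * H s (%_. 0)) + \<mu> (%s. \<Sum>j<n. Lj j (coordq j (H s)))"
   by (rule smooth_functionalD(1)[OF \<mu> sm1 sm2])
  also have "\<mu> (%s. L (%_. 1) * H s (%_. 0)) = L (%_. 1) * G (%_. 0)"
   unfolding G_def by (rule smooth_functionalD(2)[OF \<mu> sm0])
  also have "\<mu> (%s. \<Sum>j<n. Lj j (coordq j (H s))) = (\<Sum>j<n. \<mu> (%s. Lj j (coordq j (H s))))"
   by (rule smooth_functional_sum[OF \<mu>]) (simp_all add: IH(1))
  also have "\<dots> = (\<Sum>j<n. Lj j (coordq j G))"
  proof (rule sum.cong[OF refl])
   fix j assume "j \<in> {..<n}"
   then have j: "j < n" by simp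
   have "Lj j (%x. \<mu> (%s. coordq j (H s) x)) = Lj j (coordq j G)"
   proof (rule jet_functionalD(3)[OF jet_functional_coord[OF L j], folded Lj_def])
    show "csmooth n (%x. \<mu> (%s. coordq j (H s) x))"
     by (rule smooth_functional_family[OF \<mu> smooth_family_coordq[OF H j]])
    fix x assume x: "x \<in> Rn n"
    have "smooth2 (%s t. H s ((zero_below j x)(j := t)))"
     using smooth_family_coordq_aux[OF H j smooth_real_id curve_Rn_const[OF x]] .
    from smooth_functional_hadq[OF \<mu> this]
    show "\<mu> (%s. coordq j (H s) x) = coordq j G x" unfolding coordq_def G_def ..
   qed
   then show "\<mu> (%s. Lj j (coordq j (H s))) = Lj j (coordq j G)" using IH(2)[OF j \<mu>] by simp
  qed
  also have "L (%_. 1) * G (%_. 0) + (\<Sum>j<n. Lj j (coordq j G)) = L G"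
   using jet_functional_hadamard[OF L G] unfolding Lj_def by (simp add: mult.commute)
  finally show "\<mu> (%s. L (H s)) = L (%x. \<mu> (%s. H s x))" unfolding G_def .
 qed
qed

section \<open>Dual bases\<close>

text \<open>The linear span of \<open>B\<close> modulo the space \<open>S\<close>.\<close>

inductive span_mod :: "((point => real) => bool) => (point => real) set => (point => real) => bool" for S B where
 space: "S g ==> span_mod S B g"
| step: "span_mod S B g ==> b \<in> B ==> span_mod S B (%x. c * b x + g x)"

lemma span_mod_mono: "span_mod S B g ==> B \<subseteq> B' ==> span_mod S B' g"
 by (induction rule: span_mod.induct) (auto intro: span_mod.intros)

lemma (in function_space) span_mod_cong:
 "span_mod P B f ==> (!!x. x \<in> Rn n ==> f x = g x) ==> span_mod P B g"
proof (induction arbitrary: g rule: span_mod.induct)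
 case (space f)
 show ?case by (rule span_mod.space, rule cong[OF space(1)]) (rule space(2))
next
 case (step f b c)
 have "span_mod P B (%x. g x - c * b x)"
 proof (rule step.IH)
  fix x assume "x \<in> Rn n"
  from step.prems[OF this] show "f x = g x - c * b x" by linarith
 qed
 from span_mod.step[OF this step(2), of c] show ?case by simp
qed

lemma (in function_space) span_mod_add_space:
 assumes "span_mod P B g" and f: "P f" shows "span_mod P B (%x. f x + g x)" using assms(1)
proof (induction rule: span_mod.induct)
 case (space g)
 show ?case by (rule span_mod.space, rule add[OF f space])
next
 case (step g b c)
 show ?case by (rule span_mod_cong[OF span_mod.step[OF step.IH step(2), of c]]) simp
qed

lemma (in function_space) span_mod_add:
 assumes "span_mod P B f" and g: "span_mod P B g" shows "span_mod P B (%x. f x + g x)" using assms(1)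
proof (induction rule: span_mod.induct)
 case (space f)
 show ?case by (rule span_mod_add_space[OF g space])
next
 case (step f b c)
 show ?case by (rule span_mod_cong[OF span_mod.step[OF step.IH step(2), of c]]) simp
qed

lemma span_mod_coord:
 "span_mod (%g. csmooth n g & S (%x. x j * g x)) B g ==>
   span_mod S ((%b x. x j * b x) ` B) (%x. x j * g x)"
proof (induction rule: span_mod.induct)
 case (space g)
 show ?case by (rule span_mod.space) (use space in simp)
next
 case (step g b c)
 have "(%x. x j * b x) \<in> (%b x. x j * b x) ` B" using step(2) by blast
 from span_mod.step[OF step.IH this, of c] show ?case by (simp add: distrib_left mult_ac)
qed

text \<open>By Hadamard's lemma a function is its value at \<open>0\<close> plus multiples of the coordinates, whose
  cofactors are only needed modulo a condition of one order less.\<close>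

lemma finite_span_mod:
 assumes "function_space n S"
  and "!!w g. length w = k ==> set w \<subseteq> {..<n} ==> csmooth n g ==> S (%x. monomial w x * g x)"
 shows "EX B. finite B & (\<forall>b\<in>B. csmooth n b) & (ALL g. csmooth n g --> span_mod S B g)" using assms
proof (induction k arbitrary: S)
 case 0
 have "S g" if "csmooth n g" for g using 0(2)[of "[]" g] that by simp
 then have "span_mod S {} g" if "csmooth n g" for g using that by (intro span_mod.space) simp
 then show ?case by (intro exI[of _ "{}"]) simp
next
 case (Suc k)
 interpret function_space n S by (rule Suc.prems(1))
 define Sj where "Sj j g \<longleftrightarrow> csmooth n g & S (%x. x j * g x)" for j g
 have "EX B. finite B & (\<forall>b\<in>B. csmooth n b) & (ALL g. csmooth n g --> span_mod (Sj j) B g)" if j: "j < n" for j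
 proof (rule Suc.IH)
  show "function_space n (Sj j)"
  proof
   fix f g :: "point => real" and c
   show "Sj j f ==> csmooth n f" by (simp add: Sj_def)
   show "Sj j g" if "Sj j f" "!!x. x \<in> Rn n ==> f x = g x"
    using that csmooth_cong[of n f g] cong[of "%x. x j * f x" "%x. x j * g x"] by (simp add: Sj_def)
   show "Sj j (%_. 0)" using zero by (simp add: Sj_def)
   show "Sj j (%x. f x + g x)" if "Sj j f" "Sj j g"
    using that add[of "%x. x j * f x" "%x. x j * g x"] by (simp add: Sj_def csmooth_add distrib_left)
   show "Sj j (%x. c * f x)" if "Sj j f"
    using that scale[of "%x. x j * f x" c] by (simp add: Sj_def csmooth_scale mult.left_commute)
  qed
  fix w :: "nat list" and g assume "length w = k" "set w \<subseteq> {..<n}" "csmooth n g"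
  then show "Sj j (%x. monomial w x * g x)"
   using Suc.prems(2)[of "j # w" g] j by (simp add: Sj_def csmooth_mult mult.assoc)
 qed
 then have "ALL j. EX B. j < n --> finite B & (\<forall>b\<in>B. csmooth n b) & (ALL g. csmooth n g --> span_mod (Sj j) B g)"
  by simp
 from choice[OF this] obtain B where
  B: "ALL j. j < n --> finite (B j) & (\<forall>b\<in>B j. csmooth n b) & (ALL g. csmooth n g --> span_mod (Sj j) (B j) g)" ..
 define B' where "B' = insert (%_. 1) (\<Union>j<n. (%b x. x j * b x) ` B j)"
 have fin: "finite B'" using B by (simp add: B'_def)
 have smB: "\<forall>b\<in>B'. csmooth n b" using B by (auto simp: B'_def intro: csmooth_mult)
 have "span_mod S B' g" if g: "csmooth n g" for g
 proof -
  have sj: "span_mod S B' (%x. x j * coordq j g x)" if j: "j < n" for j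
  proof (rule span_mod_mono[OF span_mod_coord])
   have "Sj j = (%g. csmooth n g & S (%x. x j * g x))" by (simp add: Sj_def fun_eq_iff)
   then show "span_mod (%g. csmooth n g & S (%x. x j * g x)) (B j) (coordq j g)"
    using B[rule_format, OF j] csmooth_coordq[OF g j] by simp
  qed (use j in \<open>auto simp: B'_def\<close>)
  have sums: "m \<le> n ==> span_mod S B' (%x. \<Sum>j<m. x j * coordq j g x)" for m
  proof (induction m)
   case 0
   show ?case by (simp, intro span_mod.space, rule zero)
  next
   case (Suc m)
   have "span_mod S B' (%x. (\<Sum>j<m. x j * coordq j g x) + x m * coordq m g x)"
    by (rule span_mod_add) (use Suc sj[of m] in simp_all)
   then show ?case by simp
  qed
  from span_mod.step[OF sums[OF order_refl], of "%_. 1" "g (%_. 0)"]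
  have "span_mod S B' (%x. g (%_. 0) * 1 + (\<Sum>j<n. x j * coordq j g x))" by (simp add: B'_def)
  then show ?thesis
  proof (rule span_mod_cong)
   fix x assume "x \<in> Rn n"
   from hadamard[OF this, of g] show "g (%_. 0) * 1 + (\<Sum>j<n. x j * coordq j g x) = g x" by simp
  qed
 qed
 with fin smB show ?case by (intro exI[of _ B'] conjI allI impI)
qed

text \<open>Linear functionals that vanish on the space \<open>S\<close>.\<close>

definition annihilator :: "nat => ((point => real) => bool) => ((point => real) => real) => bool" where
 "annihilator n S L \<longleftrightarrow>
   (ALL f g. csmooth n f --> csmooth n g --> L (%x. f x + g x) = L f + L g) &
   (ALL c f. csmooth n f --> L (%x. c * f x) = c * L f) &
   (ALL f. S f --> L f = 0)"

lemma annihilatorD: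
 assumes "annihilator n S L"
 shows "csmooth n f ==> csmooth n g ==> L (%x. f x + g x) = L f + L g"
  and "csmooth n f ==> L (%x. c * f x) = c * L f"
  and "S f ==> L f = 0" using assms unfolding annihilator_def by simp_all

lemma annihilator_diff:
 assumes "annihilator n S L" "csmooth n f" "csmooth n g"
 shows "L (%x. f x - g x) = L f - L g" using annihilatorD(1)[OF assms(1,2) csmooth_scale[OF assms(3), of "-1"]]
  annihilatorD(2)[OF assms(1,3), of "-1"] by simp

lemma annihilator_mono:
 assumes L: "annihilator n T L" and ST: "!!f. S f ==> T f" shows "annihilator n S L" unfolding annihilator_def
proof (intro conjI allI impI)
 fix f g c assume f: "csmooth n f"
 show "L (%x. c * f x) = c * L f" by (rule annihilatorD(2)[OF L f])
 assume g: "csmooth n g"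
 show "L (%x. f x + g x) = L f + L g" by (rule annihilatorD(1)[OF L f g])
next
 fix f assume "S f"
 then show "L f = 0" by (intro annihilatorD(3)[OF L] ST)
qed

text \<open>The functions that are in \<open>S\<close> up to a multiple of \<open>b\<close>.\<close>

definition span_line :: "nat => ((point => real) => bool) => (point => real) => (point => real) => bool" where
 "span_line n S b g \<longleftrightarrow> csmooth n g & (EX c. S (%x. g x - c * b x))"

definition dual_system :: "nat => ((point => real) => bool) => nat =>
  (nat => point => real) => (nat => (point => real) => real) => bool" where
 "dual_system n S N e \<Lambda> \<longleftrightarrow> (\<forall>j<N. csmooth n (e j) & annihilator n S (\<Lambda> j)) &
   (ALL g. csmooth n g --> S (%x. g x - (\<Sum>j<N. \<Lambda> j g * e j x)))"

lemma dual_systemD: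
 assumes "dual_system n S N e \<Lambda>"
 shows "j < N ==> csmooth n (e j)" "j < N ==> annihilator n S (\<Lambda> j)"
  "csmooth n g ==> S (%x. g x - (\<Sum>j<N. \<Lambda> j g * e j x))" using assms by (simp_all add: dual_system_def)

lemma span_lineI: "csmooth n g ==> S (%x. g x - c * b x) ==> span_line n S b g"
 unfolding span_line_def by (intro conjI exI)

lemma span_lineE:
 assumes "span_line n S b g" obtains c where "csmooth n g" "S (%x. g x - c * b x)"
 using assms unfolding span_line_def by (elim conjE exE)

lemma span_line_smooth: "span_line n S b g ==> csmooth n g" unfolding span_line_def by (rule conjunct1)

lemma span_line_mem:
 assumes "function_space n S" and g: "S g" shows "span_line n S b g"
proof (rule span_lineI)
 interpret function_space n S by fact
 show "csmooth n g" by (rule smooth[OF g])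
 show "S (%x. g x - 0 * b x)" by (rule cong[OF g]) simp
qed

lemma span_line_space:
 assumes "function_space n S" and b: "csmooth n b"
 shows "function_space n (span_line n S b)"
proof
 interpret function_space n S by fact
 show "csmooth n f" if "span_line n S b f" for f using that by (rule span_line_smooth)
 show "span_line n S b g" if f: "span_line n S b f" and fg: "!!x. x \<in> Rn n ==> f x = g x" for f g
 proof -
  obtain d where sf: "csmooth n f" and d: "S (%x. f x - d * b x)" using f by (rule span_lineE)
  have "csmooth n f \<longleftrightarrow> csmooth n g" by (rule csmooth_cong) (rule fg)
  then have sg: "csmooth n g" using sf by (rule iffD1)
  have "S (%x. g x - d * b x)" by (rule cong[OF d]) (simp add: fg)
  with sg show ?thesis by (rule span_lineI)
 qed
 show "span_line n S b (%_. 0)" by (rule span_line_mem[OF assms(1) zero])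
 show "span_line n S b (%x. f x + g x)" if f: "span_line n S b f" and g: "span_line n S b g" for f g
 proof -
  obtain d where sf: "csmooth n f" and d: "S (%x. f x - d * b x)" using f by (rule span_lineE)
  obtain d' where sg: "csmooth n g" and d': "S (%x. g x - d' * b x)" using g by (rule span_lineE)
  have "S (%x. (f x + g x) - (d + d') * b x)" by (rule cong[OF add[OF d d']]) (simp add: algebra_simps)
  then show ?thesis by (rule span_lineI[OF csmooth_add[OF sf sg]])
 qed
 show "span_line n S b (%x. c * f x)" if f: "span_line n S b f" for f c
 proof -
  obtain d where sf: "csmooth n f" and d: "S (%x. f x - d * b x)" using f by (rule span_lineE)
  have "S (%x. c * f x - (c * d) * b x)" by (rule cong[OF scale[OF d, of c]]) (simp add: algebra_simps)
  then show ?thesis by (rule span_lineI[OF csmooth_scale[OF sf]])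
 qed
qed

lemma dual_system_step:
 assumes "function_space n S" and b: "csmooth n b" and False: "\<not> S b"
  and T: "dual_system n (span_line n S b) N e \<Lambda>"
 shows "\<exists>N e \<Lambda>. dual_system n S N e \<Lambda>"
proof -
 interpret function_space n S by fact
 have IH1: "csmooth n (e j)" "annihilator n (span_line n S b) (\<Lambda> j)" if "j < N" for j
  using T that by (simp_all add: dual_system_def)
 have annS: "annihilator n S (\<Lambda> j)" if "j < N" for j
  by (rule annihilator_mono[OF IH1(2)[OF that]]) (rule span_line_mem[OF assms(1)])
 define r where "r g x = g x - (\<Sum>j<N. \<Lambda> j g * e j x)" for g x
 have rT: "span_line n S b (r g)" if "csmooth n g" for g
 proof -
  have "r g = (%x. g x - (\<Sum>j<N. \<Lambda> j g * e j x))" by (simp add: r_def fun_eq_iff)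
  then show ?thesis using T that by (simp add: dual_system_def)
 qed
 have uniq: "c = d" if c: "S (%x. g x - c * b x)" and d: "S (%x. g x - d * b x)" for g c d
 proof (rule ccontr)
  assume "c ~= d"
  have "S (%x. (d - c) * b x)" by (rule cong[OF diff[OF c d]]) (simp add: left_diff_distrib)
  then have "S b" by (rule scaleD) (use \<open>c ~= d\<close> in simp)
  with False show False by simp
 qed
 define l where "l g = (THE c. S (%x. r g x - c * b x))" for g
 have l: "S (%x. r g x - l g * b x)" if g: "csmooth n g" for g
 proof -
  obtain c where c: "S (%x. r g x - c * b x)" using rT[OF g] by (rule span_lineE)
  have "\<exists>!c. S (%x. r g x - c * b x)"
  proof (rule ex1I[of _ c])
   show "S (%x. r g x - c * b x)" by (rule c)
   show "d = c" if d: "S (%x. r g x - d * b x)" for d by (rule uniq[OF d c])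
  qed
  from theI'[OF this] show ?thesis by (simp only: l_def)
 qed
 have radd: "r (%x. f x + g x) x = r f x + r g x" if "csmooth n f" "csmooth n g" for f g x
 proof -
  have "(\<Sum>j<N. \<Lambda> j (%x. f x + g x) * e j x) = (\<Sum>j<N. \<Lambda> j f * e j x + \<Lambda> j g * e j x)"
   by (rule sum.cong[OF refl]) (simp add: annihilatorD(1)[OF IH1(2) that] distrib_right)
  then show ?thesis by (simp add: r_def sum.distrib)
 qed
 have rscale: "r (%x. c * f x) x = c * r f x" if "csmooth n f" for c f x
 proof -
  have "(\<Sum>j<N. \<Lambda> j (%x. c * f x) * e j x) = (\<Sum>j<N. c * (\<Lambda> j f * e j x))"
   by (rule sum.cong[OF refl]) (simp add: annihilatorD(2)[OF IH1(2) that])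
  then show ?thesis by (simp add: r_def right_diff_distrib sum_distrib_left)
 qed
 have annl: "annihilator n S l" unfolding annihilator_def
 proof (intro conjI allI impI)
  fix f g assume f: "csmooth n f" and g: "csmooth n g"
  have "S (%x. r (%x. f x + g x) x - (l f + l g) * b x)"
   by (rule cong[OF add[OF l[OF f] l[OF g]]]) (simp add: radd[OF f g] distrib_right)
  then show "l (%x. f x + g x) = l f + l g" by (rule uniq[OF l[OF csmooth_add[OF f g]]])
 next
  fix c f assume f: "csmooth n f"
  have "S (%x. r (%x. c * f x) x - (c * l f) * b x)"
   by (rule cong[OF scale[OF l[OF f], of c]]) (simp add: rscale[OF f] right_diff_distrib)
  then show "l (%x. c * f x) = c * l f" by (rule uniq[OF l[OF csmooth_scale[OF f]]])
 next
  fix f assume f: "S f"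
  have "(\<Sum>j<N. \<Lambda> j f * e j x) = 0" for x by (rule sum.neutral) (simp add: annihilatorD(3)[OF annS] f)
  then have "S (%x. r f x - 0 * b x)" by (intro cong[OF f]) (simp add: r_def)
  then show "l f = 0" by (rule uniq[OF l[OF smooth[OF f]]])
 qed
 define e' where "e' j = (if j < N then e j else b)" for j
 define \<Lambda>' where "\<Lambda>' j = (if j < N then \<Lambda> j else l)" for j
 have eq: "(\<Sum>j<Suc N. \<Lambda>' j g * e' j x) = (\<Sum>j<N. \<Lambda> j g * e j x) + l g * b x" for g x
 proof -
  have "(\<Sum>j<N. \<Lambda>' j g * e' j x) = (\<Sum>j<N. \<Lambda> j g * e j x)"
   by (rule sum.cong[OF refl]) (simp add: e'_def \<Lambda>'_def)
  moreover have "\<Lambda>' N = l" "e' N = b" by (simp_all add: e'_def \<Lambda>'_def)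
  ultimately show ?thesis by (simp only: sum.lessThan_Suc)
 qed
 have fin: "S (%x. g x - (\<Sum>j<Suc N. \<Lambda>' j g * e' j x))" if g: "csmooth n g" for g
 proof (rule cong[OF l[OF g]])
  fix x show "r g x - l g * b x = g x - (\<Sum>j<Suc N. \<Lambda>' j g * e' j x)"
   unfolding eq r_def by (rule diff_diff_add)
 qed
 have sm: "csmooth n (e' j)" if "j < Suc N" for j using that IH1(1)[of j] b by (cases "j < N") (simp_all add: e'_def)
 have an: "annihilator n S (\<Lambda>' j)" if "j < Suc N" for j
  using that annS[of j] annl by (cases "j < N") (simp_all add: \<Lambda>'_def)
 have "dual_system n S (Suc N) e' \<Lambda>'" unfolding dual_system_def
 proof (intro conjI allI impI)
  show "csmooth n (e' j)" "annihilator n S (\<Lambda>' j)" if "j < Suc N" for j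
   by (rule sm[OF that], rule an[OF that])
  show "S (%x. g x - (\<Sum>j<Suc N. \<Lambda>' j g * e' j x))" if "csmooth n g" for g by (rule fin[OF that])
 qed
 then show ?thesis by (intro exI)
qed

text \<open>The quotient by the whole space is zero. From there the spanning vectors leave the subspace one by
  one, and each of them contributes at most one functional.\<close>

lemma dual_basis:
 assumes "finite B" "function_space n S" "\<forall>b\<in>B. csmooth n b"
  "ALL g. csmooth n g --> span_mod S B g"
 shows "\<exists>N e \<Lambda>. dual_system n S N e \<Lambda>" using assms
proof (induction B arbitrary: S rule: finite_induct)
 case empty
 have "S g" if "span_mod S {} g" for g using that by cases auto
 note sp0 = this
 have S: "S g" if "csmooth n g" for g by (rule sp0, rule empty.prems(3)[rule_format, OF that])
 have "dual_system n S 0 e \<Lambda>" for e \<Lambda>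
  unfolding dual_system_def by (intro conjI allI impI S csmooth_diff) simp_all
 then show ?case by (intro exI)
next
 case (insert b B)
 interpret function_space n S by (rule insert.prems(1))
 have b: "csmooth n b" using insert.prems by simp
 let ?T = "span_line n S b"
 note sp = span_line_space[OF insert.prems(1) b]
 note mem = span_line_mem[OF insert.prems(1)]
 interpret T: function_space n ?T by (rule sp)
 have Tb: "?T (%x. c * b x)" for c
 proof (rule span_lineI[OF csmooth_scale[OF b]])
  show "S (%x. c * b x - c * b x)" by (rule cong[OF zero]) simp
 qed
 have "span_mod ?T B g" if "span_mod S (insert b B) g" for g using that
 proof (induction rule: span_mod.induct)
  case (space g)
  show ?case by (rule span_mod.space, rule mem, rule space)
 next
  case (step g b' c)
  show ?case
  proof (cases "b' = b")
   case True
   show ?thesis unfolding True by (rule T.span_mod_add[OF _ step.IH], rule span_mod.space, rule Tb)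
  next
   case False
   then show ?thesis using step by (intro span_mod.step) auto
  qed
 qed
 then have spT: "ALL g. csmooth n g --> span_mod ?T B g" using insert.prems(3) by simp
 have smB: "\<forall>b\<in>B. csmooth n b" using insert.prems(2) by simp
 from insert.IH[OF sp smB spT] obtain N :: nat and e \<Lambda> where D: "dual_system n ?T N e \<Lambda>" by (elim exE)
 show ?case
 proof (cases "S b")
  case True
  have TS: "S g" if "?T g" for g
  proof -
   obtain c where c: "S (%x. g x - c * b x)" using \<open>?T g\<close> by (rule span_lineE)
   show ?thesis by (rule cong[OF add[OF c scale[OF True, of c]]]) simp
  qed
  have "dual_system n S N e \<Lambda>" unfolding dual_system_def
  proof (intro conjI allI impI)
   fix j assume "j < N"
   then have j: "csmooth n (e j)" "annihilator n ?T (\<Lambda> j)" using D by (simp_all add: dual_system_def)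
   show "csmooth n (e j)" by (rule j(1))
   show "annihilator n S (\<Lambda> j)" by (rule annihilator_mono[OF j(2)]) (rule mem)
  next
   fix g assume "csmooth n g"
   then have "?T (%x. g x - (\<Sum>j<N. \<Lambda> j g * e j x))" using D by (simp add: dual_system_def)
   then show "S (%x. g x - (\<Sum>j<N. \<Lambda> j g * e j x))" by (rule TS)
  qed
  then show ?thesis by (intro exI)
 next
  case False
  show ?thesis by (rule dual_system_step[OF insert.prems(1) b False D])
 qed
qed

section \<open>Weil algebras as quotients\<close>

lemma carrier_Cinf: "f \<in> carrier (Cinf n) \<longleftrightarrow> f \<in> extensional (Rn n) & csmooth n f"
 by (simp add: Cinf_def boman)

lemma Cinf_simps:
 "f \<otimes>\<^bsub>Cinf n\<^esub> g = (\<lambda>x\<in>Rn n. f x * g x)"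
 "f \<oplus>\<^bsub>Cinf n\<^esub> g = (\<lambda>x\<in>Rn n. f x + g x)"
 "\<one>\<^bsub>Cinf n\<^esub> = (\<lambda>x\<in>Rn n. 1)"
 "\<zero>\<^bsub>Cinf n\<^esub> = (\<lambda>x\<in>Rn n. 0)" by (simp_all add: Cinf_def)

lemma restrict_in_Cinf: "csmooth n f ==> restrict f (Rn n) \<in> carrier (Cinf n)" by (simp add: carrier_Cinf)

lemma restrict_Cinf_id: "f \<in> carrier (Cinf n) ==> restrict f (Rn n) = f"
 by (simp add: carrier_Cinf extensional_restrict)

lemma cring_Cinf: "cring (Cinf n)"
proof (rule cringI)
 show "abelian_group (Cinf n)"
 proof (rule abelian_groupI)
  fix f assume f: "f \<in> carrier (Cinf n)"
  then have "(\<lambda>x\<in>Rn n. - f x) \<in> carrier (Cinf n)"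
   by (intro restrict_in_Cinf csmooth_uminus) (simp add: carrier_Cinf)
  moreover have "(\<lambda>x\<in>Rn n. - f x) \<oplus>\<^bsub>Cinf n\<^esub> f = \<zero>\<^bsub>Cinf n\<^esub>"
   unfolding Cinf_simps by (rule restrict_ext) simp
  ultimately show "\<exists>g\<in>carrier (Cinf n). g \<oplus>\<^bsub>Cinf n\<^esub> f = \<zero>\<^bsub>Cinf n\<^esub>" by (intro bexI[of _ "\<lambda>x\<in>Rn n. - f x"])
  show "\<zero>\<^bsub>Cinf n\<^esub> \<oplus>\<^bsub>Cinf n\<^esub> f = f"
   using restrict_Cinf_id[OF f] by (simp add: Cinf_simps cong: restrict_cong)
 qed (auto simp: Cinf_simps carrier_Cinf csmooth_add add_ac cong: restrict_cong)
 show "comm_monoid (Cinf n)"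
 proof (rule comm_monoidI)
  fix f assume f: "f \<in> carrier (Cinf n)"
  show "\<one>\<^bsub>Cinf n\<^esub> \<otimes>\<^bsub>Cinf n\<^esub> f = f"
   using restrict_Cinf_id[OF f] by (simp add: Cinf_simps cong: restrict_cong)
 qed (auto simp: Cinf_simps carrier_Cinf csmooth_mult mult_ac cong: restrict_cong)
qed (simp add: Cinf_simps distrib_right cong: restrict_cong)

lemma ring_Cinf: "ring (Cinf n)" using cring_Cinf by (rule cring.axioms)

lemma a_inv_Cinf:
 assumes f: "f \<in> carrier (Cinf n)" shows "\<ominus>\<^bsub>Cinf n\<^esub> f = (\<lambda>x\<in>Rn n. - f x)"
proof -
 interpret cring "Cinf n" by (rule cring_Cinf)
 have "(\<lambda>x\<in>Rn n. - f x) \<in> carrier (Cinf n)"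
  using f by (intro restrict_in_Cinf csmooth_uminus) (simp add: carrier_Cinf)
 moreover have "(\<lambda>x\<in>Rn n. - f x) \<oplus>\<^bsub>Cinf n\<^esub> f = \<zero>\<^bsub>Cinf n\<^esub>"
  unfolding Cinf_simps by (rule restrict_ext) simp
 ultimately show ?thesis using f by (intro minus_equality)
qed

lemma a_minus_Cinf:
 assumes f: "f \<in> carrier (Cinf n)" and g: "g \<in> carrier (Cinf n)"
 shows "f \<ominus>\<^bsub>Cinf n\<^esub> g = (\<lambda>x\<in>Rn n. f x - g x)"
 unfolding a_minus_def a_inv_Cinf[OF g] by (simp add: Cinf_simps cong: restrict_cong)

lemma function_ideal_of_ideal:
 assumes "ideal I (Cinf n)"
 shows "function_ideal n (%f. restrict f (Rn n) \<in> I)"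
proof
 interpret ideal I "Cinf n" by fact
 fix f g h :: "point => real"
 show f: "csmooth n f" if "restrict f (Rn n) \<in> I" for f using Icarr[OF that] by (simp add: carrier_Cinf)
 show "restrict g (Rn n) \<in> I" if "restrict f (Rn n) \<in> I" "!!x. x \<in> Rn n ==> f x = g x"
  using that(1) restrict_ext[of "Rn n" f g] that(2) by simp
 show "restrict (%_. 0) (Rn n) \<in> I"
  using additive_subgroup.zero_closed[OF ideal.axioms(1)[OF assms]] by (simp add: Cinf_simps)
 show "(\<lambda>x\<in>Rn n. f x + g x) \<in> I" if "restrict f (Rn n) \<in> I" "restrict g (Rn n) \<in> I"
  using additive_subgroup.a_closed[OF ideal.axioms(1)[OF assms] that] by (simp add: Cinf_simps cong: restrict_cong)
 show "(\<lambda>x\<in>Rn n. h x * f x) \<in> I" if "csmooth n h" "restrict f (Rn n) \<in> I"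
  using I_l_closed[OF that(2) restrict_in_Cinf[OF that(1)]] by (simp add: Cinf_simps cong: restrict_cong)
qed

lemma ideal_of_function_ideal:
 assumes "function_ideal n P"
 shows "ideal {f \<in> extensional (Rn n). P f} (Cinf n)"
proof -
 interpret function_ideal n P by fact
 interpret R: cring "Cinf n" by (rule cring_Cinf)
 have restr: "P (restrict f (Rn n))" if "P f" for f by (rule cong[OF that]) simp
 show ?thesis
 proof (rule idealI[OF ring_Cinf])
  show "subgroup {f \<in> extensional (Rn n). P f} (add_monoid (Cinf n))"
  proof (rule R.add.subgroupI)
   show "{f \<in> extensional (Rn n). P f} \<subseteq> carrier (Cinf n)" using smooth by (auto simp: carrier_Cinf)
   have "(\<lambda>x\<in>Rn n. 0) \<in> {f \<in> extensional (Rn n). P f}" using restr[OF zero] by simp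
   then show "{f \<in> extensional (Rn n). P f} ~= {}" by blast
   fix f assume f: "f \<in> {f \<in> extensional (Rn n). P f}"
   then have "f \<in> carrier (Cinf n)" using smooth[of f] by (simp add: carrier_Cinf)
   then show "\<ominus>\<^bsub>Cinf n\<^esub> f \<in> {f \<in> extensional (Rn n). P f}"
    using restr[OF scale[of f "-1"]] f by (simp add: a_inv_Cinf)
   fix g assume "g \<in> {f \<in> extensional (Rn n). P f}"
   then show "f \<oplus>\<^bsub>Cinf n\<^esub> g \<in> {f \<in> extensional (Rn n). P f}"
    using restr[OF add[of f g]] f by (simp add: Cinf_simps)
  qed
  fix f h assume f: "f \<in> {f \<in> extensional (Rn n). P f}" and h: "h \<in> carrier (Cinf n)"
  then have sm: "csmooth n h" by (simp add: carrier_Cinf)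
  show "h \<otimes>\<^bsub>Cinf n\<^esub> f \<in> {f \<in> extensional (Rn n). P f}"
   using restr[OF mult[OF sm, of f]] f by (simp add: Cinf_simps)
  show "f \<otimes>\<^bsub>Cinf n\<^esub> h \<in> {f \<in> extensional (Rn n). P f}"
   using restr[OF mult_right[OF sm, of f]] f by (simp add: Cinf_simps)
 qed
qed

lemma max_ideal0_iff: "f \<in> max_ideal0 n \<longleftrightarrow> f \<in> extensional (Rn n) & csmooth n f & f (%_. 0) = 0"
 by (simp add: max_ideal0_def carrier_Cinf)

abbreviation mpow :: "nat => nat => (point => real) set" where
 "mpow n k \<equiv> (ideal_prod (Cinf n) (max_ideal0 n) ^^ k) (carrier (Cinf n))"

lemma monomial_in_mpow: "set w \<subseteq> {..<n} ==> restrict (monomial w) (Rn n) \<in> mpow n (length w)"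
proof (induction w)
 case Nil
 have "restrict (monomial []) (Rn n) \<in> carrier (Cinf n)" by (rule restrict_in_Cinf[OF csmooth_monomial])
 then show ?case by (simp only: list.size funpow_0)
next
 case (Cons i w)
 have 1: "(\<lambda>x\<in>Rn n. x i) \<in> max_ideal0 n" by (simp add: max_ideal0_iff)
 have "set w \<subseteq> {..<n}" using Cons.prems by simp
 note 2 = Cons.IH[OF this]
 have "restrict (monomial (i # w)) (Rn n) = (\<lambda>x\<in>Rn n. x i) \<otimes>\<^bsub>Cinf n\<^esub> restrict (monomial w) (Rn n)"
  unfolding Cinf_simps by (rule restrict_ext) simp
 also have "\<dots> \<in> ideal_prod (Cinf n) (max_ideal0 n) (mpow n (length w))" by (rule ideal_prod.prod[OF 1 2])
 finally show ?case by (simp only: length_Cons funpow.simps comp_apply)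
qed

lemma (in function_ideal) mpow_subset:
 assumes mon: "!!w. length w = k ==> set w \<subseteq> {..<n} ==> P (monomial w)"
  and f: "f \<in> mpow n k"
 shows "f \<in> carrier (Cinf n)" "P f"
proof -
 have "f \<in> carrier (Cinf n) & (ALL w. length w + j = k --> set w \<subseteq> {..<n} --> P (%x. f x * monomial w x))"
  if "f \<in> mpow n j" for j f using that
 proof (induction j arbitrary: f)
  case 0
  then have "csmooth n f" by (simp add: carrier_Cinf)
  with 0 show ?case using mult[OF _ mon] by simp
 next
  case (Suc j)
  from Suc.prems have "f \<in> ideal_prod (Cinf n) (max_ideal0 n) (mpow n j)" by simp
  then show ?case
  proof (induction rule: ideal_prod.induct)
   case (prod p q)
   have p: "csmooth n p" "p (%_. 0) = 0" using prod by (simp_all add: max_ideal0_iff)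
   have q: "csmooth n q" using Suc.IH[OF prod(2)] by (simp add: carrier_Cinf)
   have pw: "P (%x. (p \<otimes>\<^bsub>Cinf n\<^esub> q) x * monomial w x)" if w: "length w + Suc j = k" "set w \<subseteq> {..<n}" for w
   proof -
    have "P (%x. p x * (q x * monomial w x))"
    proof (rule hadamard_mult[OF p])
     fix i assume i: "i < n"
     have "P (%x. q x * monomial (i # w) x)"
      using conjunct2[OF Suc.IH[OF prod(2)], rule_format, of "i # w"] w i by simp
     from mult[OF csmooth_coordq[OF p(1) i] this]
     show "P (%x. (x i * coordq i p x) * (q x * monomial w x))" by (simp add: mult_ac)
    qed
    then show ?thesis by (rule cong) (simp add: Cinf_simps mult.assoc)
   qed
   have "(\<lambda>x\<in>Rn n. p x * q x) \<in> carrier (Cinf n)" by (intro restrict_in_Cinf csmooth_mult p(1) q)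
   then have "p \<otimes>\<^bsub>Cinf n\<^esub> q \<in> carrier (Cinf n)" by (simp only: Cinf_simps)
   then show ?case by (intro conjI allI impI pw)
  next
   case (sum f g)
   have pw: "P (%x. (f \<oplus>\<^bsub>Cinf n\<^esub> g) x * monomial w x)" if w: "length w + Suc j = k" "set w \<subseteq> {..<n}" for w
   proof -
    from add[OF conjunct2[OF sum.IH(1), rule_format, OF w] conjunct2[OF sum.IH(2), rule_format, OF w]] show ?thesis by (rule cong) (simp add: Cinf_simps distrib_right)
   qed
   have "csmooth n f" "csmooth n g"
    using conjunct1[OF sum.IH(1)] conjunct1[OF sum.IH(2)] by (simp_all only: carrier_Cinf)
   then have "(\<lambda>x\<in>Rn n. f x + g x) \<in> carrier (Cinf n)" by (intro restrict_in_Cinf csmooth_add)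
   then have "f \<oplus>\<^bsub>Cinf n\<^esub> g \<in> carrier (Cinf n)" by (simp only: Cinf_simps)
   then show ?case by (intro conjI allI impI pw)
  qed
 qed
 note * = this[OF f]
 show "f \<in> carrier (Cinf n)" by (rule conjunct1[OF *])
 from conjunct2[OF *, rule_format, of "[]"] show "P f" by simp
qed

definition wnull :: "weil_pres => (point => real) => bool" where
 "wnull W g \<longleftrightarrow> restrict g (Rn (wvars W)) \<in> wideal W"

lemma weil_function_ideal: "weil W ==> function_ideal (wvars W) (wnull W)"
 unfolding wnull_def by (rule function_ideal_of_ideal) (simp add: weil_def)

lemma weil_monomials:
 assumes "weil W"
 obtains k where "!!w. length w = k ==> set w \<subseteq> {..<wvars W} ==> wnull W (monomial w)"
proof -
 obtain k where "mpow (wvars W) k \<subseteq> wideal W" using assms by (auto simp: weil_def)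
 then have "wnull W (monomial w)" if "length w = k" "set w \<subseteq> {..<wvars W}" for w
  using monomial_in_mpow[OF that(2)] that(1) unfolding wnull_def by auto
 then show ?thesis by (rule that)
qed

lemma weilI:
 assumes I: "ideal (wideal W) (Cinf (wvars W))"
  and 0: "!!f. f \<in> wideal W ==> f (%_. 0) = 0"
  and mon: "!!w. length w = k ==> set w \<subseteq> {..<wvars W} ==> wnull W (monomial w)"
 shows "weil W" unfolding weil_def
proof (intro conjI exI[of _ k] subsetI I)
 interpret I: function_ideal "wvars W" "wnull W" unfolding wnull_def by (rule function_ideal_of_ideal[OF I])
 fix f
 show "f \<in> max_ideal0 (wvars W)" if "f \<in> wideal W"
  using ideal.Icarr[OF I that] 0[OF that] by (simp add: max_ideal0_def)
 assume f: "f \<in> mpow (wvars W) k"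
 note * = I.mpow_subset[OF mon f]
 show "f \<in> wideal W" using * by (simp add: wnull_def restrict_Cinf_id)
qed

locale weil_algebra =
 fixes W :: weil_pres
 assumes weil: "weil W"
begin

abbreviation "n \<equiv> wvars W"

sublocale N: function_ideal n "wnull W" by (rule weil_function_ideal[OF weil])

lemma ideal: "ideal (wideal W) (Cinf n)" using weil by (simp add: weil_def)

lemma wnull_at_0: assumes g: "wnull W g" shows "g (%_. 0) = 0"
proof -
 have "restrict g (Rn n) \<in> max_ideal0 n" using weil g unfolding weil_def wnull_def by blast
 then have "restrict g (Rn n) (%_. 0) = 0" by (simp only: max_ideal0_iff)
 then show ?thesis by simp
qed

lemma wideal_iff: "f \<in> wideal W \<longleftrightarrow> f \<in> extensional (Rn n) & wnull W f"
proof
 assume f: "f \<in> wideal W"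
 have "f \<in> carrier (Cinf n)" by (rule ideal.Icarr[OF ideal f])
 then show "f \<in> extensional (Rn n) & wnull W f" using f by (simp add: wnull_def restrict_Cinf_id) (simp add: carrier_Cinf)
next
 assume *: "f \<in> extensional (Rn n) & wnull W f"
 then have "restrict f (Rn n) = f" by (simp add: extensional_restrict)
 then show "f \<in> wideal W" using * by (simp add: wnull_def)
qed

end

definition wc :: "weil_pres => (point => real) => welem" where
 "wc W g = wcls W (restrict g (Rn (wvars W)))"

lemma wcls_eq_wc: "g \<in> carrier (Cinf (wvars W)) ==> wcls W g = wc W g" by (simp add: wc_def restrict_Cinf_id)

lemma wconst_eq_wc: "wconst W r = wc W (%_. r)" by (simp add: wconst_def wc_def)

lemma wc_cong: "(!!x. x \<in> Rn (wvars W) ==> f x = g x) ==> wc W f = wc W g"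
 unfolding wc_def by (simp cong: restrict_cong)

context weil_algebra
begin

lemma wc_eq_iff:
 assumes f: "csmooth n f" and g: "csmooth n g"
 shows "wc W f = wc W g \<longleftrightarrow> wnull W (%x. f x - g x)"
proof -
 interpret R: cring "Cinf n" by (rule cring_Cinf)
 have "restrict f (Rn n) \<ominus>\<^bsub>Cinf n\<^esub> restrict g (Rn n) = (\<lambda>x\<in>Rn n. f x - g x)"
  using f g by (simp add: a_minus_Cinf restrict_in_Cinf cong: restrict_cong)
 with R.quotient_eq_iff_same_a_r_cos[OF ideal restrict_in_Cinf[OF f] restrict_in_Cinf[OF g]]
 show ?thesis by (simp add: wc_def wcls_def wnull_def)
qed

lemma wc_zero_iff: "csmooth n f ==> wc W f = wc W (%_. 0) \<longleftrightarrow> wnull W f" by (simp add: wc_eq_iff)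

lemma carrier_weil_alg: "carrier (weil_alg W) = {wc W g | g. csmooth n g}"
proof -
 have "carrier (weil_alg W) = {wcls W g | g. g \<in> carrier (Cinf n)}"
  by (auto simp: weil_alg_def FactRing_def A_RCOSETS_def' wcls_def)
 also have "\<dots> = {wc W g | g. csmooth n g}"
 proof (intro equalityI subsetI)
  fix a assume "a \<in> {wcls W g | g. g \<in> carrier (Cinf n)}"
  then obtain g where "g \<in> carrier (Cinf n)" "a = wcls W g" by auto
  then show "a \<in> {wc W g | g. csmooth n g}" by (auto simp: wcls_eq_wc carrier_Cinf)
 next
  fix a assume "a \<in> {wc W g | g. csmooth n g}"
  then obtain g where "csmooth n g" "a = wc W g" by auto
  then show "a \<in> {wcls W g | g. g \<in> carrier (Cinf n)}" using restrict_in_Cinf unfolding wc_def by blast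
 qed
 finally show ?thesis .
qed

lemma wc_carrier: "csmooth n g ==> wc W g \<in> carrier (weil_alg W)" by (auto simp: carrier_weil_alg)

lemma wc_cases:
 assumes "a \<in> carrier (weil_alg W)" obtains g where "csmooth n g" "a = wc W g"
 using assms by (auto simp: carrier_weil_alg)

lemma wc_add:
 assumes f: "csmooth n f" and g: "csmooth n g"
 shows "wc W f \<oplus>\<^bsub>weil_alg W\<^esub> wc W g = wc W (%x. f x + g x)"
 using ideal.a_rcos_sum[OF ideal restrict_in_Cinf[OF f] restrict_in_Cinf[OF g]]
 by (simp add: wc_def wcls_def weil_alg_def FactRing_def Cinf_simps cong: restrict_cong)

lemma wc_mult:
 assumes f: "csmooth n f" and g: "csmooth n g"
 shows "wc W f \<otimes>\<^bsub>weil_alg W\<^esub> wc W g = wc W (%x. f x * g x)"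
 using ideal.rcoset_mult_add[OF ideal restrict_in_Cinf[OF f] restrict_in_Cinf[OF g]]
 by (simp add: wc_def wcls_def weil_alg_def FactRing_def Cinf_simps cong: restrict_cong)

lemma wc_one: "\<one>\<^bsub>weil_alg W\<^esub> = wc W (%_. 1)"
 by (simp add: wc_def wcls_def weil_alg_def FactRing_def Cinf_simps)

section \<open>Functionals on a Weil algebra\<close>

abbreviation "ann \<equiv> annihilator n (wnull W)"

lemma ann_of_functional:
 assumes l: "weil_functional W l" shows "ann (%g. l (wc W g))" unfolding annihilator_def
proof (intro conjI allI impI)
 have lin: "l (a \<oplus>\<^bsub>weil_alg W\<^esub> b) = l a + l b" "l (wconst W r \<otimes>\<^bsub>weil_alg W\<^esub> a) = r * l a"
  if "a \<in> carrier (weil_alg W)" "b \<in> carrier (weil_alg W)" for a b r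
  using l that by (auto simp: weil_functional_def)
 fix f g assume f: "csmooth n f"
 show sc: "l (wc W (%x. c * f x)) = c * l (wc W f)" for c
  using lin(2)[OF wc_carrier[OF f] wc_carrier[OF f], of c] f by (simp add: wconst_eq_wc wc_mult)
 assume g: "csmooth n g"
 show "l (wc W (%x. f x + g x)) = l (wc W f) + l (wc W g)"
  using lin(1)[OF wc_carrier[OF f] wc_carrier[OF g]] f g by (simp add: wc_add)
next
 fix f assume f: "wnull W f"
 have "wc W f = wc W (%_. 0)" using wc_zero_iff[OF N.smooth[OF f]] f by simp
 moreover have "l (wconst W 0 \<otimes>\<^bsub>weil_alg W\<^esub> wc W (%_. 0)) = 0 * l (wc W (%_. 0))"
  using l wc_carrier[OF csmooth_const, of 0] unfolding weil_functional_def by blast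
 then have "l (wc W (%_. 0)) = 0" by (simp add: wconst_eq_wc wc_mult)
 ultimately show "l (wc W f) = 0" by simp
qed

lemma ann_eq:
 assumes L: "ann L" and f: "csmooth n f" and g: "csmooth n g" and eq: "wc W f = wc W g"
 shows "L f = L g"
 using annihilator_diff[OF L f g] annihilatorD(3)[OF L, of "%x. f x - g x"] wc_eq_iff[OF f g] eq by simp

lemma ann_cong:
 assumes L: "ann L" and f: "csmooth n f" and fg: "!!x. x \<in> Rn n ==> f x = g x"
 shows "L f = L g"
proof -
 have "csmooth n g" using f csmooth_cong[of n f g] fg by simp
 then show ?thesis using ann_eq[OF L f _ wc_cong] fg by simp
qed

lemma functional_of_ann:
 assumes L: "ann L"
 obtains l where "weil_functional W l" "ALL g. csmooth n g --> l (wc W g) = L g"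
proof -
 define l where "l a = L (SOME g. csmooth n g & a = wc W g)" for a
 have l: "l (wc W g) = L g" if g: "csmooth n g" for g
 proof -
  have "csmooth n (SOME h. csmooth n h & wc W g = wc W h) &
    wc W g = wc W (SOME h. csmooth n h & wc W g = wc W h)"
   by (rule someI[of "%h. csmooth n h & wc W g = wc W h" g]) (simp add: g)
  then show ?thesis unfolding l_def using ann_eq[OF L _ g] by simp
 qed
 have "weil_functional W l" unfolding weil_functional_def
 proof (intro conjI ballI allI)
  fix a b r assume "a \<in> carrier (weil_alg W)"
  then obtain f where f: "csmooth n f" "a = wc W f" by (rule wc_cases)
  show "l (wconst W r \<otimes>\<^bsub>weil_alg W\<^esub> a) = r * l a" for r
   using f by (simp add: wconst_eq_wc wc_mult l csmooth_scale annihilatorD(2)[OF L])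
  assume "b \<in> carrier (weil_alg W)"
  then obtain g where g: "csmooth n g" "b = wc W g" by (rule wc_cases)
  show "l (a \<oplus>\<^bsub>weil_alg W\<^esub> b) = l a + l b"
   using f g by (simp add: wc_add l csmooth_add annihilatorD(1)[OF L])
 qed
 then show ?thesis by (rule that) (intro allI impI l)
qed

lemma weil_space_curve_iff:
 assumes g: "!!t. csmooth n (g t)"
 shows "(%t. wc W (g t)) \<in> curves (weil_space W) \<longleftrightarrow> (ALL L. ann L --> smooth_real (%t. L (g t)))"
proof
 assume *: "(%t. wc W (g t)) \<in> curves (weil_space W)"
 show "ALL L. ann L --> smooth_real (%t. L (g t))"
 proof (intro allI impI)
  fix L assume "ann L"
  then obtain l where l: "weil_functional W l" "ALL g. csmooth n g --> l (wc W g) = L g" by (rule functional_of_ann)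
  have "smooth_real (l \<circ> (%t. wc W (g t)))" using * l(1) by (simp add: weil_space_def fs_of_curves_def)
  then show "smooth_real (%t. L (g t))" using l(2)[rule_format, OF g] by (simp add: o_def)
 qed
next
 assume *: "ALL L. ann L --> smooth_real (%t. L (g t))"
 then show "(%t. wc W (g t)) \<in> curves (weil_space W)"
  using ann_of_functional by (auto simp: weil_space_def fs_of_curves_def o_def wc_carrier g)
qed

lemma weil_dual_basis:
 obtains N e \<Lambda> where "dual_system n (wnull W) N e \<Lambda>"
proof -
 obtain k where k: "!!w. length w = k ==> set w \<subseteq> {..<n} ==> wnull W (monomial w)"
  by (rule weil_monomials[OF weil]) blast
 have "EX B. finite B & (\<forall>b\<in>B. csmooth n b) & (ALL g. csmooth n g --> span_mod (wnull W) B g)"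
  by (rule finite_span_mod[OF N.function_space_axioms]) (rule N.mult_right[OF _ k])
 then obtain B where B: "finite B" "\<forall>b\<in>B. csmooth n b" "ALL g. csmooth n g --> span_mod (wnull W) B g"
  by (elim exE conjE) (rule that)
 from dual_basis[OF B(1) N.function_space_axioms B(2,3)] obtain N :: nat and e \<Lambda> where
  D: "dual_system n (wnull W) N e \<Lambda>" by (elim exE)
 show ?thesis by (rule that[OF D])
qed

lemma ann_separates:
 assumes g: "csmooth n g" and L: "!!L. ann L ==> L g = 0"
 shows "wnull W g"
proof -
 obtain N e \<Lambda> where d: "dual_system n (wnull W) N e \<Lambda>" by (rule weil_dual_basis)
 have "\<Lambda> j g = 0" if "j < N" for j by (rule L[OF dual_systemD(2)[OF d that]])
 then have z: "(\<Sum>j<N. \<Lambda> j g * e j x) = 0" for x by (intro sum.neutral) simp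
 show ?thesis by (rule N.cong[OF dual_systemD(3)[OF d g]]) (simp add: z)
qed

lemma wnull_diff_iff:
 assumes f: "csmooth n f" and g: "csmooth n g"
 shows "wnull W (%x. f x - g x) \<longleftrightarrow> (ALL L. ann L --> L f = L g)"
proof
 assume w: "wnull W (%x. f x - g x)"
 show "ALL L. ann L --> L f = L g"
 proof (intro allI impI)
  fix L assume L: "ann L"
  have "L (%x. f x - g x) = 0" by (rule annihilatorD(3)[OF L, OF w])
  then show "L f = L g" by (simp add: annihilator_diff[OF L f g])
 qed
next
 assume eq: "ALL L. ann L --> L f = L g"
 show "wnull W (%x. f x - g x)"
 proof (rule ann_separates[OF csmooth_diff[OF f g]])
  fix L assume L: "ann L"
  have "L f = L g" by (rule eq[rule_format, OF L])
  then show "L (%x. f x - g x) = 0" by (simp add: annihilator_diff[OF L f g])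
 qed
qed

text \<open>The ideal contains a power of the coordinates, so its annihilators see only a jet of fixed order.\<close>

lemma ann_jet:
 obtains k where "ALL L. ann L --> jet_functional n k L"
proof -
 obtain k where k: "!!w. length w = k ==> set w \<subseteq> {..<n} ==> wnull W (monomial w)"
  by (rule weil_monomials[OF weil]) blast
 have "jet_functional n k L" if L: "ann L" for L unfolding jet_functional_def
 proof (intro conjI allI impI)
  fix f g c assume f: "csmooth n f"
  show "L (%x. c * f x) = c * L f" by (rule annihilatorD(2)[OF L f])
  show "L f = L g" if "\<forall>x\<in>Rn n. f x = g x" by (rule ann_cong[OF L f]) (use that in simp)
  show "L (%x. f x + g x) = L f + L g" if "csmooth n g" by (rule annihilatorD(1)[OF L f that])
 next
  fix w :: "nat list" and g assume "length w = k" "set w \<subseteq> {..<n}" "csmooth n g"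
  then show "L (%x. monomial w x * g x) = 0" by (intro annihilatorD(3)[OF L] N.mult_right k)
 qed
 then show ?thesis by (intro that[of k] allI impI)
qed

lemma ann_family:
 assumes "ann L" "smooth_family n H"
 shows "smooth_real (%s. L (H s))"
  and "smooth_functional \<mu> ==> \<mu> (%s. L (H s)) = L (%x. \<mu> (%s. H s x))"
proof -
 obtain k where k: "ALL L. ann L --> jet_functional n k L" by (rule ann_jet)
 note c = jet_functional_family[OF k[rule_format, OF assms(1)] assms(2)]
 show "smooth_real (%s. L (H s))" by (rule conjunct1[OF c])
 show "\<mu> (%s. L (H s)) = L (%x. \<mu> (%s. H s x))" if "smooth_functional \<mu>" by (rule conjunct2[OF c, rule_format, OF that])
qed

text \<open>If all members of a family vanish in the Weil algebra, so does the diagonal: in the expansion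
  in powers of \<open>\<theta>(x) - \<theta>(0)\<close> all coefficients are in the ideal, which is closed, and the remainder is
  there because \<open>\<theta>(x) - \<theta>(0)\<close> is nilpotent.\<close>

lemma wnull_diagonal:
 assumes H: "smooth_family n H" and null: "!!s. wnull W (H s)" and \<theta>: "csmooth n \<theta>"
 shows "wnull W (%x. H (\<theta> x) x)"
proof -
 obtain k where k: "!!w. length w = k ==> set w \<subseteq> {..<n} ==> wnull W (monomial w)"
  by (rule weil_monomials[OF weil]) blast
 define d where "d x = \<theta> x - \<theta> (%_. 0)" for x
 have d: "csmooth n d" unfolding d_def by (intro csmooth_diff \<theta> csmooth_const)
 have diag: "csmooth n (%x. K (d x) x)" if K: "smooth_family n K" for K unfolding csmooth_def
 proof (intro allI impI)
  fix c assume c: "curve_Rn n c"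
  have "smooth_real (%u. d (c u))" using d c by (simp add: csmooth_def)
  from smooth_familyD[OF K this c] show "smooth_real (%u. K (d (c u)) (c u))" .
 qed
 have main: "wnull W (%x. d x ^ j * K (d x) x)" if "j \<le> k" "smooth_family n K" "!!s. wnull W (K s)" for j K
  using that
 proof (induction "k - j" arbitrary: j K)
  case 0
  then have "j = k" by simp
  moreover have "wnull W (%x. d x ^ k)" by (rule N.nilpotent[OF k d]) (simp_all add: d_def)
  ultimately show ?case using N.mult_right[OF diag[OF 0(3)]] by simp
 next
  case (Suc m)
  define Q where "Q s x = hadq (%t. K t x) s" for s x
  have Q: "smooth_family n Q" unfolding smooth_family_def
  proof (intro allI impI)
   fix a c assume a: "smooth_real a" and c: "curve_Rn n c"
   have "smooth2 (%u t. K t (c u))" by (rule smooth2_swap[OF smooth_family_curve2[OF Suc.prems(2) c]])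
   from smooth2D[OF smooth2_hadq[OF this] smooth_real_id a]
   show "smooth_real (%u. Q (a u) (c u))" by (simp add: Q_def)
  qed
  have Qoff: "wnull W (Q s)" if "s ~= 0" for s
  proof -
   have "wnull W (%x. (1 / s) * (K s x - K 0 x))" by (rule N.scale[OF N.diff[OF Suc.prems(3) Suc.prems(3)]])
   moreover have "Q s = (%x. (1 / s) * (K s x - K 0 x))" using that by (simp add: Q_def hadq_def fun_eq_iff)
   ultimately show ?thesis by simp
  qed
  have Q0: "wnull W (Q s)" for s
  proof (rule ann_separates[OF smooth_family_slice[OF Q]])
   fix L assume L: "ann L"
   have "(%s. L (Q s)) s = (%s. 0) s" by (rule eq_at_0_if_eq_off_0[of "%s. L (Q s)" "%s. 0"])
      (simp_all add: ann_family(1)[OF L Q] annihilatorD(3)[OF L, OF Qoff])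
   then show "L (Q s) = 0" .
  qed
  have 1: "wnull W (%x. d x ^ Suc j * Q (d x) x)" by (rule Suc.hyps(1)[OF _ _ Q Q0]) (use Suc.hyps(2) in simp_all)
  have 2: "wnull W (%x. d x ^ j * K 0 x)" by (rule N.mult[OF csmooth_power[OF d] Suc.prems(3)])
  show ?case
  proof (rule N.cong[OF N.add[OF 1 2]])
   fix x
   have "K (d x) x = K 0 x + d x * Q (d x) x" unfolding Q_def by (rule hadq_eq)
   then show "d x ^ Suc j * Q (d x) x + d x ^ j * K 0 x = d x ^ j * K (d x) x" by (simp add: algebra_simps)
  qed
 qed
 have fam: "smooth_family n (%s. H (s + \<theta> (%_. 0)))" unfolding smooth_family_def
 proof (intro allI impI)
  fix a c assume a: "smooth_real a" and c: "curve_Rn n c"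
  show "smooth_real (%u. H (a u + \<theta> (%_. 0)) (c u))"
   by (rule smooth_familyD[OF H smooth_real_add[OF a smooth_real_const] c])
 qed
 from main[of 0 "%s. H (s + \<theta> (%_. 0))", OF le0 fam null]
 show ?thesis by (simp add: d_def)
qed

end

section \<open>Homomorphisms of Weil algebras\<close>

lemma curves_fs_Rn: "curves (fs_Rn n) = {c. curve_Rn n c}" by (auto simp: fs_Rn_def fs_of_curves_def curve_Rn_def)

lemma carrier_fs_Rn [simp]: "carrier (fs_Rn n) = Rn n" by (simp add: fs_Rn_def fs_of_curves_def)

lemma smooth_maps_Rn_iff:
 "Theta \<in> smooth_maps (fs_Rn m) (fs_Rn n) \<longleftrightarrow>
   Theta \<in> Rn m \<rightarrow>\<^sub>E Rn n & (ALL c. curve_Rn m c --> curve_Rn n (%u. Theta (c u)))"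
 by (simp add: smooth_maps_def curves_fs_Rn o_def)

lemma smooth_maps_Rn_closed: "Theta \<in> smooth_maps (fs_Rn m) (fs_Rn n) ==> x \<in> Rn m ==> Theta x \<in> Rn n"
 unfolding smooth_maps_Rn_iff by (blast dest: PiE_mem)

lemma smooth_maps_Rn_comp:
 assumes "Theta \<in> smooth_maps (fs_Rn m) (fs_Rn n)" "csmooth n g"
 shows "csmooth m (%x. g (Theta x))" using assms unfolding smooth_maps_Rn_iff csmooth_def by simp

lemma smooth_maps_RnI:
 assumes t: "!!i. i < n ==> csmooth m (t i)"
 shows "(\<lambda>x\<in>Rn m. %i. if i < n then t i x else 0) \<in> smooth_maps (fs_Rn m) (fs_Rn n)"
 unfolding smooth_maps_Rn_iff
proof (intro conjI allI impI)
 show "(\<lambda>x\<in>Rn m. %i. if i < n then t i x else 0) \<in> Rn m \<rightarrow>\<^sub>E Rn n" by (auto simp: Rn_def)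
 fix c assume c: "curve_Rn m c"
 then have cR: "c u \<in> Rn m" for u by (simp add: curve_Rn_def)
 show "curve_Rn n (%u. (\<lambda>x\<in>Rn m. %i. if i < n then t i x else 0) (c u))" unfolding curve_Rn_def
 proof (intro conjI allI impI)
  show "(\<lambda>x\<in>Rn m. %i. if i < n then t i x else 0) (c u) \<in> Rn n" for u using cR by (simp add: Rn_def)
  fix i assume i: "i < n"
  have "smooth_real (%u. t i (c u))" using t[OF i] c by (simp add: csmooth_def)
  then show "smooth_real (%u. (\<lambda>x\<in>Rn m. %i. if i < n then t i x else 0) (c u) i)" using cR i by simp
 qed
qed

lemma induces_hom_iff:
 "induces_hom V W Theta phi \<longleftrightarrow> Theta \<in> smooth_maps (fs_Rn (wvars W)) (fs_Rn (wvars V)) &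
   Theta (%_. 0) = (%_. 0) &
   (ALL g. csmooth (wvars V) g --> phi (wc V g) = wc W (%x. g (Theta x)))"
proof (cases "Theta \<in> smooth_maps (fs_Rn (wvars W)) (fs_Rn (wvars V))")
 case True
 have eq: "wcls W (compose (Rn (wvars W)) (restrict g (Rn (wvars V))) Theta) = wc W (%x. g (Theta x))" for g
  unfolding wc_def compose_def
  by (rule arg_cong[where f = "wcls W"], rule restrict_ext) (simp add: smooth_maps_Rn_closed[OF True])
 have "(\<forall>g\<in>carrier (Cinf (wvars V)). phi (wcls V g) = wcls W (compose (Rn (wvars W)) g Theta)) \<longleftrightarrow>
   (ALL g. csmooth (wvars V) g --> phi (wc V g) = wc W (%x. g (Theta x)))"
 proof (intro iffI allI impI ballI)
  fix g assume *: "\<forall>g\<in>carrier (Cinf (wvars V)). phi (wcls V g) = wcls W (compose (Rn (wvars W)) g Theta)"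
   and g: "csmooth (wvars V) g"
  from bspec[OF * restrict_in_Cinf[OF g]] show "phi (wc V g) = wc W (%x. g (Theta x))"
   unfolding eq by (simp only: wc_def)
 next
  fix g assume *: "ALL g. csmooth (wvars V) g --> phi (wc V g) = wc W (%x. g (Theta x))"
   and g: "g \<in> carrier (Cinf (wvars V))"
  have "csmooth (wvars V) g" using g by (simp add: carrier_Cinf)
  with * have "phi (wc V g) = wc W (%x. g (Theta x))" by simp
  then show "phi (wcls V g) = wcls W (compose (Rn (wvars W)) g Theta)"
   using eq[of g] by (simp add: wc_def restrict_Cinf_id[OF g])
 qed
 then show ?thesis by (simp add: induces_hom_def)
qed (simp add: induces_hom_def)

locale weil_pair = V: weil_algebra V + W: weil_algebra W for V W
begin

lemma weil_hom_closed: "phi \<in> weil_hom V W ==> a \<in> carrier (weil_alg V) ==> phi a \<in> carrier (weil_alg W)"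
 by (auto simp: weil_hom_def intro: ring_hom_closed)

lemma weil_hom_add:
 assumes "phi \<in> weil_hom V W" and f: "csmooth V.n f" and g: "csmooth V.n g"
 shows "phi (wc V (%x. f x + g x)) = phi (wc V f) \<oplus>\<^bsub>weil_alg W\<^esub> phi (wc V g)"
proof -
 have "phi \<in> ring_hom (weil_alg V) (weil_alg W)" using assms(1) by (simp add: weil_hom_def)
 from ring_hom_add[OF this V.wc_carrier[OF f] V.wc_carrier[OF g]]
 show ?thesis by (simp add: V.wc_add f g)
qed

lemma weil_hom_mult:
 assumes "phi \<in> weil_hom V W" and f: "csmooth V.n f" and g: "csmooth V.n g"
 shows "phi (wc V (%x. f x * g x)) = phi (wc V f) \<otimes>\<^bsub>weil_alg W\<^esub> phi (wc V g)"
proof -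
 have "phi \<in> ring_hom (weil_alg V) (weil_alg W)" using assms(1) by (simp add: weil_hom_def)
 from ring_hom_mult[OF this V.wc_carrier[OF f] V.wc_carrier[OF g]]
 show ?thesis by (simp add: V.wc_mult f g)
qed

lemma weil_hom_const: "phi \<in> weil_hom V W ==> phi (wc V (%_. r)) = wc W (%_. r)"
 by (simp add: weil_hom_def wconst_eq_wc)

lemma weil_hom_null:
 assumes "phi \<in> weil_hom V W" and f: "wnull V f" shows "phi (wc V f) = wc W (%_. 0)"
 using V.wc_zero_iff[OF V.N.smooth[OF f]] f weil_hom_const[OF assms(1), of 0] by simp

text \<open>Choosing representatives of the images of the coordinates gives a map that induces the
  homomorphism on polynomials; both sides vanish on high powers of the coordinates.\<close>

theorem weil_hom_induced:
 assumes phi: "phi \<in> weil_hom V W"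
 shows "EX Theta. induces_hom V W Theta phi"
proof -
 have "ALL i. EX g. csmooth W.n g & phi (wc V (%x. x i)) = wc W g"
 proof
  fix i
  have "phi (wc V (%x. x i)) \<in> carrier (weil_alg W)" by (intro weil_hom_closed[OF phi] V.wc_carrier csmooth_coord)
  then show "EX g. csmooth W.n g & phi (wc V (%x. x i)) = wc W g" by (auto simp: W.carrier_weil_alg)
 qed
 from choice[OF this] obtain t where t: "ALL i. csmooth W.n (t i) & phi (wc V (%x. x i)) = wc W (t i)" ..
 define Theta where "Theta = (\<lambda>x\<in>Rn W.n. %i. if i < V.n then t i x else 0)"
 have Theta: "Theta \<in> smooth_maps (fs_Rn W.n) (fs_Rn V.n)"
  unfolding Theta_def by (rule smooth_maps_RnI) (simp add: t)
 note comp = smooth_maps_Rn_comp[OF Theta]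
 define Q where "Q g \<longleftrightarrow> phi (wc V g) = wc W (%x. g (Theta x))" for g
 have Qcong: "Q g" if "Q f" and fg: "!!x. x \<in> Rn V.n ==> f x = g x" for f g
 proof -
  have "wc V g = wc V f" by (rule wc_cong) (simp add: fg)
  moreover have "wc W (%x. g (Theta x)) = wc W (%x. f (Theta x))"
   by (rule wc_cong) (simp add: fg smooth_maps_Rn_closed[OF Theta])
  ultimately show ?thesis using \<open>Q f\<close> by (simp add: Q_def)
 qed
 have Qconst: "Q (%_. c)" for c by (simp add: Q_def weil_hom_const[OF phi])
 have Qcoord: "Q (%x. x i)" if "i < V.n" for i
 proof -
  have "wc W (%x. Theta x i) = wc W (t i)" by (rule wc_cong) (simp add: Theta_def that)
  then show ?thesis using t by (simp add: Q_def)
 qed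
 have Qadd: "Q (%x. f x + g x)" if "csmooth V.n f" "csmooth V.n g" "Q f" "Q g" for f g
  using that by (simp add: Q_def weil_hom_add[OF phi] W.wc_add comp)
 have Qmult: "Q (%x. f x * g x)" if "csmooth V.n f" "csmooth V.n g" "Q f" "Q g" for f g
  using that by (simp add: Q_def weil_hom_mult[OF phi] W.wc_mult comp)
 have Qmon: "Q (monomial w)" if "set w \<subseteq> {..<V.n}" for w using that
 proof (induction w)
  case Nil
  then show ?case by (simp add: Qconst)
 next
  case (Cons i w)
  then show ?case using Qmult[of "%x. x i" "monomial w"] Qcoord[of i] by simp
 qed
 have null: "wnull W (%x. g (Theta x))" if "Q g" "wnull V g" for g
 proof -
  have "wc W (%x. g (Theta x)) = wc W (%_. 0)" using that weil_hom_null[OF phi] by (simp add: Q_def)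
  then show ?thesis using W.wc_zero_iff[OF comp[OF V.N.smooth[OF that(2)]]] by simp
 qed
 obtain k where k: "!!w. length w = k ==> set w \<subseteq> {..<V.n} ==> wnull V (monomial w)"
  by (rule weil_monomials[OF V.weil]) blast
 have all: "Q g" if g: "csmooth V.n g" for g
 proof (rule polynomial_induct[OF g, of Q k])
  fix w g assume w: "length w = k" "set w \<subseteq> {..<V.n}" and g: "csmooth V.n g"
  have 1: "wnull W (%x. monomial w (Theta x) * g (Theta x))"
   by (rule W.N.mult_right[OF comp[OF g] null[OF Qmon[OF w(2)] k[OF w]]])
  have 2: "wnull V (%x. monomial w x * g x)" by (rule V.N.mult_right[OF g k[OF w]])
  show "Q (%x. monomial w x * g x)" unfolding Q_def weil_hom_null[OF phi 2]
   using W.wc_zero_iff[OF W.N.smooth[OF 1]] 1 by simp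
 qed (fact Qcong Qconst Qcoord Qadd Qmult)+
 have "Theta (%_. 0) i = 0" for i
 proof (cases "i < V.n")
  case True
  have Qp: "Q (%x. x i ^ k)" by (rule all) (rule csmooth_power[OF csmooth_coord])
  have "wnull V (%x. x i ^ k)" by (rule V.N.nilpotent[OF k]) simp_all
  from W.wnull_at_0[OF null[OF Qp this]] show ?thesis by simp
 next
  case False
  then show ?thesis by (simp add: Theta_def)
 qed
 then have "Theta (%_. 0) = (%_. 0)" by (rule ext)
 with Theta all show ?thesis unfolding induces_hom_iff Q_def by (intro exI[of _ Theta] conjI allI impI)
qed

text \<open>The coordinates generate, because smooth functions are polynomials modulo the ideal.\<close>

lemma weil_hom_eqI:
 assumes phi: "phi \<in> weil_hom V W" and \<psi>: "\<psi> \<in> weil_hom V W"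
  and eq: "!!i. i < V.n ==> phi (wc V (%x. x i)) = \<psi> (wc V (%x. x i))"
 shows "phi = \<psi>"
proof -
 obtain k where k: "!!w. length w = k ==> set w \<subseteq> {..<V.n} ==> wnull V (monomial w)"
  by (rule weil_monomials[OF V.weil]) blast
 have all: "phi (wc V g) = \<psi> (wc V g)" if g: "csmooth V.n g" for g
 proof (rule polynomial_induct[OF g, of "%g. phi (wc V g) = \<psi> (wc V g)" k])
  show "phi (wc V g) = \<psi> (wc V g)"
   if "phi (wc V f) = \<psi> (wc V f)" "!!x. x \<in> Rn V.n ==> f x = g x" for f g
   using that(1) wc_cong[of V f g] that(2) by simp
  fix w g assume w: "length w = k" "set w \<subseteq> {..<V.n}" and g: "csmooth V.n g"
  have "wnull V (%x. monomial w x * g x)" by (rule V.N.mult_right[OF g k[OF w]])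
  then show "phi (wc V (%x. monomial w x * g x)) = \<psi> (wc V (%x. monomial w x * g x))"
   by (simp add: weil_hom_null[OF phi] weil_hom_null[OF \<psi>])
 qed (simp_all add: weil_hom_const[OF phi] weil_hom_const[OF \<psi>] weil_hom_add[OF phi] weil_hom_add[OF \<psi>]
   weil_hom_mult[OF phi] weil_hom_mult[OF \<psi>] eq)
 show ?thesis
 proof (rule extensionalityI[of _ "carrier (weil_alg V)"])
  show "phi \<in> extensional (carrier (weil_alg V))" "\<psi> \<in> extensional (carrier (weil_alg V))"
   using phi \<psi> by (simp_all add: weil_hom_def)
  fix a assume "a \<in> carrier (weil_alg V)"
  then obtain g where "csmooth V.n g" "a = wc V g" by (rule V.wc_cases)
  then show "phi a = \<psi> a" using all by simp
 qed
qed

lemma induces_null: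
 assumes phi: "phi \<in> weil_hom V W" and Theta: "induces_hom V W Theta phi" and g: "wnull V g"
 shows "wnull W (%x. g (Theta x))"
proof -
 note sm = V.N.smooth[OF g]
 have "wc W (%x. g (Theta x)) = wc W (%_. 0)" using Theta sm weil_hom_null[OF phi g] by (simp add: induces_hom_iff)
 moreover have "csmooth W.n (%x. g (Theta x))"
  by (rule smooth_maps_Rn_comp[OF _ sm]) (use Theta in \<open>simp add: induces_hom_iff\<close>)
 ultimately show ?thesis using W.wc_zero_iff by blast
qed

lemma ex_induced_hom:
 assumes Theta: "Theta \<in> smooth_maps (fs_Rn W.n) (fs_Rn V.n)" and 0: "Theta (%_. 0) = (%_. 0)"
  and null: "!!g. wnull V g ==> wnull W (%x. g (Theta x))"
 shows "\<exists>phi\<in>weil_hom V W. induces_hom V W Theta phi"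
proof -
 note comp = smooth_maps_Rn_comp[OF Theta]
 define phi where "phi = (\<lambda>a\<in>carrier (weil_alg V). wc W (%x. (SOME g. csmooth V.n g & a = wc V g) (Theta x)))"
 have phi: "phi (wc V g) = wc W (%x. g (Theta x))" if g: "csmooth V.n g" for g
 proof -
  define h where "h = (SOME h. csmooth V.n h & wc V g = wc V h)"
  have h: "csmooth V.n h & wc V g = wc V h"
   unfolding h_def by (rule someI[of "%h. csmooth V.n h & wc V g = wc V h" g]) (simp add: g)
  then have "wnull V (%x. g x - h x)" using V.wc_eq_iff[OF g, of h] by simp
  from null[OF this] have "wc W (%x. g (Theta x)) = wc W (%x. h (Theta x))"
   using W.wc_eq_iff[OF comp[OF g] comp[of h]] h by simp
  then show ?thesis by (simp add: phi_def V.wc_carrier[OF g] h_def)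
 qed
 have "phi \<in> ring_hom (weil_alg V) (weil_alg W)"
 proof (rule ring_hom_memI)
  fix a b assume "a \<in> carrier (weil_alg V)"
  then obtain f where f: "csmooth V.n f" "a = wc V f" by (rule V.wc_cases)
  then show "phi a \<in> carrier (weil_alg W)" by (simp add: phi W.wc_carrier comp)
  assume "b \<in> carrier (weil_alg V)"
  then obtain g where g: "csmooth V.n g" "b = wc V g" by (rule V.wc_cases)
  show "phi (a \<otimes>\<^bsub>weil_alg V\<^esub> b) = phi a \<otimes>\<^bsub>weil_alg W\<^esub> phi b"
   using f g by (simp add: V.wc_mult W.wc_mult phi comp csmooth_mult)
  show "phi (a \<oplus>\<^bsub>weil_alg V\<^esub> b) = phi a \<oplus>\<^bsub>weil_alg W\<^esub> phi b"
   using f g by (simp add: V.wc_add W.wc_add phi comp csmooth_add)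
 next
  show "phi \<one>\<^bsub>weil_alg V\<^esub> = \<one>\<^bsub>weil_alg W\<^esub>" by (simp add: V.wc_one W.wc_one phi)
 qed
 moreover have "phi \<in> extensional (carrier (weil_alg V))" by (simp add: phi_def)
 ultimately have "phi \<in> weil_hom V W" by (simp add: weil_hom_def wconst_eq_wc phi)
 moreover have "induces_hom V W Theta phi" using Theta 0 by (simp add: induces_hom_iff phi)
 ultimately show ?thesis by blast
qed

end

section \<open>Tensor products\<close>

lemma wvars_tensor [simp]: "wvars (V \<otimes>\<^sub>W W) = wvars V + wvars W" by (simp add: weil_tensor_def Let_def)

lemma pr_left_Rn: "x \<in> Rn (n + m) ==> pr_left n x \<in> Rn n"
 and pr_right_Rn: "x \<in> Rn (n + m) ==> pr_right n x \<in> Rn m"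
 and join_Rn: "a \<in> Rn n ==> b \<in> Rn m ==> join n a b \<in> Rn (n + m)"
 by (simp_all add: Rn_def pr_left_def pr_right_def join_def)

lemma pr_join [simp]: "a \<in> Rn n ==> pr_left n (join n a b) = a" "pr_right n (join n a b) = b"
 by (auto simp: pr_left_def pr_right_def join_def Rn_def fun_eq_iff)

lemma csmooth_pr_left: "csmooth n f ==> csmooth (n + m) (%x. f (pr_left n x))"
 and csmooth_pr_right: "csmooth m g ==> csmooth (n + m) (%x. g (pr_right n x))"
proof -
 have "curve_Rn n (%u. pr_left n (c u))" "curve_Rn m (%u. pr_right n (c u))" if c: "curve_Rn (n + m) c" for c
 proof -
  have "pr_left n (c u) \<in> Rn n" "pr_right n (c u) \<in> Rn m" for u
   using c pr_left_Rn[of "c u" n m] pr_right_Rn[of "c u" n m] by (simp_all add: curve_Rn_def)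
  with c show "curve_Rn n (%u. pr_left n (c u))" "curve_Rn m (%u. pr_right n (c u))"
   by (simp_all add: curve_Rn_def pr_left_def pr_right_def)
 qed
 then show "csmooth n f ==> csmooth (n + m) (%x. f (pr_left n x))"
  and "csmooth m g ==> csmooth (n + m) (%x. g (pr_right n x))" by (simp_all add: csmooth_def)
qed

context weil_pair
begin

definition tensor_gens :: "(point => real) set" where
 "tensor_gens = (%f. compose (Rn (V.n + W.n)) f (pr_left V.n)) ` wideal V \<union>
   (%g. compose (Rn (V.n + W.n)) g (pr_right V.n)) ` wideal W"

lemma wideal_tensor: "wideal (V \<otimes>\<^sub>W W) = Idl\<^bsub>Cinf (V.n + W.n)\<^esub> tensor_gens"
 by (simp add: weil_tensor_def Let_def tensor_gens_def)

lemma tensor_gens_closed: "tensor_gens \<subseteq> carrier (Cinf (V.n + W.n))"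
proof
 fix h assume "h \<in> tensor_gens"
 then consider f where "f \<in> wideal V" "h = compose (Rn (V.n + W.n)) f (pr_left V.n)"
  | g where "g \<in> wideal W" "h = compose (Rn (V.n + W.n)) g (pr_right V.n)" by (auto simp: tensor_gens_def)
 then show "h \<in> carrier (Cinf (V.n + W.n))"
 proof cases
  case 1
  then have "csmooth V.n f" using V.wideal_iff V.N.smooth by blast
  then show ?thesis unfolding 1 compose_def by (intro restrict_in_Cinf csmooth_pr_left)
 next
  case 2
  then have "csmooth W.n g" using W.wideal_iff W.N.smooth by blast
  then show ?thesis unfolding 2 compose_def by (intro restrict_in_Cinf csmooth_pr_right)
 qed
qed

lemma ideal_tensor: "ideal (wideal (V \<otimes>\<^sub>W W)) (Cinf (V.n + W.n))"
 unfolding wideal_tensor by (rule ring.genideal_ideal[OF ring_Cinf tensor_gens_closed])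

lemma wnull_tensor_left:
 assumes "wnull V f" shows "wnull (V \<otimes>\<^sub>W W) (%x. f (pr_left V.n x))"
proof -
 have "compose (Rn (V.n + W.n)) (restrict f (Rn V.n)) (pr_left V.n) \<in> tensor_gens"
  using assms by (auto simp: tensor_gens_def wnull_def)
 moreover have "compose (Rn (V.n + W.n)) (restrict f (Rn V.n)) (pr_left V.n) =
   restrict (%x. f (pr_left V.n x)) (Rn (V.n + W.n))"
  unfolding compose_def by (rule restrict_ext) (simp add: pr_left_Rn)
 ultimately show ?thesis
  using ring.genideal_self[OF ring_Cinf tensor_gens_closed] by (auto simp: wnull_def wideal_tensor)
qed

lemma wnull_tensor_right:
 assumes "wnull W g" shows "wnull (V \<otimes>\<^sub>W W) (%x. g (pr_right V.n x))"
proof -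
 have "compose (Rn (V.n + W.n)) (restrict g (Rn W.n)) (pr_right V.n) \<in> tensor_gens"
  using assms by (auto simp: tensor_gens_def wnull_def)
 moreover have "compose (Rn (V.n + W.n)) (restrict g (Rn W.n)) (pr_right V.n) =
   restrict (%x. g (pr_right V.n x)) (Rn (V.n + W.n))"
  unfolding compose_def by (rule restrict_ext) (simp add: pr_right_Rn)
 ultimately show ?thesis
  using ring.genideal_self[OF ring_Cinf tensor_gens_closed] by (auto simp: wnull_def wideal_tensor)
qed

text \<open>What is true of both pulled back ideals and stable under the ideal operations is true of the ideal
  of the tensor product.\<close>

lemma tensor_minimal:
 assumes P: "function_ideal (V.n + W.n) P"
  and l: "!!f. wnull V f ==> P (%x. f (pr_left V.n x))"
  and r: "!!g. wnull W g ==> P (%x. g (pr_right V.n x))"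
  and h: "wnull (V \<otimes>\<^sub>W W) h"
 shows "P h"
proof -
 interpret function_ideal "V.n + W.n" P by fact
 have "tensor_gens \<subseteq> {f \<in> extensional (Rn (V.n + W.n)). P f}"
 proof
  fix h assume "h \<in> tensor_gens"
  then consider f where "f \<in> wideal V" "h = compose (Rn (V.n + W.n)) f (pr_left V.n)"
   | g where "g \<in> wideal W" "h = compose (Rn (V.n + W.n)) g (pr_right V.n)" by (auto simp: tensor_gens_def)
  then show "h \<in> {f \<in> extensional (Rn (V.n + W.n)). P f}"
  proof cases
   case 1
   have "P (%x. f (pr_left V.n x))" using 1 by (intro l) (simp add: V.wideal_iff)
   then have "P h" by (rule cong) (simp add: 1 compose_def)
   then show ?thesis by (simp add: 1)
  next
   case 2
   have "P (%x. g (pr_right V.n x))" using 2 by (intro r) (simp add: W.wideal_iff)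
   then have "P h" by (rule cong) (simp add: 2 compose_def)
   then show ?thesis by (simp add: 2)
  qed
 qed
 from ring.genideal_minimal[OF ring_Cinf ideal_of_function_ideal[OF P] this]
 have "restrict h (Rn (V.n + W.n)) \<in> {f \<in> extensional (Rn (V.n + W.n)). P f}"
  using h by (auto simp: wnull_def wideal_tensor)
 then have "P (restrict h (Rn (V.n + W.n)))" by simp
 then show ?thesis by (rule cong) simp
qed

lemma monomial_split:
 "monomial w x = monomial (filter (%i. i < N) w) x * monomial (filter (%i. \<not> i < N) w) x" by (induction w) auto

lemma monomial_pr_left: "set w \<subseteq> {..<N} ==> monomial w (pr_left N x) = monomial w x"
 by (induction w) (auto simp: pr_left_def)

lemma monomial_pr_right: "\<forall>i\<in>set w. N \<le> i ==> monomial (map (%i. i - N) w) (pr_right N x) = monomial w x"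
 by (induction w) (auto simp: pr_right_def)

text \<open>A long monomial has many factors from one of the two groups of variables and lies in the ideal of
  that group.\<close>

lemma weil_tensor: "weil (V \<otimes>\<^sub>W W)"
proof -
 interpret T: function_ideal "V.n + W.n" "wnull (V \<otimes>\<^sub>W W)"
  using function_ideal_of_ideal[OF ideal_tensor] unfolding wnull_def by simp
 obtain k1 where k1: "!!w. length w = k1 ==> set w \<subseteq> {..<V.n} ==> wnull V (monomial w)"
  by (rule weil_monomials[OF V.weil]) blast
 obtain k2 where k2: "!!w. length w = k2 ==> set w \<subseteq> {..<W.n} ==> wnull W (monomial w)"
  by (rule weil_monomials[OF W.weil]) blast
 show ?thesis
 proof (rule weilI[where k = "k1 + k2"])
  show "ideal (wideal (V \<otimes>\<^sub>W W)) (Cinf (wvars (V \<otimes>\<^sub>W W)))" using ideal_tensor by simp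
  fix f assume f: "f \<in> wideal (V \<otimes>\<^sub>W W)"
  have "function_ideal (V.n + W.n) (%g. csmooth (V.n + W.n) g & g (%_. 0) = 0)"
  proof
   fix f g :: "point => real"
   assume "csmooth (V.n + W.n) f & f (%_. 0) = 0" and "!!x. x \<in> Rn (V.n + W.n) ==> f x = g x"
   then show "csmooth (V.n + W.n) g & g (%_. 0) = 0"
    using csmooth_cong[of "V.n + W.n" f g] zero_in_Rn[of "V.n + W.n"] by metis
  qed (simp_all add: csmooth_add csmooth_mult)
  moreover have "csmooth (V.n + W.n) (%x. f (pr_left V.n x)) & f (pr_left V.n (%_. 0)) = 0" if "wnull V f" for f
   using V.wnull_at_0[OF that] csmooth_pr_left[OF V.N.smooth[OF that]] by (simp add: pr_left_def)
  moreover have "csmooth (V.n + W.n) (%x. g (pr_right V.n x)) & g (pr_right V.n (%_. 0)) = 0" if "wnull W g" for g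
   using W.wnull_at_0[OF that] csmooth_pr_right[OF W.N.smooth[OF that]] by (simp add: pr_right_def)
  moreover have "wnull (V \<otimes>\<^sub>W W) f"
   using f ideal.Icarr[OF ideal_tensor f] by (simp add: wnull_def restrict_Cinf_id)
  ultimately have "csmooth (V.n + W.n) f & f (%_. 0) = 0" by (rule tensor_minimal)
  then show "f (%_. 0) = 0" ..
 next
  fix w :: "nat list" assume w: "length w = k1 + k2" "set w \<subseteq> {..<wvars (V \<otimes>\<^sub>W W)}"
  define w1 where "w1 = filter (%i. i < V.n) w"
  define w2 where "w2 = filter (%i. \<not> i < V.n) w"
  have "length w1 + length w2 = length w" unfolding w1_def w2_def by (rule sum_length_filter_compl)
  then consider "k1 \<le> length w1" | "k2 \<le> length w2" using w(1) by linarith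
  then show "wnull (V \<otimes>\<^sub>W W) (monomial w)"
  proof cases
   case 1
   have sub: "set (take k1 w1) \<subseteq> {..<V.n}" using set_take_subset[of k1 w1] by (auto simp: w1_def)
   have "wnull V (monomial (take k1 w1))" by (rule k1) (use 1 sub in simp_all)
   from T.mult_right[OF csmooth_mult[OF csmooth_monomial csmooth_monomial] wnull_tensor_left[OF this]]
   have "wnull (V \<otimes>\<^sub>W W) (%x. monomial (take k1 w1) (pr_left V.n x) * (monomial (drop k1 w1) x * monomial w2 x))" .
   then show ?thesis
   proof (rule T.cong)
    fix x
    have "monomial (take k1 w1) x * monomial (drop k1 w1) x = monomial w1 x" by (simp flip: monomial_append)
    moreover have "monomial w x = monomial w1 x * monomial w2 x" unfolding w1_def w2_def by (rule monomial_split)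
    ultimately show "monomial (take k1 w1) (pr_left V.n x) * (monomial (drop k1 w1) x * monomial w2 x) = monomial w x"
     by (simp only: monomial_pr_left[OF sub] mult.assoc[symmetric])
   qed
  next
   case 2
   have sub: "\<forall>i\<in>set (take k2 w2). V.n \<le> i & i < V.n + W.n"
    using set_take_subset[of k2 w2] w(2) by (auto simp: w2_def)
   have "wnull W (monomial (map (%i. i - V.n) (take k2 w2)))" by (rule k2) (use 2 sub in auto)
   from T.mult_right[OF csmooth_mult[OF csmooth_monomial csmooth_monomial] wnull_tensor_right[OF this]]
   have "wnull (V \<otimes>\<^sub>W W) (%x. monomial (map (%i. i - V.n) (take k2 w2)) (pr_right V.n x) * (monomial (drop k2 w2) x * monomial w1 x))" .
   then show ?thesis
   proof (rule T.cong)
    fix x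
    have 1: "monomial (take k2 w2) x * monomial (drop k2 w2) x = monomial w2 x" by (simp flip: monomial_append)
    have 2: "monomial (map (%i. i - V.n) (take k2 w2)) (pr_right V.n x) = monomial (take k2 w2) x"
     by (rule monomial_pr_right) (use sub in simp)
    show "monomial (map (%i. i - V.n) (take k2 w2)) (pr_right V.n x) * (monomial (drop k2 w2) x * monomial w1 x) = monomial w x"
     unfolding 2 mult.assoc[symmetric] 1 using monomial_split[of w x V.n] by (simp add: w1_def w2_def mult.commute)
   qed
  qed
 qed
qed

end

context weil_algebra
begin

lemma wc_member:
 assumes f: "csmooth n f" and h: "h \<in> wc W f"
 shows "csmooth n h & wc W h = wc W f"
proof -
 obtain i where i: "i \<in> wideal W" "h = i \<oplus>\<^bsub>Cinf n\<^esub> restrict f (Rn n)"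
  using h unfolding wc_def wcls_def a_r_coset_def' by blast
 have si: "csmooth n i" "wnull W i" using i(1) wideal_iff N.smooth by blast+
 have sh: "csmooth n h" unfolding i(2) Cinf_simps csmooth_restrict
  by (intro csmooth_add si(1)) (simp only: csmooth_restrict f)
 have "wnull W (%x. h x - f x)" by (rule N.cong[OF si(2)]) (simp add: i(2) Cinf_simps)
 then show ?thesis using sh wc_eq_iff[OF sh f] by simp
qed

lemma wc_nonempty:
 assumes f: "csmooth n f" shows "wc W f ~= {}"
proof -
 have "\<zero>\<^bsub>Cinf n\<^esub> \<in> wideal W"
  using additive_subgroup.zero_closed[OF ideal.axioms(1)[OF ideal]] .
 then show ?thesis unfolding wc_def wcls_def a_r_coset_def' by blast
qed

end

lemma the_elem_image:
 assumes "A ~= {}" "!!x. x \<in> A ==> F x = c" shows "the_elem (F ` A) = c"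
proof -
 have "F ` A = {c}" using assms by auto
 then show ?thesis by simp
qed

context weil_pair
begin

lemma weil_inl_wc:
 assumes f: "csmooth V.n f"
 shows "weil_inl V W (wc V f) = wc (V \<otimes>\<^sub>W W) (%x. f (pr_left V.n x))"
proof -
 interpret T: weil_algebra "V \<otimes>\<^sub>W W" by (rule weil_algebra.intro[OF weil_tensor])
 have eq: "wcls (V \<otimes>\<^sub>W W) (compose (Rn (V.n + W.n)) h (pr_left V.n)) = wc (V \<otimes>\<^sub>W W) (%x. h (pr_left V.n x))" for h
  by (simp add: wc_def compose_def)
 have *: "wc (V \<otimes>\<^sub>W W) (%x. h (pr_left V.n x)) = wc (V \<otimes>\<^sub>W W) (%x. f (pr_left V.n x))" if "h \<in> wc V f" for h
 proof -
  have h: "csmooth V.n h" "wc V h = wc V f" using V.wc_member[OF f that] by simp_all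
  then have "wnull V (%x. h x - f x)" using V.wc_eq_iff[OF h(1) f] by simp
  from wnull_tensor_left[OF this] show ?thesis
   using T.wc_eq_iff[of "%x. h (pr_left V.n x)" "%x. f (pr_left V.n x)"] csmooth_pr_left[OF h(1)] csmooth_pr_left[OF f]
   by simp
 qed
 have "the_elem ((%h. wc (V \<otimes>\<^sub>W W) (%x. h (pr_left V.n x))) ` wc V f) = wc (V \<otimes>\<^sub>W W) (%x. f (pr_left V.n x))"
  by (rule the_elem_image[OF V.wc_nonempty[OF f]]) (rule *)
 then show ?thesis by (simp add: weil_inl_def eq V.wc_carrier[OF f])
qed

lemma weil_inr_wc:
 assumes f: "csmooth W.n f"
 shows "weil_inr V W (wc W f) = wc (V \<otimes>\<^sub>W W) (%x. f (pr_right V.n x))"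
proof -
 interpret T: weil_algebra "V \<otimes>\<^sub>W W" by (rule weil_algebra.intro[OF weil_tensor])
 have eq: "wcls (V \<otimes>\<^sub>W W) (compose (Rn (V.n + W.n)) h (pr_right V.n)) = wc (V \<otimes>\<^sub>W W) (%x. h (pr_right V.n x))" for h
  by (simp add: wc_def compose_def)
 have *: "wc (V \<otimes>\<^sub>W W) (%x. h (pr_right V.n x)) = wc (V \<otimes>\<^sub>W W) (%x. f (pr_right V.n x))" if "h \<in> wc W f" for h
 proof -
  have h: "csmooth W.n h" "wc W h = wc W f" using W.wc_member[OF f that] by simp_all
  then have "wnull W (%x. h x - f x)" using W.wc_eq_iff[OF h(1) f] by simp
  from wnull_tensor_right[OF this] show ?thesis
   using T.wc_eq_iff[of "%x. h (pr_right V.n x)" "%x. f (pr_right V.n x)"] csmooth_pr_right[OF h(1)] csmooth_pr_right[OF f]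
   by simp
 qed
 have "the_elem ((%h. wc (V \<otimes>\<^sub>W W) (%x. h (pr_right V.n x))) ` wc W f) = wc (V \<otimes>\<^sub>W W) (%x. f (pr_right V.n x))"
  by (rule the_elem_image[OF W.wc_nonempty[OF f]]) (rule *)
 then show ?thesis by (simp add: weil_inr_def eq W.wc_carrier[OF f])
qed

end

lemma smooth_maps_join:
 assumes \<alpha>: "\<alpha> \<in> smooth_maps (fs_Rn n') (fs_Rn n)" and \<beta>: "\<beta> \<in> smooth_maps (fs_Rn m') (fs_Rn m)"
 shows "(\<lambda>x\<in>Rn (n' + m'). join n (\<alpha> (pr_left n' x)) (\<beta> (pr_right n' x))) \<in> smooth_maps (fs_Rn (n' + m')) (fs_Rn (n + m))"
  (is "?\<gamma> \<in> _")
proof -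
 define t where "t i x = (if i < n then \<alpha> (pr_left n' x) i else \<beta> (pr_right n' x) (i - n))" for i x
 have "csmooth (n' + m') (t i)" for i
 proof (cases "i < n")
  case True
  have "csmooth (n' + m') (%x. (%y. \<alpha> y i) (pr_left n' x))"
   by (rule csmooth_pr_left, rule smooth_maps_Rn_comp[OF \<alpha> csmooth_coord])
  with True show ?thesis by (simp add: t_def[abs_def])
 next
  case False
  have "csmooth (n' + m') (%x. (%y. \<beta> y (i - n)) (pr_right n' x))"
   by (rule csmooth_pr_right, rule smooth_maps_Rn_comp[OF \<beta> csmooth_coord])
  with False show ?thesis by (simp add: t_def[abs_def])
 qed
 then have "(\<lambda>x\<in>Rn (n' + m'). %i. if i < n + m then t i x else 0) \<in> smooth_maps (fs_Rn (n' + m')) (fs_Rn (n + m))"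
  by (rule smooth_maps_RnI)
 moreover have "(\<lambda>x\<in>Rn (n' + m'). %i. if i < n + m then t i x else 0) = ?\<gamma>"
 proof (rule restrict_ext, rule ext)
  fix x i assume x: "x \<in> Rn (n' + m')"
  have "\<beta> (pr_right n' x) (i - n) = 0" if "\<not> i < n + m"
   using smooth_maps_Rn_closed[OF \<beta> pr_right_Rn[OF x]] that by (simp add: Rn_def)
  then show "(if i < n + m then t i x else 0) = join n (\<alpha> (pr_left n' x)) (\<beta> (pr_right n' x)) i"
   by (auto simp: t_def join_def)
 qed
 ultimately show ?thesis by simp
qed

text \<open>The tensor product of two homomorphisms is induced by the product of the inducing maps.\<close>

lemma weil_tensor_hom_induced:
 assumes V: "weil V" and V': "weil V'" and W: "weil W" and W': "weil W'"
  and phi: "phi \<in> weil_hom V V'" and \<psi>: "\<psi> \<in> weil_hom W W'"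
  and \<alpha>: "induces_hom V V' \<alpha> phi" and \<beta>: "induces_hom W W' \<beta> \<psi>"
 defines "\<gamma> \<equiv> (\<lambda>x\<in>Rn (wvars V' + wvars W'). join (wvars V) (\<alpha> (pr_left (wvars V') x)) (\<beta> (pr_right (wvars V') x)))"
 shows "weil_tensor_hom V V' W W' phi \<psi> \<in> weil_hom (V \<otimes>\<^sub>W W) (V' \<otimes>\<^sub>W W')"
  and "induces_hom (V \<otimes>\<^sub>W W) (V' \<otimes>\<^sub>W W') \<gamma> (weil_tensor_hom V V' W W' phi \<psi>)"
proof -
 interpret VW: weil_pair V W using V W by (simp add: weil_pair_def weil_algebra_def)
 interpret VW': weil_pair V' W' using V' W' by (simp add: weil_pair_def weil_algebra_def)
 interpret VV: weil_pair V V' using V V' by (simp add: weil_pair_def weil_algebra_def)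
 interpret WW: weil_pair W W' using W W' by (simp add: weil_pair_def weil_algebra_def)
 interpret T: weil_pair "V \<otimes>\<^sub>W W" "V' \<otimes>\<^sub>W W'"
  using VW.weil_tensor VW'.weil_tensor by (simp add: weil_pair_def weil_algebra_def)
 let ?n = "wvars V" and ?m = "wvars W" and ?n' = "wvars V'" and ?m' = "wvars W'"
 have \<alpha>s: "\<alpha> \<in> smooth_maps (fs_Rn ?n') (fs_Rn ?n)" and \<beta>s: "\<beta> \<in> smooth_maps (fs_Rn ?m') (fs_Rn ?m)"
  using \<alpha> \<beta> by (simp_all add: induces_hom_iff)
 have \<gamma>s: "\<gamma> \<in> smooth_maps (fs_Rn (?n' + ?m')) (fs_Rn (?n + ?m))"
  unfolding \<gamma>_def by (rule smooth_maps_join[OF \<alpha>s \<beta>s])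
 have \<gamma>0: "\<gamma> (%_. 0) = (%_. 0)"
  using \<alpha> \<beta> by (simp add: \<gamma>_def induces_hom_iff pr_left_def pr_right_def join_def fun_eq_iff)
 have prl: "pr_left ?n (\<gamma> x) = \<alpha> (pr_left ?n' x)" and prr: "pr_right ?n (\<gamma> x) = \<beta> (pr_right ?n' x)"
  if "x \<in> Rn (?n' + ?m')" for x
  using that smooth_maps_Rn_closed[OF \<alpha>s pr_left_Rn[OF that]] by (simp_all add: \<gamma>_def)
 have left: "wc (V' \<otimes>\<^sub>W W') (%x. f (pr_left ?n (\<gamma> x))) = wc (V' \<otimes>\<^sub>W W') (%x. f (\<alpha> (pr_left ?n' x)))" for f
  by (rule wc_cong) (simp add: prl)
 have right: "wc (V' \<otimes>\<^sub>W W') (%x. f (pr_right ?n (\<gamma> x))) = wc (V' \<otimes>\<^sub>W W') (%x. f (\<beta> (pr_right ?n' x)))" for f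
  by (rule wc_cong) (simp add: prr)
 have null: "wnull (V' \<otimes>\<^sub>W W') (%x. g (\<gamma> x))" if g: "wnull (V \<otimes>\<^sub>W W) g" for g
 proof -
  define P where "P g \<longleftrightarrow> csmooth (?n + ?m) g & wnull (V' \<otimes>\<^sub>W W') (%x. g (\<gamma> x))" for g
  have "function_ideal (?n + ?m) P"
  proof
   fix f g h :: "point => real"
   show "P f ==> csmooth (?n + ?m) f" by (simp add: P_def)
   show "P (%_. 0)" by (simp add: P_def T.W.N.zero)
   show "P g" if f: "P f" and fg: "!!x. x \<in> Rn (?n + ?m) ==> f x = g x"
   proof -
    have 1: "wnull (V' \<otimes>\<^sub>W W') (%x. f (\<gamma> x))" using f by (simp add: P_def)
    have "wnull (V' \<otimes>\<^sub>W W') (%x. g (\<gamma> x))"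
    proof (rule T.W.N.cong[OF 1])
     fix x assume "x \<in> Rn (wvars (V' \<otimes>\<^sub>W W'))"
     then show "f (\<gamma> x) = g (\<gamma> x)" by (intro fg smooth_maps_Rn_closed[OF \<gamma>s]) simp
    qed
    then show ?thesis using f csmooth_cong[of "?n + ?m" f g] fg by (simp add: P_def)
   qed
   show "P (%x. f x + g x)" if "P f" "P g"
    using that T.W.N.add[of "%x. f (\<gamma> x)" "%x. g (\<gamma> x)"] by (simp add: P_def csmooth_add)
   show "P (%x. h x * f x)" if h: "csmooth (?n + ?m) h" and f: "P f"
   proof -
    have "csmooth (wvars (V' \<otimes>\<^sub>W W')) (%x. h (\<gamma> x))" using smooth_maps_Rn_comp[OF \<gamma>s h] by simp
    from T.W.N.mult[OF this, of "%x. f (\<gamma> x)"] show ?thesis using f h by (simp add: P_def csmooth_mult)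
   qed
  qed
  moreover have "P (%x. f (pr_left ?n x))" if f: "wnull V f" for f
  proof -
   have "wnull (V' \<otimes>\<^sub>W W') (%x. f (\<alpha> (pr_left ?n' x)))"
    by (rule VW'.wnull_tensor_left[OF VV.induces_null[OF phi \<alpha> f]])
   then have "wnull (V' \<otimes>\<^sub>W W') (%x. f (pr_left ?n (\<gamma> x)))" by (rule T.W.N.cong) (simp add: prl)
   then show ?thesis using csmooth_pr_left[OF VW.V.N.smooth[OF f]] by (simp add: P_def)
  qed
  moreover have "P (%x. f (pr_right ?n x))" if f: "wnull W f" for f
  proof -
   have "wnull (V' \<otimes>\<^sub>W W') (%x. f (\<beta> (pr_right ?n' x)))"
    by (rule VW'.wnull_tensor_right[OF WW.induces_null[OF \<psi> \<beta> f]])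
   then have "wnull (V' \<otimes>\<^sub>W W') (%x. f (pr_right ?n (\<gamma> x)))" by (rule T.W.N.cong) (simp add: prr)
   then show ?thesis using csmooth_pr_right[OF VW.W.N.smooth[OF f]] by (simp add: P_def)
  qed
  ultimately have "P g" using g by (rule VW.tensor_minimal)
  then show ?thesis by (simp add: P_def)
 qed
 have "\<exists>h\<in>weil_hom (V \<otimes>\<^sub>W W) (V' \<otimes>\<^sub>W W'). induces_hom (V \<otimes>\<^sub>W W) (V' \<otimes>\<^sub>W W') \<gamma> h"
  by (rule T.ex_induced_hom) (use \<gamma>s \<gamma>0 null in simp_all)
 then obtain h where h: "h \<in> weil_hom (V \<otimes>\<^sub>W W) (V' \<otimes>\<^sub>W W')" "induces_hom (V \<otimes>\<^sub>W W) (V' \<otimes>\<^sub>W W') \<gamma> h" ..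
 have hwc: "h (wc (V \<otimes>\<^sub>W W) g) = wc (V' \<otimes>\<^sub>W W') (%x. g (\<gamma> x))" if "csmooth (?n + ?m) g" for g
  using h(2) that by (simp add: induces_hom_iff)
 have phiwc: "phi (wc V f) = wc V' (%x. f (\<alpha> x))" if "csmooth ?n f" for f
  using \<alpha> that by (simp add: induces_hom_iff)
 have \<psi>wc: "\<psi> (wc W f) = wc W' (%x. f (\<beta> x))" if "csmooth ?m f" for f
  using \<beta> that by (simp add: induces_hom_iff)
 have "weil_tensor_hom V V' W W' phi \<psi> = h" unfolding weil_tensor_hom_def
 proof (rule the_equality)
  have "compose (carrier (weil_alg V)) h (weil_inl V W) = compose (carrier (weil_alg V)) (weil_inl V' W') phi"
   unfolding compose_def
  proof (rule restrict_ext)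
   fix a assume "a \<in> carrier (weil_alg V)"
   then obtain f where f: "csmooth ?n f" "a = wc V f" by (rule VW.V.wc_cases)
   show "h (weil_inl V W a) = weil_inl V' W' (phi a)"
    using f(1) unfolding f(2) by (simp add: VW.weil_inl_wc hwc csmooth_pr_left phiwc left
      VW'.weil_inl_wc smooth_maps_Rn_comp[OF \<alpha>s])
  qed
  moreover have "compose (carrier (weil_alg W)) h (weil_inr V W) = compose (carrier (weil_alg W)) (weil_inr V' W') \<psi>"
   unfolding compose_def
  proof (rule restrict_ext)
   fix a assume "a \<in> carrier (weil_alg W)"
   then obtain f where f: "csmooth ?m f" "a = wc W f" by (rule VW.W.wc_cases)
   show "h (weil_inr V W a) = weil_inr V' W' (\<psi> a)"
    using f(1) unfolding f(2) by (simp add: VW.weil_inr_wc hwc csmooth_pr_right \<psi>wc right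
      VW'.weil_inr_wc smooth_maps_Rn_comp[OF \<beta>s])
  qed
  ultimately show h3: "h \<in> weil_hom (V \<otimes>\<^sub>W W) (V' \<otimes>\<^sub>W W') &
   compose (carrier (weil_alg V)) h (weil_inl V W) = compose (carrier (weil_alg V)) (weil_inl V' W') phi &
   compose (carrier (weil_alg W)) h (weil_inr V W) = compose (carrier (weil_alg W)) (weil_inr V' W') \<psi>"
   using h(1) by simp
  fix h' assume h': "h' \<in> weil_hom (V \<otimes>\<^sub>W W) (V' \<otimes>\<^sub>W W') &
   compose (carrier (weil_alg V)) h' (weil_inl V W) = compose (carrier (weil_alg V)) (weil_inl V' W') phi &
   compose (carrier (weil_alg W)) h' (weil_inr V W) = compose (carrier (weil_alg W)) (weil_inr V' W') \<psi>"
  show "h' = h"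
  proof (rule T.weil_hom_eqI)
   show "h' \<in> weil_hom (V \<otimes>\<^sub>W W) (V' \<otimes>\<^sub>W W')" "h \<in> weil_hom (V \<otimes>\<^sub>W W) (V' \<otimes>\<^sub>W W')"
    using h(1) h' by simp_all
   fix i assume "i < wvars (V \<otimes>\<^sub>W W)"
   show "h' (wc (V \<otimes>\<^sub>W W) (%x. x i)) = h (wc (V \<otimes>\<^sub>W W) (%x. x i))"
   proof (cases "i < ?n")
    case True
    have "wc (V \<otimes>\<^sub>W W) (%x. x i) = weil_inl V W (wc V (%x. x i))"
     using True by (simp add: VW.weil_inl_wc pr_left_def)
    moreover have "compose (carrier (weil_alg V)) h' (weil_inl V W) (wc V (%x. x i)) =
      compose (carrier (weil_alg V)) h (weil_inl V W) (wc V (%x. x i))" using h' h3 by simp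
    ultimately show ?thesis by (simp add: compose_def VW.V.wc_carrier)
   next
    case False
    have "wc (V \<otimes>\<^sub>W W) (%x. x i) = weil_inr V W (wc W (%x. x (i - ?n)))"
     using False by (simp add: VW.weil_inr_wc pr_right_def)
    moreover have "compose (carrier (weil_alg W)) h' (weil_inr V W) (wc W (%x. x (i - ?n))) =
      compose (carrier (weil_alg W)) h (weil_inr V W) (wc W (%x. x (i - ?n)))" using h' h3 by simp
    ultimately show ?thesis by (simp add: compose_def VW.W.wc_carrier)
   qed
  qed
 qed
 with h show "weil_tensor_hom V V' W W' phi \<psi> \<in> weil_hom (V \<otimes>\<^sub>W W) (V' \<otimes>\<^sub>W W')"
  and "induces_hom (V \<otimes>\<^sub>W W) (V' \<otimes>\<^sub>W W') \<gamma> (weil_tensor_hom V V' W W' phi \<psi>)" by simp_all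
qed

definition weil_real :: weil_pres where
 "weil_real = \<lparr>wvars = 0, wideal = {\<lambda>x\<in>Rn 0. 0}\<rparr>"

lemma wvars_weil_real [simp]: "wvars weil_real = 0" by (simp add: weil_real_def)

lemma Rn_0: "Rn 0 = {%_. 0}" by (auto simp: Rn_def)

lemma weil_weil_real: "weil weil_real"
proof (rule weilI[where k = 1])
 have "ideal {\<zero>\<^bsub>Cinf 0\<^esub>} (Cinf 0)" by (rule ring.zeroideal[OF ring_Cinf])
 then show "ideal (wideal weil_real) (Cinf (wvars weil_real))" by (simp add: weil_real_def Cinf_simps)
 show "f (%_. 0) = 0" if "f \<in> wideal weil_real" for f using that by (simp add: weil_real_def)
 show "wnull weil_real (monomial w)" if "length w = 1" "set w \<subseteq> {..<wvars weil_real}" for w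
  using that by (cases w) auto
qed

lemma weil_real_tensor:
 assumes W: "weil W" shows "weil_real \<otimes>\<^sub>W W = W"
proof -
 interpret weil_pair weil_real W using W weil_weil_real by (simp add: weil_pair_def weil_algebra_def)
 have pr: "pr_right 0 x = x" for x :: point by (simp add: pr_right_def)
 have gens: "tensor_gens \<subseteq> wideal W"
 proof
  fix h assume "h \<in> tensor_gens"
  then consider f where "f \<in> wideal weil_real" "h = compose (Rn W.n) f (pr_left 0)"
   | g where "g \<in> wideal W" "h = compose (Rn W.n) g (pr_right 0)" by (auto simp: tensor_gens_def)
  then show "h \<in> wideal W"
  proof cases
   case 1
   have "h = restrict (%_. 0) (Rn W.n)"
    unfolding 1(2) compose_def by (rule restrict_ext) (use 1(1) in \<open>simp add: weil_real_def Rn_0 pr_left_def\<close>)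
   then show ?thesis using W.N.zero by (simp add: wnull_def)
  next
   case 2
   have "h = restrict g (Rn W.n)" unfolding 2(2) compose_def by (simp add: pr)
   then show ?thesis using 2(1) W.wideal_iff[of g] by (simp add: wnull_def)
  qed
 qed
 have sup: "wideal W \<subseteq> tensor_gens"
 proof
  fix g assume g: "g \<in> wideal W"
  then have "g = compose (Rn W.n) g (pr_right 0)"
   using W.wideal_iff[of g] by (simp add: compose_def pr extensional_restrict)
  with g show "g \<in> tensor_gens" by (auto simp: tensor_gens_def)
 qed
 have "wideal (weil_real \<otimes>\<^sub>W W) = wideal W"
 proof
  show "wideal (weil_real \<otimes>\<^sub>W W) \<subseteq> wideal W"
   unfolding wideal_tensor by (rule ring.genideal_minimal[OF ring_Cinf _ gens]) (use W.ideal in simp)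
  show "wideal W \<subseteq> wideal (weil_real \<otimes>\<^sub>W W)"
   unfolding wideal_tensor using ring.genideal_self[OF ring_Cinf tensor_gens_closed] sup by blast
 qed
 then show ?thesis by (intro weil_pres.equality) simp_all
qed

section \<open>Froelicher spaces\<close>

lemma fs_of_curves_simps [simp]:
 "carrier (fs_of_curves A C) = A" "curves (fs_of_curves A C) = C"
 "funcs (fs_of_curves A C) = {f \<in> extensional A. \<forall>c\<in>C. smooth_real (f \<circ> c)}"
 by (simp_all add: fs_of_curves_def)

lemma froelicher_fs_of_curvesI:
 assumes "!!c t. c \<in> C ==> c t \<in> A"
  and "!!c. (!!t. c t \<in> A) ==>
   (!!f. f \<in> funcs (fs_of_curves A C) ==> smooth_real (%t. f (c t))) ==> c \<in> C"
 shows "froelicher (fs_of_curves A C)"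
proof -
 let ?X = "fs_of_curves A C"
 have mem: "c \<in> C \<longleftrightarrow> c \<in> UNIV \<rightarrow> A & (\<forall>f\<in>funcs ?X. smooth_real (f \<circ> c))" for c
 proof
  assume c: "c \<in> C"
  show "c \<in> UNIV \<rightarrow> A & (\<forall>f\<in>funcs ?X. smooth_real (f \<circ> c))"
  proof (intro conjI ballI)
   show "c \<in> UNIV \<rightarrow> A" by (rule funcsetI) (rule assms(1)[OF c])
   show "smooth_real (f \<circ> c)" if "f \<in> funcs ?X" for f using that c by simp
  qed
 next
  assume *: "c \<in> UNIV \<rightarrow> A & (\<forall>f\<in>funcs ?X. smooth_real (f \<circ> c))"
  show "c \<in> C"
  proof (rule assms(2))
   show "c t \<in> A" for t by (rule funcset_mem[OF conjunct1[OF *]]) (rule UNIV_I)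
   show "smooth_real (%t. f (c t))" if "f \<in> funcs ?X" for f
    using bspec[OF conjunct2[OF *] that] by (simp only: o_def)
  qed
 qed
 have "curves ?X = {c \<in> UNIV \<rightarrow> carrier ?X. \<forall>f\<in>funcs ?X. smooth_real (f \<circ> c)}"
  by (rule Set.set_eqI) (simp only: fs_of_curves_simps(1,2) mem mem_Collect_eq)
 moreover have "funcs ?X = {f \<in> extensional (carrier ?X). \<forall>c\<in>curves ?X. smooth_real (f \<circ> c)}" by simp
 ultimately show ?thesis unfolding froelicher_def by (intro conjI)
qed

lemma curve_in: "froelicher X ==> c \<in> curves X ==> c t \<in> carrier X" unfolding froelicher_def by blast

lemma func_curve: "froelicher X ==> f \<in> funcs X ==> c \<in> curves X ==> smooth_real (%t. f (c t))"
 unfolding froelicher_def o_def by blast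

lemma curvesI:
 assumes X: "froelicher X" and c: "!!t. c t \<in> carrier X" and f: "!!f. f \<in> funcs X ==> smooth_real (%t. f (c t))"
 shows "c \<in> curves X"
proof -
 have eq: "curves X = {c \<in> UNIV \<rightarrow> carrier X. \<forall>f\<in>funcs X. smooth_real (f \<circ> c)}"
  using X unfolding froelicher_def by (rule conjunct2)
 have 1: "c \<in> UNIV \<rightarrow> carrier X" by (rule funcsetI) (rule c)
 have 2: "\<forall>f\<in>funcs X. smooth_real (f \<circ> c)"
 proof
  fix g assume "g \<in> funcs X"
  from f[OF this] show "smooth_real (g \<circ> c)" by (simp only: o_def)
 qed
 show ?thesis by (subst eq) (intro CollectI conjI 1 2)
qed

lemma funcsI:
 assumes X: "froelicher X" and f: "!!c. c \<in> curves X ==> smooth_real (%t. f (c t))"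
 shows "restrict f (carrier X) \<in> funcs X"
proof -
 have eq: "funcs X = {f \<in> extensional (carrier X). \<forall>c\<in>curves X. smooth_real (f \<circ> c)}"
  using X unfolding froelicher_def by (rule conjunct1)
 have "\<forall>c\<in>curves X. smooth_real (restrict f (carrier X) \<circ> c)"
 proof
  fix c assume c: "c \<in> curves X"
  have "restrict f (carrier X) \<circ> c = (%t. f (c t))"
  proof
   fix t show "(restrict f (carrier X) \<circ> c) t = f (c t)" using curve_in[OF X c, of t] by simp
  qed
  then show "smooth_real (restrict f (carrier X) \<circ> c)" using f[OF c] by (simp only:)
 qed
 then show ?thesis by (subst eq) (intro CollectI conjI restrict_extensional)
qed

lemma const_curve: "froelicher X ==> x \<in> carrier X ==> (%_. x) \<in> curves X" by (rule curvesI) simp_all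

lemma curve_reparam: "froelicher X ==> c \<in> curves X ==> smooth_real a ==> (%t. c (a t)) \<in> curves X"
 by (rule curvesI) (simp_all add: curve_in smooth_real_compose[OF func_curve])

lemma smD:
 assumes "h \<in> smooth_maps X Y"
 shows "x \<in> carrier X ==> h x \<in> carrier Y" "c \<in> curves X ==> (%t. h (c t)) \<in> curves Y"
  "h \<in> extensional (carrier X)" using assms by (auto simp: smooth_maps_def o_def PiE_def)

lemma smI:
 assumes "!!x. x \<in> carrier X ==> h x \<in> carrier Y" "!!c. c \<in> curves X ==> (%t. h (c t)) \<in> curves Y"
  "h \<in> extensional (carrier X)"
 shows "h \<in> smooth_maps X Y" using assms by (auto simp: smooth_maps_def o_def PiE_def)

lemma sm_restrictI:
 assumes X: "froelicher X" and "!!x. x \<in> carrier X ==> h x \<in> carrier Y"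
  and "!!c. c \<in> curves X ==> (%t. h (c t)) \<in> curves Y"
 shows "restrict h (carrier X) \<in> smooth_maps X Y"
proof (rule smI)
 fix c assume c: "c \<in> curves X"
 have "(%t. restrict h (carrier X) (c t)) = (%t. h (c t))" using curve_in[OF X c] by simp
 then show "(%t. restrict h (carrier X) (c t)) \<in> curves Y" using assms(3)[OF c] by simp
qed (use assms(2) in simp_all)

lemma sm_eqI:
 assumes "h \<in> smooth_maps X Y" "k \<in> smooth_maps X Z" "!!x. x \<in> carrier X ==> h x = k x"
 shows "h = k" by (rule extensionalityI[OF smD(3)[OF assms(1)] smD(3)[OF assms(2)] assms(3)])

lemma sm_compose:
 assumes X: "froelicher X" and f: "f \<in> smooth_maps X Y" and g: "g \<in> smooth_maps Y Z"
 shows "compose (carrier X) g f \<in> smooth_maps X Z" unfolding compose_def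
 by (rule sm_restrictI[OF X]) (use smD(1,2)[OF f] smD(1,2)[OF g] in auto)

lemma func_compose:
 assumes X: "froelicher X" and f: "f \<in> smooth_maps X Y" and Y: "froelicher Y" and xi: "xi \<in> funcs Y"
 shows "(\<lambda>x\<in>carrier X. xi (f x)) \<in> funcs X"
 by (rule funcsI[OF X]) (rule func_curve[OF Y xi smD(2)[OF f]])

lemma curves_fs_real [simp]: "curves fs_real = {c. smooth_real c}" and carrier_fs_real [simp]: "carrier fs_real = UNIV"
 by (simp_all add: fs_real_def)

lemma froelicher_Rn: "froelicher (fs_Rn n)"
proof -
 have "froelicher (fs_of_curves (Rn n) {c. curve_Rn n c})"
 proof (rule froelicher_fs_of_curvesI)
  fix c assume cR: "!!t. c t \<in> Rn n"
   and f: "!!f. f \<in> funcs (fs_of_curves (Rn n) {c. curve_Rn n c}) ==> smooth_real (%t. f (c t))"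
  have "smooth_real (%u. c u i)" if "i < n" for i
  proof -
   have "(\<lambda>x\<in>Rn n. x i) \<in> funcs (fs_of_curves (Rn n) {c. curve_Rn n c})"
    using that by (auto simp: curve_Rn_def o_def)
   from f[OF this] show ?thesis using cR by simp
  qed
  with cR show "c \<in> {c. curve_Rn n c}" by (simp add: curve_Rn_def)
 qed (simp add: curve_Rn_def)
 moreover have "fs_Rn n = fs_of_curves (Rn n) {c. curve_Rn n c}"
  unfolding fs_Rn_def by (rule arg_cong[where f = "fs_of_curves (Rn n)"]) (auto simp: curve_Rn_def)
 ultimately show ?thesis by simp
qed

lemma froelicher_point: "froelicher fs_point" unfolding fs_point_def by (rule froelicher_fs_of_curvesI) simp_all

lemma carrier_prod [simp]: "carrier (fs_prod X Y) = carrier X \<times> carrier Y" by (simp add: fs_prod_def)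

lemma curves_prod_iff: "c \<in> curves (fs_prod X Y) \<longleftrightarrow> (%t. fst (c t)) \<in> curves X & (%t. snd (c t)) \<in> curves Y"
 by (simp add: fs_prod_def o_def)

lemma froelicher_prod:
 assumes X: "froelicher X" and Y: "froelicher Y" shows "froelicher (fs_prod X Y)" unfolding fs_prod_def
proof (rule froelicher_fs_of_curvesI)
 let ?C = "{c. fst \<circ> c \<in> curves X & snd \<circ> c \<in> curves Y}"
 fix c
 show "c t \<in> carrier X \<times> carrier Y" if "c \<in> ?C" for t
  using curve_in[OF X, of "fst \<circ> c" t] curve_in[OF Y, of "snd \<circ> c" t] that by (cases "c t") simp
 assume cA: "!!t. c t \<in> carrier X \<times> carrier Y"
  and f: "!!f. f \<in> funcs (fs_of_curves (carrier X \<times> carrier Y) ?C) ==> smooth_real (%t. f (c t))"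
 have "(%t. fst (c t)) \<in> curves X"
 proof (rule curvesI[OF X])
  show "fst (c t) \<in> carrier X" for t using cA[of t] by auto
  fix xi assume xi: "xi \<in> funcs X"
  have "smooth_real (restrict (%p. xi (fst p)) (carrier X \<times> carrier Y) \<circ> d)" if d: "d \<in> ?C" for d
  proof -
   have "d t \<in> carrier X \<times> carrier Y" for t
    using curve_in[OF X, of "fst \<circ> d" t] curve_in[OF Y, of "snd \<circ> d" t] d by (cases "d t") simp
   moreover have "smooth_real (%t. xi ((fst \<circ> d) t))"
    by (rule func_curve[OF X xi, of "fst \<circ> d"]) (use d in \<open>simp only: mem_Collect_eq\<close>)
   ultimately show ?thesis by (simp add: o_def)
  qed
  then have "restrict (%p. xi (fst p)) (carrier X \<times> carrier Y) \<in> funcs (fs_of_curves (carrier X \<times> carrier Y) ?C)" by simp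
  from f[OF this] show "smooth_real (%t. xi (fst (c t)))" using cA by simp
 qed
 moreover have "(%t. snd (c t)) \<in> curves Y"
 proof (rule curvesI[OF Y])
  show "snd (c t) \<in> carrier Y" for t using cA[of t] by auto
  fix xi assume xi: "xi \<in> funcs Y"
  have "smooth_real (restrict (%p. xi (snd p)) (carrier X \<times> carrier Y) \<circ> d)" if d: "d \<in> ?C" for d
  proof -
   have "d t \<in> carrier X \<times> carrier Y" for t
    using curve_in[OF X, of "fst \<circ> d" t] curve_in[OF Y, of "snd \<circ> d" t] d by (cases "d t") simp
   moreover have "smooth_real (%t. xi ((snd \<circ> d) t))"
    by (rule func_curve[OF Y xi, of "snd \<circ> d"]) (use d in \<open>simp only: mem_Collect_eq\<close>)
   ultimately show ?thesis by (simp add: o_def)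
  qed
  then have "restrict (%p. xi (snd p)) (carrier X \<times> carrier Y) \<in> funcs (fs_of_curves (carrier X \<times> carrier Y) ?C)" by simp
  from f[OF this] show "smooth_real (%t. xi (snd (c t)))" using cA by simp
 qed
 ultimately show "c \<in> ?C" by (simp add: o_def)
qed

lemma carrier_exp [simp]: "carrier (fs_exp X Y) = smooth_maps Y X" by (simp add: fs_exp_def)

lemma curves_exp_iff:
 assumes Y: "froelicher Y"
 shows "c \<in> curves (fs_exp X Y) \<longleftrightarrow> (ALL t. c t \<in> smooth_maps Y X) &
   (ALL a eta. smooth_real a --> eta \<in> curves Y --> (%s. c (a s) (eta s)) \<in> curves X)"
proof -
 have "(\<lambda>(t, y)\<in>UNIV \<times> carrier Y. c t y) \<in> smooth_maps (fs_prod fs_real Y) X \<longleftrightarrow>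
   (ALL a eta. smooth_real a --> eta \<in> curves Y --> (%s. c (a s) (eta s)) \<in> curves X)" (is "?T \<in> _ \<longleftrightarrow> ?R")
  if c: "!!t. c t \<in> smooth_maps Y X"
 proof
  assume T: "?T \<in> smooth_maps (fs_prod fs_real Y) X"
  show ?R
  proof (intro allI impI)
   fix a eta assume a: "smooth_real a" and eta: "eta \<in> curves Y"
   then have "(%s. (a s, eta s)) \<in> curves (fs_prod fs_real Y)" by (simp add: curves_prod_iff)
   from smD(2)[OF T this] show "(%s. c (a s) (eta s)) \<in> curves X" using curve_in[OF Y eta] by simp
  qed
 next
  assume R: ?R
  show "?T \<in> smooth_maps (fs_prod fs_real Y) X"
  proof (rule smI)
   show "?T p \<in> carrier X" if "p \<in> carrier (fs_prod fs_real Y)" for p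
    using that smD(1)[OF c] by (cases p) simp
   fix d assume "d \<in> curves (fs_prod fs_real Y)"
   then have d: "smooth_real (%t. fst (d t))" "(%t. snd (d t)) \<in> curves Y" by (simp_all add: curves_prod_iff)
   have "?T (d t) = c (fst (d t)) (snd (d t))" for t using curve_in[OF Y d(2), of t] by (cases "d t") simp
   then show "(%t. ?T (d t)) \<in> curves X" using R d by simp
  qed simp
 qed
 then show ?thesis by (auto simp: fs_exp_def)
qed

text \<open>A curve of smooth maps is recovered from the smooth functions of it: for a function \<open>\<xi>\<close> and a
  curve \<open>\<eta>\<close>, the functionals \<open>u \<mapsto> \<mu>(\<xi> \<circ> u \<circ> \<eta>)\<close> are smooth, and there are sufficiently many \<open>\<mu>\<close>.\<close>

lemma froelicher_exp:
 assumes X: "froelicher X" and Y: "froelicher Y" shows "froelicher (fs_exp X Y)"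
proof -
 let ?C = "curves (fs_exp X Y)"
 have eq: "fs_exp X Y = fs_of_curves (smooth_maps Y X) ?C" by (simp add: fs_exp_def)
 have "froelicher (fs_of_curves (smooth_maps Y X) ?C)"
 proof (rule froelicher_fs_of_curvesI)
  show "c t \<in> smooth_maps Y X" if "c \<in> ?C" for c t using that unfolding curves_exp_iff[OF Y] by blast
  fix c assume c: "!!t. c t \<in> smooth_maps Y X"
   and f: "!!f. f \<in> funcs (fs_of_curves (smooth_maps Y X) ?C) ==> smooth_real (%t. f (c t))"
  have "(%s. c (a s) (eta s)) \<in> curves X" if a: "smooth_real a" and eta: "eta \<in> curves Y" for a eta
  proof (rule curvesI[OF X])
   show "c (a s) (eta s) \<in> carrier X" for s using smD(1)[OF c curve_in[OF Y eta]] .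
   fix xi assume xi: "xi \<in> funcs X"
   have "smooth2 (%t s. xi (c t (eta s)))"
   proof (rule smooth2_if_smooth_functionals)
    show "smooth_real (%s. xi (c t (eta s)))" for t by (rule func_curve[OF X xi smD(2)[OF c eta]])
    fix \<mu> assume \<mu>: "smooth_functional \<mu>"
    define \<rho> where "\<rho> = (\<lambda>u\<in>smooth_maps Y X. \<mu> (%s. xi (u (eta s))))"
    have "smooth_real (\<rho> \<circ> d)" if d: "d \<in> ?C" for d
    proof -
     have dt: "d t \<in> smooth_maps Y X" for t using d unfolding curves_exp_iff[OF Y] by blast
     have "smooth2 (%s t. xi (d t (eta s)))" unfolding smooth2_def
     proof (intro allI impI)
      fix \<alpha> \<beta> assume ab: "smooth_real \<alpha> & smooth_real \<beta>"
      then have "(%s. eta (\<alpha> s)) \<in> curves Y" using curve_reparam[OF Y eta] by blast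
      then have "(%u. d (\<beta> u) (eta (\<alpha> u))) \<in> curves X"
       using d ab unfolding curves_exp_iff[OF Y] by blast
      from func_curve[OF X xi this] show "smooth_real (%u. xi (d (\<beta> u) (eta (\<alpha> u))))" .
     qed
     from smooth_functionalD(3)[OF \<mu> this] show ?thesis using dt by (simp add: \<rho>_def o_def)
    qed
    then have "\<rho> \<in> funcs (fs_of_curves (smooth_maps Y X) ?C)" by (simp add: \<rho>_def)
    from f[OF this] show "smooth_real (%t. \<mu> (%s. xi (c t (eta s))))" using c by (simp add: \<rho>_def)
   qed
   from smooth2D[OF this a smooth_real_id] show "smooth_real (%s. xi (c (a s) (eta s)))" .
  qed
  with c show "c \<in> ?C" unfolding curves_exp_iff[OF Y] by blast
 qed
 with eq show ?thesis by simp
qed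

section \<open>Isomorphisms\<close>

lemma fs_isoI:
 assumes "h \<in> smooth_maps X Y" "k \<in> smooth_maps Y X"
  "!!x. x \<in> carrier X ==> k (h x) = x" "!!y. y \<in> carrier Y ==> h (k y) = y"
 shows "fs_iso X Y h" unfolding fs_iso_def using assms by blast

text \<open>An isomorphism between \<open>A\<close> and \<open>B\<close> that takes the element \<open>p F\<close> of \<open>A\<close> to the element \<open>q F\<close>
  of \<open>B\<close>, for all \<open>F\<close> in \<open>S\<close>.\<close>

definition iso_along ::
  "'a froelicher => 'b froelicher => 'f set => ('f => 'a) => ('f => 'b) => bool" where
 "iso_along A B S p q \<longleftrightarrow> (\<forall>F\<in>S. p F \<in> carrier A) & (EX h. fs_iso A B h & (\<forall>F\<in>S. h (p F) = q F))"

lemma iso_alongI: "fs_iso A B h ==> (!!F. F \<in> S ==> p F \<in> carrier A) ==> (!!F. F \<in> S ==> h (p F) = q F) ==> iso_along A B S p q"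
 unfolding iso_along_def by blast

lemma iso_along_sym:
 assumes "iso_along A B S p q" shows "iso_along B A S q p"
proof -
 obtain h where h: "fs_iso A B h" "!!F. F \<in> S ==> h (p F) = q F" and p: "!!F. F \<in> S ==> p F \<in> carrier A"
  using assms by (auto simp: iso_along_def)
 obtain k where k: "h \<in> smooth_maps A B" "k \<in> smooth_maps B A"
   "!!x. x \<in> carrier A ==> k (h x) = x" "!!y. y \<in> carrier B ==> h (k y) = y"
  using h(1) by (auto simp: fs_iso_def)
 show ?thesis
 proof (rule iso_alongI[OF fs_isoI[OF k(2,1,4,3)]])
  fix F assume F: "F \<in> S"
  show "q F \<in> carrier B" using smD(1)[OF k(1) p[OF F]] h(2)[OF F] by simp
  show "k (q F) = p F" using k(3)[OF p[OF F]] h(2)[OF F] by simp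
 qed
qed

lemma iso_along_trans:
 assumes A: "froelicher A" and C: "froelicher C" and "iso_along A B S p q" "iso_along B C S q r"
 shows "iso_along A C S p r"
proof -
 obtain h where h: "fs_iso A B h" "!!F. F \<in> S ==> h (p F) = q F" and p: "!!F. F \<in> S ==> p F \<in> carrier A"
  using assms(3) by (auto simp: iso_along_def)
 obtain h' where h': "fs_iso B C h'" "!!F. F \<in> S ==> h' (q F) = r F" using assms(4) by (auto simp: iso_along_def)
 obtain k where k: "h \<in> smooth_maps A B" "k \<in> smooth_maps B A"
   "!!x. x \<in> carrier A ==> k (h x) = x" "!!y. y \<in> carrier B ==> h (k y) = y"
  using h(1) by (auto simp: fs_iso_def)
 obtain k' where k': "h' \<in> smooth_maps B C" "k' \<in> smooth_maps C B"
   "!!x. x \<in> carrier B ==> k' (h' x) = x" "!!y. y \<in> carrier C ==> h' (k' y) = y"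
  using h'(1) by (auto simp: fs_iso_def)
 have "fs_iso A C (compose (carrier A) h' h)"
 proof (rule fs_isoI)
  show "compose (carrier A) h' h \<in> smooth_maps A C" by (rule sm_compose[OF A k(1) k'(1)])
  show "compose (carrier C) k k' \<in> smooth_maps C A" by (rule sm_compose[OF C k'(2) k(2)])
  show "compose (carrier C) k k' (compose (carrier A) h' h x) = x" if x: "x \<in> carrier A" for x
   using x smD(1)[OF k(1) x] smD(1)[OF k'(1) smD(1)[OF k(1) x]] by (simp add: compose_def k(3) k'(3))
  show "compose (carrier A) h' h (compose (carrier C) k k' y) = y" if y: "y \<in> carrier C" for y
   using y smD(1)[OF k'(2) y] smD(1)[OF k(2) smD(1)[OF k'(2) y]] by (simp add: compose_def k(4) k'(4))
 qed
 then show ?thesis by (rule iso_alongI) (use p h(2) h'(2) in \<open>simp_all add: compose_def\<close>)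
qed

lemma postcomp_smooth:
 assumes A: "froelicher A" and Y: "froelicher Y" and h: "h \<in> smooth_maps A B"
 shows "postcomp A Y h \<in> smooth_maps (fs_exp A Y) (fs_exp B Y)" unfolding postcomp_def
proof (rule sm_restrictI[OF froelicher_exp[OF A Y]])
 fix u assume "u \<in> carrier (fs_exp A Y)"
 then show "compose (carrier Y) h u \<in> carrier (fs_exp B Y)" using sm_compose[OF Y _ h] by simp
next
 fix c assume c: "c \<in> curves (fs_exp A Y)"
 then have ct: "!!t. c t \<in> smooth_maps Y A" unfolding curves_exp_iff[OF Y] by blast
 show "(%t. compose (carrier Y) h (c t)) \<in> curves (fs_exp B Y)" unfolding curves_exp_iff[OF Y]
 proof (intro conjI allI impI)
  show "compose (carrier Y) h (c t) \<in> smooth_maps Y B" for t by (rule sm_compose[OF Y ct h])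
  fix a eta assume a: "smooth_real a" and eta: "eta \<in> curves Y"
  have "(%s. c (a s) (eta s)) \<in> curves A" using c a eta unfolding curves_exp_iff[OF Y] by blast
  from smD(2)[OF h this] show "(%s. compose (carrier Y) h (c (a s)) (eta s)) \<in> curves B"
   using curve_in[OF Y eta] by (simp add: compose_def)
 qed
qed

lemma postcomp_iso:
 assumes A: "froelicher A" and B: "froelicher B" and Y: "froelicher Y" and h: "fs_iso A B h"
 shows "fs_iso (fs_exp A Y) (fs_exp B Y) (postcomp A Y h)"
proof -
 obtain k where k: "h \<in> smooth_maps A B" "k \<in> smooth_maps B A"
   "!!x. x \<in> carrier A ==> k (h x) = x" "!!y. y \<in> carrier B ==> h (k y) = y"
  using h by (auto simp: fs_iso_def)
 show ?thesis
 proof (rule fs_isoI[OF postcomp_smooth[OF A Y k(1)] postcomp_smooth[OF B Y k(2)]])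
  fix u assume "u \<in> carrier (fs_exp A Y)"
  then have u: "u \<in> smooth_maps Y A" by simp
  have "compose (carrier Y) k (compose (carrier Y) h u) = u"
   by (rule sm_eqI[OF sm_compose[OF Y sm_compose[OF Y u k(1)] k(2)] u])
     (simp add: compose_def k(3) smD(1)[OF u])
  then show "postcomp B Y k (postcomp A Y h u) = u" using u sm_compose[OF Y u k(1)] by (simp add: postcomp_def)
 next
  fix u assume "u \<in> carrier (fs_exp B Y)"
  then have u: "u \<in> smooth_maps Y B" by simp
  have "compose (carrier Y) h (compose (carrier Y) k u) = u"
   by (rule sm_eqI[OF sm_compose[OF Y sm_compose[OF Y u k(2)] k(1)] u])
     (simp add: compose_def k(4) smD(1)[OF u])
  then show "postcomp A Y h (postcomp B Y k u) = u" using u sm_compose[OF Y u k(2)] by (simp add: postcomp_def)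
 qed
qed

definition fs_curry :: "'b froelicher => 'c froelicher => ('c \<times> 'b => 'a) => 'c => 'b => 'a" where
 "fs_curry Y Z u = (\<lambda>z\<in>carrier Z. \<lambda>y\<in>carrier Y. u (z, y))"

definition fs_uncurry :: "'b froelicher => 'c froelicher => ('c => 'b => 'a) => 'c \<times> 'b => 'a" where
 "fs_uncurry Y Z u = (\<lambda>p\<in>carrier Z \<times> carrier Y. u (fst p) (snd p))"

lemma slice_smooth:
 assumes Y: "froelicher Y" and Z: "froelicher Z" and u: "u \<in> smooth_maps (fs_prod Z Y) X" and z: "z \<in> carrier Z"
 shows "(\<lambda>y\<in>carrier Y. u (z, y)) \<in> smooth_maps Y X"
proof (rule sm_restrictI[OF Y])
 show "u (z, y) \<in> carrier X" if "y \<in> carrier Y" for y using smD(1)[OF u, of "(z, y)"] z that by simp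
 fix c assume "c \<in> curves Y"
 then have "(%t. (z, c t)) \<in> curves (fs_prod Z Y)" by (simp add: curves_prod_iff const_curve[OF Z z])
 from smD(2)[OF u this] show "(%t. u (z, c t)) \<in> curves X" .
qed

lemma fs_curry_smooth:
 assumes Y: "froelicher Y" and Z: "froelicher Z" and u: "u \<in> smooth_maps (fs_prod Z Y) X"
 shows "fs_curry Y Z u \<in> smooth_maps Z (fs_exp X Y)" unfolding fs_curry_def
proof (rule sm_restrictI[OF Z])
 show "(\<lambda>y\<in>carrier Y. u (z, y)) \<in> carrier (fs_exp X Y)" if "z \<in> carrier Z" for z
  using slice_smooth[OF Y Z u that] by simp
 fix c assume c: "c \<in> curves Z"
 show "(%t. \<lambda>y\<in>carrier Y. u (c t, y)) \<in> curves (fs_exp X Y)" unfolding curves_exp_iff[OF Y]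
 proof (intro conjI allI impI)
  show "(\<lambda>y\<in>carrier Y. u (c t, y)) \<in> smooth_maps Y X" for t by (rule slice_smooth[OF Y Z u curve_in[OF Z c]])
  fix a eta assume "smooth_real a" and eta: "eta \<in> curves Y"
  then have "(%s. (c (a s), eta s)) \<in> curves (fs_prod Z Y)" by (simp add: curves_prod_iff curve_reparam[OF Z c])
  from smD(2)[OF u this] show "(%s. (\<lambda>y\<in>carrier Y. u (c (a s), y)) (eta s)) \<in> curves X"
   using curve_in[OF Y eta] by simp
 qed
qed

lemma fs_uncurry_smooth:
 assumes Y: "froelicher Y" and Z: "froelicher Z" and u: "u \<in> smooth_maps Z (fs_exp X Y)"
 shows "fs_uncurry Y Z u \<in> smooth_maps (fs_prod Z Y) X"
proof -
 have uz: "u z \<in> smooth_maps Y X" if "z \<in> carrier Z" for z using smD(1)[OF u that] by simp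
 have "(\<lambda>p\<in>carrier (fs_prod Z Y). u (fst p) (snd p)) \<in> smooth_maps (fs_prod Z Y) X"
 proof (rule sm_restrictI[OF froelicher_prod[OF Z Y]])
  show "u (fst p) (snd p) \<in> carrier X" if "p \<in> carrier (fs_prod Z Y)" for p using that smD(1)[OF uz] by auto
  fix c assume "c \<in> curves (fs_prod Z Y)"
  then have c: "(%t. fst (c t)) \<in> curves Z" "(%t. snd (c t)) \<in> curves Y" by (simp_all add: curves_prod_iff)
  from smD(2)[OF u c(1)] have uc: "(%t. u (fst (c t))) \<in> curves (fs_exp X Y)" .
  have "smooth_real (%s. s)" by simp
  with uc c(2) show "(%t. u (fst (c t)) (snd (c t))) \<in> curves X" unfolding curves_exp_iff[OF Y] by fast
 qed
 then show ?thesis by (simp add: fs_uncurry_def)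
qed

lemma uncurry_curry: "u \<in> smooth_maps (fs_prod Z Y) X ==> fs_uncurry Y Z (fs_curry Y Z u) = u"
 by (rule extensionalityI[of _ "carrier (fs_prod Z Y)"])
   (auto simp: fs_uncurry_def fs_curry_def smD(3)[of u "fs_prod Z Y" X, simplified])

lemma curry_uncurry:
 assumes Y: "froelicher Y" and u: "u \<in> smooth_maps Z (fs_exp X Y)"
 shows "fs_curry Y Z (fs_uncurry Y Z u) = u"
proof (rule extensionalityI[of _ "carrier Z"])
 show "fs_curry Y Z (fs_uncurry Y Z u) \<in> extensional (carrier Z)" by (simp add: fs_curry_def)
 show "u \<in> extensional (carrier Z)" by (rule smD(3)[OF u])
 fix z assume z: "z \<in> carrier Z"
 have "u z \<in> extensional (carrier Y)" using smD(1)[OF u z] by (simp add: smD(3))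
 then have "(\<lambda>y\<in>carrier Y. u z y) = u z" by (rule extensional_restrict)
 with z show "fs_curry Y Z (fs_uncurry Y Z u) z = u z" by (simp add: fs_curry_def fs_uncurry_def cong: restrict_cong)
qed

lemma curry_iso:
 assumes X: "froelicher X" and Y: "froelicher Y" and Z: "froelicher Z"
 shows "fs_iso (fs_exp X (fs_prod Z Y)) (fs_exp (fs_exp X Y) Z) (\<lambda>u\<in>smooth_maps (fs_prod Z Y) X. fs_curry Y Z u)"
proof (rule fs_isoI)
 let ?ZY = "fs_prod Z Y"
 note ZY = froelicher_prod[OF Z Y]
 let ?k = "\<lambda>u\<in>smooth_maps Z (fs_exp X Y). fs_uncurry Y Z u"
 have "restrict (fs_curry Y Z) (carrier (fs_exp X ?ZY)) \<in> smooth_maps (fs_exp X ?ZY) (fs_exp (fs_exp X Y) Z)"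
 proof (rule sm_restrictI[OF froelicher_exp[OF X ZY]])
  show "fs_curry Y Z u \<in> carrier (fs_exp (fs_exp X Y) Z)" if "u \<in> carrier (fs_exp X ?ZY)" for u
   using fs_curry_smooth[OF Y Z] that by simp
  fix c assume c: "c \<in> curves (fs_exp X ?ZY)"
  then have ct: "!!t. c t \<in> smooth_maps ?ZY X" unfolding curves_exp_iff[OF ZY] by blast
  show "(%t. fs_curry Y Z (c t)) \<in> curves (fs_exp (fs_exp X Y) Z)" unfolding curves_exp_iff[OF Z]
  proof (intro conjI allI impI)
   show "fs_curry Y Z (c t) \<in> smooth_maps Z (fs_exp X Y)" for t by (rule fs_curry_smooth[OF Y Z ct])
   fix a \<zeta> assume a: "smooth_real a" and \<zeta>: "\<zeta> \<in> curves Z"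
   show "(%s. fs_curry Y Z (c (a s)) (\<zeta> s)) \<in> curves (fs_exp X Y)" unfolding curves_exp_iff[OF Y]
   proof (intro conjI allI impI)
    show "fs_curry Y Z (c (a s)) (\<zeta> s) \<in> smooth_maps Y X" for s
     using smD(1)[OF fs_curry_smooth[OF Y Z ct] curve_in[OF Z \<zeta>]] by simp
    fix b eta assume b: "smooth_real b" and eta: "eta \<in> curves Y"
    have "(%s. (\<zeta> (b s), eta s)) \<in> curves ?ZY" using eta by (simp add: curves_prod_iff curve_reparam[OF Z \<zeta> b])
    moreover have "smooth_real (%s. a (b s))" by (rule smooth_real_compose[OF a b])
    ultimately have "(%s. c (a (b s)) (\<zeta> (b s), eta s)) \<in> curves X"
     using c unfolding curves_exp_iff[OF ZY] by fast
    then show "(%s. fs_curry Y Z (c (a (b s))) (\<zeta> (b s)) (eta s)) \<in> curves X"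
     using curve_in[OF Y eta] curve_in[OF Z \<zeta>] by (simp add: fs_curry_def)
   qed
  qed
 qed
 then show "(\<lambda>u\<in>smooth_maps ?ZY X. fs_curry Y Z u) \<in> smooth_maps (fs_exp X ?ZY) (fs_exp (fs_exp X Y) Z)" by simp
 have "restrict (fs_uncurry Y Z) (carrier (fs_exp (fs_exp X Y) Z)) \<in> smooth_maps (fs_exp (fs_exp X Y) Z) (fs_exp X ?ZY)"
 proof (rule sm_restrictI[OF froelicher_exp[OF froelicher_exp[OF X Y] Z]])
  show "fs_uncurry Y Z u \<in> carrier (fs_exp X ?ZY)" if "u \<in> carrier (fs_exp (fs_exp X Y) Z)" for u
   using fs_uncurry_smooth[OF Y Z] that by simp
  fix c assume c: "c \<in> curves (fs_exp (fs_exp X Y) Z)"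
  then have ct: "!!t. c t \<in> smooth_maps Z (fs_exp X Y)" unfolding curves_exp_iff[OF Z] by blast
  show "(%t. fs_uncurry Y Z (c t)) \<in> curves (fs_exp X ?ZY)" unfolding curves_exp_iff[OF ZY]
  proof (intro conjI allI impI)
   show "fs_uncurry Y Z (c t) \<in> smooth_maps ?ZY X" for t by (rule fs_uncurry_smooth[OF Y Z ct])
   fix a eta assume a: "smooth_real a" and "eta \<in> curves ?ZY"
   then have eta: "(%t. fst (eta t)) \<in> curves Z" "(%t. snd (eta t)) \<in> curves Y" by (simp_all add: curves_prod_iff)
   have "(%s. c (a s) (fst (eta s))) \<in> curves (fs_exp X Y)"
    using c a eta(1) unfolding curves_exp_iff[OF Z] by fast
   moreover have "smooth_real (%s. s)" by simp
   ultimately have "(%s. c (a s) (fst (eta s)) (snd (eta s))) \<in> curves X"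
    using eta(2) unfolding curves_exp_iff[OF Y] by fast
   moreover have "eta s \<in> carrier Z \<times> carrier Y" for s
    using curve_in[OF Z eta(1), of s] curve_in[OF Y eta(2), of s] by (cases "eta s") simp
   ultimately show "(%s. fs_uncurry Y Z (c (a s)) (eta s)) \<in> curves X" by (simp add: fs_uncurry_def)
  qed
 qed
 then show "?k \<in> smooth_maps (fs_exp (fs_exp X Y) Z) (fs_exp X ?ZY)" by simp
 show "?k ((\<lambda>u\<in>smooth_maps ?ZY X. fs_curry Y Z u) u) = u" if "u \<in> carrier (fs_exp X ?ZY)" for u
  using that fs_curry_smooth[OF Y Z, of u X] uncurry_curry[of u Z Y X] by simp
 show "(\<lambda>u\<in>smooth_maps ?ZY X. fs_curry Y Z u) (?k u) = u" if "u \<in> carrier (fs_exp (fs_exp X Y) Z)" for u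
  using that fs_uncurry_smooth[OF Y Z, of u X] curry_uncurry[OF Y, of u Z X] by simp
qed

lemma pair_smooth:
 assumes T: "froelicher T" and f: "f \<in> smooth_maps T X" and g: "g \<in> smooth_maps T Y"
 shows "(\<lambda>s\<in>carrier T. (f s, g s)) \<in> smooth_maps T (fs_prod X Y)"
 by (rule sm_restrictI[OF T]) (simp_all add: curves_prod_iff smD(1,2)[OF f] smD(1,2)[OF g])

lemma fst_smooth: "froelicher X ==> froelicher Y ==> restrict fst (carrier X \<times> carrier Y) \<in> smooth_maps (fs_prod X Y) X"
 using sm_restrictI[OF froelicher_prod, of X Y fst X] by (auto simp: curves_prod_iff)

lemma snd_smooth: "froelicher X ==> froelicher Y ==> restrict snd (carrier X \<times> carrier Y) \<in> smooth_maps (fs_prod X Y) Y"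
 using sm_restrictI[OF froelicher_prod, of X Y snd Y] by (auto simp: curves_prod_iff)

lemma comp_fst_smooth:
 assumes X: "froelicher X" and Y: "froelicher Y" and T: "froelicher T" and u: "u \<in> smooth_maps T (fs_prod X Y)"
 shows "(\<lambda>s\<in>carrier T. fst (u s)) \<in> smooth_maps T X" "(\<lambda>s\<in>carrier T. snd (u s)) \<in> smooth_maps T Y"
proof -
 have "fst (u s) \<in> carrier X" "snd (u s) \<in> carrier Y" if "s \<in> carrier T" for s
  using smD(1)[OF u that] by auto
 then show "(\<lambda>s\<in>carrier T. fst (u s)) \<in> smooth_maps T X" "(\<lambda>s\<in>carrier T. snd (u s)) \<in> smooth_maps T Y"
  using smD(2)[OF u] by (auto intro!: sm_restrictI[OF T] simp: curves_prod_iff)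
qed

lemma prod_map_iso:
 assumes X: "froelicher X" and Y: "froelicher Y" and X': "froelicher X'" and Y': "froelicher Y'"
  and h: "fs_iso X X' h" and k: "fs_iso Y Y' k"
 shows "fs_iso (fs_prod X Y) (fs_prod X' Y') (\<lambda>p\<in>carrier X \<times> carrier Y. (h (fst p), k (snd p)))"
proof -
 obtain h' where h': "h \<in> smooth_maps X X'" "h' \<in> smooth_maps X' X"
   "!!x. x \<in> carrier X ==> h' (h x) = x" "!!y. y \<in> carrier X' ==> h (h' y) = y"
  using h by (auto simp: fs_iso_def)
 obtain k' where k': "k \<in> smooth_maps Y Y'" "k' \<in> smooth_maps Y' Y"
   "!!x. x \<in> carrier Y ==> k' (k x) = x" "!!y. y \<in> carrier Y' ==> k (k' y) = y"
  using k by (auto simp: fs_iso_def)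
 show ?thesis
 proof (rule fs_isoI)
  show "(\<lambda>p\<in>carrier X \<times> carrier Y. (h (fst p), k (snd p))) \<in> smooth_maps (fs_prod X Y) (fs_prod X' Y')"
   using sm_restrictI[OF froelicher_prod[OF X Y], of "%p. (h (fst p), k (snd p))" "fs_prod X' Y'"]
    smD(1,2)[OF h'(1)] smD(1,2)[OF k'(1)] by (auto simp: curves_prod_iff)
  show "(\<lambda>p\<in>carrier X' \<times> carrier Y'. (h' (fst p), k' (snd p))) \<in> smooth_maps (fs_prod X' Y') (fs_prod X Y)"
   using sm_restrictI[OF froelicher_prod[OF X' Y'], of "%p. (h' (fst p), k' (snd p))" "fs_prod X Y"]
    smD(1,2)[OF h'(2)] smD(1,2)[OF k'(2)] by (auto simp: curves_prod_iff)
 qed (auto simp: h'(3,4) k'(3,4) smD(1)[OF h'(1)] smD(1)[OF h'(2)] smD(1)[OF k'(1)] smD(1)[OF k'(2)])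
qed

lemma exp_prod_iso:
 assumes X: "froelicher X" and Y: "froelicher Y" and Z: "froelicher Z"
 shows "fs_iso (fs_exp (fs_prod X Y) Z) (fs_prod (fs_exp X Z) (fs_exp Y Z))
  (\<lambda>u\<in>smooth_maps Z (fs_prod X Y). (\<lambda>z\<in>carrier Z. fst (u z), \<lambda>z\<in>carrier Z. snd (u z)))" (is "fs_iso ?A ?B ?h")
proof (rule fs_isoI)
 let ?k = "\<lambda>p\<in>smooth_maps Z X \<times> smooth_maps Z Y. \<lambda>z\<in>carrier Z. (fst p z, snd p z)"
 note comps = comp_fst_smooth[OF X Y Z]
 have "restrict (%u. (\<lambda>z\<in>carrier Z. fst (u z), \<lambda>z\<in>carrier Z. snd (u z))) (carrier ?A) \<in> smooth_maps ?A ?B"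
 proof (rule sm_restrictI[OF froelicher_exp[OF froelicher_prod[OF X Y] Z]])
  show "(\<lambda>z\<in>carrier Z. fst (u z), \<lambda>z\<in>carrier Z. snd (u z)) \<in> carrier ?B" if "u \<in> carrier ?A" for u
   using comps[of u] that by simp
  fix c assume c: "c \<in> curves ?A"
  then have ct: "!!t. c t \<in> smooth_maps Z (fs_prod X Y)"
   and cc: "!!a eta. smooth_real a ==> eta \<in> curves Z ==> (%s. c (a s) (eta s)) \<in> curves (fs_prod X Y)"
   unfolding curves_exp_iff[OF Z] by blast+
  show "(%t. (\<lambda>z\<in>carrier Z. fst (c t z), \<lambda>z\<in>carrier Z. snd (c t z))) \<in> curves ?B"
   using comps[OF ct] cc by (simp add: curves_prod_iff curves_exp_iff[OF Z] curve_in[OF Z])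
 qed
 then show "?h \<in> smooth_maps ?A ?B" by simp
 have "restrict (%p. \<lambda>z\<in>carrier Z. (fst p z, snd p z)) (carrier ?B) \<in> smooth_maps ?B ?A"
 proof (rule sm_restrictI[OF froelicher_prod[OF froelicher_exp[OF X Z] froelicher_exp[OF Y Z]]])
  show "(\<lambda>z\<in>carrier Z. (fst p z, snd p z)) \<in> carrier ?A" if "p \<in> carrier ?B" for p
   using pair_smooth[OF Z, of "fst p" X "snd p" Y] that by auto
  fix c assume c: "c \<in> curves ?B"
  then have ct: "!!t. fst (c t) \<in> smooth_maps Z X" "!!t. snd (c t) \<in> smooth_maps Z Y"
   and cc: "!!a eta. smooth_real a ==> eta \<in> curves Z ==> (%s. fst (c (a s)) (eta s)) \<in> curves X & (%s. snd (c (a s)) (eta s)) \<in> curves Y"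
   unfolding curves_prod_iff curves_exp_iff[OF Z] by blast+
  show "(%t. \<lambda>z\<in>carrier Z. (fst (c t) z, snd (c t) z)) \<in> curves ?A"
   using pair_smooth[OF Z ct] cc by (simp add: curves_prod_iff curves_exp_iff[OF Z] curve_in[OF Z])
 qed
 then show "?k \<in> smooth_maps ?B ?A" by simp
 fix u assume "u \<in> carrier ?A"
 then have u: "u \<in> smooth_maps Z (fs_prod X Y)" by simp
 have "(\<lambda>z\<in>carrier Z. (fst (u z), snd (u z))) = u" using smD(3)[OF u] by (simp add: extensional_restrict)
 then show "?k (?h u) = u" using u comps[OF u] by (simp cong: restrict_cong)
next
 fix p assume p: "p \<in> carrier ?B"
 then have p12: "fst p \<in> smooth_maps Z X" "snd p \<in> smooth_maps Z Y" by auto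
 have "(\<lambda>z\<in>carrier Z. fst p z) = fst p" "(\<lambda>z\<in>carrier Z. snd p z) = snd p"
  using smD(3)[OF p12(1)] smD(3)[OF p12(2)] by (simp_all add: extensional_restrict)
 then show "?h ((\<lambda>p\<in>smooth_maps Z X \<times> smooth_maps Z Y. \<lambda>z\<in>carrier Z. (fst p z, snd p z)) p) = p"
  using p p12 pair_smooth[OF Z p12] by (cases p) (simp cong: restrict_cong)
qed

section \<open>Weil prolongation in terms of representatives\<close>

abbreviation Ann :: "weil_pres => ((point => real) => real) => bool" where
 "Ann W \<equiv> annihilator (wvars W) (wnull W)"

text \<open>Smoothness for functions whose values outside the space resp. outside Euclidean space do not
  matter. It spares the restrictions that membership in the sets of smooth maps requires.\<close>

definition fsmooth :: "'a froelicher => ('a => real) => bool" where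
 "fsmooth X xi \<longleftrightarrow> (\<forall>c\<in>curves X. smooth_real (%t. xi (c t)))"

definition rep :: "nat => 'a froelicher => (point => 'a) => bool" where
 "rep n X f \<longleftrightarrow> (ALL c. curve_Rn n c --> (%u. f (c u)) \<in> curves X)"

lemma fsmoothD: "fsmooth X xi ==> c \<in> curves X ==> smooth_real (%t. xi (c t))" by (simp add: fsmooth_def)

lemma repD: "rep n X f ==> curve_Rn n c ==> (%u. f (c u)) \<in> curves X" by (simp add: rep_def)

lemma rep_carrier: "froelicher X ==> rep n X f ==> x \<in> Rn n ==> f x \<in> carrier X"
 using curve_in[OF _ repD[OF _ curve_Rn_const]] .

lemma rep_cong:
 assumes f: "rep n X f" and eq: "!!x. x \<in> Rn n ==> f x = g x" shows "rep n X g" unfolding rep_def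
proof (intro allI impI)
 fix c assume c: "curve_Rn n c"
 then have "(%u. g (c u)) = (%u. f (c u))" using eq by (simp add: curve_Rn_def)
 then show "(%u. g (c u)) \<in> curves X" using repD[OF f c] by simp
qed

lemma rep_iff:
 assumes X: "froelicher X" shows "restrict f (Rn n) \<in> smooth_maps (fs_Rn n) X \<longleftrightarrow> rep n X f"
proof
 assume f: "restrict f (Rn n) \<in> smooth_maps (fs_Rn n) X"
 have "rep n X (restrict f (Rn n))" unfolding rep_def by (intro allI impI smD(2)[OF f]) (simp add: curves_fs_Rn)
 then show "rep n X f" by (rule rep_cong) simp
next
 assume f: "rep n X f"
 have "restrict f (carrier (fs_Rn n)) \<in> smooth_maps (fs_Rn n) X"
  by (rule sm_restrictI[OF froelicher_Rn]) (simp_all add: rep_carrier[OF X f] repD[OF f] curves_fs_Rn)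
 then show "restrict f (Rn n) \<in> smooth_maps (fs_Rn n) X" by simp
qed

lemma sm_rep:
 assumes X: "froelicher X" and f: "f \<in> smooth_maps (fs_Rn n) X"
 shows "rep n X f" "restrict f (Rn n) = f"
proof -
 show eq: "restrict f (Rn n) = f" using smD(3)[OF f] by (simp add: extensional_restrict)
 show "rep n X f" using rep_iff[OF X, of f n] f eq by simp
qed

lemma fsmooth_rep:
 assumes "fsmooth X xi" "rep n X f" shows "csmooth n (%x. xi (f x))"
 unfolding csmooth_def by (intro allI impI fsmoothD[OF assms(1) repD[OF assms(2)]])

lemma fsmooth_func: "froelicher X ==> xi \<in> funcs X ==> fsmooth X xi" by (simp add: fsmooth_def func_curve)

lemma fsmooth_restrict: "froelicher X ==> fsmooth X xi ==> restrict xi (carrier X) \<in> funcs X"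
 by (rule funcsI) (simp_all add: fsmoothD)

lemma fsmooth_sm:
 assumes h: "h \<in> smooth_maps X Y" and xi: "fsmooth Y xi" shows "fsmooth X (%x. xi (h x))" unfolding fsmooth_def
proof
 fix c assume "c \<in> curves X"
 from fsmoothD[OF xi smD(2)[OF h this]] show "smooth_real (%t. xi (h (c t)))" .
qed

lemma rep_sm:
 assumes h: "h \<in> smooth_maps X Y" and f: "rep n X f" shows "rep n Y (%x. h (f x))" unfolding rep_def
proof (intro allI impI)
 fix c assume "curve_Rn n c"
 from smD(2)[OF h repD[OF f this]] show "(%u. h (f (c u))) \<in> curves Y" .
qed

text \<open>Two representatives agree in the Weil algebra along every smooth function.\<close>

definition weil_eq :: "'a froelicher => weil_pres => (point => 'a) => (point => 'a) => bool" where
 "weil_eq X W f g \<longleftrightarrow>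
   (ALL xi L. fsmooth X xi --> Ann W L --> L (%x. xi (f x)) = L (%x. xi (g x)))"

lemma weil_eqD:
 assumes "weil_eq X W f g" "fsmooth X xi" "Ann W L" shows "L (%x. xi (f x)) = L (%x. xi (g x))"
 by (rule assms(1)[unfolded weil_eq_def, rule_format, OF assms(2,3)])

lemma weil_eqI:
 assumes "!!xi L. fsmooth X xi ==> Ann W L ==> L (%x. xi (f x)) = L (%x. xi (g x))"
 shows "weil_eq X W f g" unfolding weil_eq_def
proof (intro allI impI)
 fix xi L assume xi: "fsmooth X xi" and L: "Ann W L"
 show "L (%x. xi (f x)) = L (%x. xi (g x))" by (rule assms[OF xi L])
qed

lemma weil_eq_refl: "weil_eq X W f f" by (rule weil_eqI) (rule refl)

lemma weil_eq_sym: assumes "weil_eq X W f g" shows "weil_eq X W g f"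
proof (rule weil_eqI)
 fix xi L assume xi: "fsmooth X xi" and L: "Ann W L"
 show "L (%x. xi (g x)) = L (%x. xi (f x))" by (rule weil_eqD[OF assms xi L, symmetric])
qed

lemma weil_eq_trans: assumes "weil_eq X W f g" "weil_eq X W g h" shows "weil_eq X W f h"
proof (rule weil_eqI)
 fix xi L assume xi: "fsmooth X xi" and L: "Ann W L"
 show "L (%x. xi (f x)) = L (%x. xi (h x))" by (rule trans[OF weil_eqD[OF assms(1) xi L] weil_eqD[OF assms(2) xi L]])
qed

lemma prolong_rel_iff:
 assumes X: "froelicher X" and W: "weil W"
  and f: "f \<in> smooth_maps (fs_Rn (wvars W)) X" and g: "g \<in> smooth_maps (fs_Rn (wvars W)) X"
 shows "(f, g) \<in> prolong_rel X W \<longleftrightarrow> f (%_. 0) = g (%_. 0) & weil_eq X W f g"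
proof -
 interpret W: weil_algebra W by (rule weil_algebra.intro[OF W])
 note rf = sm_rep(1)[OF X f] and rg = sm_rep(1)[OF X g]
 have 1: "(\<lambda>x\<in>Rn (wvars W). xi (f x) - xi (g x)) \<in> wideal W \<longleftrightarrow>
   (ALL L. Ann W L --> L (%x. xi (f x)) = L (%x. xi (g x)))" if xi: "fsmooth X xi" for xi
 proof -
  have "(\<lambda>x\<in>Rn (wvars W). xi (f x) - xi (g x)) \<in> wideal W \<longleftrightarrow> wnull W (%x. xi (f x) - xi (g x))"
   by (simp only: wnull_def)
  also note W.wnull_diff_iff[OF fsmooth_rep[OF xi rf] fsmooth_rep[OF xi rg]]
  finally show ?thesis .
 qed
 have 2: "(\<forall>xi\<in>funcs X. (\<lambda>x\<in>Rn (wvars W). xi (f x) - xi (g x)) \<in> wideal W) \<longleftrightarrow> weil_eq X W f g"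
 proof
  assume *: "\<forall>xi\<in>funcs X. (\<lambda>x\<in>Rn (wvars W). xi (f x) - xi (g x)) \<in> wideal W"
  show "weil_eq X W f g"
  proof (rule weil_eqI)
   fix xi L assume xi: "fsmooth X xi" and L: "Ann W L"
   let ?xi = "restrict xi (carrier X)"
   have F: "?xi \<in> funcs X" by (rule fsmooth_restrict[OF X xi])
   from iffD1[OF 1[OF fsmooth_func[OF X F]] bspec[OF * F]]
   have "Ann W L --> L (%x. ?xi (f x)) = L (%x. ?xi (g x))" by (rule spec)
   then have e: "L (%x. ?xi (f x)) = L (%x. ?xi (g x))" using L by (rule mp)
   have r: "L (%x. xi (h x)) = L (%x. ?xi (h x))" if h: "rep (wvars W) X h" for h
    by (rule W.ann_cong[OF L fsmooth_rep[OF xi h]]) (simp add: rep_carrier[OF X h])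
   show "L (%x. xi (f x)) = L (%x. xi (g x))" unfolding r[OF rf] r[OF rg] by (rule e)
  qed
 next
  assume *: "weil_eq X W f g"
  show "\<forall>xi\<in>funcs X. (\<lambda>x\<in>Rn (wvars W). xi (f x) - xi (g x)) \<in> wideal W"
  proof
   fix xi assume "xi \<in> funcs X"
   then have xi: "fsmooth X xi" by (intro fsmooth_func[OF X])
   show "(\<lambda>x\<in>Rn (wvars W). xi (f x) - xi (g x)) \<in> wideal W"
   proof (rule iffD2[OF 1[OF xi]], intro allI impI)
    fix L assume "Ann W L"
    then show "L (%x. xi (f x)) = L (%x. xi (g x))" by (rule weil_eqD[OF * xi])
   qed
  qed
 qed
 have "(f, g) \<in> prolong_rel X W \<longleftrightarrow> f (%_. 0) = g (%_. 0) &
   (\<forall>xi\<in>funcs X. (\<lambda>x\<in>Rn (wvars W). xi (f x) - xi (g x)) \<in> wideal W)"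
  using f g by (simp add: prolong_rel_def)
 then show ?thesis unfolding 2 .
qed

definition pc :: "'a froelicher => weil_pres => (point => 'a) => (point => 'a) set" where
 "pc X W f = pcls X W (restrict f (Rn (wvars W)))"

lemma pc_cong: "(!!x. x \<in> Rn (wvars W) ==> f x = g x) ==> pc X W f = pc X W g"
 unfolding pc_def by (simp cong: restrict_cong)

lemma pcls_eq_pc: "froelicher X ==> f \<in> smooth_maps (fs_Rn (wvars W)) X ==> pcls X W f = pc X W f"
 by (simp add: pc_def sm_rep(2))

lemma pcls_eqI:
 assumes X: "froelicher X" and W: "weil W"
  and f: "f \<in> smooth_maps (fs_Rn (wvars W)) X" and g: "g \<in> smooth_maps (fs_Rn (wvars W)) X"
 shows "pcls X W f = pcls X W g \<longleftrightarrow> (f, g) \<in> prolong_rel X W"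
proof
 have "(g, g) \<in> prolong_rel X W" unfolding prolong_rel_iff[OF X W g g] by (simp add: weil_eq_refl)
 then have gg: "g \<in> pcls X W g" by (simp add: pcls_def)
 show "(f, g) \<in> prolong_rel X W" if e: "pcls X W f = pcls X W g"
 proof -
  have "g \<in> pcls X W f" unfolding e by (rule gg)
  then show ?thesis by (simp add: pcls_def)
 qed
 assume fg: "(f, g) \<in> prolong_rel X W"
 have "(f, h) \<in> prolong_rel X W \<longleftrightarrow> (g, h) \<in> prolong_rel X W" for h
 proof (cases "h \<in> smooth_maps (fs_Rn (wvars W)) X")
  case True
  have 0: "f (%_. 0) = g (%_. 0)" and e: "weil_eq X W f g" using fg[unfolded prolong_rel_iff[OF X W f g]] by simp_all
  have "weil_eq X W f h \<longleftrightarrow> weil_eq X W g h"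
   using weil_eq_trans[OF e, of h] weil_eq_trans[OF weil_eq_sym[OF e], of h] by (rule iffI[rotated])
  with 0 show ?thesis unfolding prolong_rel_iff[OF X W f True] prolong_rel_iff[OF X W g True] by simp
 qed (simp add: prolong_rel_def)
 then show "pcls X W f = pcls X W g" unfolding pcls_def by blast
qed

lemma pc_eq_iff:
 assumes X: "froelicher X" and W: "weil W" and f: "rep (wvars W) X f" and g: "rep (wvars W) X g"
 shows "pc X W f = pc X W g \<longleftrightarrow> f (%_. 0) = g (%_. 0) & weil_eq X W f g"
proof -
 interpret W: weil_algebra W by (rule weil_algebra.intro[OF W])
 let ?f = "restrict f (Rn (wvars W))" and ?g = "restrict g (Rn (wvars W))"
 have M: "?f \<in> smooth_maps (fs_Rn (wvars W)) X" "?g \<in> smooth_maps (fs_Rn (wvars W)) X"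
  using f g by (simp_all add: rep_iff[OF X])
 have eq: "weil_eq X W (restrict h (Rn (wvars W))) h" if h: "rep (wvars W) X h" for h
 proof (rule weil_eqI)
  fix xi L assume xi: "fsmooth X xi" and L: "Ann W L"
  show "L (%x. xi (restrict h (Rn (wvars W)) x)) = L (%x. xi (h x))"
   by (rule sym, rule W.ann_cong[OF L fsmooth_rep[OF xi h]]) simp
 qed
 have "pc X W f = pc X W g \<longleftrightarrow> ?f (%_. 0) = ?g (%_. 0) & weil_eq X W ?f ?g"
  unfolding pc_def pcls_eqI[OF X W M] by (rule prolong_rel_iff[OF X W M])
 also have "weil_eq X W ?f ?g \<longleftrightarrow> weil_eq X W f g"
 proof
  show "weil_eq X W f g" if "weil_eq X W ?f ?g"
   by (rule weil_eq_trans[OF weil_eq_sym[OF eq[OF f]] weil_eq_trans[OF that eq[OF g]]])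
  show "weil_eq X W ?f ?g" if "weil_eq X W f g"
   by (rule weil_eq_trans[OF eq[OF f] weil_eq_trans[OF that weil_eq_sym[OF eq[OF g]]]])
 qed
 also have "?f (%_. 0) = ?g (%_. 0) \<longleftrightarrow> f (%_. 0) = g (%_. 0)" by simp
 finally show ?thesis .
qed

lemma carrier_prolong: "carrier (prolong X W) = pcls X W ` smooth_maps (fs_Rn (wvars W)) X"
 by (auto simp: prolong_def Let_def quotient_def pcls_def)

lemma pc_carrier: "froelicher X ==> rep (wvars W) X f ==> pc X W f \<in> carrier (prolong X W)"
 by (simp add: carrier_prolong pc_def rep_iff)

lemma pc_cases:
 assumes X: "froelicher X" and a: "a \<in> carrier (prolong X W)"
 obtains f where "rep (wvars W) X f" "a = pc X W f"
proof -
 obtain f where f: "f \<in> smooth_maps (fs_Rn (wvars W)) X" "a = pcls X W f" using a by (auto simp: carrier_prolong)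
 show ?thesis by (rule that[OF sm_rep(1)[OF X f(1)]]) (simp add: f(2) pcls_eq_pc[OF X f(1)])
qed

text \<open>Members of a class are again representatives of it, so that any construction on
  representatives that respects the relation is what the selection operator returns.\<close>

lemma the_elem_pc:
 assumes X: "froelicher X" and W: "weil W" and f: "rep (wvars W) X f"
  and G: "!!g. rep (wvars W) X g ==> pc X W g = pc X W f ==> G g = c"
 shows "the_elem (G ` pc X W f) = c"
proof (rule the_elem_image)
 let ?f = "restrict f (Rn (wvars W))"
 have M: "?f \<in> smooth_maps (fs_Rn (wvars W)) X" using f by (simp add: rep_iff[OF X])
 have "(?f, ?f) \<in> prolong_rel X W" using pcls_eqI[OF X W M M] by simp
 then show "pc X W f ~= {}" unfolding pc_def pcls_def by blast
 fix g assume "g \<in> pc X W f"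
 then have g: "(?f, g) \<in> prolong_rel X W" by (simp add: pc_def pcls_def)
 then have Mg: "g \<in> smooth_maps (fs_Rn (wvars W)) X" by (simp add: prolong_rel_def)
 have "pc X W g = pc X W f" using pcls_eqI[OF X W M Mg] g by (simp add: pc_def sm_rep(2)[OF X Mg])
 then show "G g = c" by (rule G[OF sm_rep(1)[OF X Mg]])
qed

lemma prolong_func_pc:
 assumes X: "froelicher X" and W: "weil W" and f: "rep (wvars W) X f" and xi: "xi \<in> funcs X"
 shows "prolong_func W xi (pc X W f) = wc W (%x. xi (f x))" unfolding prolong_func_def
proof (rule the_elem_pc[OF X W f])
 interpret W: weil_algebra W by (rule weil_algebra.intro[OF W])
 fix g assume g: "rep (wvars W) X g" and eq: "pc X W g = pc X W f"
 note sm = fsmooth_rep[OF fsmooth_func[OF X xi]]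
 have e: "weil_eq X W g f" using eq[unfolded pc_eq_iff[OF X W g f]] by simp
 have "wnull W (%x. xi (g x) - xi (f x))" unfolding W.wnull_diff_iff[OF sm[OF g] sm[OF f]]
 proof (intro allI impI)
  fix L assume "Ann W L"
  then show "L (%x. xi (g x)) = L (%x. xi (f x))" by (rule weil_eqD[OF e fsmooth_func[OF X xi]])
 qed
 then have "wc W (%x. xi (g x)) = wc W (%x. xi (f x))" unfolding W.wc_eq_iff[OF sm[OF g] sm[OF f]] .
 then show "wcls W (compose (Rn (wvars W)) xi g) = wc W (%x. xi (f x))" by (simp add: wc_def compose_def)
qed

lemma prolong_eq:
 "prolong X W = fs_of_curves (carrier (prolong X W))
   {c \<in> UNIV \<rightarrow> carrier (prolong X W). \<forall>xi\<in>funcs X. prolong_func W xi \<circ> c \<in> curves (weil_space W)}"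
 by (simp add: prolong_def Let_def)

lemma curves_prolong:
 "curves (prolong X W) =
   {c \<in> UNIV \<rightarrow> carrier (prolong X W). \<forall>xi\<in>funcs X. prolong_func W xi \<circ> c \<in> curves (weil_space W)}"
 by (subst prolong_eq) simp

lemma froelicher_prolong:
 assumes X: "froelicher X" and W: "weil W" shows "froelicher (prolong X W)"
proof -
 interpret W: weil_algebra W by (rule weil_algebra.intro[OF W])
 let ?A = "carrier (prolong X W)"
 let ?C = "{c \<in> UNIV \<rightarrow> ?A. \<forall>xi\<in>funcs X. prolong_func W xi \<circ> c \<in> curves (weil_space W)}"
 have "froelicher (fs_of_curves ?A ?C)"
 proof (rule froelicher_fs_of_curvesI)
  show "c t \<in> ?A" if "c \<in> ?C" for c t using that by blast
  fix c assume cA: "!!t. c t \<in> ?A"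
   and c: "!!f. f \<in> funcs (fs_of_curves ?A ?C) ==> smooth_real (%t. f (c t))"
  have "prolong_func W xi \<circ> c \<in> curves (weil_space W)" if xi: "xi \<in> funcs X" for xi
  proof -
   have mem: "prolong_func W xi a \<in> carrier (weil_alg W)" if "a \<in> ?A" for a
   proof -
    obtain f where f: "rep (wvars W) X f" "a = pc X W f" using pc_cases[OF X \<open>a \<in> ?A\<close>] .
    show ?thesis unfolding f(2) prolong_func_pc[OF X W f(1) xi]
     by (rule W.wc_carrier[OF fsmooth_rep[OF fsmooth_func[OF X xi] f(1)]])
   qed
   have "smooth_real (l \<circ> (prolong_func W xi \<circ> c))" if l: "weil_functional W l" for l
   proof -
    let ?g = "\<lambda>a\<in>?A. l (prolong_func W xi a)"
    have "smooth_real (?g \<circ> d)" if d: "d \<in> ?C" for d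
    proof -
     have "smooth_real (l \<circ> (prolong_func W xi \<circ> d))" using d l xi by (simp add: weil_space_def)
     moreover have "?g \<circ> d = l \<circ> (prolong_func W xi \<circ> d)" using d by (simp add: fun_eq_iff Pi_iff)
     ultimately show ?thesis by simp
    qed
    then have "?g \<in> funcs (fs_of_curves ?A ?C)" unfolding fs_of_curves_simps by blast
    from c[OF this] show ?thesis using cA by (simp add: o_def)
   qed
   then show ?thesis using mem cA by (simp add: weil_space_def Pi_iff)
  qed
  then show "c \<in> ?C" using cA by blast
 qed
 then show ?thesis unfolding prolong_eq[symmetric] .
qed

definition weil_curve :: "'a froelicher => weil_pres => (real => point => 'a) => bool" where
 "weil_curve X W f \<longleftrightarrow>
   (ALL xi L. fsmooth X xi --> Ann W L --> smooth_real (%t. L (%x. xi (f t x))))"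

lemma weil_curveD:
 assumes "weil_curve X W f" "fsmooth X xi" "Ann W L" shows "smooth_real (%t. L (%x. xi (f t x)))"
 by (rule assms(1)[unfolded weil_curve_def, rule_format, OF assms(2,3)])

lemma weil_curveI:
 assumes "!!xi L. fsmooth X xi ==> Ann W L ==> smooth_real (%t. L (%x. xi (f t x)))"
 shows "weil_curve X W f" unfolding weil_curve_def
proof (intro allI impI)
 fix xi L assume xi: "fsmooth X xi" and L: "Ann W L"
 show "smooth_real (%t. L (%x. xi (f t x)))" by (rule assms[OF xi L])
qed

lemma pc_curve_iff:
 assumes X: "froelicher X" and W: "weil W" and f: "!!t. rep (wvars W) X (f t)"
 shows "(%t. pc X W (f t)) \<in> curves (prolong X W) \<longleftrightarrow> weil_curve X W f"
proof -
 interpret W: weil_algebra W by (rule weil_algebra.intro[OF W])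
 have 1: "prolong_func W xi \<circ> (%t. pc X W (f t)) \<in> curves (weil_space W) \<longleftrightarrow>
   (ALL L. Ann W L --> smooth_real (%t. L (%x. xi (f t x))))" if xi: "xi \<in> funcs X" for xi
  using W.weil_space_curve_iff[OF fsmooth_rep[OF fsmooth_func[OF X xi] f]]
  by (simp add: o_def prolong_func_pc[OF X W f xi])
 have "(%t. pc X W (f t)) \<in> curves (prolong X W) \<longleftrightarrow>
   (\<forall>xi\<in>funcs X. ALL L. Ann W L --> smooth_real (%t. L (%x. xi (f t x))))"
  unfolding curves_prolong using 1 pc_carrier[OF X f] by (simp add: Pi_iff)
 also have "\<dots> \<longleftrightarrow> weil_curve X W f" unfolding weil_curve_def
 proof (intro iffI allI impI ballI)
  fix xi L assume *: "\<forall>xi\<in>funcs X. ALL L. Ann W L --> smooth_real (%t. L (%x. xi (f t x)))"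
   and xi: "fsmooth X xi" and L: "Ann W L"
  have "smooth_real (%t. L (%x. restrict xi (carrier X) (f t x)))"
   using bspec[OF * fsmooth_restrict[OF X xi]] L by blast
  moreover have "L (%x. xi (f t x)) = L (%x. restrict xi (carrier X) (f t x))" for t
   by (rule W.ann_cong[OF L fsmooth_rep[OF xi f]]) (simp add: rep_carrier[OF X f])
  ultimately show "smooth_real (%t. L (%x. xi (f t x)))" by simp
 next
  fix xi L assume *: "ALL xi L. fsmooth X xi --> Ann W L --> smooth_real (%t. L (%x. xi (f t x)))"
   and xi: "xi \<in> funcs X" and L: "Ann W L"
  show "smooth_real (%t. L (%x. xi (f t x)))" by (rule *[rule_format, OF fsmooth_func[OF X xi] L])
 qed
 finally show ?thesis .
qed

lemma prolong_curveE:
 assumes X: "froelicher X" and W: "weil W" and c: "c \<in> curves (prolong X W)"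
 obtains f where "ALL t. rep (wvars W) X (f t)" "c = (%t. pc X W (f t))"
  "weil_curve X W f"
proof -
 have "ALL t. EX f. rep (wvars W) X f & c t = pc X W f"
  by (intro allI, rule pc_cases[OF X curve_in[OF froelicher_prolong[OF X W] c]]) (intro exI conjI)
 from choice[OF this] obtain f where f: "ALL t. rep (wvars W) X (f t) & c t = pc X W (f t)" ..
 then have f1: "rep (wvars W) X (f t)" for t by simp
 have f2: "c = (%t. pc X W (f t))" using f by (simp add: fun_eq_iff)
 note c' = c[unfolded f2 pc_curve_iff[OF X W f1]]
 show ?thesis
 proof (rule that)
  show "ALL t. rep (wvars W) X (f t)" by (intro allI f1)
  show "c = (%t. pc X W (f t))" by (rule f2)
  show "weil_curve X W f" by (rule c')
 qed
qed

lemma pc_family: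
 assumes X: "froelicher X" and W: "weil W"
  and f: "!!a c. smooth_real a ==> curve_Rn (wvars W) c ==> (%u. f (a u) (c u)) \<in> curves X"
 shows "rep (wvars W) X (f t)" "(%t. pc X W (f t)) \<in> curves (prolong X W)"
proof -
 interpret W: weil_algebra W by (rule weil_algebra.intro[OF W])
 show rep: "rep (wvars W) X (f t)" for t unfolding rep_def by (intro allI impI f) simp_all
 show "(%t. pc X W (f t)) \<in> curves (prolong X W)" unfolding pc_curve_iff[OF X W rep]
 proof (rule weil_curveI)
  fix xi L assume xi: "fsmooth X xi" and L: "Ann W L"
  show "smooth_real (%t. L (%x. xi (f t x)))"
   by (rule W.ann_family(1)[OF L]) (simp add: smooth_family_def fsmoothD[OF xi f])
 qed
qed

lemma prolong_map_pc:
 assumes X: "froelicher X" and Y: "froelicher Y" and W: "weil W" and h: "h \<in> smooth_maps X Y"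
  and f: "rep (wvars W) X f"
 shows "prolong_map X Y W h (pc X W f) = pc Y W (%x. h (f x))"
proof -
 have "the_elem ((%f. pcls Y W (compose (Rn (wvars W)) h f)) ` pc X W f) = pc Y W (%x. h (f x))"
 proof (rule the_elem_pc[OF X W f])
  fix g assume g: "rep (wvars W) X g" and eq: "pc X W g = pc X W f"
  have "pc Y W (%x. h (g x)) = pc Y W (%x. h (f x))" unfolding pc_eq_iff[OF Y W rep_sm[OF h g] rep_sm[OF h f]]
  proof (intro conjI weil_eqI)
   note * = eq[unfolded pc_eq_iff[OF X W g f]]
   show "h (g (%_. 0)) = h (f (%_. 0))" using * by simp
   fix xi L assume xi: "fsmooth Y xi" and L: "Ann W L"
   show "L (%x. xi (h (g x))) = L (%x. xi (h (f x)))" by (rule weil_eqD[OF conjunct2[OF *] fsmooth_sm[OF h xi] L])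
  qed
  then show "pcls Y W (compose (Rn (wvars W)) h g) = pc Y W (%x. h (f x))" by (simp add: pc_def compose_def)
 qed
 then show ?thesis by (simp add: prolong_map_def pc_carrier[OF X f])
qed

lemma prolong_map_smooth:
 assumes X: "froelicher X" and Y: "froelicher Y" and W: "weil W" and h: "h \<in> smooth_maps X Y"
 shows "prolong_map X Y W h \<in> smooth_maps (prolong X W) (prolong Y W)"
proof (rule smI)
 show "prolong_map X Y W h a \<in> carrier (prolong Y W)" if a: "a \<in> carrier (prolong X W)" for a
 proof -
  obtain f where f: "rep (wvars W) X f" "a = pc X W f" using pc_cases[OF X a] .
  show ?thesis unfolding f(2) prolong_map_pc[OF X Y W h f(1)] by (rule pc_carrier[OF Y rep_sm[OF h f(1)]])
 qed
 show "prolong_map X Y W h \<in> extensional (carrier (prolong X W))" by (simp add: prolong_map_def)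
 fix c assume "c \<in> curves (prolong X W)"
 then obtain f where f': "ALL t. rep (wvars W) X (f t)" and f2: "c = (%t. pc X W (f t))"
  and f3: "weil_curve X W f" by (rule prolong_curveE[OF X W])
 note f = spec[OF f'] f2 f3
 show "(%t. prolong_map X Y W h (c t)) \<in> curves (prolong Y W)"
  unfolding f(2) prolong_map_pc[OF X Y W h f(1)] pc_curve_iff[OF Y W rep_sm[OF h f(1)]]
 proof (rule weil_curveI)
  fix xi L assume xi: "fsmooth Y xi" and L: "Ann W L"
  from weil_curveD[OF f(3) fsmooth_sm[OF h xi] L] show "smooth_real (%t. L (%x. xi (h (f t x))))" .
 qed
qed

lemma prolong_map_iso:
 assumes X: "froelicher X" and Y: "froelicher Y" and W: "weil W" and h: "fs_iso X Y h"
 shows "fs_iso (prolong X W) (prolong Y W) (prolong_map X Y W h)"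
proof -
 obtain k where k: "h \<in> smooth_maps X Y" "k \<in> smooth_maps Y X"
   "!!x. x \<in> carrier X ==> k (h x) = x" "!!y. y \<in> carrier Y ==> h (k y) = y"
  using h by (auto simp: fs_iso_def)
 show ?thesis
 proof (rule fs_isoI[OF prolong_map_smooth[OF X Y W k(1)] prolong_map_smooth[OF Y X W k(2)]])
  fix a assume a: "a \<in> carrier (prolong X W)"
  obtain f where f: "rep (wvars W) X f" "a = pc X W f" using pc_cases[OF X a] .
  show "prolong_map Y X W k (prolong_map X Y W h a) = a"
   unfolding f(2) prolong_map_pc[OF X Y W k(1) f(1)] prolong_map_pc[OF Y X W k(2) rep_sm[OF k(1) f(1)]]
   by (rule pc_cong) (simp add: k(3) rep_carrier[OF X f(1)])
 next
  fix a assume a: "a \<in> carrier (prolong Y W)"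
  obtain f where f: "rep (wvars W) Y f" "a = pc Y W f" using pc_cases[OF Y a] .
  show "prolong_map X Y W h (prolong_map Y X W k a) = a"
   unfolding f(2) prolong_map_pc[OF Y X W k(2) f(1)] prolong_map_pc[OF X Y W k(1) rep_sm[OF k(2) f(1)]]
   by (rule pc_cong) (simp add: k(4) rep_carrier[OF Y f(1)])
 qed
qed

lemma induces_wc: "induces_hom V W Theta phi ==> csmooth (wvars V) g ==> phi (wc V g) = wc W (%x. g (Theta x))"
 by (simp add: induces_hom_iff)

lemma induces_rep:
 assumes Theta: "induces_hom V W Theta phi" and f: "rep (wvars V) X f" shows "rep (wvars W) X (%x. f (Theta x))"
 unfolding rep_def
proof (intro allI impI)
 fix c assume "curve_Rn (wvars W) c"
 then have "curve_Rn (wvars V) (%u. Theta (c u))" using Theta by (simp add: induces_hom_iff smooth_maps_Rn_iff)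
 then show "(%u. f (Theta (c u))) \<in> curves X" by (rule repD[OF f])
qed

lemma Ann_pullback:
 assumes V: "weil V" and W: "weil W" and phi: "phi \<in> weil_hom V W" and Theta: "induces_hom V W Theta phi" and L: "Ann W L"
 shows "Ann V (%g. L (%x. g (Theta x)))"
proof -
 interpret weil_pair V W using V W by (simp add: weil_pair_def weil_algebra_def)
 have Theta': "Theta \<in> smooth_maps (fs_Rn (wvars W)) (fs_Rn (wvars V))" using Theta by (simp add: induces_hom_iff)
 note comp = smooth_maps_Rn_comp[OF Theta']
 show ?thesis unfolding annihilator_def[of "wvars V"]
 proof (intro conjI allI impI)
  fix f g c assume f: "csmooth (wvars V) f"
  show "L (%x. c * f (Theta x)) = c * L (%x. f (Theta x))" by (rule annihilatorD(2)[OF L comp[OF f]])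
  assume g: "csmooth (wvars V) g"
  show "L (%x. f (Theta x) + g (Theta x)) = L (%x. f (Theta x)) + L (%x. g (Theta x))"
   by (rule annihilatorD(1)[OF L comp[OF f] comp[OF g]])
 next
  fix f assume "wnull V f"
  then show "L (%x. f (Theta x)) = 0" by (intro annihilatorD(3)[OF L] induces_null[OF phi Theta])
 qed
qed

lemma prolong_hom_pc:
 assumes X: "froelicher X" and V: "weil V" and W: "weil W" and phi: "phi \<in> weil_hom V W"
  and Theta: "induces_hom V W Theta phi" and f: "rep (wvars V) X f"
 shows "prolong_hom X V W phi (pc X V f) = pc X W (%x. f (Theta x))"
proof -
 interpret weil_pair V W using V W by (simp add: weil_pair_def weil_algebra_def)
 define Theta' where "Theta' = (SOME \<theta>. induces_hom V W \<theta> phi)"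
 have Theta': "induces_hom V W Theta' phi" unfolding Theta'_def by (rule someI[of "%\<theta>. induces_hom V W \<theta> phi", OF Theta])
 have z: "Theta (%_. 0) = (%_. 0)" "Theta' (%_. 0) = (%_. 0)" using Theta Theta' by (simp_all add: induces_hom_iff)
 have "the_elem ((%f. pcls X W (compose (Rn (wvars W)) f Theta')) ` pc X V f) = pc X W (%x. f (Theta x))"
 proof (rule the_elem_pc[OF X V f])
  fix g assume g: "rep (wvars V) X g" and eq: "pc X V g = pc X V f"
  note * = eq[unfolded pc_eq_iff[OF X V g f]]
  have "pc X W (%x. g (Theta' x)) = pc X W (%x. f (Theta x))"
   unfolding pc_eq_iff[OF X W induces_rep[OF Theta' g] induces_rep[OF Theta f]]
  proof (intro conjI weil_eqI)
   show "g (Theta' (%_. 0)) = f (Theta (%_. 0))" using * z by simp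
   fix xi L assume xi: "fsmooth X xi" and L: "Ann W L"
   have "L (%x. xi (g (Theta' x))) = L (%x. xi (f (Theta' x)))"
    by (rule weil_eqD[OF conjunct2[OF *] xi Ann_pullback[OF V W phi Theta' L]])
   also have "\<dots> = L (%x. xi (f (Theta x)))"
   proof (rule W.ann_eq[OF L])
    show "csmooth W.n (%x. xi (f (Theta' x)))" by (rule fsmooth_rep[OF xi induces_rep[OF Theta' f]])
    show "csmooth W.n (%x. xi (f (Theta x)))" by (rule fsmooth_rep[OF xi induces_rep[OF Theta f]])
    have "csmooth V.n (%x. xi (f x))" by (rule fsmooth_rep[OF xi f])
    from induces_wc[OF Theta' this] induces_wc[OF Theta this] show "wc W (%x. xi (f (Theta' x))) = wc W (%x. xi (f (Theta x)))" by simp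
   qed
   finally show "L (%x. xi (g (Theta' x))) = L (%x. xi (f (Theta x)))" .
  qed
  then show "pcls X W (compose (Rn (wvars W)) g Theta') = pc X W (%x. f (Theta x))" by (simp add: pc_def compose_def)
 qed
 then show ?thesis by (simp add: prolong_hom_def pc_carrier[OF X f] Theta'_def)
qed

lemma ex_induces:
 assumes "weil V" "weil W" "phi \<in> weil_hom V W"
 obtains Theta where "induces_hom V W Theta phi"
 using weil_pair.weil_hom_induced[of V W phi] assms by (auto simp: weil_pair_def weil_algebra_def)

lemma prolong_hom_smooth:
 assumes X: "froelicher X" and V: "weil V" and W: "weil W" and phi: "phi \<in> weil_hom V W"
 shows "prolong_hom X V W phi \<in> smooth_maps (prolong X V) (prolong X W)"
proof (rule smI)
 obtain Theta where Theta: "induces_hom V W Theta phi" by (rule ex_induces[OF V W phi])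
 note eq = prolong_hom_pc[OF X V W phi Theta]
 show "prolong_hom X V W phi a \<in> carrier (prolong X W)" if a: "a \<in> carrier (prolong X V)" for a
 proof -
  obtain f where f: "rep (wvars V) X f" "a = pc X V f" using pc_cases[OF X a] .
  show ?thesis unfolding f(2) eq[OF f(1)] by (rule pc_carrier[OF X induces_rep[OF Theta f(1)]])
 qed
 show "prolong_hom X V W phi \<in> extensional (carrier (prolong X V))" by (simp add: prolong_hom_def)
 fix c assume "c \<in> curves (prolong X V)"
 then obtain f where f': "ALL t. rep (wvars V) X (f t)" and f2: "c = (%t. pc X V (f t))"
  and f3: "weil_curve X V f" by (rule prolong_curveE[OF X V])
 note f = spec[OF f'] f2 f3
 show "(%t. prolong_hom X V W phi (c t)) \<in> curves (prolong X W)"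
  unfolding f(2) eq[OF f(1)] pc_curve_iff[OF X W induces_rep[OF Theta f(1)]]
 proof (rule weil_curveI)
  fix xi L assume xi: "fsmooth X xi" and L: "Ann W L"
  from weil_curveD[OF f(3) xi Ann_pullback[OF V W phi Theta L]]
  show "smooth_real (%t. L (%x. xi (f t (Theta x))))" .
 qed
qed

lemma prolong_hom_compose:
 assumes X: "froelicher X" and A: "weil A" and V: "weil V" and W: "weil W"
  and phi: "phi \<in> weil_hom A V" and \<psi>: "\<psi> \<in> weil_hom V W" and \<rho>: "\<rho> \<in> weil_hom A W"
  and eq: "compose (carrier (weil_alg A)) \<psi> phi = \<rho>"
 shows "compose (carrier (prolong X A)) (prolong_hom X V W \<psi>) (prolong_hom X A V phi) = prolong_hom X A W \<rho>"
proof (rule extensionalityI[of _ "carrier (prolong X A)"])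
 interpret A: weil_algebra A by (rule weil_algebra.intro[OF A])
 obtain Theta where Theta: "induces_hom A V Theta phi" by (rule ex_induces[OF A V phi])
 obtain \<Xi> where \<Xi>: "induces_hom V W \<Xi> \<psi>" by (rule ex_induces[OF V W \<psi>])
 have sm: "Theta \<in> smooth_maps (fs_Rn (wvars V)) (fs_Rn (wvars A))" "\<Xi> \<in> smooth_maps (fs_Rn (wvars W)) (fs_Rn (wvars V))"
  using Theta \<Xi> by (simp_all add: induces_hom_iff)
 let ?\<Psi> = "compose (Rn (wvars W)) Theta \<Xi>"
 have \<Psi>: "induces_hom A W ?\<Psi> \<rho>" unfolding induces_hom_iff
 proof (intro conjI allI impI)
  show "?\<Psi> \<in> smooth_maps (fs_Rn (wvars W)) (fs_Rn (wvars A))"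
   using sm_compose[OF froelicher_Rn sm(2,1)] by simp
  show "?\<Psi> (%_. 0) = (%_. 0)" using Theta \<Xi> by (simp add: compose_def induces_hom_iff)
  fix g assume g: "csmooth (wvars A) g"
  have "\<rho> (wc A g) = \<psi> (phi (wc A g))" unfolding eq[symmetric] by (simp add: compose_def A.wc_carrier[OF g])
  also have "\<dots> = wc W (%x. g (Theta (\<Xi> x)))"
   by (simp only: induces_wc[OF Theta g] induces_wc[OF \<Xi> smooth_maps_Rn_comp[OF sm(1) g]])
  also have "\<dots> = wc W (%x. g (?\<Psi> x))" by (rule wc_cong) (simp add: compose_def)
  finally show "\<rho> (wc A g) = wc W (%x. g (?\<Psi> x))" .
 qed
 show "compose (carrier (prolong X A)) (prolong_hom X V W \<psi>) (prolong_hom X A V phi) \<in> extensional (carrier (prolong X A))"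
  by (simp add: compose_def)
 show "prolong_hom X A W \<rho> \<in> extensional (carrier (prolong X A))" by (simp add: prolong_hom_def)
 fix a assume a: "a \<in> carrier (prolong X A)"
 obtain f where f: "rep (wvars A) X f" "a = pc X A f" using pc_cases[OF X a] .
 have "prolong_hom X V W \<psi> (prolong_hom X A V phi a) = pc X W (%x. f (Theta (\<Xi> x)))"
  unfolding f(2) prolong_hom_pc[OF X A V phi Theta f(1)]
  by (rule prolong_hom_pc[OF X V W \<psi> \<Xi> induces_rep[OF Theta f(1)]])
 also have "\<dots> = pc X W (%x. f (?\<Psi> x))" by (rule pc_cong) (simp add: compose_def)
 also have "\<dots> = prolong_hom X A W \<rho> a" unfolding f(2) by (rule prolong_hom_pc[OF X A W \<rho> \<Psi> f(1), symmetric])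
 finally show "compose (carrier (prolong X A)) (prolong_hom X V W \<psi>) (prolong_hom X A V phi) a = prolong_hom X A W \<rho> a"
  using a by (simp add: compose_def)
qed

definition base :: "'a froelicher => weil_pres => (point => 'a) set => 'a" where
 "base X W = (\<lambda>a\<in>carrier (prolong X W). (SOME f. rep (wvars W) X f & a = pc X W f) (%_. 0))"

lemma base_pc:
 assumes X: "froelicher X" and W: "weil W" and f: "rep (wvars W) X f"
 shows "base X W (pc X W f) = f (%_. 0)"
proof -
 let ?g = "SOME g. rep (wvars W) X g & pc X W f = pc X W g"
 have "rep (wvars W) X ?g & pc X W f = pc X W ?g"
  by (rule someI[of "%g. rep (wvars W) X g & pc X W f = pc X W g" f]) (simp add: f)
 then have "?g (%_. 0) = f (%_. 0)" using pc_eq_iff[OF X W f, of ?g] by simp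
 then show ?thesis by (simp add: base_def pc_carrier[OF X f])
qed

lemma base_smooth:
 assumes X: "froelicher X" and W: "weil W" shows "base X W \<in> smooth_maps (prolong X W) X"
proof (rule smI)
 show "base X W \<in> extensional (carrier (prolong X W))" by (simp add: base_def)
 show "base X W a \<in> carrier X" if a: "a \<in> carrier (prolong X W)" for a
 proof -
  obtain f where f: "rep (wvars W) X f" "a = pc X W f" using pc_cases[OF X a] .
  show ?thesis unfolding f(2) base_pc[OF X W f(1)] by (rule rep_carrier[OF X f(1)]) simp
 qed
 fix c assume "c \<in> curves (prolong X W)"
 then obtain f where f': "ALL t. rep (wvars W) X (f t)" and f2: "c = (%t. pc X W (f t))"
  and f3: "weil_curve X W f" by (rule prolong_curveE[OF X W])
 note f = spec[OF f'] f2 f3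
 have ev: "Ann W (%g. g (%_. 0))" by (simp add: annihilator_def weil_algebra.wnull_at_0[OF weil_algebra.intro[OF W]])
 show "(%t. base X W (c t)) \<in> curves X" unfolding f(2) base_pc[OF X W f(1)]
 proof (rule curvesI[OF X])
  show "f t (%_. 0) \<in> carrier X" for t by (rule rep_carrier[OF X f(1)]) simp
  show "smooth_real (%t. xi (f t (%_. 0)))" if "xi \<in> funcs X" for xi
   using weil_curveD[OF f(3) fsmooth_func[OF X that] ev] .
 qed
qed

lemma rep_const: "froelicher X ==> p \<in> carrier X ==> rep n X (%_. p)" by (simp add: rep_def const_curve)

text \<open>The ideal of \<open>\<real>\<close> is zero, so a class is determined by the value at \<open>0\<close>.\<close>

lemma base_real_iso:
 assumes X: "froelicher X" shows "fs_iso (prolong X weil_real) X (base X weil_real)"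
proof (rule fs_isoI[OF base_smooth[OF X weil_weil_real]])
 note R = weil_weil_real
 let ?k = "\<lambda>p\<in>carrier X. pc X weil_real (%_. p)"
 show "?k \<in> smooth_maps X (prolong X weil_real)"
 proof (rule sm_restrictI[OF X])
  show "pc X weil_real (%_. p) \<in> carrier (prolong X weil_real)" if "p \<in> carrier X" for p
   by (rule pc_carrier[OF X rep_const[OF X that]])
  show "(%t. pc X weil_real (%_. c t)) \<in> curves (prolong X weil_real)" if "c \<in> curves X" for c
   by (rule pc_family(2)[OF X R]) (rule curve_reparam[OF X that])
 qed
 show "?k (base X weil_real a) = a" if a: "a \<in> carrier (prolong X weil_real)" for a
 proof -
  obtain f where f: "rep (wvars weil_real) X f" "a = pc X weil_real f" using pc_cases[OF X a] .
  have "f (%_. 0) \<in> carrier X" by (rule rep_carrier[OF X f(1)]) simp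
  moreover have "pc X weil_real (%_. f (%_. 0)) = pc X weil_real f" by (rule pc_cong) (simp add: Rn_0)
  ultimately show ?thesis unfolding f(2) base_pc[OF X R f(1)] by simp
 qed
 show "base X weil_real (?k p) = p" if "p \<in> carrier X" for p
  using base_pc[OF X R rep_const[OF X that]] that by simp
qed

section \<open>Prolongations of products\<close>

text \<open>A function of two points that is in the ideal whenever the second point is fixed is in the
  ideal on the diagonal: the coordinates of the second point are replaced one after the other.\<close>

lemma wnull_diagonal_Rn:
 assumes W: "weil W"
  and H: "!!b c. curve_Rn (wvars W) b ==> curve_Rn (wvars W) c ==> smooth_real (%u. H (b u) (c u))"
  and null: "!!y. y \<in> Rn (wvars W) ==> wnull W (H y)"
 shows "wnull W (%x. H x x)"
proof -
 interpret W: weil_algebra W by (rule weil_algebra.intro[OF W])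
 let ?n = "wvars W"
 define mix :: "nat => point => point => point" where "mix m x y = (%i. if i < m then x i else y i)" for m x y
 have mix_Rn: "mix m x y \<in> Rn ?n" if "x \<in> Rn ?n" "y \<in> Rn ?n" for m x y
  using that by (simp add: mix_def Rn_def)
 have main: "m \<le> ?n ==> \<forall>y\<in>Rn ?n. wnull W (%x. H (mix m x y) x)" for m
 proof (induction m)
  case 0
  show ?case using null by (simp add: mix_def)
 next
  case (Suc m)
  then have m: "m < ?n" and IH: "!!y. y \<in> Rn ?n ==> wnull W (%x. H (mix m x y) x)" by simp_all
  show ?case
  proof
   fix y assume y: "y \<in> Rn ?n"
   have upd: "y(m := s) \<in> Rn ?n" for s using y m by (simp add: Rn_def)
   have fam: "smooth_family ?n (%s x. H (mix m x (y(m := s))) x)" unfolding smooth_family_def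
   proof (intro allI impI)
    fix a c assume a: "smooth_real a" and c: "curve_Rn ?n c"
    have "smooth_real (%u. mix m (c u) (y(m := a u)) i)" if "i < ?n" for i
     using a c that by (cases "i < m"; cases "i = m") (simp_all add: mix_def curve_Rn_def)
    then have "curve_Rn ?n (%u. mix m (c u) (y(m := a u)))"
     unfolding curve_Rn_def using c mix_Rn[OF _ upd] by (simp add: curve_Rn_def)
    from H[OF this c] show "smooth_real (%u. H (mix m (c u) (y(m := a u))) (c u))" .
   qed
   have "wnull W (%x. H (mix m x (y(m := x m))) x)"
   proof (rule W.wnull_diagonal[OF fam])
    show "wnull W (%x. H (mix m x (y(m := s))) x)" for s by (rule IH[OF upd])
    show "csmooth ?n (%x. x m)" by (rule csmooth_coord)
   qed
   moreover have "mix m x (y(m := x m)) = mix (Suc m) x y" for x by (auto simp: mix_def fun_eq_iff less_Suc_eq)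
   ultimately show "wnull W (%x. H (mix (Suc m) x y) x)" by simp
  qed
 qed
 have "wnull W (%x. H (mix ?n x (%_. 0)) x)" using main[of ?n] by simp
 then show ?thesis
 proof (rule W.N.cong)
  fix x :: point assume "x \<in> Rn ?n"
  then have "mix ?n x (%_. 0) = x" by (auto simp: mix_def Rn_def fun_eq_iff)
  then show "H (mix ?n x (%_. 0)) x = H x x" by simp
 qed
qed

lemma rep_pair: "rep n X f ==> rep n Y g ==> rep n (fs_prod X Y) (%x. (f x, g x))"
 by (simp add: rep_def curves_prod_iff)

lemma rep_fst: "rep n (fs_prod X Y) f ==> rep n X (%x. fst (f x))"
 and rep_snd: "rep n (fs_prod X Y) f ==> rep n Y (%x. snd (f x))" by (simp_all add: rep_def curves_prod_iff)

lemma fsmooth_pair: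
 assumes Y: "froelicher Y" and xi: "fsmooth (fs_prod X Y) xi" and q: "q \<in> carrier Y"
 shows "fsmooth X (%p. xi (p, q))" unfolding fsmooth_def
 by (intro ballI fsmoothD[OF xi]) (simp add: curves_prod_iff const_curve[OF Y q])

lemma fsmooth_swap:
 assumes xi: "fsmooth (fs_prod X Y) xi" shows "fsmooth (fs_prod Y X) (%p. xi (snd p, fst p))"
 unfolding fsmooth_def by (intro ballI fsmoothD[OF xi]) (simp add: curves_prod_iff)

text \<open>With the second argument fixed the two sides agree by definition of the relation; the diagonal
  argument lets it move along \<open>g\<close>.\<close>

lemma pair_left_congruent:
 assumes X: "froelicher X" and Y: "froelicher Y" and W: "weil W"
  and f: "rep (wvars W) X f" "rep (wvars W) X f'" and g: "rep (wvars W) Y g"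
  and eq: "pc X W f = pc X W f'" and xi: "fsmooth (fs_prod X Y) xi" and L: "Ann W L"
 shows "L (%x. xi (f x, g x)) = L (%x. xi (f' x, g x))"
proof -
 interpret W: weil_algebra W by (rule weil_algebra.intro[OF W])
 have smp: "csmooth (wvars W) (%x. xi (h x, g x))" if "rep (wvars W) X h" for h
  by (rule fsmooth_rep[OF xi rep_pair[OF that g]])
 have "wnull W (%x. xi (f x, g x) - xi (f' x, g x))"
 proof (rule wnull_diagonal_Rn[OF W, of "%y x. xi (f x, g y) - xi (f' x, g y)"])
  fix b c assume b: "curve_Rn (wvars W) b" and c: "curve_Rn (wvars W) c"
  have "smooth_real (%u. xi (h (c u), g (b u)))" if h: "rep (wvars W) X h" for h
   by (rule fsmoothD[OF xi]) (simp add: curves_prod_iff repD[OF h c] repD[OF g b])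
  then show "smooth_real (%u. xi (f (c u), g (b u)) - xi (f' (c u), g (b u)))"
   using f by (intro smooth_real_diff) simp_all
 next
  fix y assume "y \<in> Rn (wvars W)"
  then have q: "fsmooth X (%p. xi (p, g y))" by (intro fsmooth_pair[OF Y xi] rep_carrier[OF Y g])
  show "wnull W (%x. xi (f x, g y) - xi (f' x, g y))"
   unfolding W.wnull_diff_iff[OF fsmooth_rep[OF q f(1)] fsmooth_rep[OF q f(2)]]
  proof (intro allI impI)
   fix L assume "Ann W L"
   then show "L (%x. xi (f x, g y)) = L (%x. xi (f' x, g y))"
    by (rule weil_eqD[OF conjunct2[OF eq[unfolded pc_eq_iff[OF X W f]]] q])
  qed
 qed
 then have "Ann W L --> L (%x. xi (f x, g x)) = L (%x. xi (f' x, g x))"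
  unfolding W.wnull_diff_iff[OF smp[OF f(1)] smp[OF f(2)]] by (rule spec)
 then show ?thesis using L by (rule mp)
qed

lemma pc_pair_cong:
 assumes X: "froelicher X" and Y: "froelicher Y" and W: "weil W"
  and f: "rep (wvars W) X f" "rep (wvars W) X f'" and g: "rep (wvars W) Y g" "rep (wvars W) Y g'"
  and eq: "pc X W f = pc X W f'" "pc Y W g = pc Y W g'"
 shows "pc (fs_prod X Y) W (%x. (f x, g x)) = pc (fs_prod X Y) W (%x. (f' x, g' x))"
 unfolding pc_eq_iff[OF froelicher_prod[OF X Y] W rep_pair[OF f(1) g(1)] rep_pair[OF f(2) g(2)]]
proof (intro conjI weil_eqI)
 show "(f (%_. 0), g (%_. 0)) = (f' (%_. 0), g' (%_. 0))"
  using eq[unfolded pc_eq_iff[OF X W f] pc_eq_iff[OF Y W g]] by simp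
 fix xi L assume xi: "fsmooth (fs_prod X Y) xi" and L: "Ann W L"
 have "L (%x. xi (f x, g x)) = L (%x. xi (f' x, g x))" by (rule pair_left_congruent[OF X Y W f g(1) eq(1) xi L])
 also have "\<dots> = L (%x. xi (f' x, g' x))"
  using pair_left_congruent[OF Y X W g f(2) eq(2) fsmooth_swap[OF xi] L] by simp
 finally show "L (%x. xi (f x, g x)) = L (%x. xi (f' x, g' x))" .
qed

text \<open>A smooth curve in the prolongation need not lift to a smooth curve of representatives.
  The two parameters can nevertheless be treated jointly: a functional applied to the second
  parameter gives a smooth function on the space, along which the curve is smooth.\<close>

lemma smooth2_along_curve:
 assumes X: "froelicher X" and W: "weil W" and f: "!!t. rep (wvars W) X (f t)"
  and curve: "weil_curve X W f"
  and \<psi>: "!!a c. smooth_real a ==> c \<in> curves X ==> smooth_real (%u. \<psi> (a u) (c u))"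
  and L: "Ann W L"
 shows "smooth2 (%t s. L (%x. \<psi> s (f t x)))"
proof (rule smooth2_if_smooth_functionals)
 interpret W: weil_algebra W by (rule weil_algebra.intro[OF W])
 have fam: "smooth_family (wvars W) (%s x. \<psi> s (f t x))" for t
  unfolding smooth_family_def by (intro allI impI \<psi> repD[OF f])
 show "smooth_real (%s. L (%x. \<psi> s (f t x)))" for t by (rule W.ann_family(1)[OF L fam])
 fix \<mu> assume \<mu>: "smooth_functional \<mu>"
 have "fsmooth X (%p. \<mu> (%s. \<psi> s p))" unfolding fsmooth_def
 proof
  fix c assume c: "c \<in> curves X"
  have "smooth2 (%s u. \<psi> s (c u))" unfolding smooth2_def using \<psi>[OF _ curve_reparam[OF X c]] by simp
  from smooth_functionalD(3)[OF \<mu> this] show "smooth_real (%t. \<mu> (%s. \<psi> s (c t)))" .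
 qed
 from weil_curveD[OF curve this L] show "smooth_real (%t. \<mu> (%s. L (%x. \<psi> s (f t x))))"
  by (simp only: W.ann_family(2)[OF L fam \<mu>])
qed

lemma Ann_sum:
 assumes W: "weil W" and L: "Ann W L" and f: "!!i. i < (m::nat) ==> csmooth (wvars W) (f i)"
 shows "L (%x. \<Sum>i<m. f i x) = (\<Sum>i<m. L (f i))"
proof -
 obtain k where k: "ALL L. Ann W L --> jet_functional (wvars W) k L"
  by (rule weil_algebra.ann_jet[OF weil_algebra.intro[OF W]])
 from jet_functional_sum[OF k[rule_format, OF L] f] show ?thesis .
qed

lemma pc_pair_curve:
 assumes X: "froelicher X" and Y: "froelicher Y" and W: "weil W"
  and f: "!!t. rep (wvars W) X (f t)" and g: "!!t. rep (wvars W) Y (g t)"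
  and fc: "weil_curve X W f"
  and gc: "weil_curve Y W g"
 shows "(%t. pc (fs_prod X Y) W (%x. (f t x, g t x))) \<in> curves (prolong (fs_prod X Y) W)"
 unfolding pc_curve_iff[OF froelicher_prod[OF X Y] W rep_pair[OF f g]]
proof (rule weil_curveI)
 interpret W: weil_algebra W by (rule weil_algebra.intro[OF W])
 let ?n = "wvars W"
 fix h L assume h: "fsmooth (fs_prod X Y) h" and L: "Ann W L"
 obtain N e \<Lambda> where d: "dual_system ?n (wnull W) N e \<Lambda>" by (rule W.weil_dual_basis)
 note e = dual_systemD(1)[OF d] and \<Lambda> = dual_systemD(2)[OF d] and dual = dual_systemD(3)[OF d]
 have hc: "smooth_real (%u. h (c u, d u))" if "c \<in> curves X" "d \<in> curves Y" for c d
  by (rule fsmoothD[OF h]) (simp add: curves_prod_iff that)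
 \<comment> \<open>the coefficients with respect to the dual basis when only the first component varies\<close>
 define A where "A j s q = \<Lambda> j (%z. h (f s z, q))" for j s q
 have A: "smooth_real (%u. A j (a u) (d u))" if j: "j < N" and a: "smooth_real a" and d: "d \<in> curves Y" for j a d
 proof -
  have "smooth2 (%t s. \<Lambda> j (%x. h (f t x, d s)))"
  proof (rule smooth2_along_curve[OF X W _ fc _ \<Lambda>[OF j], where \<psi> = "%s p. h (p, d s)"])
   show "rep ?n X (f t)" for t by (rule f)
   fix b :: "real => real" and c assume "smooth_real b" "c \<in> curves X"
   then show "smooth_real (%u. h (c u, d (b u)))" by (intro hc curve_reparam[OF Y d])
  qed
  from smooth2D[OF this a smooth_real_id] show ?thesis by (simp add: A_def)
 qed
 have prod: "csmooth ?n (%x. A j t (g t x) * e j x)" if j: "j < N" for j t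
 proof (rule csmooth_mult[OF _ e[OF j]])
  show "csmooth ?n (%x. A j t (g t x))"
   unfolding csmooth_def by (intro allI impI A[OF j smooth_real_const] repD[OF g])
 qed
 have eqL: "L (%x. h (f t x, g t x)) = (\<Sum>j<N. L (%x. A j t (g t x) * e j x))" for t
 proof -
  have "wnull W (%x. h (f t x, g t x) - (\<Sum>j<N. A j t (g t x) * e j x))"
  proof (rule wnull_diagonal_Rn[OF W, of "%y x. h (f t x, g t y) - (\<Sum>j<N. A j t (g t y) * e j x)"])
   fix b c assume b: "curve_Rn ?n b" and c: "curve_Rn ?n c"
   have "smooth_real (%u. A j t (g t (b u)) * e j (c u))" if j: "j < N" for j
    using e[OF j] c by (intro smooth_real_mult A[OF j smooth_real_const repD[OF g b]]) (simp add: csmooth_def)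
   then show "smooth_real (%u. h (f t (c u), g t (b u)) - (\<Sum>j<N. A j t (g t (b u)) * e j (c u)))"
    by (intro smooth_real_diff hc[OF repD[OF f c] repD[OF g b]] smooth_real_sum) simp
  next
   fix y assume "y \<in> Rn ?n"
   then have q: "fsmooth X (%p. h (p, g t y))" by (intro fsmooth_pair[OF Y h] rep_carrier[OF Y g])
   from dual[OF fsmooth_rep[OF q f[of t]]]
   show "wnull W (%x. h (f t x, g t y) - (\<Sum>j<N. A j t (g t y) * e j x))" unfolding A_def .
  qed
  then have z: "L (%x. h (f t x, g t x) - (\<Sum>j<N. A j t (g t x) * e j x)) = 0" by (rule annihilatorD(3)[OF L])
  have s1: "csmooth ?n (%x. h (f t x, g t x))" by (rule fsmooth_rep[OF h rep_pair[OF f g]])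
  have s2: "csmooth ?n (%x. \<Sum>j<N. A j t (g t x) * e j x)" by (rule csmooth_sum) (simp add: prod)
  have "L (%x. h (f t x, g t x)) = L (%x. \<Sum>j<N. A j t (g t x) * e j x)"
   using z annihilator_diff[OF L s1 s2] by simp
  also have "\<dots> = (\<Sum>j<N. L (%x. A j t (g t x) * e j x))" by (rule Ann_sum[OF W L prod])
  finally show ?thesis .
 qed
 have smj: "smooth_real (%t. L (%x. A j t (g t x) * e j x))" if j: "j < N" for j
 proof -
  have "Ann W (%k. L (%x. k x * e j x))" unfolding annihilator_def
  proof (intro conjI allI impI)
   fix k k' c assume k: "csmooth ?n k"
   note m = csmooth_mult[OF k e[OF j]]
   show "L (%x. (c * k x) * e j x) = c * L (%x. k x * e j x)"
    using annihilatorD(2)[OF L m, of c] by (simp add: mult.assoc)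
   assume "csmooth ?n k'"
   from annihilatorD(1)[OF L m csmooth_mult[OF this e[OF j]]]
   show "L (%x. (k x + k' x) * e j x) = L (%x. k x * e j x) + L (%x. k' x * e j x)" by (simp add: distrib_right)
  next
   fix k assume "wnull W k"
   then show "L (%x. k x * e j x) = 0" by (intro annihilatorD(3)[OF L] W.N.mult_right e[OF j])
  qed
  note Lj = this
  have "smooth2 (%t s. (%k. L (%x. k x * e j x)) (%x. A j s (g t x)))"
  proof (rule smooth2_along_curve[OF Y W _ gc _ Lj, where \<psi> = "A j"])
   show "rep ?n Y (g t)" for t by (rule g)
   show "smooth_real (%u. A j (a u) (c u))" if "smooth_real a" "c \<in> curves Y" for a c by (rule A[OF j that])
  qed
  from smooth2D[OF this smooth_real_id smooth_real_id] show ?thesis .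
 qed
 show "smooth_real (%t. L (%x. h (f t x, g t x)))" unfolding eqL by (intro smooth_real_sum smj) simp
qed

text \<open>Pairs of representatives represent pairs, independently of their choice; smoothness of the inverse
  is the smoothness of paired curves.\<close>

lemma prolong_prod_iso:
 assumes X: "froelicher X" and Y: "froelicher Y" and W: "weil W"
 shows "\<exists>\<pi>. fs_iso (prolong (fs_prod X Y) W) (fs_prod (prolong X W) (prolong Y W)) \<pi> &
  (ALL f. rep (wvars W) (fs_prod X Y) f -->
    \<pi> (pc (fs_prod X Y) W f) = (pc X W (%x. fst (f x)), pc Y W (%x. snd (f x))))"
proof -
 note XY = froelicher_prod[OF X Y]
 note P = froelicher_prolong[OF X W] and Q = froelicher_prolong[OF Y W] and PQ = froelicher_prolong[OF XY W]
 let ?p = "prolong_map (fs_prod X Y) X W (restrict fst (carrier X \<times> carrier Y))"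
 let ?q = "prolong_map (fs_prod X Y) Y W (restrict snd (carrier X \<times> carrier Y))"
 define \<pi> where "\<pi> = (\<lambda>a\<in>carrier (prolong (fs_prod X Y) W). (?p a, ?q a))"
 have \<pi>: "\<pi> (pc (fs_prod X Y) W f) = (pc X W (%x. fst (f x)), pc Y W (%x. snd (f x)))"
  if f: "rep (wvars W) (fs_prod X Y) f" for f
 proof -
  have c: "f x \<in> carrier X \<times> carrier Y" if "x \<in> Rn (wvars W)" for x using rep_carrier[OF XY f that] by simp
  have "?p (pc (fs_prod X Y) W f) = pc X W (%x. fst (f x))"
   unfolding prolong_map_pc[OF XY X W fst_smooth[OF X Y] f] by (rule pc_cong) (simp add: c)
  moreover have "?q (pc (fs_prod X Y) W f) = pc Y W (%x. snd (f x))"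
   unfolding prolong_map_pc[OF XY Y W snd_smooth[OF X Y] f] by (rule pc_cong) (simp add: c)
  ultimately show ?thesis by (simp add: \<pi>_def pc_carrier[OF XY f])
 qed
 have rP: "rep (wvars W) X (SOME f. rep (wvars W) X f & a = pc X W f) &
   a = pc X W (SOME f. rep (wvars W) X f & a = pc X W f)" if "a \<in> carrier (prolong X W)" for a
 proof -
  obtain f where "rep (wvars W) X f" "a = pc X W f" using pc_cases[OF X \<open>a \<in> carrier (prolong X W)\<close>] .
  then show ?thesis by (intro someI[of "%f. rep (wvars W) X f & a = pc X W f" f]) simp
 qed
 have rQ: "rep (wvars W) Y (SOME f. rep (wvars W) Y f & a = pc Y W f) &
   a = pc Y W (SOME f. rep (wvars W) Y f & a = pc Y W f)" if "a \<in> carrier (prolong Y W)" for a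
 proof -
  obtain f where "rep (wvars W) Y f" "a = pc Y W f" using pc_cases[OF Y \<open>a \<in> carrier (prolong Y W)\<close>] .
  then show ?thesis by (intro someI[of "%f. rep (wvars W) Y f & a = pc Y W f" f]) simp
 qed
 define \<sigma> where "\<sigma> = (\<lambda>p\<in>carrier (prolong X W) \<times> carrier (prolong Y W). pc (fs_prod X Y) W
  (%x. ((SOME f. rep (wvars W) X f & fst p = pc X W f) x, (SOME f. rep (wvars W) Y f & snd p = pc Y W f) x)))"
 have \<sigma>: "\<sigma> (pc X W f, pc Y W g) = pc (fs_prod X Y) W (%x. (f x, g x))"
  if f: "rep (wvars W) X f" and g: "rep (wvars W) Y g" for f g
 proof -
  note 1 = rP[OF pc_carrier[OF X f]] and 2 = rQ[OF pc_carrier[OF Y g]]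
  have "pc (fs_prod X Y) W (%x. ((SOME h. rep (wvars W) X h & pc X W f = pc X W h) x,
    (SOME h. rep (wvars W) Y h & pc Y W g = pc Y W h) x)) = pc (fs_prod X Y) W (%x. (f x, g x))"
   by (rule pc_pair_cong[OF X Y W conjunct1[OF 1] f conjunct1[OF 2] g
    conjunct2[OF 1, symmetric] conjunct2[OF 2, symmetric]])
  then show ?thesis by (simp add: \<sigma>_def pc_carrier[OF X f] pc_carrier[OF Y g])
 qed
 have "fs_iso (prolong (fs_prod X Y) W) (fs_prod (prolong X W) (prolong Y W)) \<pi>"
 proof (rule fs_isoI)
  show "\<pi> \<in> smooth_maps (prolong (fs_prod X Y) W) (fs_prod (prolong X W) (prolong Y W))" unfolding \<pi>_def
   by (rule pair_smooth[OF PQ prolong_map_smooth[OF XY X W fst_smooth[OF X Y]]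
    prolong_map_smooth[OF XY Y W snd_smooth[OF X Y]]])
  show "\<sigma> \<in> smooth_maps (fs_prod (prolong X W) (prolong Y W)) (prolong (fs_prod X Y) W)"
  proof (rule smI)
   show "\<sigma> \<in> extensional (carrier (fs_prod (prolong X W) (prolong Y W)))" by (simp add: \<sigma>_def)
   fix p assume "p \<in> carrier (fs_prod (prolong X W) (prolong Y W))"
   then obtain a b where p: "p = (a, b)" "a \<in> carrier (prolong X W)" "b \<in> carrier (prolong Y W)" by auto
   obtain f where f: "rep (wvars W) X f" "a = pc X W f" using pc_cases[OF X p(2)] .
   obtain g where g: "rep (wvars W) Y g" "b = pc Y W g" using pc_cases[OF Y p(3)] .
   show "\<sigma> p \<in> carrier (prolong (fs_prod X Y) W)"
    unfolding p(1) f(2) g(2) \<sigma>[OF f(1) g(1)] by (rule pc_carrier[OF XY rep_pair[OF f(1) g(1)]])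
  next
   fix c assume "c \<in> curves (fs_prod (prolong X W) (prolong Y W))"
   then have c: "(%t. fst (c t)) \<in> curves (prolong X W)" "(%t. snd (c t)) \<in> curves (prolong Y W)"
    by (simp_all add: curves_prod_iff)
   obtain f where f': "ALL t. rep (wvars W) X (f t)" and f2: "(%t. fst (c t)) = (%t. pc X W (f t))"
    and f3: "weil_curve X W f" by (rule prolong_curveE[OF X W c(1)])
   note f = spec[OF f'] f2 f3
   obtain g where g': "ALL t. rep (wvars W) Y (g t)" and g2: "(%t. snd (c t)) = (%t. pc Y W (g t))"
    and g3: "weil_curve Y W g" by (rule prolong_curveE[OF Y W c(2)])
   note g = spec[OF g'] g2 g3
   have "c t = (pc X W (f t), pc Y W (g t))" for t
    using fun_cong[OF f(2), of t] fun_cong[OF g(2), of t] by (cases "c t") simp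
   then have "(%t. \<sigma> (c t)) = (%t. pc (fs_prod X Y) W (%x. (f t x, g t x)))" using \<sigma>[OF f(1) g(1)] by simp
   then show "(%t. \<sigma> (c t)) \<in> curves (prolong (fs_prod X Y) W)"
    using pc_pair_curve[OF X Y W _ _ f(3) g(3)] f(1) g(1) by simp
  qed
  show "\<sigma> (\<pi> a) = a" if a: "a \<in> carrier (prolong (fs_prod X Y) W)" for a
  proof -
   obtain f where f: "rep (wvars W) (fs_prod X Y) f" "a = pc (fs_prod X Y) W f" using pc_cases[OF XY a] .
   show ?thesis unfolding f(2) \<pi>[OF f(1)] \<sigma>[OF rep_fst[OF f(1)] rep_snd[OF f(1)]] by simp
  qed
  show "\<pi> (\<sigma> p) = p" if "p \<in> carrier (fs_prod (prolong X W) (prolong Y W))" for p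
  proof -
   obtain a b where p: "p = (a, b)" "a \<in> carrier (prolong X W)" "b \<in> carrier (prolong Y W)" using \<open>p \<in> _\<close> by auto
   obtain f where f: "rep (wvars W) X f" "a = pc X W f" using pc_cases[OF X p(2)] .
   obtain g where g: "rep (wvars W) Y g" "b = pc Y W g" using pc_cases[OF Y p(3)] .
   show ?thesis unfolding p(1) f(2) g(2) \<sigma>[OF f(1) g(1)] \<pi>[OF rep_pair[OF f(1) g(1)]] by simp
  qed
 qed
 then show ?thesis by (intro exI[of _ \<pi>] conjI allI impI \<pi>)
qed

section \<open>Weil exponentiability on represented elements\<close>

lemma join_0 [simp]: "join 0 a b = b" by (simp add: join_def)

lemma smooth_prodD:
 assumes F: "F \<in> smooth_maps (fs_prod Y (fs_Rn k)) X" and "eta \<in> curves Y" "curve_Rn k c"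
 shows "(%u. F (eta u, c u)) \<in> curves X" by (rule smD(2)[OF F]) (simp add: curves_prod_iff curves_fs_Rn assms)

lemma curve_join:
 assumes a: "curve_Rn n a" and b: "curve_Rn m b" shows "curve_Rn (n + m) (%u. join n (a u) (b u))"
proof -
 have "smooth_real (%u. join n (a u) (b u) i)" if "i < n + m" for i
  using a b that by (cases "i < n") (simp_all add: curve_Rn_def join_def)
 then show ?thesis using a b join_Rn by (simp add: curve_Rn_def)
qed

text \<open>A smooth family of representatives gives a smooth map into the prolongation.\<close>

lemma param_smooth:
 assumes X: "froelicher X" and Y: "froelicher Y" and U: "weil U"
  and F: "!!eta c. eta \<in> curves Y ==> curve_Rn (wvars U) c ==> (%u. F (eta u) (c u)) \<in> curves X"
 shows "(\<lambda>y\<in>carrier Y. pc X U (F y)) \<in> smooth_maps Y (prolong X U)"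
proof (rule sm_restrictI[OF Y])
 fix y assume "y \<in> carrier Y"
 then have "rep (wvars U) X (F y)" unfolding rep_def by (intro allI impI F const_curve[OF Y])
 then show "pc X U (F y) \<in> carrier (prolong X U)" by (rule pc_carrier[OF X])
next
 fix eta assume eta: "eta \<in> curves Y"
 show "(%t. pc X U (F (eta t))) \<in> curves (prolong X U)"
 proof (rule pc_family(2)[OF X U])
  fix a c assume a: "smooth_real a" and c: "curve_Rn (wvars U) c"
  show "(%u. F (eta (a u)) (c u)) \<in> curves X" by (rule F[OF curve_reparam[OF Y eta a] c])
 qed
qed

lemma exp_rep:
 assumes X: "froelicher X" and Y: "froelicher Y" and V: "weil V"
  and F: "!!eta b c. eta \<in> curves Y ==> curve_Rn m b ==> curve_Rn (wvars V) c ==> (%u. F (eta u) (c u) (b u)) \<in> curves X"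
 shows "rep m (fs_exp (prolong X V) Y) (%b. \<lambda>y\<in>carrier Y. pc X V (%a. F y a b))"
 unfolding rep_def curves_exp_iff[OF Y]
proof (intro allI impI conjI)
 fix b assume b: "curve_Rn m b"
 have bR: "b t \<in> Rn m" for t using b by (simp add: curve_Rn_def)
 show "(\<lambda>y\<in>carrier Y. pc X V (%a. F y a (b t))) \<in> smooth_maps Y (prolong X V)" for t
 proof (rule param_smooth[OF X Y V])
  fix eta c assume "eta \<in> curves Y" "curve_Rn (wvars V) c"
  then show "(%u. F (eta u) (c u) (b t)) \<in> curves X" by (rule F[OF _ curve_Rn_const[OF bR]])
 qed
 fix a eta assume a: "smooth_real a" and eta: "eta \<in> curves Y"
 have "(%s. pc X V (%x. F (eta s) x (b (a s)))) \<in> curves (prolong X V)"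
 proof (rule pc_family(2)[OF X V])
  fix a' c assume a': "smooth_real a'" and c: "curve_Rn (wvars V) c"
  show "(%u. F (eta (a' u)) (c u) (b (a (a' u)))) \<in> curves X"
   by (rule F[OF curve_reparam[OF Y eta a'] curve_Rn_reparam[OF b smooth_real_compose[OF a a']] c])
 qed
 then show "(%s. (\<lambda>y\<in>carrier Y. pc X V (%x. F y x (b (a s)))) (eta s)) \<in> curves (prolong X V)"
  by (simp add: curve_in[OF Y eta])
qed

lemma we_lhs_elem_eq: "we_lhs_elem X Y V W F = (\<lambda>y\<in>carrier Y. pc X (V \<otimes>\<^sub>W W) (%x. F (y, x)))"
 by (simp add: we_lhs_elem_def pc_def)

lemma we_rhs_elem_eq:
 "we_rhs_elem X Y V W F = pc (fs_exp (prolong X V) Y) W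
   (%b. \<lambda>y\<in>carrier Y. pc X V (%a. F (y, join (wvars V) a b)))" by (simp add: we_rhs_elem_def pc_def)

abbreviation elems where
 "elems X Y V W \<equiv> smooth_maps (fs_prod Y (fs_Rn (wvars V + wvars W))) X"

lemma tensor_weil: "weil V ==> weil W ==> weil (V \<otimes>\<^sub>W W)"
 by (rule weil_pair.weil_tensor) (simp add: weil_pair_def weil_algebra_def)

lemma slice_rep:
 assumes Y: "froelicher Y" and F: "F \<in> smooth_maps (fs_prod Y (fs_Rn k)) X" and y: "y \<in> carrier Y"
 shows "rep k X (%x. F (y, x))" unfolding rep_def by (intro allI impI smooth_prodD[OF F const_curve[OF Y y]])

lemma we_lhs_elem_closed:
 assumes X: "froelicher X" and Y: "froelicher Y" and V: "weil V" and W: "weil W" and F: "F \<in> elems X Y V W"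
 shows "we_lhs_elem X Y V W F \<in> smooth_maps Y (prolong X (V \<otimes>\<^sub>W W))" unfolding we_lhs_elem_eq
proof (rule param_smooth[OF X Y tensor_weil[OF V W]])
 fix eta c assume "eta \<in> curves Y" "curve_Rn (wvars (V \<otimes>\<^sub>W W)) c"
 then show "(%u. F (eta u, c u)) \<in> curves X" by (simp add: smooth_prodD[OF F])
qed

lemma we_rhs_rep:
 assumes X: "froelicher X" and Y: "froelicher Y" and V: "weil V" and F: "F \<in> elems X Y V W"
 shows "rep (wvars W) (fs_exp (prolong X V) Y) (%b. \<lambda>y\<in>carrier Y. pc X V (%a. F (y, join (wvars V) a b)))"
proof (rule exp_rep[OF X Y V])
 fix eta b c assume "eta \<in> curves Y" "curve_Rn (wvars W) b" "curve_Rn (wvars V) c"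
 then show "(%u. F (eta u, join (wvars V) (c u) (b u))) \<in> curves X" by (intro smooth_prodD[OF F] curve_join)
qed

lemma join_rep:
 assumes Y: "froelicher Y" and F: "F \<in> elems X Y V W" and y: "y \<in> carrier Y" and b: "b \<in> Rn (wvars W)"
 shows "rep (wvars V) X (%a. F (y, join (wvars V) a b))" unfolding rep_def
 by (intro allI impI smooth_prodD[OF F const_curve[OF Y y]] curve_join curve_Rn_const[OF b])

lemma froelicher_we:
 assumes X: "froelicher X" and Y: "froelicher Y" and V: "weil V" and W: "weil W"
 shows "froelicher (we_lhs X Y V W)" "froelicher (we_rhs X Y V W)" unfolding we_lhs_def we_rhs_def
 by (rule froelicher_exp[OF froelicher_prolong[OF X tensor_weil[OF V W]] Y],
   rule froelicher_prolong[OF froelicher_exp[OF froelicher_prolong[OF X V] Y] W])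

text \<open>The essential part of Weil exponentiability. Naturality follows from it because all
  elements are represented.\<close>

definition core :: "'y itself => 'a froelicher => bool" where
 "core t X \<longleftrightarrow> (\<forall>(Y :: 'y froelicher) V W. froelicher Y & weil V & weil W -->
   iso_along (we_lhs X Y V W) (we_rhs X Y V W) (elems X Y V W)
    (we_lhs_elem X Y V W) (we_rhs_elem X Y V W))"

lemma coreD:
 assumes "core TYPE('y) X" "froelicher (Y :: 'y froelicher)" "weil V" "weil W"
 shows "iso_along (we_lhs X Y V W) (we_rhs X Y V W) (elems X Y V W) (we_lhs_elem X Y V W) (we_rhs_elem X Y V W)"
 by (rule assms(1)[unfolded core_def, rule_format]) (intro conjI assms(2,3,4))

lemma iso_alongE:
 assumes "iso_along A B S p q"
 obtains h where "fs_iso A B h" "\<forall>F\<in>S. p F \<in> carrier A" "\<forall>F\<in>S. h (p F) = q F"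
 using assms unfolding iso_along_def by (elim conjE exE) (rule that)

lemma fs_isoE:
 assumes "fs_iso A B h"
 obtains k where "h \<in> smooth_maps A B" "k \<in> smooth_maps B A"
  "\<forall>x\<in>carrier A. k (h x) = x" "\<forall>y\<in>carrier B. h (k y) = y"
 using assms unfolding fs_iso_def by (elim conjE bexE) (rule that)

lemma fs_iso_sm: "fs_iso A B h ==> h \<in> smooth_maps A B" unfolding fs_iso_def by (rule conjunct1)

lemma fs_iso_inj:
 assumes h: "fs_iso A B h" and x: "x \<in> carrier A" "y \<in> carrier A" and eq: "h x = h y" shows "x = y"
proof -
 obtain k where k: "\<forall>x\<in>carrier A. k (h x) = x" using h by (rule fs_isoE)
 have "x = k (h x)" by (rule bspec[OF k x(1), symmetric])
 also have "\<dots> = k (h y)" by (rule arg_cong[OF eq])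
 also have "\<dots> = y" by (rule bspec[OF k x(2)])
 finally show ?thesis .
qed

lemma iso_along_mem: assumes "iso_along A B S p q" and F: "F \<in> S" shows "q F \<in> carrier B"
proof -
 obtain h where h: "fs_iso A B h" "\<forall>F\<in>S. p F \<in> carrier A" "\<forall>F\<in>S. h (p F) = q F"
  using assms(1) by (rule iso_alongE)
 show ?thesis using smD(1)[OF fs_iso_sm[OF h(1)] bspec[OF h(2) F]] bspec[OF h(3) F] by simp
qed

lemma iso_along_reindex:
 assumes "iso_along A B S' p q" and g: "!!F. F \<in> S ==> g F \<in> S'"
 shows "iso_along A B S (%F. p (g F)) (%F. q (g F))"
proof -
 obtain h where h: "fs_iso A B h" "\<forall>F\<in>S'. p F \<in> carrier A" "\<forall>F\<in>S'. h (p F) = q F"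
  using assms(1) by (rule iso_alongE)
 show ?thesis by (rule iso_alongI[OF h(1)]) (simp_all add: h(2,3) g)
qed

lemma postcomp_apply: "u \<in> smooth_maps Y A ==> postcomp A Y h u = (\<lambda>y\<in>carrier Y. h (u y))"
 by (simp add: postcomp_def compose_def)

lemma iso_along_cong:
 assumes "iso_along A B S p q" and eq: "!!F. F \<in> S ==> q F = q' F"
 shows "iso_along A B S p q'"
proof -
 obtain h where h: "fs_iso A B h" "\<forall>F\<in>S. p F \<in> carrier A" "\<forall>F\<in>S. h (p F) = q F"
  using assms(1) by (rule iso_alongE)
 show ?thesis
 proof (rule iso_alongI[OF h(1)])
  fix F assume F: "F \<in> S"
  show "p F \<in> carrier A" by (rule bspec[OF h(2) F])
  show "h (p F) = q' F" using bspec[OF h(3) F] eq[OF F] by (rule trans)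
 qed
qed

lemma uncurry_rep:
 assumes A: "froelicher A" and Y: "froelicher Y" and q: "rep m (fs_exp A Y) q"
 shows "(\<lambda>p\<in>carrier Y \<times> Rn m. q (snd p) (fst p)) \<in> smooth_maps (fs_prod Y (fs_Rn m)) A"
proof -
 have "(\<lambda>p\<in>carrier (fs_prod Y (fs_Rn m)). q (snd p) (fst p)) \<in> smooth_maps (fs_prod Y (fs_Rn m)) A"
 proof (rule sm_restrictI[OF froelicher_prod[OF Y froelicher_Rn]])
  fix p assume p: "p \<in> carrier (fs_prod Y (fs_Rn m))"
  then have "q (snd p) \<in> smooth_maps Y A" using rep_carrier[OF froelicher_exp[OF A Y] q, of "snd p"] by auto
  then show "q (snd p) (fst p) \<in> carrier A" using p smD(1)[of "q (snd p)" Y A "fst p"] by auto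
 next
  fix c assume "c \<in> curves (fs_prod Y (fs_Rn m))"
  then have c: "(%t. fst (c t)) \<in> curves Y" "curve_Rn m (%t. snd (c t))"
   by (simp_all add: curves_prod_iff curves_fs_Rn)
  have "ALL a eta. smooth_real a --> eta \<in> curves Y --> (%s. q (snd (c (a s))) (eta s)) \<in> curves A"
   by (rule conjunct2[OF repD[OF q c(2), unfolded curves_exp_iff[OF Y]]])
  from this[rule_format, OF smooth_real_id c(1)]
  show "(%t. q (snd (c t)) (fst (c t))) \<in> curves A" by simp
 qed
 then show ?thesis by simp
qed

lemma smooth_maps_ext: "u \<in> smooth_maps Y A ==> (\<lambda>y\<in>carrier Y. u y) = u"
 by (rule extensional_restrict[OF smD(3)])

text \<open>With the real numbers as the first algebra the isomorphism shows that every smooth map into a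
  prolongation is represented by a smooth map into the space.\<close>

lemma elem_represented:
 fixes Y :: "'y froelicher"
 assumes X: "froelicher X" and core: "core TYPE('y) X" and Y: "froelicher Y" and U: "weil U"
  and u: "u \<in> smooth_maps Y (prolong X U)"
 obtains F where "F \<in> smooth_maps (fs_prod Y (fs_Rn (wvars U))) X" "u = (\<lambda>y\<in>carrier Y. pc X U (%x. F (y, x)))"
proof -
 note R = weil_weil_real and eqU = weil_real_tensor[OF U]
 note PR = froelicher_prolong[OF X R]
 let ?E = "fs_exp (prolong X weil_real) Y"
 note E = froelicher_exp[OF PR Y]
 obtain h where h: "fs_iso (we_lhs X Y weil_real U) (we_rhs X Y weil_real U) h"
  and lc: "\<forall>F\<in>elems X Y weil_real U. we_lhs_elem X Y weil_real U F \<in> carrier (we_lhs X Y weil_real U)"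
  and hF: "\<forall>F\<in>elems X Y weil_real U. h (we_lhs_elem X Y weil_real U F) = we_rhs_elem X Y weil_real U F"
  using coreD[OF core Y R U] by (rule iso_alongE)
 have uc: "u \<in> carrier (we_lhs X Y weil_real U)" using u by (simp add: we_lhs_def eqU)
 have "h u \<in> carrier (prolong ?E U)" using smD(1)[OF fs_iso_sm[OF h] uc] by (simp add: we_rhs_def)
 then obtain q where q: "rep (wvars U) ?E q" "h u = pc ?E U q" by (rule pc_cases[OF E])
 define F where "F = (\<lambda>p\<in>carrier Y \<times> Rn (wvars U). base X weil_real (q (snd p) (fst p)))"
 let ?G = "\<lambda>p\<in>carrier Y \<times> Rn (wvars U). q (snd p) (fst p)"
 have "compose (carrier (fs_prod Y (fs_Rn (wvars U)))) (base X weil_real) ?G \<in> smooth_maps (fs_prod Y (fs_Rn (wvars U))) X"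
  by (rule sm_compose[OF froelicher_prod[OF Y froelicher_Rn] uncurry_rep[OF PR Y q(1)] base_smooth[OF X R]])
 moreover have "compose (carrier (fs_prod Y (fs_Rn (wvars U)))) (base X weil_real) ?G = F"
  by (simp add: compose_def F_def cong: restrict_cong)
 ultimately have F: "F \<in> smooth_maps (fs_prod Y (fs_Rn (wvars U))) X" by simp
 then have FE: "F \<in> elems X Y weil_real U" by simp
 have "we_rhs_elem X Y weil_real U F = pc ?E U q" unfolding we_rhs_elem_eq
 proof (rule pc_cong)
  fix b assume b: "b \<in> Rn (wvars U)"
  have qb: "q b \<in> smooth_maps Y (prolong X weil_real)" using rep_carrier[OF E q(1) b] by simp
  have "pc X weil_real (%a. F (y, b)) = q b y" if y: "y \<in> carrier Y" for y
  proof -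
   obtain f where f: "rep (wvars weil_real) X f" "q b y = pc X weil_real f" using pc_cases[OF X smD(1)[OF qb y]] .
   have "F (y, b) = f (%_. 0)" using y b by (simp add: F_def f(2) base_pc[OF X R f(1)])
   then show ?thesis unfolding f(2) by (intro pc_cong) (simp add: Rn_0)
  qed
  then have "(\<lambda>y\<in>carrier Y. pc X weil_real (%a. F (y, b))) = (\<lambda>y\<in>carrier Y. q b y)" by (rule restrict_ext)
  then show "(\<lambda>y\<in>carrier Y. pc X weil_real (%a. F (y, join (wvars weil_real) a b))) = q b"
   by (simp add: smooth_maps_ext[OF qb])
 qed
 then have "h (we_lhs_elem X Y weil_real U F) = h u" using bspec[OF hF FE] q(2) by simp
 from fs_iso_inj[OF h bspec[OF lc FE] uc, OF this] have "u = (\<lambda>y\<in>carrier Y. pc X U (%x. F (y, x)))"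
  by (simp add: we_lhs_elem_eq eqU)
 with F show ?thesis by (rule that)
qed

lemma core_if_weil_exponentiable:
 fixes X :: "'a froelicher"
 assumes X: "froelicher X" and WE: "weil_exponentiable TYPE('y) X" shows "core TYPE('y) X"
proof -
 obtain \<Phi> where iso: "\<forall>(Y :: 'y froelicher) V W. froelicher Y & weil V & weil W -->
    fs_iso (we_lhs X Y V W) (we_rhs X Y V W) (\<Phi> Y V W)"
  and el: "\<forall>(Y :: 'y froelicher) V W. froelicher Y & weil V & weil W -->
    (\<forall>F\<in>smooth_maps (fs_prod Y (fs_Rn (wvars V + wvars W))) X.
      \<Phi> Y V W (we_lhs_elem X Y V W F) = we_rhs_elem X Y V W F)"
  using WE unfolding weil_exponentiable_def by (elim exE conjE) (rule that)
 show ?thesis unfolding core_def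
 proof (intro allI impI)
  fix Y :: "'y froelicher" and V W assume *: "froelicher Y & weil V & weil W"
  show "iso_along (we_lhs X Y V W) (we_rhs X Y V W) (elems X Y V W) (we_lhs_elem X Y V W) (we_rhs_elem X Y V W)"
  proof (rule iso_alongI[OF iso[rule_format, OF *]])
   fix F assume F: "F \<in> elems X Y V W"
   show "we_lhs_elem X Y V W F \<in> carrier (we_lhs X Y V W)"
    using we_lhs_elem_closed[OF X _ _ _ F] * by (simp add: we_lhs_def)
   show "\<Phi> Y V W (we_lhs_elem X Y V W F) = we_rhs_elem X Y V W F" by (rule el[rule_format, OF * F])
  qed
 qed
qed

text \<open>All elements have representatives, and every map of the naturality squares acts on representatives
  by composition.\<close>

lemma weil_exponentiable_if_core:
 fixes X :: "'a froelicher"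
 assumes X: "froelicher X" and core: "core TYPE('y) X" shows "weil_exponentiable TYPE('y) X"
proof -
 define \<Phi> where "\<Phi> Y V W = (SOME h. fs_iso (we_lhs X Y V W) (we_rhs X Y V W) h &
  (\<forall>F\<in>elems X Y V W. h (we_lhs_elem X Y V W F) = we_rhs_elem X Y V W F))" for Y :: "'y froelicher" and V W
 have \<Phi>: "fs_iso (we_lhs X Y V W) (we_rhs X Y V W) (\<Phi> Y V W) &
  (\<forall>F\<in>elems X Y V W. \<Phi> Y V W (we_lhs_elem X Y V W F) = we_rhs_elem X Y V W F)"
  if "froelicher Y" "weil V" "weil W" for Y :: "'y froelicher" and V W
 proof -
  have "EX h. fs_iso (we_lhs X Y V W) (we_rhs X Y V W) h &
   (\<forall>F\<in>elems X Y V W. h (we_lhs_elem X Y V W F) = we_rhs_elem X Y V W F)"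
   using coreD[OF core that] unfolding iso_along_def by (rule conjunct2)
  from someI_ex[OF this] show ?thesis unfolding \<Phi>_def .
 qed
 have el: "\<Phi> Y V W (we_lhs_elem X Y V W F) = we_rhs_elem X Y V W F"
  if "froelicher Y" "weil V" "weil W" "F \<in> elems X Y V W" for Y :: "'y froelicher" and V W F
  using \<Phi>[OF that(1,2,3)] that(4) by simp
 have repr: "\<exists>F\<in>elems X Y V W. u = we_lhs_elem X Y V W F"
  if Y: "froelicher Y" and V: "weil V" and W: "weil W" and u: "u \<in> carrier (we_lhs X Y V W)" for Y :: "'y froelicher" and V W u
 proof -
  have "u \<in> smooth_maps Y (prolong X (V \<otimes>\<^sub>W W))" using u by (simp add: we_lhs_def)
  then obtain F where "F \<in> smooth_maps (fs_prod Y (fs_Rn (wvars (V \<otimes>\<^sub>W W)))) X"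
   "u = (\<lambda>y\<in>carrier Y. pc X (V \<otimes>\<^sub>W W) (%x. F (y, x)))" by (rule elem_represented[OF X core Y tensor_weil[OF V W]])
  then show ?thesis by (intro bexI[of _ F]) (simp_all add: we_lhs_elem_eq)
 qed
 show ?thesis unfolding weil_exponentiable_def
 proof (rule exI[of _ \<Phi>], intro conjI allI impI ballI)
  fix Y :: "'y froelicher" and V W assume *: "froelicher Y & weil V & weil W"
  then show "fs_iso (we_lhs X Y V W) (we_rhs X Y V W) (\<Phi> Y V W)" using \<Phi> by simp
  fix F assume "F \<in> elems X Y V W"
  then show "\<Phi> Y V W (we_lhs_elem X Y V W F) = we_rhs_elem X Y V W F" using el * by simp
 next
  fix Y Y' :: "'y froelicher" and V W g
  assume *: "froelicher Y & froelicher Y' & weil V & weil W" and g: "g \<in> smooth_maps Y' Y"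
  then have Y: "froelicher Y" and Y': "froelicher Y'" and V: "weil V" and W: "weil W" by simp_all
  let ?E = "fs_exp (prolong X V) Y" and ?E' = "fs_exp (prolong X V) Y'"
  note PV = froelicher_prolong[OF X V]
  note E = froelicher_exp[OF PV Y] and E' = froelicher_exp[OF PV Y']
  have pre: "precomp (prolong X V) Y Y' g \<in> smooth_maps ?E ?E'" unfolding precomp_def
  proof (rule sm_restrictI[OF E])
   show "compose (carrier Y') u g \<in> carrier ?E'" if "u \<in> carrier ?E" for u
    using sm_compose[OF Y' g, of u] that by simp
   fix c assume "c \<in> curves ?E"
   then have c: "c t \<in> smooth_maps Y (prolong X V)" "smooth_real a ==> eta \<in> curves Y ==> (%s. c (a s) (eta s)) \<in> curves (prolong X V)" for t a eta
    unfolding curves_exp_iff[OF Y] by simp_all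
   show "(%t. compose (carrier Y') (c t) g) \<in> curves ?E'" unfolding curves_exp_iff[OF Y']
   proof (intro conjI allI impI)
    show "compose (carrier Y') (c t) g \<in> smooth_maps Y' (prolong X V)" for t by (rule sm_compose[OF Y' g c(1)])
    fix a eta assume a: "smooth_real a" and eta: "eta \<in> curves Y'"
    from c(2)[OF a smD(2)[OF g eta]]
    show "(%s. compose (carrier Y') (c (a s)) g (eta s)) \<in> curves (prolong X V)"
     by (simp add: compose_def curve_in[OF Y' eta])
   qed
  qed
  show "compose (carrier (we_lhs X Y V W)) (\<Phi> Y' V W) (precomp (prolong X (V \<otimes>\<^sub>W W)) Y Y' g) =
    compose (carrier (we_lhs X Y V W)) (prolong_map ?E ?E' W (precomp (prolong X V) Y Y' g)) (\<Phi> Y V W)"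
   unfolding compose_def[of "carrier (we_lhs X Y V W)"]
  proof (rule restrict_ext)
   fix u assume u: "u \<in> carrier (we_lhs X Y V W)"
   obtain F where F: "F \<in> elems X Y V W" "u = we_lhs_elem X Y V W F" using repr[OF Y V W u] by (elim bexE)
   let ?k = "wvars V + wvars W"
   define F' where "F' = (\<lambda>p\<in>carrier Y' \<times> Rn ?k. F (g (fst p), snd p))"
   have "(\<lambda>p\<in>carrier (fs_prod Y' (fs_Rn ?k)). F (g (fst p), snd p)) \<in> elems X Y' V W"
   proof (rule sm_restrictI[OF froelicher_prod[OF Y' froelicher_Rn]])
    show "F (g (fst p), snd p) \<in> carrier X" if "p \<in> carrier (fs_prod Y' (fs_Rn ?k))" for p
     using that smD(1)[OF F(1), of "(g (fst p), snd p)"] smD(1)[OF g, of "fst p"] by auto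
    fix c assume "c \<in> curves (fs_prod Y' (fs_Rn ?k))"
    then show "(%t. F (g (fst (c t)), snd (c t))) \<in> curves X"
     by (intro smooth_prodD[OF F(1)] smD(2)[OF g]) (simp_all add: curves_prod_iff curves_fs_Rn)
   qed
   then have F': "F' \<in> elems X Y' V W" by (simp add: F'_def)
   have gy: "g y \<in> carrier Y" if "y \<in> carrier Y'" for y using smD(1)[OF g that] .
   have "precomp (prolong X (V \<otimes>\<^sub>W W)) Y Y' g u = (\<lambda>y\<in>carrier Y'. u (g y))"
    using u by (simp add: precomp_def we_lhs_def compose_def)
   also have "\<dots> = we_lhs_elem X Y' V W F'" unfolding F(2) we_lhs_elem_eq
   proof (rule restrict_ext)
    fix y assume y: "y \<in> carrier Y'"
    have "pc X (V \<otimes>\<^sub>W W) (%x. F (g y, x)) = pc X (V \<otimes>\<^sub>W W) (%x. F' (y, x))"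
     by (rule pc_cong) (simp add: F'_def y)
    then show "(\<lambda>y\<in>carrier Y. pc X (V \<otimes>\<^sub>W W) (%x. F (y, x))) (g y) = pc X (V \<otimes>\<^sub>W W) (%x. F' (y, x))"
     by (simp add: gy y)
   qed
   finally have 1: "precomp (prolong X (V \<otimes>\<^sub>W W)) Y Y' g u = we_lhs_elem X Y' V W F'" .
   note rep = we_rhs_rep[OF X Y V F(1)]
   have "prolong_map ?E ?E' W (precomp (prolong X V) Y Y' g) (\<Phi> Y V W u) =
     pc ?E' W (%b. precomp (prolong X V) Y Y' g (\<lambda>y\<in>carrier Y. pc X V (%a. F (y, join (wvars V) a b))))"
    unfolding F(2) el[OF Y V W F(1)] we_rhs_elem_eq by (rule prolong_map_pc[OF E E' W pre rep])
   also have "\<dots> = we_rhs_elem X Y' V W F'" unfolding we_rhs_elem_eq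
   proof (rule pc_cong)
    fix b assume b: "b \<in> Rn (wvars W)"
    have "(\<lambda>y\<in>carrier Y. pc X V (%a. F (y, join (wvars V) a b))) \<in> smooth_maps Y (prolong X V)"
     using rep_carrier[OF E rep b] by simp
    then have "precomp (prolong X V) Y Y' g (\<lambda>y\<in>carrier Y. pc X V (%a. F (y, join (wvars V) a b))) =
      (\<lambda>y\<in>carrier Y'. (\<lambda>y\<in>carrier Y. pc X V (%a. F (y, join (wvars V) a b))) (g y))"
     by (simp add: precomp_def compose_def)
    also have "\<dots> = (\<lambda>y\<in>carrier Y'. pc X V (%a. F' (y, join (wvars V) a b)))"
    proof (rule restrict_ext)
     fix y assume y: "y \<in> carrier Y'"
     have "pc X V (%a. F (g y, join (wvars V) a b)) = pc X V (%a. F' (y, join (wvars V) a b))"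
      by (rule pc_cong) (simp add: F'_def y join_Rn b)
     then show "(\<lambda>y\<in>carrier Y. pc X V (%a. F (y, join (wvars V) a b))) (g y) =
       pc X V (%a. F' (y, join (wvars V) a b))" by (simp add: gy y)
    qed
    finally show "precomp (prolong X V) Y Y' g (\<lambda>y\<in>carrier Y. pc X V (%a. F (y, join (wvars V) a b))) =
      (\<lambda>y\<in>carrier Y'. pc X V (%a. F' (y, join (wvars V) a b)))" .
   qed
   finally show "\<Phi> Y' V W (precomp (prolong X (V \<otimes>\<^sub>W W)) Y Y' g u) =
     prolong_map ?E ?E' W (precomp (prolong X V) Y Y' g) (\<Phi> Y V W u)" unfolding 1 using el[OF Y' V W F'] by simp
  qed
 next
  fix Y :: "'y froelicher" and V V' W W' phi \<psi>
  assume *: "froelicher Y & weil V & weil V' & weil W & weil W'"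
   and phi: "phi \<in> weil_hom V V'" and \<psi>: "\<psi> \<in> weil_hom W W'"
  then have Y: "froelicher Y" and V: "weil V" and V': "weil V'" and W: "weil W" and W': "weil W'" by simp_all
  obtain \<alpha> where \<alpha>: "induces_hom V V' \<alpha> phi" by (rule ex_induces[OF V V' phi])
  obtain \<beta> where \<beta>: "induces_hom W W' \<beta> \<psi>" by (rule ex_induces[OF W W' \<psi>])
  define \<gamma> where "\<gamma> = (\<lambda>x\<in>Rn (wvars V' + wvars W'). join (wvars V) (\<alpha> (pr_left (wvars V') x)) (\<beta> (pr_right (wvars V') x)))"
  let ?\<tau> = "weil_tensor_hom V V' W W' phi \<psi>"
  have \<tau>: "?\<tau> \<in> weil_hom (V \<otimes>\<^sub>W W) (V' \<otimes>\<^sub>W W')" "induces_hom (V \<otimes>\<^sub>W W) (V' \<otimes>\<^sub>W W') \<gamma> ?\<tau>"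
   unfolding \<gamma>_def by (rule weil_tensor_hom_induced[OF V V' W W' phi \<psi> \<alpha> \<beta>])+
  note T = tensor_weil[OF V W] and T' = tensor_weil[OF V' W']
  let ?E = "fs_exp (prolong X V) Y" and ?E' = "fs_exp (prolong X V') Y"
  note PV = froelicher_prolong[OF X V] and PV' = froelicher_prolong[OF X V']
  note E = froelicher_exp[OF PV Y] and E' = froelicher_exp[OF PV' Y]
  note hV = prolong_hom_smooth[OF X V V' phi]
  let ?post = "postcomp (prolong X V) Y (prolong_hom X V V' phi)"
  note post = postcomp_smooth[OF PV Y hV]
  show "compose (carrier (we_lhs X Y V W)) (\<Phi> Y V' W')
     (postcomp (prolong X (V \<otimes>\<^sub>W W)) Y (prolong_hom X (V \<otimes>\<^sub>W W) (V' \<otimes>\<^sub>W W') ?\<tau>)) =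
    compose (carrier (we_lhs X Y V W))
     (compose (carrier (we_rhs X Y V W)) (prolong_hom ?E' W W' \<psi>) (prolong_map ?E ?E' W ?post)) (\<Phi> Y V W)"
   unfolding compose_def[of "carrier (we_lhs X Y V W)"]
  proof (rule restrict_ext)
   fix u assume u: "u \<in> carrier (we_lhs X Y V W)"
   obtain F where F: "F \<in> elems X Y V W" "u = we_lhs_elem X Y V W F" using repr[OF Y V W u] by (elim bexE)
   let ?k = "wvars V' + wvars W'"
   define F' where "F' = (\<lambda>p\<in>carrier Y \<times> Rn ?k. F (fst p, \<gamma> (snd p)))"
   have \<gamma>: "\<gamma> \<in> smooth_maps (fs_Rn ?k) (fs_Rn (wvars V + wvars W))" using \<tau>(2) by (simp add: induces_hom_iff)
   have "(\<lambda>p\<in>carrier (fs_prod Y (fs_Rn ?k)). F (fst p, \<gamma> (snd p))) \<in> elems X Y V' W'"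
   proof (rule sm_restrictI[OF froelicher_prod[OF Y froelicher_Rn]])
    show "F (fst p, \<gamma> (snd p)) \<in> carrier X" if "p \<in> carrier (fs_prod Y (fs_Rn ?k))" for p
     using that smD(1)[OF F(1), of "(fst p, \<gamma> (snd p))"] smD(1)[OF \<gamma>, of "snd p"] by auto
    fix c assume "c \<in> curves (fs_prod Y (fs_Rn ?k))"
    then show "(%t. F (fst (c t), \<gamma> (snd (c t)))) \<in> curves X" using smD(2)[OF \<gamma>, of "%t. snd (c t)"]
     by (intro smooth_prodD[OF F(1)]) (simp_all add: curves_prod_iff curves_fs_Rn)
   qed
   then have F': "F' \<in> elems X Y V' W'" by (simp add: F'_def)
   have "postcomp (prolong X (V \<otimes>\<^sub>W W)) Y (prolong_hom X (V \<otimes>\<^sub>W W) (V' \<otimes>\<^sub>W W') ?\<tau>) u =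
     (\<lambda>y\<in>carrier Y. prolong_hom X (V \<otimes>\<^sub>W W) (V' \<otimes>\<^sub>W W') ?\<tau> (u y))"
    using u by (intro postcomp_apply) (simp add: we_lhs_def)
   also have "\<dots> = we_lhs_elem X Y V' W' F'" unfolding F(2) we_lhs_elem_eq
   proof (rule restrict_ext)
    fix y assume y: "y \<in> carrier Y"
    have r: "rep (wvars (V \<otimes>\<^sub>W W)) X (%x. F (y, x))" using slice_rep[OF Y F(1) y] by simp
    have "prolong_hom X (V \<otimes>\<^sub>W W) (V' \<otimes>\<^sub>W W') ?\<tau> (pc X (V \<otimes>\<^sub>W W) (%x. F (y, x))) = pc X (V' \<otimes>\<^sub>W W') (%x. F (y, \<gamma> x))"
     by (rule prolong_hom_pc[OF X T T' \<tau> r])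
    also have "\<dots> = pc X (V' \<otimes>\<^sub>W W') (%x. F' (y, x))" by (rule pc_cong) (simp add: F'_def y)
    finally show "prolong_hom X (V \<otimes>\<^sub>W W) (V' \<otimes>\<^sub>W W') ?\<tau> ((\<lambda>y\<in>carrier Y. pc X (V \<otimes>\<^sub>W W) (%x. F (y, x))) y) =
      pc X (V' \<otimes>\<^sub>W W') (%x. F' (y, x))" by (simp add: y)
   qed
   finally have 1: "postcomp (prolong X (V \<otimes>\<^sub>W W)) Y (prolong_hom X (V \<otimes>\<^sub>W W) (V' \<otimes>\<^sub>W W') ?\<tau>) u = we_lhs_elem X Y V' W' F'" .
   note rep = we_rhs_rep[OF X Y V F(1)]
   have Pu: "\<Phi> Y V W u = we_rhs_elem X Y V W F" unfolding F(2) by (rule el[OF Y V W F(1)])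
   have rc: "\<Phi> Y V W u \<in> carrier (we_rhs X Y V W)"
    unfolding Pu we_rhs_elem_eq we_rhs_def by (rule pc_carrier[OF E rep])
   have "prolong_hom ?E' W W' \<psi> (prolong_map ?E ?E' W ?post (\<Phi> Y V W u)) =
     prolong_hom ?E' W W' \<psi> (pc ?E' W (%b. ?post (\<lambda>y\<in>carrier Y. pc X V (%a. F (y, join (wvars V) a b)))))"
    unfolding Pu we_rhs_elem_eq prolong_map_pc[OF E E' W post rep] by (rule refl)
   also have "\<dots> = pc ?E' W' (%b. ?post (\<lambda>y\<in>carrier Y. pc X V (%a. F (y, join (wvars V) a (\<beta> b)))))"
    by (rule prolong_hom_pc[OF E' W W' \<psi> \<beta> rep_sm[OF post rep]])
   also have "\<dots> = we_rhs_elem X Y V' W' F'" unfolding we_rhs_elem_eq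
   proof (rule pc_cong)
    fix b assume b: "b \<in> Rn (wvars W')"
    have \<beta>b: "\<beta> b \<in> Rn (wvars W)"
     using smooth_maps_Rn_closed[of \<beta> "wvars W'" "wvars W" b] \<beta> b by (simp add: induces_hom_iff)
    have "(\<lambda>y\<in>carrier Y. pc X V (%a. F (y, join (wvars V) a (\<beta> b)))) \<in> smooth_maps Y (prolong X V)"
     using rep_carrier[OF E rep \<beta>b] by simp
    then have "?post (\<lambda>y\<in>carrier Y. pc X V (%a. F (y, join (wvars V) a (\<beta> b)))) =
      (\<lambda>y\<in>carrier Y. prolong_hom X V V' phi ((\<lambda>y\<in>carrier Y. pc X V (%a. F (y, join (wvars V) a (\<beta> b)))) y))"
     by (rule postcomp_apply)
    also have "\<dots> = (\<lambda>y\<in>carrier Y. pc X V' (%a. F' (y, join (wvars V') a b)))"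
    proof (rule restrict_ext)
     fix y assume y: "y \<in> carrier Y"
     have "prolong_hom X V V' phi (pc X V (%a. F (y, join (wvars V) a (\<beta> b)))) =
       pc X V' (%a. F (y, join (wvars V) (\<alpha> a) (\<beta> b)))"
      by (rule prolong_hom_pc[OF X V V' phi \<alpha> join_rep[OF Y F(1) y \<beta>b]])
     also have "\<dots> = pc X V' (%a. F' (y, join (wvars V') a b))"
      by (rule pc_cong) (simp add: F'_def \<gamma>_def y join_Rn b)
     finally show "prolong_hom X V V' phi ((\<lambda>y\<in>carrier Y. pc X V (%a. F (y, join (wvars V) a (\<beta> b)))) y) =
       pc X V' (%a. F' (y, join (wvars V') a b))" by (simp add: y)
    qed
    finally show "?post (\<lambda>y\<in>carrier Y. pc X V (%a. F (y, join (wvars V) a (\<beta> b)))) =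
      (\<lambda>y\<in>carrier Y. pc X V' (%a. F' (y, join (wvars V') a b)))" .
   qed
   finally have 2: "prolong_hom ?E' W W' \<psi> (prolong_map ?E ?E' W ?post (\<Phi> Y V W u)) = we_rhs_elem X Y V' W' F'" .
   have "compose (carrier (we_rhs X Y V W)) (prolong_hom ?E' W W' \<psi>) (prolong_map ?E ?E' W ?post) (\<Phi> Y V W u) =
     we_rhs_elem X Y V' W' F'" using rc 2 by (simp add: compose_def)
   then show "\<Phi> Y V' W' (postcomp (prolong X (V \<otimes>\<^sub>W W)) Y (prolong_hom X (V \<otimes>\<^sub>W W) (V' \<otimes>\<^sub>W W') ?\<tau>) u) =
     compose (carrier (we_rhs X Y V W)) (prolong_hom ?E' W W' \<psi>) (prolong_map ?E ?E' W ?post) (\<Phi> Y V W u)"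
    unfolding 1 using el[OF Y V' W' F'] by simp
  qed
 qed
qed

text \<open>For the real numbers as the first algebra the isomorphism moves exponents out of prolongations.\<close>

lemma exp_prolong_iso:
 fixes Y :: "'y froelicher"
 assumes X: "froelicher X" and core: "core TYPE('y) X" and Y: "froelicher Y" and U: "weil U"
 shows "\<exists>\<kappa>. fs_iso (prolong (fs_exp X Y) U) (fs_exp (prolong X U) Y) \<kappa> &
  (ALL q. rep (wvars U) (fs_exp X Y) q --> \<kappa> (pc (fs_exp X Y) U q) = (\<lambda>y\<in>carrier Y. pc X U (%x. q x y)))"
proof -
 note R = weil_weil_real and eqU = weil_real_tensor[OF U]
 note PR = froelicher_prolong[OF X R] and XY = froelicher_exp[OF X Y]
 let ?E = "fs_exp (prolong X weil_real) Y"
 note E = froelicher_exp[OF PR Y]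
 let ?S = "elems X Y weil_real U" and ?B = "base X weil_real"
 let ?p = "%F. pc (fs_exp X Y) U (%b. \<lambda>y\<in>carrier Y. F (y, b))"
 note iso = postcomp_iso[OF PR X Y base_real_iso[OF X]]
 have 1: "iso_along (we_rhs X Y weil_real U) (prolong (fs_exp X Y) U) ?S (we_rhs_elem X Y weil_real U) ?p"
 proof (rule iso_alongI)
  show "fs_iso (we_rhs X Y weil_real U) (prolong (fs_exp X Y) U) (prolong_map ?E (fs_exp X Y) U (postcomp (prolong X weil_real) Y ?B))"
   unfolding we_rhs_def by (rule prolong_map_iso[OF E XY U iso])
  fix F assume F: "F \<in> ?S"
  note rep = we_rhs_rep[OF X Y R F]
  show "we_rhs_elem X Y weil_real U F \<in> carrier (we_rhs X Y weil_real U)"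
   unfolding we_rhs_elem_eq we_rhs_def by (rule pc_carrier[OF E rep])
  show "prolong_map ?E (fs_exp X Y) U (postcomp (prolong X weil_real) Y ?B) (we_rhs_elem X Y weil_real U F) = ?p F"
   unfolding we_rhs_elem_eq prolong_map_pc[OF E XY U fs_iso_sm[OF iso] rep]
  proof (rule pc_cong)
   fix b assume b: "b \<in> Rn (wvars U)"
   have "(\<lambda>y\<in>carrier Y. pc X weil_real (%a. F (y, join (wvars weil_real) a b))) \<in> smooth_maps Y (prolong X weil_real)"
    using rep_carrier[OF E rep b] by simp
   then have "postcomp (prolong X weil_real) Y ?B (\<lambda>y\<in>carrier Y. pc X weil_real (%a. F (y, join (wvars weil_real) a b))) =
     (\<lambda>y\<in>carrier Y. ?B ((\<lambda>y\<in>carrier Y. pc X weil_real (%a. F (y, join (wvars weil_real) a b))) y))"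
    by (rule postcomp_apply)
   also have "\<dots> = (\<lambda>y\<in>carrier Y. F (y, b))"
   proof (rule restrict_ext)
    fix y assume y: "y \<in> carrier Y"
    from base_pc[OF X R join_rep[OF Y F y b]]
    show "?B ((\<lambda>y\<in>carrier Y. pc X weil_real (%a. F (y, join (wvars weil_real) a b))) y) = F (y, b)"
     by (simp add: y)
   qed
   finally show "postcomp (prolong X weil_real) Y ?B (\<lambda>y\<in>carrier Y. pc X weil_real (%a. F (y, join (wvars weil_real) a b))) =
     (\<lambda>y\<in>carrier Y. F (y, b))" .
  qed
 qed
 have "iso_along (prolong (fs_exp X Y) U) (we_lhs X Y weil_real U) ?S ?p (we_lhs_elem X Y weil_real U)"
  by (rule iso_along_trans[OF froelicher_prolong[OF XY U] froelicher_we(1)[OF X Y R U]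
   iso_along_sym[OF 1] iso_along_sym[OF coreD[OF core Y R U]]])
 then obtain \<kappa> where \<kappa>: "fs_iso (prolong (fs_exp X Y) U) (we_lhs X Y weil_real U) \<kappa>"
  and eq: "\<forall>F\<in>?S. \<kappa> (?p F) = we_lhs_elem X Y weil_real U F" by (rule iso_alongE)
 have "\<kappa> (pc (fs_exp X Y) U q) = (\<lambda>y\<in>carrier Y. pc X U (%x. q x y))" if q: "rep (wvars U) (fs_exp X Y) q" for q
 proof -
  define F where "F = (\<lambda>p\<in>carrier Y \<times> Rn (wvars U). q (snd p) (fst p))"
  have F: "F \<in> ?S" using uncurry_rep[OF X Y q] by (simp add: F_def)
  have "pc (fs_exp X Y) U q = ?p F"
  proof (rule pc_cong)
   fix b assume b: "b \<in> Rn (wvars U)"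
   have "q b \<in> smooth_maps Y X" using rep_carrier[OF XY q b] by simp
   from smooth_maps_ext[OF this] show "q b = (\<lambda>y\<in>carrier Y. F (y, b))" by (simp add: F_def b cong: restrict_cong)
  qed
  then have "\<kappa> (pc (fs_exp X Y) U q) = (\<lambda>y\<in>carrier Y. pc X U (%x. F (y, x)))"
   using bspec[OF eq F] by (simp add: we_lhs_elem_eq eqU)
  also have "\<dots> = (\<lambda>y\<in>carrier Y. pc X U (%x. q x y))"
  proof (rule restrict_ext)
   fix y assume "y \<in> carrier Y"
   then show "pc X U (%x. F (y, x)) = pc X U (%x. q x y)" by (intro pc_cong) (simp add: F_def)
  qed
  finally show ?thesis .
 qed
 with \<kappa> show ?thesis by (intro exI[of _ \<kappa>]) (simp add: we_lhs_def eqU)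
qed

section \<open>Weil exponentiability of products and exponentials\<close>

lemma iso_along_prolong:
 assumes A: "froelicher A" and B: "froelicher B" and W: "weil W" and h: "fs_iso A B h"
  and q: "!!F. F \<in> S ==> rep (wvars W) A (q F)"
 shows "iso_along (prolong A W) (prolong B W) S (%F. pc A W (q F)) (%F. pc B W (%b. h (q F b)))"
proof (rule iso_alongI[OF prolong_map_iso[OF A B W h]])
 fix F assume "F \<in> S"
 note r = q[OF this]
 show "pc A W (q F) \<in> carrier (prolong A W)" by (rule pc_carrier[OF A r])
 show "prolong_map A B W h (pc A W (q F)) = pc B W (%b. h (q F b))" by (rule prolong_map_pc[OF A B W fs_iso_sm[OF h] r])
qed

text \<open>Products move out of prolongations and exponentials on both sides.\<close>

lemma core_prod:
 fixes X :: "'a froelicher" and Y :: "'b froelicher"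
 assumes X: "froelicher X" and Y: "froelicher Y" and cX: "core TYPE('t) X" and cY: "core TYPE('t) Y"
 shows "core TYPE('t) (fs_prod X Y)" unfolding core_def
proof (intro allI impI)
 fix Z :: "'t froelicher" and V W assume "froelicher Z & weil V & weil W"
 then have Z: "froelicher Z" and V: "weil V" and W: "weil W" by simp_all
 let ?P = "fs_prod X Y" and ?T = "V \<otimes>\<^sub>W W" and ?D = "fs_prod Z (fs_Rn (wvars V + wvars W))"
 let ?S = "elems ?P Z V W" and ?j = "join (wvars V)"
 note P = froelicher_prod[OF X Y] and T = tensor_weil[OF V W] and D = froelicher_prod[OF Z froelicher_Rn]
 note PT = froelicher_prolong[OF P T] and XT = froelicher_prolong[OF X T] and YT = froelicher_prolong[OF Y T]
 note PV = froelicher_prolong[OF P V] and XV = froelicher_prolong[OF X V] and YV = froelicher_prolong[OF Y V]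
 define F1 where "F1 F = (\<lambda>s\<in>carrier ?D. fst (F s))" for F :: "'t \<times> point => 'a \<times> 'b"
 define F2 where "F2 F = (\<lambda>s\<in>carrier ?D. snd (F s))" for F :: "'t \<times> point => 'a \<times> 'b"
 have F1: "F1 F \<in> elems X Z V W" and F2: "F2 F \<in> elems Y Z V W" if "F \<in> ?S" for F
  unfolding F1_def F2_def by (rule comp_fst_smooth[OF X Y D that])+
 obtain \<pi> where \<pi>: "fs_iso (prolong ?P ?T) (fs_prod (prolong X ?T) (prolong Y ?T)) \<pi>"
  and \<pi>': "ALL f. rep (wvars ?T) ?P f --> \<pi> (pc ?P ?T f) = (pc X ?T (%x. fst (f x)), pc Y ?T (%x. snd (f x)))"
  using prolong_prod_iso[OF X Y T] by (elim exE conjE) (rule that)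
 obtain \<sigma> where \<sigma>: "fs_iso (prolong ?P V) (fs_prod (prolong X V) (prolong Y V)) \<sigma>"
  and \<sigma>': "ALL f. rep (wvars V) ?P f --> \<sigma> (pc ?P V f) = (pc X V (%x. fst (f x)), pc Y V (%x. snd (f x)))"
  using prolong_prod_iso[OF X Y V] by (elim exE conjE) (rule that)
 obtain hX where hX: "fs_iso (we_lhs X Z V W) (we_rhs X Z V W) hX"
  and lX: "\<forall>F\<in>elems X Z V W. we_lhs_elem X Z V W F \<in> carrier (we_lhs X Z V W)"
  and eX: "\<forall>F\<in>elems X Z V W. hX (we_lhs_elem X Z V W F) = we_rhs_elem X Z V W F"
  using coreD[OF cX Z V W] by (rule iso_alongE)
 obtain hY where hY: "fs_iso (we_lhs Y Z V W) (we_rhs Y Z V W) hY"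
  and lY: "\<forall>F\<in>elems Y Z V W. we_lhs_elem Y Z V W F \<in> carrier (we_lhs Y Z V W)"
  and eY: "\<forall>F\<in>elems Y Z V W. hY (we_lhs_elem Y Z V W F) = we_rhs_elem Y Z V W F"
  using coreD[OF cY Z V W] by (rule iso_alongE)
 let ?TT = "fs_prod (prolong X ?T) (prolong Y ?T)"
 let ?LL = "fs_prod (we_lhs X Z V W) (we_lhs Y Z V W)" and ?RR = "fs_prod (we_rhs X Z V W) (we_rhs Y Z V W)"
 let ?r = "%F. (we_rhs_elem X Z V W (F1 F), we_rhs_elem Y Z V W (F2 F))"
 let ?l = "%F. (we_lhs_elem X Z V W (F1 F), we_lhs_elem Y Z V W (F2 F))"
 let ?m = "%F. \<lambda>z\<in>carrier Z. (pc X ?T (%x. fst (F (z, x))), pc Y ?T (%x. snd (F (z, x))))"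
 note LX = froelicher_we[OF X Z V W] and LY = froelicher_we[OF Y Z V W] and LP = froelicher_we[OF P Z V W]
 have RR: "froelicher ?RR" by (rule froelicher_prod[OF LX(2) LY(2)])
 have LL: "froelicher ?LL" by (rule froelicher_prod[OF LX(1) LY(1)])
 have a: "iso_along (we_lhs ?P Z V W) (fs_exp ?TT Z) ?S (we_lhs_elem ?P Z V W) ?m"
 proof (rule iso_alongI)
  show "fs_iso (we_lhs ?P Z V W) (fs_exp ?TT Z) (postcomp (prolong ?P ?T) Z \<pi>)"
   unfolding we_lhs_def by (rule postcomp_iso[OF PT froelicher_prod[OF XT YT] Z \<pi>])
  fix F assume F: "F \<in> ?S"
  note cl = we_lhs_elem_closed[OF P Z V W F]
  show "we_lhs_elem ?P Z V W F \<in> carrier (we_lhs ?P Z V W)" using cl by (simp add: we_lhs_def)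
  have "postcomp (prolong ?P ?T) Z \<pi> (we_lhs_elem ?P Z V W F) = (\<lambda>z\<in>carrier Z. \<pi> (we_lhs_elem ?P Z V W F z))"
   by (rule postcomp_apply[OF cl])
  also have "\<dots> = ?m F"
  proof (rule restrict_ext)
   fix z assume z: "z \<in> carrier Z"
   have "rep (wvars ?T) ?P (%x. F (z, x))" using slice_rep[OF Z F z] by simp
   from \<pi>'[rule_format, OF this] show "\<pi> (we_lhs_elem ?P Z V W F z) = (pc X ?T (%x. fst (F (z, x))), pc Y ?T (%x. snd (F (z, x))))"
    by (simp add: we_lhs_elem_eq z)
  qed
  finally show "postcomp (prolong ?P ?T) Z \<pi> (we_lhs_elem ?P Z V W F) = ?m F" .
 qed
 have b: "iso_along (fs_exp ?TT Z) ?LL ?S ?m ?l"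
 proof (rule iso_alongI)
  show "fs_iso (fs_exp ?TT Z) ?LL (\<lambda>u\<in>smooth_maps Z ?TT. (\<lambda>z\<in>carrier Z. fst (u z), \<lambda>z\<in>carrier Z. snd (u z)))"
   unfolding we_lhs_def by (rule exp_prod_iso[OF XT YT Z])
  fix F assume F: "F \<in> ?S"
  show m: "?m F \<in> carrier (fs_exp ?TT Z)" by (rule iso_along_mem[OF a F])
  have "pc X ?T (%x. fst (F (z, x))) = pc X ?T (%x. F1 F (z, x))" "pc Y ?T (%x. snd (F (z, x))) = pc Y ?T (%x. F2 F (z, x))"
   if "z \<in> carrier Z" for z by (rule pc_cong, simp add: F1_def that, rule pc_cong, simp add: F2_def that)
  then show "(\<lambda>u\<in>smooth_maps Z ?TT. (\<lambda>z\<in>carrier Z. fst (u z), \<lambda>z\<in>carrier Z. snd (u z))) (?m F) = ?l F"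
   using m by (simp add: we_lhs_elem_eq cong: restrict_cong)
 qed
 have c: "iso_along ?LL ?RR ?S ?l ?r"
 proof (rule iso_alongI[OF prod_map_iso[OF LX(1) LY(1) LX(2) LY(2) hX hY]])
  fix F assume F: "F \<in> ?S"
  note m = bspec[OF lX F1[OF F]] bspec[OF lY F2[OF F]]
  show "?l F \<in> carrier ?LL" using m by simp
  show "(\<lambda>p\<in>carrier (we_lhs X Z V W) \<times> carrier (we_lhs Y Z V W). (hX (fst p), hY (snd p))) (?l F) = ?r F"
   using m bspec[OF eX F1[OF F]] bspec[OF eY F2[OF F]] by simp
 qed
 have L: "iso_along (we_lhs ?P Z V W) ?RR ?S (we_lhs_elem ?P Z V W) ?r"
  by (rule iso_along_trans[OF LP(1) RR iso_along_trans[OF LP(1) LL a b] c])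
 let ?E0 = "fs_exp (prolong ?P V) Z" and ?E1 = "fs_exp (fs_prod (prolong X V) (prolong Y V)) Z"
  and ?EX = "fs_exp (prolong X V) Z" and ?EY = "fs_exp (prolong Y V) Z"
 let ?E2 = "fs_prod ?EX ?EY"
 note E0 = froelicher_exp[OF PV Z] and E1 = froelicher_exp[OF froelicher_prod[OF XV YV] Z]
 note EX = froelicher_exp[OF XV Z] and EY = froelicher_exp[OF YV Z]
 note E2 = froelicher_prod[OF EX EY]
 let ?Q = "%F b. \<lambda>z\<in>carrier Z. pc ?P V (%a. F (z, ?j a b))"
 let ?h1 = "postcomp (prolong ?P V) Z \<sigma>"
  and ?h2 = "\<lambda>u\<in>smooth_maps Z (fs_prod (prolong X V) (prolong Y V)). (\<lambda>z\<in>carrier Z. fst (u z), \<lambda>z\<in>carrier Z. snd (u z))"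
 note h1 = postcomp_iso[OF PV froelicher_prod[OF XV YV] Z \<sigma>] and h2 = exp_prod_iso[OF XV YV Z]
 have Q: "rep (wvars W) ?E0 (?Q F)" if "F \<in> ?S" for F by (rule we_rhs_rep[OF P Z V that])
 have Q1: "rep (wvars W) ?E1 (%b. ?h1 (?Q F b))" if "F \<in> ?S" for F by (rule rep_sm[OF fs_iso_sm[OF h1] Q[OF that]])
 have Q2: "rep (wvars W) ?E2 (%b. ?h2 (?h1 (?Q F b)))" if "F \<in> ?S" for F by (rule rep_sm[OF fs_iso_sm[OF h2] Q1[OF that]])
 have d: "iso_along (we_rhs ?P Z V W) (prolong ?E1 W) ?S (we_rhs_elem ?P Z V W) (%F. pc ?E1 W (%b. ?h1 (?Q F b)))"
  unfolding we_rhs_def we_rhs_elem_eq[abs_def] by (rule iso_along_prolong[OF E0 E1 W h1 Q])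
 have e: "iso_along (prolong ?E1 W) (prolong ?E2 W) ?S (%F. pc ?E1 W (%b. ?h1 (?Q F b))) (%F. pc ?E2 W (%b. ?h2 (?h1 (?Q F b))))"
  by (rule iso_along_prolong[OF E1 E2 W h2 Q1])
 obtain \<tau> where \<tau>: "fs_iso (prolong ?E2 W) (fs_prod (prolong ?EX W) (prolong ?EY W)) \<tau>"
  and \<tau>': "ALL f. rep (wvars W) ?E2 f --> \<tau> (pc ?E2 W f) = (pc ?EX W (%x. fst (f x)), pc ?EY W (%x. snd (f x)))"
  using prolong_prod_iso[OF EX EY W] by (elim exE conjE) (rule that)
 have g: "iso_along (prolong ?E2 W) ?RR ?S (%F. pc ?E2 W (%b. ?h2 (?h1 (?Q F b)))) ?r"
 proof (rule iso_alongI)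
  show "fs_iso (prolong ?E2 W) ?RR \<tau>" unfolding we_rhs_def by (rule \<tau>)
  fix F assume F: "F \<in> ?S"
  show "pc ?E2 W (%b. ?h2 (?h1 (?Q F b))) \<in> carrier (prolong ?E2 W)" by (rule pc_carrier[OF E2 Q2[OF F]])
  have val: "?h2 (?h1 (?Q F b)) = (\<lambda>z\<in>carrier Z. pc X V (%a. F1 F (z, ?j a b)), \<lambda>z\<in>carrier Z. pc Y V (%a. F2 F (z, ?j a b)))"
   if b: "b \<in> Rn (wvars W)" for b
  proof -
   have "?Q F b \<in> smooth_maps Z (prolong ?P V)" using rep_carrier[OF E0 Q[OF F] b] by simp
   from postcomp_apply[OF this]
   have "?h1 (?Q F b) = (\<lambda>z\<in>carrier Z. \<sigma> (?Q F b z))" .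
   also have "\<dots> = (\<lambda>z\<in>carrier Z. (pc X V (%a. F1 F (z, ?j a b)), pc Y V (%a. F2 F (z, ?j a b))))"
   proof (rule restrict_ext)
    fix z assume z: "z \<in> carrier Z"
    have "pc X V (%a. fst (F (z, ?j a b))) = pc X V (%a. F1 F (z, ?j a b))"
     by (rule pc_cong) (simp add: F1_def z join_Rn b)
    moreover have "pc Y V (%a. snd (F (z, ?j a b))) = pc Y V (%a. F2 F (z, ?j a b))"
     by (rule pc_cong) (simp add: F2_def z join_Rn b)
    ultimately show "\<sigma> (?Q F b z) = (pc X V (%a. F1 F (z, ?j a b)), pc Y V (%a. F2 F (z, ?j a b)))"
     using \<sigma>'[rule_format, OF join_rep[OF Z F z b]] by (simp add: z)
   qed
   finally have eq: "?h1 (?Q F b) = (\<lambda>z\<in>carrier Z. (pc X V (%a. F1 F (z, ?j a b)), pc Y V (%a. F2 F (z, ?j a b))))" .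
   have "?h1 (?Q F b) \<in> smooth_maps Z (fs_prod (prolong X V) (prolong Y V))"
    using rep_carrier[OF E1 Q1[OF F] b] by simp
   then show ?thesis unfolding eq by (simp cong: restrict_cong)
  qed
  have "pc ?EX W (%b. fst (?h2 (?h1 (?Q F b)))) = we_rhs_elem X Z V W (F1 F)"
   unfolding we_rhs_elem_eq by (rule pc_cong) (simp only: val fst_conv)
  moreover have "pc ?EY W (%b. snd (?h2 (?h1 (?Q F b)))) = we_rhs_elem Y Z V W (F2 F)"
   unfolding we_rhs_elem_eq by (rule pc_cong) (simp only: val snd_conv)
  ultimately show "\<tau> (pc ?E2 W (%b. ?h2 (?h1 (?Q F b)))) = ?r F"
   unfolding \<tau>'[rule_format, OF Q2[OF F]] by (simp only:)
 qed
 have R: "iso_along (we_rhs ?P Z V W) ?RR ?S (we_rhs_elem ?P Z V W) ?r"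
  by (rule iso_along_trans[OF LP(2) RR iso_along_trans[OF LP(2) froelicher_prolong[OF E2 W] d e] g])
 show "iso_along (we_lhs ?P Z V W) (we_rhs ?P Z V W) ?S (we_lhs_elem ?P Z V W) (we_rhs_elem ?P Z V W)"
  by (rule iso_along_trans[OF LP(1) LP(2) L iso_along_sym[OF R]])
qed

text \<open>Currying reduces \<open>X\<^sup>Y\<close> with exponent \<open>Z\<close> to \<open>X\<close> with exponent \<open>Z \<times> Y\<close>.\<close>

lemma core_exp:
 fixes X :: "'a froelicher" and Y :: "'b froelicher"
 assumes X: "froelicher X" and Y: "froelicher Y"
  and c1: "core TYPE('t \<times> 'b) X" and c2: "core TYPE('b) X"
 shows "core TYPE('t) (fs_exp X Y)" unfolding core_def
proof (intro allI impI)
 fix Z :: "'t froelicher" and V W assume "froelicher Z & weil V & weil W"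
 then have Z: "froelicher Z" and V: "weil V" and W: "weil W" by simp_all
 let ?P = "fs_exp X Y" and ?T = "V \<otimes>\<^sub>W W" and ?k = "wvars V + wvars W" and ?ZY = "fs_prod Z Y"
 let ?S = "elems ?P Z V W" and ?j = "join (wvars V)"
 note P = froelicher_exp[OF X Y] and T = tensor_weil[OF V W] and ZY = froelicher_prod[OF Z Y]
 note PT = froelicher_prolong[OF P T] and XT = froelicher_prolong[OF X T]
 note PV = froelicher_prolong[OF P V] and XV = froelicher_prolong[OF X V]
 note XTY = froelicher_exp[OF XT Y] and XVY = froelicher_exp[OF XV Y]
 define F' where "F' F = (\<lambda>s\<in>carrier (fs_prod ?ZY (fs_Rn ?k)). F (fst (fst s), snd s) (snd (fst s)))"
  for F :: "'t \<times> point => 'b => 'a"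
 have F': "F' F \<in> elems X ?ZY V W" if F: "F \<in> ?S" for F unfolding F'_def
 proof (rule sm_restrictI[OF froelicher_prod[OF ZY froelicher_Rn]])
  fix s assume s: "s \<in> carrier (fs_prod ?ZY (fs_Rn ?k))"
  then have "F (fst (fst s), snd s) \<in> smooth_maps Y X" using smD(1)[OF F, of "(fst (fst s), snd s)"] by auto
  then show "F (fst (fst s), snd s) (snd (fst s)) \<in> carrier X" using smD(1)[of _ Y X "snd (fst s)"] s by auto
 next
  fix c assume "c \<in> curves (fs_prod ?ZY (fs_Rn ?k))"
  then have c: "(%t. fst (fst (c t))) \<in> curves Z" "(%t. snd (fst (c t))) \<in> curves Y" "curve_Rn ?k (%t. snd (c t))"
   by (simp_all add: curves_prod_iff curves_fs_Rn)
  have "ALL a eta. smooth_real a --> eta \<in> curves Y --> (%s. F (fst (fst (c (a s))), snd (c (a s))) (eta s)) \<in> curves X"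
   by (rule conjunct2[OF smooth_prodD[OF F c(1,3), unfolded curves_exp_iff[OF Y]]])
  from this[rule_format, OF smooth_real_id c(2)]
  show "(%t. F (fst (fst (c t)), snd (c t)) (snd (fst (c t)))) \<in> curves X" by simp
 qed
 obtain \<kappa> where \<kappa>: "fs_iso (prolong ?P ?T) (fs_exp (prolong X ?T) Y) \<kappa>"
  and \<kappa>': "ALL q. rep (wvars ?T) ?P q --> \<kappa> (pc ?P ?T q) = (\<lambda>y\<in>carrier Y. pc X ?T (%x. q x y))"
  using exp_prolong_iso[OF X c2 Y T] by (elim exE conjE) (rule that)
 obtain \<rho> where \<rho>: "fs_iso (prolong ?P V) (fs_exp (prolong X V) Y) \<rho>"
  and \<rho>': "ALL q. rep (wvars V) ?P q --> \<rho> (pc ?P V q) = (\<lambda>y\<in>carrier Y. pc X V (%x. q x y))"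
  using exp_prolong_iso[OF X c2 Y V] by (elim exE conjE) (rule that)
 note LP = froelicher_we[OF P Z V W] and LX = froelicher_we[OF X ZY V W]
 let ?B = "fs_exp (fs_exp (prolong X ?T) Y) Z"
 have B: "froelicher ?B" by (rule froelicher_exp[OF XTY Z])
 let ?m = "%F. \<lambda>z\<in>carrier Z. \<lambda>y\<in>carrier Y. pc X ?T (%x. F (z, x) y)"
 have a: "iso_along (we_lhs ?P Z V W) ?B ?S (we_lhs_elem ?P Z V W) ?m"
 proof (rule iso_alongI)
  show "fs_iso (we_lhs ?P Z V W) ?B (postcomp (prolong ?P ?T) Z \<kappa>)"
   unfolding we_lhs_def by (rule postcomp_iso[OF PT XTY Z \<kappa>])
  fix F assume F: "F \<in> ?S"
  note cl = we_lhs_elem_closed[OF P Z V W F]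
  show "we_lhs_elem ?P Z V W F \<in> carrier (we_lhs ?P Z V W)" using cl by (simp add: we_lhs_def)
  have "postcomp (prolong ?P ?T) Z \<kappa> (we_lhs_elem ?P Z V W F) = (\<lambda>z\<in>carrier Z. \<kappa> (we_lhs_elem ?P Z V W F z))"
   by (rule postcomp_apply[OF cl])
  also have "\<dots> = ?m F"
  proof (rule restrict_ext)
   fix z assume z: "z \<in> carrier Z"
   have "rep (wvars ?T) ?P (%x. F (z, x))" using slice_rep[OF Z F z] by simp
   from \<kappa>'[rule_format, OF this] show "\<kappa> (we_lhs_elem ?P Z V W F z) = (\<lambda>y\<in>carrier Y. pc X ?T (%x. F (z, x) y))"
    by (simp add: we_lhs_elem_eq z)
  qed
  finally show "postcomp (prolong ?P ?T) Z \<kappa> (we_lhs_elem ?P Z V W F) = ?m F" .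
 qed
 let ?cu = "\<lambda>u\<in>smooth_maps ?ZY (prolong X ?T). fs_curry Y Z u"
 have b: "iso_along (we_lhs X ?ZY V W) ?B ?S (%F. we_lhs_elem X ?ZY V W (F' F)) ?m"
 proof (rule iso_alongI)
  show "fs_iso (we_lhs X ?ZY V W) ?B ?cu" unfolding we_lhs_def by (rule curry_iso[OF XT Y Z])
  fix F assume F: "F \<in> ?S"
  note cl = we_lhs_elem_closed[OF X ZY V W F'[OF F]]
  show "we_lhs_elem X ?ZY V W (F' F) \<in> carrier (we_lhs X ?ZY V W)" using cl by (simp add: we_lhs_def)
  have "?cu (we_lhs_elem X ?ZY V W (F' F)) = fs_curry Y Z (we_lhs_elem X ?ZY V W (F' F))" using cl by simp
  also have "\<dots> = ?m F" unfolding fs_curry_def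
  proof (rule restrict_ext, rule restrict_ext)
   fix z y assume z: "z \<in> carrier Z" and y: "y \<in> carrier Y"
   have "pc X ?T (%x. F' F ((z, y), x)) = pc X ?T (%x. F (z, x) y)" by (rule pc_cong) (simp add: F'_def z y)
   then show "we_lhs_elem X ?ZY V W (F' F) (z, y) = pc X ?T (%x. F (z, x) y)" by (simp add: we_lhs_elem_eq z y)
  qed
  finally show "?cu (we_lhs_elem X ?ZY V W (F' F)) = ?m F" .
 qed
 have c: "iso_along (we_lhs X ?ZY V W) (we_rhs X ?ZY V W) ?S (%F. we_lhs_elem X ?ZY V W (F' F)) (%F. we_rhs_elem X ?ZY V W (F' F))"
  by (rule iso_along_reindex[OF coreD[OF c1 ZY V W] F'])
 let ?E0 = "fs_exp (prolong X V) ?ZY" and ?E1 = "fs_exp (fs_exp (prolong X V) Y) Z" and ?E2 = "fs_exp (prolong ?P V) Z"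
 note E0 = froelicher_exp[OF XV ZY] and E1 = froelicher_exp[OF XVY Z] and E2 = froelicher_exp[OF PV Z]
 let ?cv = "\<lambda>u\<in>smooth_maps ?ZY (prolong X V). fs_curry Y Z u" and ?po = "postcomp (prolong ?P V) Z \<rho>"
 note cv = curry_iso[OF XV Y Z] and po = postcomp_iso[OF PV XVY Z \<rho>]
 let ?Q = "%F b. \<lambda>p\<in>carrier ?ZY. pc X V (%a. F' F (p, ?j a b))"
 let ?R = "%F b. \<lambda>z\<in>carrier Z. pc ?P V (%a. F (z, ?j a b))"
 have Q: "rep (wvars W) ?E0 (?Q F)" if "F \<in> ?S" for F by (rule we_rhs_rep[OF X ZY V F'[OF that]])
 have R: "rep (wvars W) ?E2 (?R F)" if "F \<in> ?S" for F by (rule we_rhs_rep[OF P Z V that])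
 have d: "iso_along (we_rhs X ?ZY V W) (prolong ?E1 W) ?S (%F. we_rhs_elem X ?ZY V W (F' F)) (%F. pc ?E1 W (%b. ?cv (?Q F b)))"
  unfolding we_rhs_def we_rhs_elem_eq by (rule iso_along_prolong[OF E0 E1 W cv Q])
 have e: "iso_along (we_rhs ?P Z V W) (prolong ?E1 W) ?S (we_rhs_elem ?P Z V W) (%F. pc ?E1 W (%b. ?po (?R F b)))"
  unfolding we_rhs_def we_rhs_elem_eq[abs_def] by (rule iso_along_prolong[OF E2 E1 W po R])
 have eq: "pc ?E1 W (%b. ?po (?R F b)) = pc ?E1 W (%b. ?cv (?Q F b))" if F: "F \<in> ?S" for F
 proof (rule pc_cong)
  fix b assume b: "b \<in> Rn (wvars W)"
  have q: "?Q F b \<in> smooth_maps ?ZY (prolong X V)" using rep_carrier[OF E0 Q[OF F] b] by simp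
  have r: "?R F b \<in> smooth_maps Z (prolong ?P V)" using rep_carrier[OF E2 R[OF F] b] by simp
  have "?po (?R F b) = (\<lambda>z\<in>carrier Z. \<rho> (?R F b z))" by (rule postcomp_apply[OF r])
  also have "\<dots> = fs_curry Y Z (?Q F b)" unfolding fs_curry_def
  proof (rule restrict_ext)
   fix z assume z: "z \<in> carrier Z"
   have "\<rho> (?R F b z) = (\<lambda>y\<in>carrier Y. pc X V (%a. F (z, ?j a b) y))"
    using \<rho>'[rule_format, OF join_rep[OF Z F z b]] by (simp add: z)
   also have "\<dots> = (\<lambda>y\<in>carrier Y. ?Q F b (z, y))"
   proof (rule restrict_ext)
    fix y assume y: "y \<in> carrier Y"
    have "pc X V (%a. F (z, ?j a b) y) = pc X V (%a. F' F ((z, y), ?j a b))"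
     by (rule pc_cong) (simp add: F'_def z y join_Rn b)
    then show "pc X V (%a. F (z, ?j a b) y) = ?Q F b (z, y)" by (simp add: z y)
   qed
   finally show "\<rho> (?R F b z) = (\<lambda>y\<in>carrier Y. ?Q F b (z, y))" .
  qed
  also have "\<dots> = ?cv (?Q F b)" using q by simp
  finally show "?po (?R F b) = ?cv (?Q F b)" .
 qed
 have e': "iso_along (we_rhs ?P Z V W) (prolong ?E1 W) ?S (we_rhs_elem ?P Z V W) (%F. pc ?E1 W (%b. ?cv (?Q F b)))"
  by (rule iso_along_cong[OF e]) (rule eq)
 note fE1 = froelicher_prolong[OF E1 W]
 have 1: "iso_along (we_lhs ?P Z V W) (we_lhs X ?ZY V W) ?S (we_lhs_elem ?P Z V W) (%F. we_lhs_elem X ?ZY V W (F' F))"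
  by (rule iso_along_trans[OF LP(1) LX(1) a iso_along_sym[OF b]])
 have 2: "iso_along (we_lhs ?P Z V W) (we_rhs X ?ZY V W) ?S (we_lhs_elem ?P Z V W) (%F. we_rhs_elem X ?ZY V W (F' F))"
  by (rule iso_along_trans[OF LP(1) LX(2) 1 c])
 have 3: "iso_along (we_lhs ?P Z V W) (prolong ?E1 W) ?S (we_lhs_elem ?P Z V W) (%F. pc ?E1 W (%b. ?cv (?Q F b)))"
  by (rule iso_along_trans[OF LP(1) fE1 2 d])
 show "iso_along (we_lhs ?P Z V W) (we_rhs ?P Z V W) ?S (we_lhs_elem ?P Z V W) (we_rhs_elem ?P Z V W)"
  by (rule iso_along_trans[OF LP(1) LP(2) 3 iso_along_sym[OF e']])
qed

lemma smooth_maps_singleton: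
 assumes T: "froelicher T" and A: "froelicher A" and a: "carrier A = {a}"
 shows "smooth_maps T A = {\<lambda>s\<in>carrier T. a}"
proof (rule Set.set_eqI, rule iffI)
 fix h assume h: "h \<in> smooth_maps T A"
 have "h = (\<lambda>s\<in>carrier T. a)" by (rule extensionalityI[OF smD(3)[OF h]]) (use smD(1)[OF h] a in simp_all)
 then show "h \<in> {\<lambda>s\<in>carrier T. a}" by simp
next
 fix h assume "h \<in> {\<lambda>s\<in>carrier T. a}"
 moreover have "(\<lambda>s\<in>carrier T. a) \<in> smooth_maps T A"
  using const_curve[OF A, of a] a by (intro sm_restrictI[OF T]) simp_all
 ultimately show "h \<in> smooth_maps T A" by simp
qed

lemma carrier_prolong_singleton:
 assumes A: "froelicher A" and a: "carrier A = {a}"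
 shows "carrier (prolong A W) = {pc A W (%_. a)}"
proof -
 have e: "b = pc A W (%_. a)" if b: "b \<in> carrier (prolong A W)" for b
 proof -
  obtain f where f: "rep (wvars W) A f" "b = pc A W f" using pc_cases[OF A b] .
  show ?thesis unfolding f(2)
  proof (rule pc_cong)
   fix x assume x: "x \<in> Rn (wvars W)"
   from rep_carrier[OF A f(1) x] show "f x = a" unfolding a by (rule singletonD)
  qed
 qed
 have c: "pc A W (%_. a) \<in> carrier (prolong A W)" using a by (intro pc_carrier[OF A] rep_const[OF A]) simp
 show ?thesis
 proof (rule Set.equalityI)
  show "carrier (prolong A W) \<subseteq> {pc A W (%_. a)}"
  proof (rule subsetI)
   fix b assume "b \<in> carrier (prolong A W)"
   then show "b \<in> {pc A W (%_. a)}" unfolding singleton_iff by (rule e)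
  qed
  show "{pc A W (%_. a)} \<subseteq> carrier (prolong A W)"
   unfolding insert_subset by (rule conjI[OF c empty_subsetI])
 qed
qed

lemma carrier_point [simp]: "carrier fs_point = {()}" by (auto simp: fs_point_def)

lemma fs_iso_singleton:
 assumes A: "froelicher A" and B: "froelicher B" and a: "carrier A = {a}" and b: "carrier B = {b}"
 shows "fs_iso A B (\<lambda>s\<in>carrier A. b)"
proof (rule fs_isoI)
 show "(\<lambda>s\<in>carrier A. b) \<in> smooth_maps A B" unfolding smooth_maps_singleton[OF A B b] by (rule singletonI)
 show "(\<lambda>s\<in>carrier B. a) \<in> smooth_maps B A" unfolding smooth_maps_singleton[OF B A a] by (rule singletonI)
qed (simp_all add: a b)

lemma core_singleton:
 fixes X :: "'a froelicher"
 assumes X: "froelicher X" and x: "carrier X = {x}"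
 shows "core TYPE('t) X" unfolding core_def
proof (intro allI impI)
 fix Z :: "'t froelicher" and V W assume "froelicher Z & weil V & weil W"
 then have Z: "froelicher Z" and V: "weil V" and W: "weil W" by simp_all
 note L = froelicher_we[OF X Z V W] and T = tensor_weil[OF V W]
 note XV = froelicher_prolong[OF X V]
 note E = froelicher_exp[OF XV Z]
 let ?l = "\<lambda>s\<in>carrier Z. pc X (V \<otimes>\<^sub>W W) (%_. x)"
 let ?r = "pc (fs_exp (prolong X V) Z) W (%_. \<lambda>s\<in>carrier Z. pc X V (%_. x))"
 have l: "carrier (we_lhs X Z V W) = {?l}" unfolding we_lhs_def carrier_exp
  by (rule smooth_maps_singleton[OF Z froelicher_prolong[OF X T] carrier_prolong_singleton[OF X x]])
 have "carrier (fs_exp (prolong X V) Z) = {\<lambda>s\<in>carrier Z. pc X V (%_. x)}"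
  unfolding carrier_exp by (rule smooth_maps_singleton[OF Z XV carrier_prolong_singleton[OF X x]])
 then have r: "carrier (we_rhs X Z V W) = {?r}" unfolding we_rhs_def by (rule carrier_prolong_singleton[OF E])
 show "iso_along (we_lhs X Z V W) (we_rhs X Z V W) (elems X Z V W) (we_lhs_elem X Z V W) (we_rhs_elem X Z V W)"
 proof (rule iso_alongI[OF fs_iso_singleton[OF L l r]])
  fix F assume F: "F \<in> elems X Z V W"
  show lc: "we_lhs_elem X Z V W F \<in> carrier (we_lhs X Z V W)"
   unfolding we_lhs_def carrier_exp by (rule we_lhs_elem_closed[OF X Z V W F])
  have "we_rhs_elem X Z V W F \<in> carrier (we_rhs X Z V W)"
   unfolding we_rhs_elem_eq we_rhs_def by (rule pc_carrier[OF E we_rhs_rep[OF X Z V F]])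
  then have e1: "we_rhs_elem X Z V W F = ?r" unfolding r by (rule singletonD)
  have e2: "(\<lambda>s\<in>carrier (we_lhs X Z V W). ?r) (we_lhs_elem X Z V W F) = ?r" using lc by (rule restrict_apply')
  show "(\<lambda>s\<in>carrier (we_lhs X Z V W). ?r) (we_lhs_elem X Z V W F) = we_rhs_elem X Z V W F"
   by (rule trans[OF e2 e1[symmetric]])
 qed
qed

section \<open>Microlinear spaces\<close>

text \<open>Cones over prolonged diagrams and maps into the prolonged limit, expressed by values.\<close>

definition pcone :: "'a froelicher => weil_diagram => 't froelicher => (nat => 't => (point => 'a) set) => bool" where
 "pcone X D T f \<longleftrightarrow> (\<forall>v\<in>dverts D. f v \<in> smooth_maps T (prolong X (dobj D v))) &
   (ALL u v phi s. (u, v, phi) \<in> darrs D --> s \<in> carrier T --> prolong_hom X (dobj D u) (dobj D v) phi (f u s) = f v s)"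

definition plift :: "'a froelicher => weil_diagram => weil_pres => (nat => whom) => 't froelicher =>
  (nat => 't => (point => 'a) set) => ('t => (point => 'a) set) => bool" where
 "plift X D A p T f h \<longleftrightarrow> h \<in> smooth_maps T (prolong X A) &
   (\<forall>v\<in>dverts D. \<forall>s\<in>carrier T. prolong_hom X A (dobj D v) (p v) (h s) = f v s)"

abbreviation parrs :: "'a froelicher => weil_diagram => (nat \<times> nat \<times> ((point => 'a) set => (point => 'a) set)) set" where
 "parrs X D \<equiv> (%(u, v, phi). (u, v, prolong_hom X (dobj D u) (dobj D v) phi)) ` darrs D"

lemma ex1_eq: "\<exists>!x. P x ==> P x ==> P y ==> x = y" by blast

lemma compose_eq_iff:
 assumes f: "f \<in> extensional A" shows "compose A g h = f \<longleftrightarrow> (\<forall>s\<in>A. g (h s) = f s)"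
proof
 assume e: "compose A g h = f"
 show "\<forall>s\<in>A. g (h s) = f s"
 proof
  fix s assume "s \<in> A"
  then show "g (h s) = f s" using fun_cong[OF e, of s] by (simp add: compose_def)
 qed
next
 assume e: "\<forall>s\<in>A. g (h s) = f s"
 show "compose A g h = f" by (rule extensionalityI[OF compose_extensional f]) (simp add: compose_def e)
qed

lemma pcone_sm: "pcone X D T f ==> \<forall>v\<in>dverts D. f v \<in> smooth_maps T (prolong X (dobj D v))"
 unfolding pcone_def by (rule conjunct1)

lemma pcone_arr:
 assumes "pcone X D T f" "(u, v, phi) \<in> darrs D" "s \<in> carrier T"
 shows "prolong_hom X (dobj D u) (dobj D v) phi (f u s) = f v s"
 by (rule conjunct2[OF assms(1)[unfolded pcone_def], rule_format, OF assms(2,3)])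

lemma diagram_vert: "D \<in> finite_diagrams ==> v \<in> dverts D ==> weil (dobj D v)"
 by (simp add: finite_diagrams_def)

lemma diagram_arr:
 assumes "D \<in> finite_diagrams" "(u, v, phi) \<in> darrs D"
 shows "u \<in> dverts D" "v \<in> dverts D" "phi \<in> weil_hom (dobj D u) (dobj D v)"
proof -
 have "\<forall>(u, v, phi)\<in>darrs D. u \<in> dverts D & v \<in> dverts D & phi \<in> weil_hom (dobj D u) (dobj D v)"
  using assms(1) by (simp add: finite_diagrams_def)
 from bspec[OF this assms(2)] show "u \<in> dverts D" "v \<in> dverts D" "phi \<in> weil_hom (dobj D u) (dobj D v)" by simp_all
qed

lemma fs_cone_iff:
 assumes D: "D \<in> finite_diagrams"
 shows "fs_cone (dverts D) (%v. prolong X (dobj D v)) (parrs X D) T f \<longleftrightarrow> froelicher T & pcone X D T f"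
proof
 assume c: "fs_cone (dverts D) (%v. prolong X (dobj D v)) (parrs X D) T f"
 note c' = c[unfolded fs_cone_def]
 note ar = conjunct2[OF conjunct2[OF c']]
 show "froelicher T & pcone X D T f" unfolding pcone_def
 proof (intro conjI allI impI)
  show "froelicher T" by (rule conjunct1[OF c'])
  show "\<forall>v\<in>dverts D. f v \<in> smooth_maps T (prolong X (dobj D v))" by (rule conjunct1[OF conjunct2[OF c']])
  fix u v phi s assume a: "(u, v, phi) \<in> darrs D" and s: "s \<in> carrier T"
  have "(u, v, prolong_hom X (dobj D u) (dobj D v) phi) \<in> parrs X D" using a by (rule rev_image_eqI) simp
  from bspec[OF ar this] have "compose (carrier T) (prolong_hom X (dobj D u) (dobj D v) phi) (f u) = f v" by simp
  from fun_cong[OF this, of s] show "prolong_hom X (dobj D u) (dobj D v) phi (f u s) = f v s" using s by (simp add: compose_def)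
 qed
next
 assume *: "froelicher T & pcone X D T f"
 note p = conjunct2[OF *]
 show "fs_cone (dverts D) (%v. prolong X (dobj D v)) (parrs X D) T f" unfolding fs_cone_def
 proof (intro conjI)
  show "froelicher T" by (rule conjunct1[OF *])
  show "\<forall>v\<in>dverts D. f v \<in> smooth_maps T (prolong X (dobj D v))" by (rule pcone_sm[OF p])
  show "\<forall>(u, v, a)\<in>parrs X D. compose (carrier T) a (f u) = f v"
  proof
   fix x assume "x \<in> parrs X D"
   then obtain u v phi where a: "(u, v, phi) \<in> darrs D" and x: "x = (u, v, prolong_hom X (dobj D u) (dobj D v) phi)" by auto
   have "compose (carrier T) (prolong_hom X (dobj D u) (dobj D v) phi) (f u) = f v"
    unfolding compose_eq_iff[OF smD(3)[OF bspec[OF pcone_sm[OF p] diagram_arr(2)[OF D a]]]]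
    by (intro ballI pcone_arr[OF p a])
   then show "case x of (u, v, a) => compose (carrier T) a (f u) = f v" by (simp add: x)
  qed
 qed
qed

lemma plift_iff:
 assumes sm: "\<forall>v\<in>dverts D. f v \<in> smooth_maps T (prolong X (dobj D v))"
 shows "h \<in> smooth_maps T (prolong X A) &
   (\<forall>v\<in>dverts D. compose (carrier T) (prolong_hom X A (dobj D v) (p v)) h = f v) \<longleftrightarrow> plift X D A p T f h"
proof -
 have "(\<forall>v\<in>dverts D. compose (carrier T) (prolong_hom X A (dobj D v) (p v)) h = f v) \<longleftrightarrow>
   (\<forall>v\<in>dverts D. \<forall>s\<in>carrier T. prolong_hom X A (dobj D v) (p v) (h s) = f v s)"
 proof (rule ball_cong[OF refl])
  fix v assume "v \<in> dverts D"
  from bspec[OF sm this]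
  show "compose (carrier T) (prolong_hom X A (dobj D v) (p v)) h = f v \<longleftrightarrow>
    (\<forall>s\<in>carrier T. prolong_hom X A (dobj D v) (p v) (h s) = f v s)" by (rule compose_eq_iff[OF smD(3)])
 qed
 then show ?thesis unfolding plift_def by (simp only:)
qed

lemma limit_cone:
 assumes "weil_limit D A p"
 shows "weil A" "v \<in> dverts D ==> p v \<in> weil_hom A (dobj D v)"
  "(u, v, phi) \<in> darrs D ==> compose (carrier (weil_alg A)) phi (p u) = p v"
proof -
 have c: "weil_cone D A p" using assms unfolding weil_limit_def by (rule conjunct1)
 note c' = c[unfolded weil_cone_def]
 show "weil A" by (rule conjunct1[OF c'])
 show "p v \<in> weil_hom A (dobj D v)" if "v \<in> dverts D" by (rule bspec[OF conjunct1[OF conjunct2[OF c']] that])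
 show "compose (carrier (weil_alg A)) phi (p u) = p v" if "(u, v, phi) \<in> darrs D"
  using bspec[OF conjunct2[OF conjunct2[OF c']] that] by simp
qed

lemma pcone_limit:
 assumes X: "froelicher X" and D: "D \<in> finite_diagrams" and lim: "weil_limit D A p"
 shows "pcone X D (prolong X A) (%v. prolong_hom X A (dobj D v) (p v))" unfolding pcone_def
proof (intro conjI ballI allI impI)
 note A = limit_cone(1)[OF lim]
 show "prolong_hom X A (dobj D v) (p v) \<in> smooth_maps (prolong X A) (prolong X (dobj D v))" if "v \<in> dverts D" for v
  by (rule prolong_hom_smooth[OF X A diagram_vert[OF D that] limit_cone(2)[OF lim that]])
 fix u v phi s assume a: "(u, v, phi) \<in> darrs D" and s: "s \<in> carrier (prolong X A)"
 note uv = diagram_arr[OF D a]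
 from prolong_hom_compose[OF X A diagram_vert[OF D uv(1)] diagram_vert[OF D uv(2)]
   limit_cone(2)[OF lim uv(1)] uv(3) limit_cone(2)[OF lim uv(2)] limit_cone(3)[OF lim a]]
 have "compose (carrier (prolong X A)) (prolong_hom X (dobj D u) (dobj D v) phi) (prolong_hom X A (dobj D u) (p u)) =
   prolong_hom X A (dobj D v) (p v)" .
 from fun_cong[OF this, of s] s
 show "prolong_hom X (dobj D u) (dobj D v) phi (prolong_hom X A (dobj D u) (p u) s) = prolong_hom X A (dobj D v) (p v) s"
  by (simp add: compose_def)
qed

text \<open>Functoriality makes the prolonged limit a cone, so that only the unique lifts remain.\<close>

lemma microlinearI:
 fixes X :: "'a froelicher"
 assumes X: "froelicher X" and K: "\<K> \<subseteq> finite_diagrams"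
  and L: "!!D A p (T :: 't froelicher) f. D \<in> \<K> ==> weil_limit D A p ==> froelicher T ==> pcone X D T f ==>
   \<exists>!h. plift X D A p T f h"
 shows "microlinear TYPE('t) \<K> X" unfolding microlinear_def
proof (intro ballI allI impI)
 fix D A p assume DK: "D \<in> \<K>" and lim: "weil_limit D A p"
 have D: "D \<in> finite_diagrams" using DK K by (rule rev_subsetD)
 show "fs_limit TYPE('t) (dverts D) (%v. prolong X (dobj D v)) (parrs X D) (prolong X A) (%v. prolong_hom X A (dobj D v) (p v))"
  unfolding fs_limit_def fs_cone_iff[OF D]
 proof (intro conjI allI impI)
  show "froelicher (prolong X A)" by (rule froelicher_prolong[OF X limit_cone(1)[OF lim]])
  show "pcone X D (prolong X A) (%v. prolong_hom X A (dobj D v) (p v))" by (rule pcone_limit[OF X D lim])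
  fix T :: "'t froelicher" and f assume *: "froelicher T & pcone X D T f"
  have "\<exists>!h. plift X D A p T f h" by (rule L[OF DK lim conjunct1[OF *] conjunct2[OF *]])
  then show "\<exists>!h. h \<in> smooth_maps T (prolong X A) &
    (\<forall>v\<in>dverts D. compose (carrier T) (prolong_hom X A (dobj D v) (p v)) h = f v)"
   by (simp only: plift_iff[OF pcone_sm[OF conjunct2[OF *]]])
 qed
qed

lemma microlinearD:
 fixes X :: "'a froelicher" and T :: "'t froelicher"
 assumes m: "microlinear TYPE('t) \<K> X" and K: "\<K> \<subseteq> finite_diagrams" and DK: "D \<in> \<K>"
  and lim: "weil_limit D A p" and T: "froelicher T" and f: "pcone X D T f"
 shows "\<exists>!h. plift X D A p T f h"
proof -
 have D: "D \<in> finite_diagrams" using DK K by (rule rev_subsetD)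
 have "fs_limit TYPE('t) (dverts D) (%v. prolong X (dobj D v)) (parrs X D) (prolong X A) (%v. prolong_hom X A (dobj D v) (p v))"
  by (rule m[unfolded microlinear_def, rule_format, OF DK lim])
 from conjunct2[OF this[unfolded fs_limit_def], rule_format, OF iffD2[OF fs_cone_iff[OF D] conjI[OF T f]]]
 show ?thesis by (simp only: plift_iff[OF pcone_sm[OF f]])
qed

lemma plift_sm: "plift X D A p T f h ==> h \<in> smooth_maps T (prolong X A)" unfolding plift_def by (rule conjunct1)

lemma plift_eq:
 assumes "plift X D A p T f h" "v \<in> dverts D" "s \<in> carrier T"
 shows "prolong_hom X A (dobj D v) (p v) (h s) = f v s"
 by (rule bspec[OF bspec[OF conjunct2[OF assms(1)[unfolded plift_def]] assms(2)] assms(3)])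

lemma microlinear_singleton:
 fixes X :: "'a froelicher"
 assumes X: "froelicher X" and x: "carrier X = {x}" and K: "\<K> \<subseteq> finite_diagrams"
 shows "microlinear TYPE('t) \<K> X"
proof (rule microlinearI[OF X K])
 fix D A p and T :: "'t froelicher" and f
 assume DK: "D \<in> \<K>" and lim: "weil_limit D A p" and T: "froelicher T" and f: "pcone X D T f"
 have D: "D \<in> finite_diagrams" using DK K by (rule rev_subsetD)
 note A = limit_cone(1)[OF lim]
 note s = smooth_maps_singleton[OF T froelicher_prolong[OF X A] carrier_prolong_singleton[OF X x]]
 let ?h = "\<lambda>s\<in>carrier T. pc X A (%_. x)"
 have h: "?h \<in> smooth_maps T (prolong X A)" unfolding s by (rule singletonI)
 show "\<exists>!h. plift X D A p T f h"
 proof (rule ex1I[of _ ?h])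
  show "plift X D A p T f ?h" unfolding plift_def
  proof (intro conjI ballI h)
   fix v t assume v: "v \<in> dverts D" and t: "t \<in> carrier T"
   note one = carrier_prolong_singleton[OF X x, of "dobj D v"]
   have "f v t \<in> carrier (prolong X (dobj D v))" by (rule smD(1)[OF bspec[OF pcone_sm[OF f] v] t])
   moreover have "prolong_hom X A (dobj D v) (p v) (?h t) \<in> carrier (prolong X (dobj D v))"
    by (rule smD(1)[OF prolong_hom_smooth[OF X A diagram_vert[OF D v] limit_cone(2)[OF lim v]] smD(1)[OF h t]])
   ultimately show "prolong_hom X A (dobj D v) (p v) (?h t) = f v t" unfolding one by (simp only: singleton_iff)
  qed
  show "h = ?h" if "plift X D A p T f h" for h using plift_sm[OF that] unfolding s by (rule singletonD)
 qed
qed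

text \<open>A cone is split into its components, and the lifts of the components are paired.\<close>

lemma microlinear_prod:
 fixes X :: "'a froelicher" and Y :: "'b froelicher"
 assumes X: "froelicher X" and Y: "froelicher Y" and K: "\<K> \<subseteq> finite_diagrams"
  and mX: "microlinear TYPE('t) \<K> X" and mY: "microlinear TYPE('t) \<K> Y"
 shows "microlinear TYPE('t) \<K> (fs_prod X Y)"
proof (rule microlinearI[OF froelicher_prod[OF X Y] K])
 let ?P = "fs_prod X Y"
 note P = froelicher_prod[OF X Y]
 fix D A p and T :: "'t froelicher" and f
 assume DK: "D \<in> \<K>" and lim: "weil_limit D A p" and T: "froelicher T" and f: "pcone ?P D T f"
 have D: "D \<in> finite_diagrams" using DK K by (rule rev_subsetD)
 note A = limit_cone(1)[OF lim] and pv = limit_cone(2)[OF lim] and ob = diagram_vert[OF D]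
 let ?Q = "%U. fs_prod (prolong X U) (prolong Y U)"
 have "ALL U. \<exists>\<pi>. weil U --> fs_iso (prolong ?P U) (?Q U) \<pi> &
  (ALL q. rep (wvars U) ?P q --> \<pi> (pc ?P U q) = (pc X U (%x. fst (q x)), pc Y U (%x. snd (q x))))"
 proof
  fix U
  show "\<exists>\<pi>. weil U --> fs_iso (prolong ?P U) (?Q U) \<pi> &
   (ALL q. rep (wvars U) ?P q --> \<pi> (pc ?P U q) = (pc X U (%x. fst (q x)), pc Y U (%x. snd (q x))))"
  proof (cases "weil U")
   case True
   from prolong_prod_iso[OF X Y True] show ?thesis by (elim exE) (intro exI impI)
  qed simp
 qed
 from choice[OF this] obtain \<pi> where \<pi>0: "ALL U. weil U --> fs_iso (prolong ?P U) (?Q U) (\<pi> U) &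
  (ALL q. rep (wvars U) ?P q --> \<pi> U (pc ?P U q) = (pc X U (%x. fst (q x)), pc Y U (%x. snd (q x))))" ..
 have \<pi>: "fs_iso (prolong ?P U) (?Q U) (\<pi> U)" if "weil U" for U by (rule conjunct1[OF mp[OF spec[OF \<pi>0] that]])
 have \<pi>': "\<pi> U (pc ?P U q) = (pc X U (%x. fst (q x)), pc Y U (%x. snd (q x)))" if U: "weil U" and q: "rep (wvars U) ?P q" for U q
  by (rule mp[OF spec[OF conjunct2[OF mp[OF spec[OF \<pi>0] U]]] q])
 have nat: "fst (\<pi> V (prolong_hom ?P U V phi a)) = prolong_hom X U V phi (fst (\<pi> U a))"
   "snd (\<pi> V (prolong_hom ?P U V phi a)) = prolong_hom Y U V phi (snd (\<pi> U a))"
  if U: "weil U" and V: "weil V" and phi: "phi \<in> weil_hom U V" and a: "a \<in> carrier (prolong ?P U)" for U V phi a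
 proof -
  obtain q where q: "rep (wvars U) ?P q" "a = pc ?P U q" using pc_cases[OF P a] .
  obtain Theta where Theta: "induces_hom U V Theta phi" by (rule ex_induces[OF U V phi])
  note r = prolong_hom_pc[OF P U V phi Theta q(1)] \<pi>'[OF V induces_rep[OF Theta q(1)]] \<pi>'[OF U q(1)]
   prolong_hom_pc[OF X U V phi Theta rep_fst[OF q(1)]] prolong_hom_pc[OF Y U V phi Theta rep_snd[OF q(1)]]
  show "fst (\<pi> V (prolong_hom ?P U V phi a)) = prolong_hom X U V phi (fst (\<pi> U a))"
   "snd (\<pi> V (prolong_hom ?P U V phi a)) = prolong_hom Y U V phi (snd (\<pi> U a))"
   by (simp_all only: q(2) r fst_conv snd_conv)
 qed
 have mem: "f v s \<in> carrier (prolong ?P (dobj D v))" if "v \<in> dverts D" "s \<in> carrier T" for v s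
  by (rule smD(1)[OF bspec[OF pcone_sm[OF f] that(1)] that(2)])
 define f1 where "f1 v = (\<lambda>s\<in>carrier T. fst (\<pi> (dobj D v) (f v s)))" for v
 define f2 where "f2 v = (\<lambda>s\<in>carrier T. snd (\<pi> (dobj D v) (f v s)))" for v
 have comps: "(\<lambda>s\<in>carrier T. fst (\<pi> U (g s))) \<in> smooth_maps T (prolong X U)"
   "(\<lambda>s\<in>carrier T. snd (\<pi> U (g s))) \<in> smooth_maps T (prolong Y U)"
  if U: "weil U" and g: "g \<in> smooth_maps T (prolong ?P U)" for U g
 proof -
  note c = comp_fst_smooth[OF froelicher_prolong[OF X U] froelicher_prolong[OF Y U] T sm_compose[OF T g fs_iso_sm[OF \<pi>[OF U]]]]
  have "(\<lambda>s\<in>carrier T. fst (compose (carrier T) (\<pi> U) g s)) = (\<lambda>s\<in>carrier T. fst (\<pi> U (g s)))"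
   "(\<lambda>s\<in>carrier T. snd (compose (carrier T) (\<pi> U) g s)) = (\<lambda>s\<in>carrier T. snd (\<pi> U (g s)))"
   by (rule restrict_ext, simp add: compose_def)+
  with c show "(\<lambda>s\<in>carrier T. fst (\<pi> U (g s))) \<in> smooth_maps T (prolong X U)"
   "(\<lambda>s\<in>carrier T. snd (\<pi> U (g s))) \<in> smooth_maps T (prolong Y U)" by (simp_all only:)
 qed
 have c1: "pcone X D T f1" unfolding pcone_def
 proof (intro conjI ballI allI impI)
  show "f1 v \<in> smooth_maps T (prolong X (dobj D v))" if v: "v \<in> dverts D" for v
   unfolding f1_def by (rule comps(1)[OF ob[OF v] bspec[OF pcone_sm[OF f] v]])
  fix u v phi s assume a: "(u, v, phi) \<in> darrs D" and s: "s \<in> carrier T"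
  note uv = diagram_arr[OF D a]
  show "prolong_hom X (dobj D u) (dobj D v) phi (f1 u s) = f1 v s"
   using nat(1)[OF ob[OF uv(1)] ob[OF uv(2)] uv(3) mem[OF uv(1) s]] pcone_arr[OF f a s] s by (simp add: f1_def)
 qed
 have c2: "pcone Y D T f2" unfolding pcone_def
 proof (intro conjI ballI allI impI)
  show "f2 v \<in> smooth_maps T (prolong Y (dobj D v))" if v: "v \<in> dverts D" for v
   unfolding f2_def by (rule comps(2)[OF ob[OF v] bspec[OF pcone_sm[OF f] v]])
  fix u v phi s assume a: "(u, v, phi) \<in> darrs D" and s: "s \<in> carrier T"
  note uv = diagram_arr[OF D a]
  show "prolong_hom Y (dobj D u) (dobj D v) phi (f2 u s) = f2 v s"
   using nat(2)[OF ob[OF uv(1)] ob[OF uv(2)] uv(3) mem[OF uv(1) s]] pcone_arr[OF f a s] s by (simp add: f2_def)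
 qed
 note u1 = microlinearD[OF mX K DK lim T c1] and u2 = microlinearD[OF mY K DK lim T c2]
 obtain h1 where h1: "plift X D A p T f1 h1" using ex1_implies_ex[OF u1] by (elim exE)
 obtain h2 where h2: "plift Y D A p T f2 h2" using ex1_implies_ex[OF u2] by (elim exE)
 obtain \<sigma> where \<sigma>: "\<sigma> \<in> smooth_maps (?Q A) (prolong ?P A)" "\<forall>y\<in>carrier (?Q A). \<pi> A (\<sigma> y) = y"
  using \<pi>[OF A] by (rule fs_isoE)
 note pr = pair_smooth[OF T plift_sm[OF h1] plift_sm[OF h2]]
 define h where "h = compose (carrier T) \<sigma> (\<lambda>s\<in>carrier T. (h1 s, h2 s))"
 have h: "h \<in> smooth_maps T (prolong ?P A)" unfolding h_def by (rule sm_compose[OF T pr \<sigma>(1)])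
 have \<pi>h: "\<pi> A (h s) = (h1 s, h2 s)" if s: "s \<in> carrier T" for s
  using bspec[OF \<sigma>(2) smD(1)[OF pr s]] s by (simp add: h_def compose_def)
 show "\<exists>!h. plift ?P D A p T f h"
 proof (rule ex1I[of _ h])
  show "plift ?P D A p T f h" unfolding plift_def
  proof (intro conjI ballI h)
   fix v s assume v: "v \<in> dverts D" and s: "s \<in> carrier T"
   note n = nat[OF A ob[OF v] pv[OF v] smD(1)[OF h s]]
   have "\<pi> (dobj D v) (prolong_hom ?P A (dobj D v) (p v) (h s)) = \<pi> (dobj D v) (f v s)"
    using n plift_eq[OF h1 v s] plift_eq[OF h2 v s] s by (intro prod_eqI) (simp_all add: \<pi>h f1_def f2_def)
   then show "prolong_hom ?P A (dobj D v) (p v) (h s) = f v s"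
    by (rule fs_iso_inj[OF \<pi>[OF ob[OF v]] smD(1)[OF prolong_hom_smooth[OF P A ob[OF v] pv[OF v]] smD(1)[OF h s]] mem[OF v s]])
  qed
  fix g assume g: "plift ?P D A p T f g"
  note gs = plift_sm[OF g]
  have "plift X D A p T f1 (\<lambda>s\<in>carrier T. fst (\<pi> A (g s)))" unfolding plift_def
  proof (intro conjI ballI comps(1)[OF A gs])
   fix v s assume v: "v \<in> dverts D" and s: "s \<in> carrier T"
   show "prolong_hom X A (dobj D v) (p v) ((\<lambda>s\<in>carrier T. fst (\<pi> A (g s))) s) = f1 v s"
    using nat(1)[OF A ob[OF v] pv[OF v] smD(1)[OF gs s]] plift_eq[OF g v s] s by (simp add: f1_def)
  qed
  then have e1: "(\<lambda>s\<in>carrier T. fst (\<pi> A (g s))) = h1" by (rule ex1_eq[of "plift X D A p T f1", OF u1 _ h1])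
  have "plift Y D A p T f2 (\<lambda>s\<in>carrier T. snd (\<pi> A (g s)))" unfolding plift_def
  proof (intro conjI ballI comps(2)[OF A gs])
   fix v s assume v: "v \<in> dverts D" and s: "s \<in> carrier T"
   show "prolong_hom Y A (dobj D v) (p v) ((\<lambda>s\<in>carrier T. snd (\<pi> A (g s))) s) = f2 v s"
    using nat(2)[OF A ob[OF v] pv[OF v] smD(1)[OF gs s]] plift_eq[OF g v s] s by (simp add: f2_def)
  qed
  then have e2: "(\<lambda>s\<in>carrier T. snd (\<pi> A (g s))) = h2" by (rule ex1_eq[of "plift Y D A p T f2", OF u2 _ h2])
  show "g = h"
  proof (rule sm_eqI[OF gs h])
   fix s assume s: "s \<in> carrier T"
   have "\<pi> A (g s) = \<pi> A (h s)"
    using fun_cong[OF e1, of s] fun_cong[OF e2, of s] s by (intro prod_eqI) (simp_all add: \<pi>h)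
   then show "g s = h s" by (rule fs_iso_inj[OF \<pi>[OF A] smD(1)[OF gs s] smD(1)[OF h s]])
  qed
 qed
qed

text \<open>A cone over \<open>T\<close> is evaluated to a cone over \<open>T \<times> Y\<close>, lifted there and curried again. Exponents
  move out of the prolongations because \<open>X\<close> is Weil exponentiable.\<close>

lemma microlinear_exp:
 fixes X :: "'a froelicher" and Y :: "'b froelicher"
 assumes X: "froelicher X" and Y: "froelicher Y" and K: "\<K> \<subseteq> finite_diagrams"
  and core: "core TYPE('b) X" and mX: "microlinear TYPE('t \<times> 'b) \<K> X"
 shows "microlinear TYPE('t) \<K> (fs_exp X Y)"
proof (rule microlinearI[OF froelicher_exp[OF X Y] K])
 let ?P = "fs_exp X Y"
 note P = froelicher_exp[OF X Y]
 fix D A p and T :: "'t froelicher" and f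
 assume DK: "D \<in> \<K>" and lim: "weil_limit D A p" and T: "froelicher T" and f: "pcone ?P D T f"
 have D: "D \<in> finite_diagrams" using DK K by (rule rev_subsetD)
 note A = limit_cone(1)[OF lim] and pv = limit_cone(2)[OF lim] and ob = diagram_vert[OF D]
 note TY = froelicher_prod[OF T Y]
 let ?Q = "%U. fs_exp (prolong X U) Y"
 have "ALL U. \<exists>\<pi>. weil U --> fs_iso (prolong ?P U) (?Q U) \<pi> &
  (ALL q. rep (wvars U) ?P q --> \<pi> (pc ?P U q) = (\<lambda>y\<in>carrier Y. pc X U (%x. q x y)))"
 proof
  fix U
  show "\<exists>\<pi>. weil U --> fs_iso (prolong ?P U) (?Q U) \<pi> &
   (ALL q. rep (wvars U) ?P q --> \<pi> (pc ?P U q) = (\<lambda>y\<in>carrier Y. pc X U (%x. q x y)))"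
  proof (cases "weil U")
   case True
   from exp_prolong_iso[OF X core Y True] show ?thesis by (elim exE) (intro exI impI)
  qed simp
 qed
 from choice[OF this] obtain \<pi> where \<pi>0: "ALL U. weil U --> fs_iso (prolong ?P U) (?Q U) (\<pi> U) &
  (ALL q. rep (wvars U) ?P q --> \<pi> U (pc ?P U q) = (\<lambda>y\<in>carrier Y. pc X U (%x. q x y)))" ..
 have \<pi>: "fs_iso (prolong ?P U) (?Q U) (\<pi> U)" if "weil U" for U by (rule conjunct1[OF mp[OF spec[OF \<pi>0] that]])
 have \<pi>': "\<pi> U (pc ?P U q) = (\<lambda>y\<in>carrier Y. pc X U (%x. q x y))" if U: "weil U" and q: "rep (wvars U) ?P q" for U q
  by (rule mp[OF spec[OF conjunct2[OF mp[OF spec[OF \<pi>0] U]]] q])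
 have \<pi>m: "\<pi> U a \<in> smooth_maps Y (prolong X U)" if "weil U" "a \<in> carrier (prolong ?P U)" for U a
  using smD(1)[OF fs_iso_sm[OF \<pi>[OF that(1)]] that(2)] by simp
 have nat: "\<pi> V (prolong_hom ?P U V phi a) y = prolong_hom X U V phi (\<pi> U a y)"
  if U: "weil U" and V: "weil V" and phi: "phi \<in> weil_hom U V" and a: "a \<in> carrier (prolong ?P U)" and y: "y \<in> carrier Y" for U V phi a y
 proof -
  obtain q where q: "rep (wvars U) ?P q" "a = pc ?P U q" using pc_cases[OF P a] .
  obtain Theta where Theta: "induces_hom U V Theta phi" by (rule ex_induces[OF U V phi])
  have ry: "rep (wvars U) X (%x. q x y)" unfolding rep_def
  proof (intro allI impI)
   fix c assume "curve_Rn (wvars U) c"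
   from conjunct2[OF repD[OF q(1) this, unfolded curves_exp_iff[OF Y]], rule_format, OF smooth_real_id const_curve[OF Y y]]
   show "(%u. q (c u) y) \<in> curves X" .
  qed
  show ?thesis
   unfolding q(2) prolong_hom_pc[OF P U V phi Theta q(1)] \<pi>'[OF V induces_rep[OF Theta q(1)]] \<pi>'[OF U q(1)]
   using prolong_hom_pc[OF X U V phi Theta ry] y by simp
 qed
 have mem: "f v s \<in> carrier (prolong ?P (dobj D v))" if "v \<in> dverts D" "s \<in> carrier T" for v s
  by (rule smD(1)[OF bspec[OF pcone_sm[OF f] that(1)] that(2)])
 define un where "un U g = fs_uncurry Y T (compose (carrier T) (\<pi> U) g)" for U g
 have un: "un U g \<in> smooth_maps (fs_prod T Y) (prolong X U)" if U: "weil U" and g: "g \<in> smooth_maps T (prolong ?P U)" for U g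
  unfolding un_def by (rule fs_uncurry_smooth[OF Y T sm_compose[OF T g fs_iso_sm[OF \<pi>[OF U]]]])
 have un_val: "un U g (s, y) = \<pi> U (g s) y" if "s \<in> carrier T" "y \<in> carrier Y" for U g s y
  using that by (simp add: un_def fs_uncurry_def compose_def)
 let ?k = "%v. un (dobj D v) (f v)"
 have c: "pcone X D (fs_prod T Y) ?k" unfolding pcone_def
 proof (intro conjI ballI allI impI)
  show "?k v \<in> smooth_maps (fs_prod T Y) (prolong X (dobj D v))" if v: "v \<in> dverts D" for v
   by (rule un[OF ob[OF v] bspec[OF pcone_sm[OF f] v]])
  fix u v phi z assume a: "(u, v, phi) \<in> darrs D" and "z \<in> carrier (fs_prod T Y)"
  then obtain s y where z: "z = (s, y)" and s: "s \<in> carrier T" and y: "y \<in> carrier Y" by auto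
  note uv = diagram_arr[OF D a]
  show "prolong_hom X (dobj D u) (dobj D v) phi (?k u z) = ?k v z" unfolding z un_val[OF s y]
   using nat[OF ob[OF uv(1)] ob[OF uv(2)] uv(3) mem[OF uv(1) s] y] pcone_arr[OF f a s] by simp
 qed
 note u = microlinearD[OF mX K DK lim TY c]
 obtain k where k: "plift X D A p (fs_prod T Y) ?k k" using ex1_implies_ex[OF u] by (elim exE)
 obtain \<sigma> where \<sigma>: "\<sigma> \<in> smooth_maps (?Q A) (prolong ?P A)" "\<forall>y\<in>carrier (?Q A). \<pi> A (\<sigma> y) = y"
  using \<pi>[OF A] by (rule fs_isoE)
 note cu = fs_curry_smooth[OF Y T plift_sm[OF k]]
 define h where "h = compose (carrier T) \<sigma> (fs_curry Y T k)"
 have h: "h \<in> smooth_maps T (prolong ?P A)" unfolding h_def by (rule sm_compose[OF T cu \<sigma>(1)])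
 have \<pi>h: "\<pi> A (h s) = (\<lambda>y\<in>carrier Y. k (s, y))" if s: "s \<in> carrier T" for s
  using bspec[OF \<sigma>(2) smD(1)[OF cu s]] s by (simp add: h_def compose_def fs_curry_def)
 show "\<exists>!h. plift ?P D A p T f h"
 proof (rule ex1I[of _ h])
  show "plift ?P D A p T f h" unfolding plift_def
  proof (intro conjI ballI h)
   fix v s assume v: "v \<in> dverts D" and s: "s \<in> carrier T"
   note m = smD(1)[OF prolong_hom_smooth[OF P A ob[OF v] pv[OF v]] smD(1)[OF h s]]
   have "\<pi> (dobj D v) (prolong_hom ?P A (dobj D v) (p v) (h s)) = \<pi> (dobj D v) (f v s)"
   proof (rule sm_eqI[OF \<pi>m[OF ob[OF v] m] \<pi>m[OF ob[OF v] mem[OF v s]]])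
    fix y assume y: "y \<in> carrier Y"
    have "(s, y) \<in> carrier (fs_prod T Y)" using s y by simp
    from plift_eq[OF k v this] nat[OF A ob[OF v] pv[OF v] smD(1)[OF h s] y]
    show "\<pi> (dobj D v) (prolong_hom ?P A (dobj D v) (p v) (h s)) y = \<pi> (dobj D v) (f v s) y"
     by (simp add: \<pi>h[OF s] un_val[OF s y] y)
   qed
   then show "prolong_hom ?P A (dobj D v) (p v) (h s) = f v s"
    by (rule fs_iso_inj[OF \<pi>[OF ob[OF v]] m mem[OF v s]])
  qed
  fix g assume g: "plift ?P D A p T f g"
  note gs = plift_sm[OF g]
  have "plift X D A p (fs_prod T Y) ?k (un A g)" unfolding plift_def
  proof (intro conjI ballI un[OF A gs])
   fix v z assume v: "v \<in> dverts D" and "z \<in> carrier (fs_prod T Y)"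
   then obtain s y where z: "z = (s, y)" and s: "s \<in> carrier T" and y: "y \<in> carrier Y" by auto
   show "prolong_hom X A (dobj D v) (p v) (un A g z) = ?k v z" unfolding z un_val[OF s y]
    using nat[OF A ob[OF v] pv[OF v] smD(1)[OF gs s] y] plift_eq[OF g v s] by simp
  qed
  then have e: "un A g = k" by (rule ex1_eq[of "plift X D A p (fs_prod T Y) ?k", OF u _ k])
  show "g = h"
  proof (rule sm_eqI[OF gs h])
   fix s assume s: "s \<in> carrier T"
   have "\<pi> A (g s) = \<pi> A (h s)"
   proof (rule sm_eqI[OF \<pi>m[OF A smD(1)[OF gs s]] \<pi>m[OF A smD(1)[OF h s]]])
    fix y assume y: "y \<in> carrier Y"
    show "\<pi> A (g s) y = \<pi> A (h s) y"
     using fun_cong[OF e, of "(s, y)"] unfolding un_val[OF s y] by (simp add: \<pi>h[OF s] y)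
   qed
   then show "g s = h s" by (rule fs_iso_inj[OF \<pi>[OF A] smD(1)[OF gs s] smD(1)[OF h s]])
  qed
 qed
qed

section \<open>The cartesian closed subcategory\<close>

lemma fs_terminal_point: "fs_terminal TYPE('t) fs_point" unfolding fs_terminal_def
proof (intro allI impI)
 fix T :: "'t froelicher" assume T: "froelicher T"
 show "\<exists>!h. h \<in> smooth_maps T fs_point"
  unfolding smooth_maps_singleton[OF T froelicher_point carrier_point] by simp
qed

lemma fs_product_prod:
 assumes X: "froelicher X" and Y: "froelicher Y"
 shows "fs_product TYPE('t) X Y (fs_prod X Y)
  (restrict fst (carrier (fs_prod X Y))) (restrict snd (carrier (fs_prod X Y)))" unfolding fs_product_def
proof (intro conjI allI impI)
 let ?p = "restrict fst (carrier (fs_prod X Y))" and ?q = "restrict snd (carrier (fs_prod X Y))"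
 show "?p \<in> smooth_maps (fs_prod X Y) X" using fst_smooth[OF X Y] by simp
 show "?q \<in> smooth_maps (fs_prod X Y) Y" using snd_smooth[OF X Y] by simp
 fix T :: "'t froelicher" and f g
 assume "froelicher T & f \<in> smooth_maps T X & g \<in> smooth_maps T Y"
 then have T: "froelicher T" and f: "f \<in> smooth_maps T X" and g: "g \<in> smooth_maps T Y" by simp_all
 let ?h = "\<lambda>s\<in>carrier T. (f s, g s)"
 show "\<exists>!h. h \<in> smooth_maps T (fs_prod X Y) & compose (carrier T) ?p h = f & compose (carrier T) ?q h = g"
  unfolding compose_eq_iff[OF smD(3)[OF f]] compose_eq_iff[OF smD(3)[OF g]]
 proof (rule ex1I[of _ ?h])
  show "?h \<in> smooth_maps T (fs_prod X Y) & (\<forall>s\<in>carrier T. ?p (?h s) = f s) & (\<forall>s\<in>carrier T. ?q (?h s) = g s)"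
   using pair_smooth[OF T f g] smD(1)[OF f] smD(1)[OF g] by simp
  fix h assume h: "h \<in> smooth_maps T (fs_prod X Y) & (\<forall>s\<in>carrier T. ?p (h s) = f s) & (\<forall>s\<in>carrier T. ?q (h s) = g s)"
  show "h = ?h"
  proof (rule sm_eqI[OF conjunct1[OF h] pair_smooth[OF T f g]])
   fix s assume s: "s \<in> carrier T"
   have hs: "h s \<in> carrier (fs_prod X Y)" by (rule smD(1)[OF conjunct1[OF h] s])
   note * = conjunct2[OF h]
   have "fst (h s) = f s" using bspec[OF conjunct1[OF *] s] unfolding restrict_apply'[OF hs] .
   moreover have "snd (h s) = g s" using bspec[OF conjunct2[OF *] s] unfolding restrict_apply'[OF hs] .
   ultimately show "h s = ?h s" using s by (cases "h s") simp
  qed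
 qed
qed

lemma fs_exponential_exp:
 fixes Y :: "'b froelicher"
 assumes X: "froelicher X" and Y: "froelicher Y"
 shows "fs_exponential TYPE('t) X Y (fs_exp X Y) (fs_eval X Y)" unfolding fs_exponential_def
proof (intro conjI allI impI)
 note E = froelicher_exp[OF X Y]
 have id: "(\<lambda>u\<in>carrier (fs_exp X Y). u) \<in> smooth_maps (fs_exp X Y) (fs_exp X Y)" by (rule sm_restrictI[OF E])
 have "fs_uncurry Y (fs_exp X Y) (\<lambda>u\<in>carrier (fs_exp X Y). u) = fs_eval X Y"
  unfolding fs_uncurry_def fs_eval_def carrier_exp by (rule restrict_ext) auto
 then show "fs_eval X Y \<in> smooth_maps (fs_prod (fs_exp X Y) Y) X" using fs_uncurry_smooth[OF Y E id] by simp
 fix T :: "'t froelicher" and f assume "froelicher T & f \<in> smooth_maps (fs_prod T Y) X"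
 then have T: "froelicher T" and f: "f \<in> smooth_maps (fs_prod T Y) X" by simp_all
 note cu = fs_curry_smooth[OF Y T f]
 show "\<exists>!h. h \<in> smooth_maps T (fs_exp X Y) &
   compose (carrier (fs_prod T Y)) (fs_eval X Y) (%(s, y). (h s, y)) = f" unfolding compose_eq_iff[OF smD(3)[OF f]]
 proof (rule ex1I[of _ "fs_curry Y T f"])
  show "fs_curry Y T f \<in> smooth_maps T (fs_exp X Y) &
    (\<forall>z\<in>carrier (fs_prod T Y). fs_eval X Y ((%(s, y). (fs_curry Y T f s, y)) z) = f z)"
  proof (intro conjI ballI cu)
   fix z assume "z \<in> carrier (fs_prod T Y)"
   then obtain s y where z: "z = (s, y)" and s: "s \<in> carrier T" and y: "y \<in> carrier Y" by auto
   have "fs_curry Y T f s \<in> smooth_maps Y X" using smD(1)[OF cu s] by simp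
   then have "fs_eval X Y (fs_curry Y T f s, y) = fs_curry Y T f s y" using y by (simp add: fs_eval_def)
   then show "fs_eval X Y ((%(s, y). (fs_curry Y T f s, y)) z) = f z" using s y by (simp add: z fs_curry_def)
  qed
  fix h assume h: "h \<in> smooth_maps T (fs_exp X Y) &
    (\<forall>z\<in>carrier (fs_prod T Y). fs_eval X Y ((%(s, y). (h s, y)) z) = f z)"
  show "h = fs_curry Y T f"
  proof (rule sm_eqI[OF conjunct1[OF h] cu])
   fix s assume s: "s \<in> carrier T"
   have hs: "h s \<in> smooth_maps Y X" "fs_curry Y T f s \<in> smooth_maps Y X"
    using smD(1)[OF conjunct1[OF h] s] smD(1)[OF cu s] by simp_all
   show "h s = fs_curry Y T f s"
   proof (rule sm_eqI[OF hs])
    fix y assume y: "y \<in> carrier Y"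
    have "(s, y) \<in> carrier (fs_prod T Y)" using s y by simp
    from bspec[OF conjunct2[OF h] this] show "h s y = fs_curry Y T f s y"
     using hs(1) s y by (simp add: fs_eval_def fs_curry_def)
   qed
  qed
 qed
qed

lemma FS_WE_ML_iff:
 fixes X :: "'a froelicher"
 shows "FS_WE_ML TYPE('t) \<K> X \<longleftrightarrow> froelicher X & core TYPE('t) X & microlinear TYPE('t) \<K> X"
 unfolding FS_WE_ML_def using core_if_weil_exponentiable[of X] weil_exponentiable_if_core[of X] by auto

theorem theorem15:
  fixes X :: "'a froelicher" and Y :: "'b froelicher" and Z :: "'c froelicher"
    and \<K> :: "weil_diagram set"
  assumes "\<K> = finite_diagrams \<or> \<K> = connected_finite_diagrams"
  shows
    "(FS_WE_ML TYPE('t) \<K> X \<longrightarrow> (\<lambda>x\<in>carrier X. x) \<in> smooth_maps X X) \<and>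
     (FS_WE_ML TYPE('t) \<K> X \<and> FS_WE_ML TYPE('t) \<K> Y \<and> FS_WE_ML TYPE('t) \<K> Z \<longrightarrow>
        (\<forall>f\<in>smooth_maps X Y. \<forall>g\<in>smooth_maps Y Z.
           compose (carrier X) g f \<in> smooth_maps X Z)) \<and>
     FS_WE_ML TYPE('t) \<K> fs_point \<and> fs_terminal TYPE('t) fs_point \<and>
     (FS_WE_ML TYPE('t) \<K> X \<and> FS_WE_ML TYPE('t) \<K> Y \<longrightarrow>
        FS_WE_ML TYPE('t) \<K> (fs_prod X Y) \<and>
        fs_product TYPE('t) X Y (fs_prod X Y)
          (restrict fst (carrier (fs_prod X Y))) (restrict snd (carrier (fs_prod X Y)))) \<and>
     (FS_WE_ML TYPE('t \<times> 'b) \<K> X \<and> FS_WE_ML TYPE('b) \<K> X \<and> FS_WE_ML TYPE('t) \<K> Y \<longrightarrow>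
        FS_WE_ML TYPE('t) \<K> (fs_exp X Y) \<and>
        fs_exponential TYPE('t) X Y (fs_exp X Y) (fs_eval X Y))"
proof -
 have K: "\<K> \<subseteq> finite_diagrams" using assms by (auto simp: connected_finite_diagrams_def)
 show ?thesis unfolding FS_WE_ML_iff
 proof (intro conjI impI ballI)
  show "(\<lambda>x\<in>carrier X. x) \<in> smooth_maps X X" if "froelicher X & core TYPE('t) X & microlinear TYPE('t) \<K> X"
   by (rule sm_restrictI[OF conjunct1[OF that]])
  show "compose (carrier X) g f \<in> smooth_maps X Z"
   if "(froelicher X & core TYPE('t) X & microlinear TYPE('t) \<K> X) &
    (froelicher Y & core TYPE('t) Y & microlinear TYPE('t) \<K> Y) & froelicher Z & core TYPE('t) Z & microlinear TYPE('t) \<K> Z"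
    and "f \<in> smooth_maps X Y" "g \<in> smooth_maps Y Z" for f g
   by (rule sm_compose[OF conjunct1[OF conjunct1[OF that(1)]] that(2,3)])
  show "froelicher fs_point" by (rule froelicher_point)
  show "core TYPE('t) fs_point" by (rule core_singleton[OF froelicher_point carrier_point])
  show "microlinear TYPE('t) \<K> fs_point" by (rule microlinear_singleton[OF froelicher_point carrier_point K])
  show "fs_terminal TYPE('t) fs_point" by (rule fs_terminal_point)
 next
  assume *: "(froelicher X & core TYPE('t) X & microlinear TYPE('t) \<K> X) &
   froelicher Y & core TYPE('t) Y & microlinear TYPE('t) \<K> Y"
  then have X: "froelicher X" and Y: "froelicher Y" by simp_all
  show "froelicher (fs_prod X Y)" by (rule froelicher_prod[OF X Y])
  show "core TYPE('t) (fs_prod X Y)" by (rule core_prod[OF X Y]) (use * in simp_all)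
  show "microlinear TYPE('t) \<K> (fs_prod X Y)" by (rule microlinear_prod[OF X Y K]) (use * in simp_all)
  show "fs_product TYPE('t) X Y (fs_prod X Y)
    (restrict fst (carrier (fs_prod X Y))) (restrict snd (carrier (fs_prod X Y)))" by (rule fs_product_prod[OF X Y])
 next
  assume *: "(froelicher X & core TYPE('t \<times> 'b) X & microlinear TYPE('t \<times> 'b) \<K> X) &
   (froelicher X & core TYPE('b) X & microlinear TYPE('b) \<K> X) &
   froelicher Y & core TYPE('t) Y & microlinear TYPE('t) \<K> Y"
  then have X: "froelicher X" and Y: "froelicher Y" by simp_all
  show "froelicher (fs_exp X Y)" by (rule froelicher_exp[OF X Y])
  show "core TYPE('t) (fs_exp X Y)" by (rule core_exp[OF X Y]) (use * in simp_all)
  show "microlinear TYPE('t) \<K> (fs_exp X Y)" by (rule microlinear_exp[OF X Y K]) (use * in simp_all)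
  show "fs_exponential TYPE('t) X Y (fs_exp X Y) (fs_eval X Y)" by (rule fs_exponential_exp[OF X Y])
 qed
qed

end
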